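(* Let $(R,\mathfrak m)$ be a one-dimensional Gorenstein local ring and let $M$ be a finitely generated, torsionfree and faithful $R$-module. If $M$ is rigid and the center $Z(\operatorname{End}_R(M))$ is a Gorenstein ring, then $M$ has a free summand.
   Context: Rings are commutative except endomorphism rings. $M$ is torsionfree if $rm=0$ with $r\in R$ a nonzerodivisor and $m\in M$ implies $m=0$. $M$ is rigid if $\operatorname{Ext}^1_R(M,M)=0$. $Z(S)$ denotes the center of a ring $S$. A Noetherian local ring $R$ with residue field $k$ is Gorenstein if $\operatorname{Ext}^i_R(k,R)=0$ for some $i>\dim R$ (equivalently, $R$ has finite injective dimension over itself); a commutative Noetherian ring is Gorenstein if its localization at every maximal ideal is a Gorenstein local ring. "Has a free summand" means: has $R$ as a direct summand. *)

theory Defs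
  imports "HOL-Algebra.Ring_Divisibility" "HOL-Algebra.Module" "HOL-Algebra.Elementary_Groups" "HOL-Library.Extended_Nat"
begin

section \<open>Rings\<close>

text \<open>Zero if there are no prime ideals, that is, for the zero ring.\<close>

definition krull_dim :: "('a, 'c) ring_scheme \<Rightarrow> enat" where
  "krull_dim R =
     Sup {enat n | n. \<exists>P. (\<forall>i\<le>n. primeideal (P i) R) \<and> (\<forall>i<n. P i \<subset> P (Suc i))}"

definition local_ring :: "('a, 'c) ring_scheme \<Rightarrow> 'a set \<Rightarrow> bool" where
  "local_ring R \<mm> \<longleftrightarrow> cring R \<and> (\<forall>I. maximalideal I R \<longleftrightarrow> I = \<mm>)"

definition nonzerodivisor :: "('a, 'c) ring_scheme \<Rightarrow> 'a \<Rightarrow> bool" where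
  "nonzerodivisor R r \<longleftrightarrow>
     r \<in> carrier R \<and> (\<forall>s\<in>carrier R. r \<otimes>\<^bsub>R\<^esub> s = \<zero>\<^bsub>R\<^esub> \<longrightarrow> s = \<zero>\<^bsub>R\<^esub>)"

definition ring_center :: "('a, 'c) ring_scheme \<Rightarrow> ('a, 'c) ring_scheme" where
  "ring_center S =
     S\<lparr>carrier := {z \<in> carrier S. \<forall>x\<in>carrier S. z \<otimes>\<^bsub>S\<^esub> x = x \<otimes>\<^bsub>S\<^esub> z}\<rparr>"

text \<open>The fraction $a/s$ as an equivalence class of pairs.\<close>

definition fraction :: "('a, 'c) ring_scheme \<Rightarrow> 'a set \<Rightarrow> 'a \<Rightarrow> 'a \<Rightarrow> ('a \<times> 'a) set" where
  "fraction R S a s =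
     {(b, t). b \<in> carrier R \<and> t \<in> S \<and>
        (\<exists>u\<in>S. u \<otimes>\<^bsub>R\<^esub> (a \<otimes>\<^bsub>R\<^esub> t) = u \<otimes>\<^bsub>R\<^esub> (b \<otimes>\<^bsub>R\<^esub> s))}"

definition localization :: "('a, 'c) ring_scheme \<Rightarrow> 'a set \<Rightarrow> ('a \<times> 'a) set ring" where
  "localization R S =
     \<lparr>carrier = {fraction R S a s | a s. a \<in> carrier R \<and> s \<in> S},
      mult = (\<lambda>p q. \<Union>(a, s)\<in>p. \<Union>(b, t)\<in>q. fraction R S (a \<otimes>\<^bsub>R\<^esub> b) (s \<otimes>\<^bsub>R\<^esub> t)),
      one = fraction R S \<one>\<^bsub>R\<^esub> \<one>\<^bsub>R\<^esub>,
      zero = fraction R S \<zero>\<^bsub>R\<^esub> \<one>\<^bsub>R\<^esub>,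
      add = (\<lambda>p q. \<Union>(a, s)\<in>p. \<Union>(b, t)\<in>q.
               fraction R S (a \<otimes>\<^bsub>R\<^esub> t \<oplus>\<^bsub>R\<^esub> b \<otimes>\<^bsub>R\<^esub> s) (s \<otimes>\<^bsub>R\<^esub> t))\<rparr>"

definition localization_at :: "('a, 'c) ring_scheme \<Rightarrow> 'a set \<Rightarrow> ('a \<times> 'a) set ring" where
  "localization_at R P = localization R (carrier R - P)"


section \<open>Modules\<close>

text \<open>
  The record of a module extends that of a ring; the locale \<^locale>\<open>module\<close> ignores the fields
  \<^const>\<open>mult\<close> and \<^const>\<open>one\<close> of the module, which are therefore left unspecified
  below whenever there is no natural multiplication.
\<close>

definition mod_hom ::
    "('a, 'c) ring_scheme \<Rightarrow> ('a, 'b, 'd) module_scheme \<Rightarrow> ('a, 'e, 'f) module_scheme \<Rightarrow> ('b \<Rightarrow> 'e) set"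
  where
  "mod_hom R M N =
     {h \<in> carrier M \<rightarrow> carrier N.
        (\<forall>x\<in>carrier M. \<forall>y\<in>carrier M. h (x \<oplus>\<^bsub>M\<^esub> y) = h x \<oplus>\<^bsub>N\<^esub> h y) \<and>
        (\<forall>r\<in>carrier R. \<forall>x\<in>carrier M. h (r \<odot>\<^bsub>M\<^esub> x) = r \<odot>\<^bsub>N\<^esub> h x)}"

text \<open>
  Homomorphisms are taken extensional (undefined off the carrier), so that equality of
  elements is equality of maps on the carrier.
\<close>

definition hom_module ::
    "('a, 'c) ring_scheme \<Rightarrow> ('a, 'b, 'd) module_scheme \<Rightarrow> ('a, 'e, 'f) module_scheme \<Rightarrow> ('a, 'b \<Rightarrow> 'e) module"
  where
  "hom_module R M N =
     \<lparr>carrier = mod_hom R M N \<inter> extensional (carrier M),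
      mult = undefined,
      one = undefined,
      zero = (\<lambda>x\<in>carrier M. \<zero>\<^bsub>N\<^esub>),
      add = (\<lambda>f g. \<lambda>x\<in>carrier M. f x \<oplus>\<^bsub>N\<^esub> g x),
      smult = (\<lambda>r f. \<lambda>x\<in>carrier M. r \<odot>\<^bsub>N\<^esub> f x)\<rparr>"

definition End_ring ::
    "('a, 'c) ring_scheme \<Rightarrow> ('a, 'b, 'd) module_scheme \<Rightarrow> ('b \<Rightarrow> 'b) ring" where
  "End_ring R M =
     \<lparr>carrier = carrier (hom_module R M M),
      mult = compose (carrier M),
      one = (\<lambda>x\<in>carrier M. x),
      zero = \<zero>\<^bsub>hom_module R M M\<^esub>,
      add = add (hom_module R M M)\<rparr>"

definition ring_module :: "('a, 'c) ring_scheme \<Rightarrow> ('a, 'a) module" where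
  "ring_module R =
     \<lparr>carrier = carrier R, mult = mult R, one = \<one>\<^bsub>R\<^esub>, zero = \<zero>\<^bsub>R\<^esub>, add = add R, smult = mult R\<rparr>"

text \<open>The cyclic module $R/I$.\<close>

definition quotient_module :: "('a, 'c) ring_scheme \<Rightarrow> 'a set \<Rightarrow> ('a, 'a set) module" where
  "quotient_module R I =
     \<lparr>carrier = carrier (R Quot I),
      mult = mult (R Quot I),
      one = \<one>\<^bsub>R Quot I\<^esub>,
      zero = \<zero>\<^bsub>R Quot I\<^esub>,
      add = add (R Quot I),
      smult = (\<lambda>r x. (I +>\<^bsub>R\<^esub> r) \<otimes>\<^bsub>R Quot I\<^esub> x)\<rparr>"

definition fg_module :: "('a, 'c) ring_scheme \<Rightarrow> ('a, 'b, 'd) module_scheme \<Rightarrow> bool" where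
  "fg_module R M \<longleftrightarrow>
     (\<exists>A. finite A \<and> A \<subseteq> carrier M \<and>
        (\<forall>x\<in>carrier M. \<exists>c\<in>A \<rightarrow> carrier R. x = (\<Oplus>\<^bsub>M\<^esub>a\<in>A. c a \<odot>\<^bsub>M\<^esub> a)))"

definition torsionfree_module :: "('a, 'c) ring_scheme \<Rightarrow> ('a, 'b, 'd) module_scheme \<Rightarrow> bool" where
  "torsionfree_module R M \<longleftrightarrow>
     (\<forall>r x. nonzerodivisor R r \<longrightarrow> x \<in> carrier M \<longrightarrow> r \<odot>\<^bsub>M\<^esub> x = \<zero>\<^bsub>M\<^esub> \<longrightarrow> x = \<zero>\<^bsub>M\<^esub>)"

definition faithful_module :: "('a, 'c) ring_scheme \<Rightarrow> ('a, 'b, 'd) module_scheme \<Rightarrow> bool" where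
  "faithful_module R M \<longleftrightarrow>
     (\<forall>r\<in>carrier R. (\<forall>x\<in>carrier M. r \<odot>\<^bsub>M\<^esub> x = \<zero>\<^bsub>M\<^esub>) \<longrightarrow> r = \<zero>\<^bsub>R\<^esub>)"

definition has_free_summand :: "('a, 'c) ring_scheme \<Rightarrow> ('a, 'b, 'd) module_scheme \<Rightarrow> bool" where
  "has_free_summand R M \<longleftrightarrow>
     (\<exists>N L. submodule N R M \<and> submodule L R M \<and>
        N \<inter> L = {\<zero>\<^bsub>M\<^esub>} \<and> N <+>\<^bsub>M\<^esub> L = carrier M \<and>
        (\<exists>h\<in>mod_hom R (ring_module R) (M\<lparr>carrier := N\<rparr>). bij_betw h (carrier R) N))"


section \<open>Ext\<close>

text \<open>The free module on \<open>I\<close>: finitely supported functions, zero off \<open>I\<close>.\<close>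

definition free_mod :: "('a, 'c) ring_scheme \<Rightarrow> 'i set \<Rightarrow> ('a, 'i \<Rightarrow> 'a) module" where
  "free_mod R I =
     \<lparr>carrier = {f. range f \<subseteq> carrier R \<and> finite {i. f i \<noteq> \<zero>\<^bsub>R\<^esub>} \<and> {i. f i \<noteq> \<zero>\<^bsub>R\<^esub>} \<subseteq> I},
      mult = undefined,
      one = undefined,
      zero = (\<lambda>i. \<zero>\<^bsub>R\<^esub>),
      add = (\<lambda>f g i. f i \<oplus>\<^bsub>R\<^esub> g i),
      smult = (\<lambda>r f i. r \<otimes>\<^bsub>R\<^esub> f i)\<rparr>"

text \<open>
  \<open>I n\<close> is a basis of the free module in degree \<open>n\<close>, \<open>d n\<close> is the differential from
  degree \<open>n + 1\<close> to degree \<open>n\<close>, and \<open>e\<close> is the augmentation.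
\<close>

definition free_resolution ::
    "('a, 'c) ring_scheme \<Rightarrow> ('a, 'b, 'd) module_scheme \<Rightarrow>
     (nat \<Rightarrow> 'i set) \<Rightarrow> (nat \<Rightarrow> ('i \<Rightarrow> 'a) \<Rightarrow> 'i \<Rightarrow> 'a) \<Rightarrow> (('i \<Rightarrow> 'a) \<Rightarrow> 'b) \<Rightarrow> bool" where
  "free_resolution R M I d e \<longleftrightarrow>
     (let F = (\<lambda>n. free_mod R (I n)) in
        (\<forall>n. d n \<in> mod_hom R (F (Suc n)) (F n)) \<and>
        e \<in> mod_hom R (F 0) M \<and>
        e ` carrier (F 0) = carrier M \<and>
        d 0 ` carrier (F 1) = {x \<in> carrier (F 0). e x = \<zero>\<^bsub>M\<^esub>} \<and>
        (\<forall>n. d (Suc n) ` carrier (F (Suc (Suc n))) =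
               {x \<in> carrier (F (Suc n)). d n x = \<zero>\<^bsub>F n\<^esub>}))"

definition Ext_cocycles ::
    "('a, 'c) ring_scheme \<Rightarrow> (nat \<Rightarrow> 'i set) \<Rightarrow> (nat \<Rightarrow> ('i \<Rightarrow> 'a) \<Rightarrow> 'i \<Rightarrow> 'a) \<Rightarrow>
     ('a, 'e, 'f) module_scheme \<Rightarrow> nat \<Rightarrow> (('i \<Rightarrow> 'a) \<Rightarrow> 'e) set" where
  "Ext_cocycles R I d N n =
     {f \<in> carrier (hom_module R (free_mod R (I n)) N).
        \<forall>x\<in>carrier (free_mod R (I (Suc n))). f (d n x) = \<zero>\<^bsub>N\<^esub>}"

fun Ext_coboundaries ::
    "('a, 'c) ring_scheme \<Rightarrow> (nat \<Rightarrow> 'i set) \<Rightarrow> (nat \<Rightarrow> ('i \<Rightarrow> 'a) \<Rightarrow> 'i \<Rightarrow> 'a) \<Rightarrow>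
     ('a, 'e, 'f) module_scheme \<Rightarrow> nat \<Rightarrow> (('i \<Rightarrow> 'a) \<Rightarrow> 'e) set" where
  "Ext_coboundaries R I d N 0 = {\<zero>\<^bsub>hom_module R (free_mod R (I 0)) N\<^esub>}"
| "Ext_coboundaries R I d N (Suc n) =
     (\<lambda>g. compose (carrier (free_mod R (I (Suc n)))) g (d n)) `
       carrier (hom_module R (free_mod R (I n)) N)"

text \<open>
  The group $\mathrm{Ext}^n_R(M,N)$ computed from a free resolution \<open>(I, d)\<close> of \<open>M\<close>: the
  cohomology in degree \<open>n\<close> of the complex $\mathrm{Hom}_R(F_\bullet, N)$.
\<close>

definition Ext_group ::
    "('a, 'c) ring_scheme \<Rightarrow> (nat \<Rightarrow> 'i set) \<Rightarrow> (nat \<Rightarrow> ('i \<Rightarrow> 'a) \<Rightarrow> 'i \<Rightarrow> 'a) \<Rightarrow>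
     ('a, 'e, 'f) module_scheme \<Rightarrow> nat \<Rightarrow> (('i \<Rightarrow> 'a) \<Rightarrow> 'e) set monoid" where
  "Ext_group R I d N n =
     (hom_module R (free_mod R (I n)) N)\<lparr>carrier := Ext_cocycles R I d N n\<rparr>
       A_Mod Ext_coboundaries R I d N n"

text \<open>
  Vanishing of $\mathrm{Ext}^n_R(M,N)$. It does not matter which resolution is used, and the
  index type is large enough for one to exist for every module \<open>M\<close>: it is infinite and both
  \<open>M\<close> and \<open>R\<close> inject into it, so the free module on a set of indices, and hence every
  syzygy, again injects into it.
\<close>

definition Ext_vanishes ::
    "('a, 'c) ring_scheme \<Rightarrow> nat \<Rightarrow> ('a, 'b, 'd) module_scheme \<Rightarrow> ('a, 'e, 'f) module_scheme \<Rightarrow> bool"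
  where
  "Ext_vanishes R n M N \<longleftrightarrow>
     (\<exists>(I :: nat \<Rightarrow> ('b + 'a) list set) d e.
        free_resolution R M I d e \<and> trivial_group (Ext_group R I d N n))"

definition rigid_module :: "('a, 'c) ring_scheme \<Rightarrow> ('a, 'b, 'd) module_scheme \<Rightarrow> bool" where
  "rigid_module R M \<longleftrightarrow> Ext_vanishes R 1 M M"


section \<open>Gorenstein rings\<close>

definition gorenstein_local_ring :: "('a, 'c) ring_scheme \<Rightarrow> 'a set \<Rightarrow> bool" where
  "gorenstein_local_ring R \<mm> \<longleftrightarrow>
     local_ring R \<mm> \<and> noetherian_ring R \<and>
     (\<exists>i. krull_dim R < enat i \<and> Ext_vanishes R i (quotient_module R \<mm>) (ring_module R))"

text \<open>The maximal ideal \<open>\<mm>\<close> below is determined by the localization.\<close>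

definition gorenstein_ring :: "('a, 'c) ring_scheme \<Rightarrow> bool" where
  "gorenstein_ring R \<longleftrightarrow>
     cring R \<and> noetherian_ring R \<and>
     (\<forall>\<nn>. maximalideal \<nn> R \<longrightarrow> (\<exists>\<mm>. gorenstein_local_ring (localization_at R \<nn>) \<mm>))"

end

theory Submission
  imports Defs
begin

text \<open>
  Let $T = Z(\mathrm{End}_R(M))$ and let \<open>a\<close> be a parameter of \<open>R\<close>. It lies in every maximal ideal of
  \<open>T\<close>, and $T/a^kT$ is self-injective because \<open>T\<close> is Gorenstein. If all maps $M \to T$ had image in a
  maximal ideal $\mathfrak n$, a socle element \<open>b\<close> of $T/a^kT$ would satisfy $bM \subseteq a^kM$ for large
  \<open>k\<close>, hence $b \in a^kT$; so the trace ideal of \<open>M\<close> over \<open>T\<close> is \<open>T\<close>. Rigidity lifts every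
  \<open>R\<close>-linear map $M \to M/aM$ to an endomorphism, which commutes with \<open>T\<close>; through the trace ideal,
  every \<open>R\<close>-linear map $T \to T/aT$ is therefore \<open>T\<close>-linear, and by Nakayama's lemma $T = R$. Thus some
  map $M \to R$ is onto.
\<close>

text \<open>The Gorenstein condition is given as the vanishing of a single group Ext^i(k, R) with i
  > dim R, while the argument uses injectivity of R/a^kR. The bridge is elementary: vanishing passes
  from k to all ideals primary to the maximal ideal, one simple quotient at a time, and drops in
  degree by means of a syzygy isomorphic to the maximal ideal. This drop needs a nonzerodivisor,
  whose existence has to be shown as well: if the parameter found in R were a zerodivisor, k would
  be a direct summand of a primary ideal, and a similar descent would end in a contradiction. For T
  the condition is known only at the localizations, so injectivity modulo a^k is proved there and
  glued. Powers of a are needed because a map M -> T/aT need not lift to a map M -> T, whereas a map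
  M -> T/a^(s+1)T with s large agrees modulo a with one that does. Maps into quotients are
  represented throughout by functions that are linear up to congruence, so that values can be lifted
  and compared in one ring or module.\<close>

section \<open>Linear maps, submodules, kernels and images\<close>

lemma mod_homI:
  assumes "\<And>x. x \<in> carrier M \<Longrightarrow> h x \<in> carrier N"
    and "\<And>x y. x \<in> carrier M \<Longrightarrow> y \<in> carrier M \<Longrightarrow> h (x \<oplus>\<^bsub>M\<^esub> y) = h x \<oplus>\<^bsub>N\<^esub> h y"
    and "\<And>r x. r \<in> carrier R \<Longrightarrow> x \<in> carrier M \<Longrightarrow> h (r \<odot>\<^bsub>M\<^esub> x) = r \<odot>\<^bsub>N\<^esub> h x"
  shows "h \<in> mod_hom R M N"
  using assms unfolding mod_hom_def by auto

lemma mod_homD: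
  assumes "h \<in> mod_hom R M N"
  shows "x \<in> carrier M \<Longrightarrow> h x \<in> carrier N"
    and "x \<in> carrier M \<Longrightarrow> y \<in> carrier M \<Longrightarrow> h (x \<oplus>\<^bsub>M\<^esub> y) = h x \<oplus>\<^bsub>N\<^esub> h y"
    and "r \<in> carrier R \<Longrightarrow> x \<in> carrier M \<Longrightarrow> h (r \<odot>\<^bsub>M\<^esub> x) = r \<odot>\<^bsub>N\<^esub> h x"
  using assms unfolding mod_hom_def by auto

lemma mod_hom_zero:
  assumes "module R M" "module R N" "h \<in> mod_hom R M N"
  shows "h \<zero>\<^bsub>M\<^esub> = \<zero>\<^bsub>N\<^esub>"
proof -
  interpret M: module R M by fact
  interpret N: module R N by fact
  have "h (\<zero>\<^bsub>R\<^esub> \<odot>\<^bsub>M\<^esub> \<zero>\<^bsub>M\<^esub>) = \<zero>\<^bsub>R\<^esub> \<odot>\<^bsub>N\<^esub> h \<zero>\<^bsub>M\<^esub>"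
    by (rule mod_homD(3)[OF assms(3)]) simp_all
  then show ?thesis using mod_homD(1)[OF assms(3), of "\<zero>\<^bsub>M\<^esub>"] by simp
qed

lemma mod_hom_minus:
  assumes "module R M" "module R N" "h \<in> mod_hom R M N" "x \<in> carrier M"
  shows "h (\<ominus>\<^bsub>M\<^esub> x) = \<ominus>\<^bsub>N\<^esub> h x"
proof -
  interpret M: module R M by fact
  interpret N: module R N by fact
  have "h ((\<ominus>\<^bsub>R\<^esub> \<one>\<^bsub>R\<^esub>) \<odot>\<^bsub>M\<^esub> x) = (\<ominus>\<^bsub>R\<^esub> \<one>\<^bsub>R\<^esub>) \<odot>\<^bsub>N\<^esub> h x"
    by (rule mod_homD(3)[OF assms(3)]) (simp_all add: assms)
  then show ?thesis using mod_homD(1)[OF assms(3,4)] assms(4)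
    by (simp add: M.smult_l_minus N.smult_l_minus)
qed

lemma mod_hom_diff:
  assumes "module R M" "module R N" "h \<in> mod_hom R M N" "x \<in> carrier M" "y \<in> carrier M"
  shows "h (x \<ominus>\<^bsub>M\<^esub> y) = h x \<ominus>\<^bsub>N\<^esub> h y"
proof -
  interpret M: module R M by fact
  interpret N: module R N by fact
  show ?thesis
    using assms mod_homD(2)[OF assms(3), of x "\<ominus>\<^bsub>M\<^esub> y"] mod_hom_minus[OF assms(1-3,5)]
    by (simp add: a_minus_def)
qed

lemma mod_hom_comp:
  "f \<in> mod_hom R M N \<Longrightarrow> g \<in> mod_hom R N L \<Longrightarrow> (\<lambda>x. g (f x)) \<in> mod_hom R M L"
  unfolding mod_hom_def by (auto simp: Pi_def)

lemma mod_hom_add_fun: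
  assumes "module R N" "f \<in> mod_hom R M N" "g \<in> mod_hom R M N"
  shows "(\<lambda>x. f x \<oplus>\<^bsub>N\<^esub> g x) \<in> mod_hom R M N"
proof -
  interpret N: module R N by fact
  show ?thesis
    by (rule mod_homI) (use mod_homD[OF assms(2)] mod_homD[OF assms(3)] in
        \<open>simp_all add: N.smult_r_distr N.add.m_ac\<close>)
qed

lemma mod_hom_smult_fun:
  assumes "module R N" "f \<in> mod_hom R M N" "r \<in> carrier R"
  shows "(\<lambda>x. r \<odot>\<^bsub>N\<^esub> f x) \<in> mod_hom R M N"
proof -
  interpret N: module R N by fact
  show ?thesis
  proof (rule mod_homI)
    fix x assume x: "x \<in> carrier M"
    note f = mod_homD[OF assms(2)]
    show "r \<odot>\<^bsub>N\<^esub> f x \<in> carrier N" using f(1)[OF x] assms(3) by simp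
    { fix y assume "y \<in> carrier M"
      then show "r \<odot>\<^bsub>N\<^esub> f (x \<oplus>\<^bsub>M\<^esub> y) = r \<odot>\<^bsub>N\<^esub> f x \<oplus>\<^bsub>N\<^esub> r \<odot>\<^bsub>N\<^esub> f y"
        using f(1,2) x assms(3) by (simp add: N.smult_r_distr) }
    { fix s assume s: "s \<in> carrier R"
      then have "r \<odot>\<^bsub>N\<^esub> f (s \<odot>\<^bsub>M\<^esub> x) = (r \<otimes>\<^bsub>R\<^esub> s) \<odot>\<^bsub>N\<^esub> f x"
        using f(1,3) x assms(3) by (simp add: N.smult_assoc1)
      also have "\<dots> = s \<odot>\<^bsub>N\<^esub> (r \<odot>\<^bsub>N\<^esub> f x)"
        using N.smult_assoc1[OF s assms(3) f(1)[OF x]] N.m_comm[OF s assms(3)] by simp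
      finally show "r \<odot>\<^bsub>N\<^esub> f (s \<odot>\<^bsub>M\<^esub> x) = s \<odot>\<^bsub>N\<^esub> (r \<odot>\<^bsub>N\<^esub> f x)" . }
  qed
qed

lemma mod_hom_diff_fun:
  assumes "module R N" "f \<in> mod_hom R M N" "g \<in> mod_hom R M N"
  shows "(\<lambda>x. f x \<ominus>\<^bsub>N\<^esub> g x) \<in> mod_hom R M N"
proof -
  interpret N: module R N by fact
  show ?thesis
    by (rule mod_homI) (use mod_homD[OF assms(2)] mod_homD[OF assms(3)] in
        \<open>simp_all add: N.smult_r_distr N.add.m_ac a_minus_def N.minus_add N.smult_r_minus\<close>)
qed

lemma mod_hom_zero_fun:
  assumes "module R N"
  shows "(\<lambda>x. \<zero>\<^bsub>N\<^esub>) \<in> mod_hom R M N"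
proof -
  interpret N: module R N by fact
  show ?thesis by (rule mod_homI) simp_all
qed

lemma mod_hom_id: "(\<lambda>x. x) \<in> mod_hom R M M"
  by (rule mod_homI) simp_all

lemma mod_hom_restrict_domain:
  "f \<in> mod_hom R M N \<Longrightarrow> K \<subseteq> carrier M \<Longrightarrow> f \<in> mod_hom R (M\<lparr>carrier := K\<rparr>) N"
  unfolding mod_hom_def by (auto simp: subset_iff)

lemma mod_hom_restrict_codomain:
  "f \<in> mod_hom R M N \<Longrightarrow> f ` carrier M \<subseteq> K \<Longrightarrow> f \<in> mod_hom R M (N\<lparr>carrier := K\<rparr>)"
  unfolding mod_hom_def by auto

lemma mod_hom_extend_codomain:
  "f \<in> mod_hom R M (N\<lparr>carrier := K\<rparr>) \<Longrightarrow> K \<subseteq> carrier N \<Longrightarrow> f \<in> mod_hom R M N"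
  unfolding mod_hom_def by auto

lemma mod_hom_cong:
  assumes "module R M" "f \<in> mod_hom R M N" "\<And>x. x \<in> carrier M \<Longrightarrow> g x = f x"
  shows "g \<in> mod_hom R M N"
proof -
  interpret M: module R M by fact
  show ?thesis
    by (rule mod_homI) (use mod_homD[OF assms(2)] assms(3) in simp_all)
qed

lemma submodule_module: "module R M \<Longrightarrow> submodule K R M \<Longrightarrow> module R (M\<lparr>carrier := K\<rparr>)"
  by (rule submodule.submodule_is_module)

lemma submodule_zero: "submodule K R M \<Longrightarrow> \<zero>\<^bsub>M\<^esub> \<in> K"
  using subgroup.one_closed[OF submodule.axioms(1)] by simp

lemma submodule_diff:
  assumes "module R M" "submodule K R M" "x \<in> K" "y \<in> K"
  shows "x \<ominus>\<^bsub>M\<^esub> y \<in> K"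
  using module.submoduleE[OF assms(1,2)] assms(3,4) by (simp add: a_minus_def)

definition hom_ker :: "('a, 'b, 'd) module_scheme \<Rightarrow> ('a, 'e, 'f) module_scheme \<Rightarrow> ('b \<Rightarrow> 'e) \<Rightarrow> 'b set" where
  "hom_ker M N f = {x \<in> carrier M. f x = \<zero>\<^bsub>N\<^esub>}"

lemma submodule_vimage:
  assumes "module R M" "module R N" "f \<in> mod_hom R M N" "submodule K R N"
  shows "submodule {x \<in> carrier M. f x \<in> K} R M"
proof -
  interpret M: module R M by fact
  interpret N: module R N by fact
  show ?thesis
    using N.submoduleE[OF assms(4)] submodule_zero[OF assms(4)] mod_hom_zero[OF assms(1-3)]
      mod_hom_minus[OF assms(1-3)] mod_homD[OF assms(3)]
    by (intro M.submoduleI) auto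
qed

lemma zero_submodule:
  assumes "module R M" shows "submodule {\<zero>\<^bsub>M\<^esub>} R M"
proof -
  interpret M: module R M by fact
  show ?thesis by (intro M.submoduleI) auto
qed

lemma hom_ker_submodule:
  assumes "module R M" "module R N" "f \<in> mod_hom R M N"
  shows "submodule (hom_ker M N f) R M"
  using submodule_vimage[OF assms zero_submodule[OF assms(2)]] unfolding hom_ker_def by simp

lemma submodule_image:
  assumes "module R M" "module R N" "f \<in> mod_hom R M N" "submodule K R M"
  shows "submodule (f ` K) R N"
proof -
  interpret M: module R M by fact
  interpret N: module R N by fact
  note K = M.submoduleE[OF assms(4)]
  show ?thesis
  proof (rule N.submoduleI)
    show "f ` K \<subseteq> carrier N" using K mod_homD[OF assms(3)] by auto
    show "\<zero>\<^bsub>N\<^esub> \<in> f ` K"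
      using submodule_zero[OF assms(4)] mod_hom_zero[OF assms(1-3)] by force
    fix a assume "a \<in> f ` K"
    then obtain x where x: "x \<in> K" "a = f x" by auto
    then show "\<ominus>\<^bsub>N\<^esub> a \<in> f ` K"
      using K(1,3) mod_hom_minus[OF assms(1-3), of x] by (metis imageI subsetD)
    { fix b assume "b \<in> f ` K"
      then obtain y where y: "y \<in> K" "b = f y" by auto
      then have "a \<oplus>\<^bsub>N\<^esub> b = f (x \<oplus>\<^bsub>M\<^esub> y)"
        using mod_homD(2)[OF assms(3), of x y] x K(1) by (simp add: subset_iff)
      then show "a \<oplus>\<^bsub>N\<^esub> b \<in> f ` K" using K(5) x y by blast }
    { fix r assume r: "r \<in> carrier R"
      then have "r \<odot>\<^bsub>N\<^esub> a = f (r \<odot>\<^bsub>M\<^esub> x)"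
        using mod_homD(3)[OF assms(3), of r x] x K(1) by (simp add: subset_iff)
      then show "r \<odot>\<^bsub>N\<^esub> a \<in> f ` K" using K(4) x r by blast }
  qed
qed

lemma submodule_Int:
  assumes "module R M" "submodule K R M" "submodule L R M"
  shows "submodule (K \<inter> L) R M"
proof -
  interpret M: module R M by fact
  show ?thesis
    using M.submoduleE[OF assms(2)] M.submoduleE[OF assms(3)] submodule_zero[OF assms(2)] submodule_zero[OF assms(3)]
    by (intro M.submoduleI) auto
qed

lemma (in abelian_group) minus_eq_zero_iff:
  assumes "x \<in> carrier G" "y \<in> carrier G"
  shows "x \<ominus> y = \<zero> \<longleftrightarrow> x = y"
proof
  assume "x \<ominus> y = \<zero>"
  then have "(x \<ominus> y) \<oplus> y = y" using assms by simp
  then show "x = y" using assms by (simp add: a_minus_def a_assoc l_neg)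
qed (use assms in \<open>simp add: a_minus_def r_neg\<close>)

subsection \<open>Free modules\<close>

lemma free_mod_simps [simp]:
  "\<zero>\<^bsub>free_mod R I\<^esub> = (\<lambda>i. \<zero>\<^bsub>R\<^esub>)"
  "f \<oplus>\<^bsub>free_mod R I\<^esub> g = (\<lambda>i. f i \<oplus>\<^bsub>R\<^esub> g i)"
  "r \<odot>\<^bsub>free_mod R I\<^esub> f = (\<lambda>i. r \<otimes>\<^bsub>R\<^esub> f i)"
  by (simp_all add: free_mod_def)

lemma free_mod_carrier:
  "v \<in> carrier (free_mod R I) \<longleftrightarrow>
    (\<forall>i. v i \<in> carrier R) \<and> finite {i. v i \<noteq> \<zero>\<^bsub>R\<^esub>} \<and> (\<forall>i. i \<notin> I \<longrightarrow> v i = \<zero>\<^bsub>R\<^esub>)"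
  by (auto simp: free_mod_def)

lemma free_mod_carrierI:
  assumes "v \<in> carrier (free_mod R J)" "\<And>i. w i \<in> carrier R" "\<And>i. v i = \<zero>\<^bsub>R\<^esub> \<Longrightarrow> w i = \<zero>\<^bsub>R\<^esub>"
    "\<And>i. i \<notin> I \<Longrightarrow> w i = \<zero>\<^bsub>R\<^esub>"
  shows "w \<in> carrier (free_mod R I)"
proof -
  have "{i. w i \<noteq> \<zero>\<^bsub>R\<^esub>} \<subseteq> {i. v i \<noteq> \<zero>\<^bsub>R\<^esub>}" using assms(3) by auto
  then show ?thesis using assms finite_subset unfolding free_mod_carrier by blast
qed

lemma free_mod_module:
  assumes "cring R" shows "module R (free_mod R I)"
proof -
  interpret R: cring R by fact
  show ?thesis
  proof (rule moduleI[OF assms])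
    show "abelian_group (free_mod R I)"
    proof (rule abelian_groupI)
      fix x y z assume x: "x \<in> carrier (free_mod R I)" and y: "y \<in> carrier (free_mod R I)"
        and z: "z \<in> carrier (free_mod R I)"
      have "{i. x i \<oplus>\<^bsub>R\<^esub> y i \<noteq> \<zero>\<^bsub>R\<^esub>} \<subseteq> {i. x i \<noteq> \<zero>\<^bsub>R\<^esub>} \<union> {i. y i \<noteq> \<zero>\<^bsub>R\<^esub>}"
        using x y by (auto simp: free_mod_carrier)
      then have "finite {i. x i \<oplus>\<^bsub>R\<^esub> y i \<noteq> \<zero>\<^bsub>R\<^esub>}"
        using x y finite_subset unfolding free_mod_carrier by blast
      then show "x \<oplus>\<^bsub>free_mod R I\<^esub> y \<in> carrier (free_mod R I)"
        using x y by (auto simp: free_mod_carrier)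
      show "x \<oplus>\<^bsub>free_mod R I\<^esub> y \<oplus>\<^bsub>free_mod R I\<^esub> z = x \<oplus>\<^bsub>free_mod R I\<^esub> (y \<oplus>\<^bsub>free_mod R I\<^esub> z)"
        using x y z by (auto simp: free_mod_carrier R.a_assoc)
      show "x \<oplus>\<^bsub>free_mod R I\<^esub> y = y \<oplus>\<^bsub>free_mod R I\<^esub> x"
        using x y by (auto simp: free_mod_carrier R.a_comm)
      show "\<zero>\<^bsub>free_mod R I\<^esub> \<oplus>\<^bsub>free_mod R I\<^esub> x = x" using x by (auto simp: free_mod_carrier)
      have "(\<lambda>i. \<ominus>\<^bsub>R\<^esub> x i) \<in> carrier (free_mod R I)"
        by (rule free_mod_carrierI[OF x]) (use x in \<open>auto simp: free_mod_carrier\<close>)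
      then show "\<exists>y\<in>carrier (free_mod R I). y \<oplus>\<^bsub>free_mod R I\<^esub> x = \<zero>\<^bsub>free_mod R I\<^esub>"
        by (rule bexI[rotated]) (use x in \<open>auto simp: free_mod_carrier R.l_neg\<close>)
    qed (auto simp: free_mod_carrier)
  next
    fix a x assume "a \<in> carrier R" and x: "x \<in> carrier (free_mod R I)"
    then show "a \<odot>\<^bsub>free_mod R I\<^esub> x \<in> carrier (free_mod R I)"
      by (intro free_mod_carrierI[OF x]) (auto simp: free_mod_carrier)
  qed (auto simp: free_mod_carrier R.l_distr R.r_distr R.m_assoc)
qed

definition unit_vec :: "('a, 'c) ring_scheme \<Rightarrow> 'i \<Rightarrow> 'i \<Rightarrow> 'a" where
  "unit_vec R i = (\<lambda>j. if j = i then \<one>\<^bsub>R\<^esub> else \<zero>\<^bsub>R\<^esub>)"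

lemma unit_vec_carrier:
  assumes "cring R" "i \<in> I" shows "unit_vec R i \<in> carrier (free_mod R I)"
proof -
  interpret R: cring R by fact
  have "{j. unit_vec R i j \<noteq> \<zero>\<^bsub>R\<^esub>} \<subseteq> {i}" by (auto simp: unit_vec_def)
  then show ?thesis using assms finite_subset by (force simp: free_mod_carrier unit_vec_def)
qed

text \<open>Besides equality of linear maps, this serves for congruences between a linear map and
  one that is linear only modulo an ideal or a submodule, which have to be carried through sums and
  multiples by hand.\<close>

lemma free_mod_induct [consumes 2, case_names zero add unit]:
  assumes "cring R" "v \<in> carrier (free_mod R I)"
    and zero: "P \<zero>\<^bsub>free_mod R I\<^esub>"
    and add: "\<And>v w. v \<in> carrier (free_mod R I) \<Longrightarrow> w \<in> carrier (free_mod R I) \<Longrightarrow> P v \<Longrightarrow> P w \<Longrightarrow> P (v \<oplus>\<^bsub>free_mod R I\<^esub> w)"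
    and unit: "\<And>r i. r \<in> carrier R \<Longrightarrow> i \<in> I \<Longrightarrow> P (r \<odot>\<^bsub>free_mod R I\<^esub> unit_vec R i)"
  shows "P v"
proof -
  interpret R: cring R by fact
  interpret F: module R "free_mod R I" by (rule free_mod_module[OF assms(1)])
  \<comment> \<open>Induction on a finite set containing the support: clearing one entry of v leaves
    a vector supported on the rest, and the difference is a multiple of a basis vector.\<close>
  have "\<forall>v \<in> carrier (free_mod R I). {i. v i \<noteq> \<zero>\<^bsub>R\<^esub>} \<subseteq> A \<longrightarrow> P v" if "finite A" for A
    using that
  proof induction
    case empty
    have "v = \<zero>\<^bsub>free_mod R I\<^esub>" if "{i. v i \<noteq> \<zero>\<^bsub>R\<^esub>} \<subseteq> {}" for v using that by (auto simp: fun_eq_iff)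
    then show ?case using zero by metis
  next
    case (insert a A)
    show ?case
    proof (intro ballI impI)
      fix v assume v: "v \<in> carrier (free_mod R I)" and s: "{i. v i \<noteq> \<zero>\<^bsub>R\<^esub>} \<subseteq> insert a A"
      define w where "w = v(a := \<zero>\<^bsub>R\<^esub>)"
      have w: "w \<in> carrier (free_mod R I)"
        by (rule free_mod_carrierI[OF v]) (use v in \<open>auto simp: w_def free_mod_carrier\<close>)
      have "{i. w i \<noteq> \<zero>\<^bsub>R\<^esub>} \<subseteq> A" using s by (auto simp: w_def)
      then have Pw: "P w" using insert.IH w by blast
      show "P v"
      proof (cases "v a = \<zero>\<^bsub>R\<^esub>")
        case True
        then have "w = v" by (auto simp: w_def)
        then show ?thesis using Pw by simp
      next
        case False
        then have a: "a \<in> I" "v a \<in> carrier R" using v by (auto simp: free_mod_carrier)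
        have "v = w \<oplus>\<^bsub>free_mod R I\<^esub> (v a \<odot>\<^bsub>free_mod R I\<^esub> unit_vec R a)"
          using v by (auto simp: w_def unit_vec_def free_mod_carrier fun_eq_iff)
        then show ?thesis
          using add[OF w _ Pw unit[OF a(2,1)]] unit_vec_carrier[OF assms(1) a(1)] a(2) F.smult_closed by metis
      qed
    qed
  qed
  then show ?thesis using assms(2) by (auto simp: free_mod_carrier)
qed

lemma free_hom_eq:
  assumes "cring R" "module R N" "f \<in> mod_hom R (free_mod R I) N" "g \<in> mod_hom R (free_mod R I) N"
    and "\<And>i. i \<in> I \<Longrightarrow> f (unit_vec R i) = g (unit_vec R i)" "v \<in> carrier (free_mod R I)"
  shows "f v = g v"
  using assms(1,6)
proof (induction rule: free_mod_induct)
  case zero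
  then show ?case
    using mod_hom_zero[OF free_mod_module[OF assms(1)] assms(2)] assms(3,4) by metis
next
  case (add v w)
  then show ?case using mod_homD(2)[OF assms(3)] mod_homD(2)[OF assms(4)] by metis
next
  case (unit r i)
  then show ?case
    using mod_homD(3)[OF assms(3)] mod_homD(3)[OF assms(4)] assms(5) unit_vec_carrier[OF assms(1)] by metis
qed

text \<open>The sum runs over the support of v, which changes with v. Additivity is therefore proved
  after enlarging the supports of v, w and their sum to a common finite set by
  \<open>lin_ext_superset\<close>.\<close>

definition lin_ext :: "('a, 'c) ring_scheme \<Rightarrow> ('a, 'b, 'd) module_scheme \<Rightarrow> ('i \<Rightarrow> 'b) \<Rightarrow> ('i \<Rightarrow> 'a) \<Rightarrow> 'b" where
  "lin_ext R N x v = (\<Oplus>\<^bsub>N\<^esub>i\<in>{i. v i \<noteq> \<zero>\<^bsub>R\<^esub>}. v i \<odot>\<^bsub>N\<^esub> x i)"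

lemma lin_ext_superset:
  assumes "module R N" "v \<in> carrier (free_mod R I)" "\<And>i. i \<in> I \<Longrightarrow> x i \<in> carrier N"
    "finite A" "{i. v i \<noteq> \<zero>\<^bsub>R\<^esub>} \<subseteq> A" "A \<subseteq> I"
  shows "lin_ext R N x v = (\<Oplus>\<^bsub>N\<^esub>i\<in>A. v i \<odot>\<^bsub>N\<^esub> x i)"
proof -
  interpret N: module R N by fact
  show ?thesis unfolding lin_ext_def
    by (rule N.add.finprod_mono_neutral_cong_left)
      (use assms in \<open>auto simp: free_mod_carrier\<close>)
qed

lemma lin_ext_hom:
  assumes "module R N" "\<And>i. i \<in> I \<Longrightarrow> x i \<in> carrier N"
  shows "lin_ext R N x \<in> mod_hom R (free_mod R I) N"
proof -
  interpret N: module R N by fact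
  interpret F: module R "free_mod R I" by (rule free_mod_module[OF N.is_cring])
  have supp: "{i. v i \<noteq> \<zero>\<^bsub>R\<^esub>} \<subseteq> I" "finite {i. v i \<noteq> \<zero>\<^bsub>R\<^esub>}" "\<And>i. v i \<in> carrier R"
    if "v \<in> carrier (free_mod R I)" for v using that by (auto simp: free_mod_carrier)
  show ?thesis
  proof (rule mod_homI)
    fix v assume v: "v \<in> carrier (free_mod R I)"
    show "lin_ext R N x v \<in> carrier N"
      unfolding lin_ext_def by (rule N.finsum_closed) (use supp[OF v] assms(2) in auto)
    { fix w assume w: "w \<in> carrier (free_mod R I)"
      let ?A = "{i. v i \<noteq> \<zero>\<^bsub>R\<^esub>} \<union> {i. w i \<noteq> \<zero>\<^bsub>R\<^esub>}"
      have A: "finite ?A" "?A \<subseteq> I" using supp[OF v] supp[OF w] by auto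
      have xA: "\<And>i. i \<in> ?A \<Longrightarrow> x i \<in> carrier N" using A assms(2) by blast
      have s: "{i. (v \<oplus>\<^bsub>free_mod R I\<^esub> w) i \<noteq> \<zero>\<^bsub>R\<^esub>} \<subseteq> ?A"
        using supp(3)[OF v] supp(3)[OF w] by auto
      have "lin_ext R N x (v \<oplus>\<^bsub>free_mod R I\<^esub> w) = (\<Oplus>\<^bsub>N\<^esub>i\<in>?A. (v \<oplus>\<^bsub>free_mod R I\<^esub> w) i \<odot>\<^bsub>N\<^esub> x i)"
        by (rule lin_ext_superset[OF assms(1) F.a_closed[OF v w] assms(2) A(1) s A(2)])
      also have "\<dots> = (\<Oplus>\<^bsub>N\<^esub>i\<in>?A. (v i \<odot>\<^bsub>N\<^esub> x i) \<oplus>\<^bsub>N\<^esub> (w i \<odot>\<^bsub>N\<^esub> x i))"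
        by (rule N.finsum_cong') (use xA supp(3)[OF v] supp(3)[OF w] in \<open>auto simp: N.smult_l_distr\<close>)
      also have "\<dots> = (\<Oplus>\<^bsub>N\<^esub>i\<in>?A. v i \<odot>\<^bsub>N\<^esub> x i) \<oplus>\<^bsub>N\<^esub> (\<Oplus>\<^bsub>N\<^esub>i\<in>?A. w i \<odot>\<^bsub>N\<^esub> x i)"
        by (rule N.finsum_addf) (use xA supp(3)[OF v] supp(3)[OF w] in auto)
      also have "\<dots> = lin_ext R N x v \<oplus>\<^bsub>N\<^esub> lin_ext R N x w"
        using lin_ext_superset[OF assms(1) v assms(2) A(1) _ A(2)] lin_ext_superset[OF assms(1) w assms(2) A(1) _ A(2)] by auto
      finally show "lin_ext R N x (v \<oplus>\<^bsub>free_mod R I\<^esub> w) = lin_ext R N x v \<oplus>\<^bsub>N\<^esub> lin_ext R N x w" . }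
    { fix r assume r: "r \<in> carrier R"
      let ?A = "{i. v i \<noteq> \<zero>\<^bsub>R\<^esub>}"
      have xA: "\<And>i. i \<in> ?A \<Longrightarrow> x i \<in> carrier N" using supp[OF v] assms(2) by blast
      have "lin_ext R N x (r \<odot>\<^bsub>free_mod R I\<^esub> v) = (\<Oplus>\<^bsub>N\<^esub>i\<in>?A. (r \<odot>\<^bsub>free_mod R I\<^esub> v) i \<odot>\<^bsub>N\<^esub> x i)"
        by (rule lin_ext_superset[OF assms(1) F.smult_closed[OF r v] assms(2) supp(2)[OF v] _ supp(1)[OF v]]) (use r in auto)
      also have "\<dots> = (\<Oplus>\<^bsub>N\<^esub>i\<in>?A. r \<odot>\<^bsub>N\<^esub> (v i \<odot>\<^bsub>N\<^esub> x i))"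
        by (rule N.finsum_cong') (use xA supp(3)[OF v] r in \<open>auto simp: N.smult_assoc1\<close>)
      also have "\<dots> = r \<odot>\<^bsub>N\<^esub> lin_ext R N x v"
        unfolding lin_ext_def
        by (rule N.finsum_smult_ldistr[symmetric]) (use xA supp[OF v] r in auto)
      finally show "lin_ext R N x (r \<odot>\<^bsub>free_mod R I\<^esub> v) = r \<odot>\<^bsub>N\<^esub> lin_ext R N x v" . }
  qed
qed

lemma lin_ext_unit:
  assumes "module R N" "\<And>i. i \<in> I \<Longrightarrow> x i \<in> carrier N" "i \<in> I"
  shows "lin_ext R N x (unit_vec R i) = x i"
proof -
  interpret N: module R N by fact
  have "lin_ext R N x (unit_vec R i) = (\<Oplus>\<^bsub>N\<^esub>j\<in>{i}. unit_vec R i j \<odot>\<^bsub>N\<^esub> x j)"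
    by (rule lin_ext_superset[OF assms(1) unit_vec_carrier[OF N.is_cring assms(3)]])
      (use assms in \<open>auto simp: unit_vec_def\<close>)
  also have "\<dots> = x i" using assms by (simp add: unit_vec_def)
  finally show ?thesis .
qed

lemma free_hom_exists:
  assumes "module R N" "\<And>i. i \<in> I \<Longrightarrow> x i \<in> carrier N"
  obtains h where "h \<in> mod_hom R (free_mod R I) N" "\<And>i. i \<in> I \<Longrightarrow> h (unit_vec R i) = x i"
  using that[of "lin_ext R N x", OF lin_ext_hom[OF assms] lin_ext_unit[OF assms]] by simp

text \<open>Projectivity of free modules: preimages are chosen for the basis vectors only, and
  linearity does the rest.\<close>

lemma free_hom_lift:
  assumes "module R N" "module R G" "f \<in> mod_hom R (free_mod R I) N" "q \<in> mod_hom R G N"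
    and "f ` carrier (free_mod R I) \<subseteq> q ` carrier G"
  obtains h where "h \<in> mod_hom R (free_mod R I) G" "\<And>v. v \<in> carrier (free_mod R I) \<Longrightarrow> q (h v) = f v"
proof -
  interpret N: module R N by fact
  have "\<exists>y. y \<in> carrier G \<and> q y = f (unit_vec R i)" if "i \<in> I" for i
    using assms(5) unit_vec_carrier[OF N.is_cring that] by (metis (no_types, lifting) image_iff image_subset_iff)
  then obtain y where y: "\<And>i. i \<in> I \<Longrightarrow> y i \<in> carrier G \<and> q (y i) = f (unit_vec R i)" by metis
  obtain h where h: "h \<in> mod_hom R (free_mod R I) G" "\<And>i. i \<in> I \<Longrightarrow> h (unit_vec R i) = y i"
    using free_hom_exists[OF assms(2), of I y] y by blast
  show ?thesis
  proof (rule that[OF h(1)])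
    fix v assume v: "v \<in> carrier (free_mod R I)"
    show "q (h v) = f v"
      using free_hom_eq[OF N.is_cring assms(1) mod_hom_comp[OF h(1) assms(4)] assms(3) _ v] h y by simp
  qed
qed

text \<open>Maps out of a quotient of F without forming the quotient. The section \<open>s\<close>
  of p is an arbitrary choice and not linear; its composite with f is linear because f is constant
  on the fibres of p.\<close>

lemma mod_hom_descend:
  assumes "module R F" "module R X" "module R N" "p \<in> mod_hom R F X" "p ` carrier F = carrier X"
    and "f \<in> mod_hom R F N" "\<And>v. v \<in> carrier F \<Longrightarrow> p v = \<zero>\<^bsub>X\<^esub> \<Longrightarrow> f v = \<zero>\<^bsub>N\<^esub>"
  obtains h where "h \<in> mod_hom R X N" "\<And>v. v \<in> carrier F \<Longrightarrow> h (p v) = f v"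
proof -
  interpret F: module R F by fact
  interpret X: module R X by fact
  interpret N: module R N by fact
  define s where "s y = (SOME v. v \<in> carrier F \<and> p v = y)" for y
  have s: "s y \<in> carrier F \<and> p (s y) = y" if "y \<in> carrier X" for y
  proof -
    have "y \<in> p ` carrier F" using that assms(5) by simp
    then have "\<exists>v. v \<in> carrier F \<and> p v = y" by blast
    then show ?thesis unfolding s_def by (rule someI_ex)
  qed
  have eq: "f v = f w" if "v \<in> carrier F" "w \<in> carrier F" "p v = p w" for v w
  proof -
    have "p (v \<ominus>\<^bsub>F\<^esub> w) = p w \<ominus>\<^bsub>X\<^esub> p w"
      using mod_hom_diff[OF assms(1,2,4) that(1,2)] that(3) by simp
    also have "\<dots> = \<zero>\<^bsub>X\<^esub>" using mod_homD(1)[OF assms(4) that(2)] by (simp add: X.r_neg a_minus_def)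
    finally have "f (v \<ominus>\<^bsub>F\<^esub> w) = \<zero>\<^bsub>N\<^esub>" using assms(7)[of "v \<ominus>\<^bsub>F\<^esub> w"] F.minus_closed that(1,2) by blast
    then have "f v \<ominus>\<^bsub>N\<^esub> f w = \<zero>\<^bsub>N\<^esub>" using mod_hom_diff[OF assms(1,3,6) that(1,2)] by simp
    then show ?thesis
      using N.M.minus_eq_zero_iff[OF mod_homD(1)[OF assms(6) that(1)] mod_homD(1)[OF assms(6) that(2)]] by simp
  qed
  have 1: "f (s (p v)) = f v" if "v \<in> carrier F" for v
    using eq s that mod_homD(1)[OF assms(4)] by blast
  show ?thesis
  proof (rule that[of "\<lambda>y. f (s y)"])
    show "(\<lambda>y. f (s y)) \<in> mod_hom R X N"
    proof (rule mod_homI)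
      fix x assume x: "x \<in> carrier X"
      show "f (s x) \<in> carrier N" using s[OF x] mod_homD(1)[OF assms(6)] by simp
      { fix y assume y: "y \<in> carrier X"
        have "f (s (x \<oplus>\<^bsub>X\<^esub> y)) = f (s x \<oplus>\<^bsub>F\<^esub> s y)"
          using s[OF x] s[OF y] s[of "x \<oplus>\<^bsub>X\<^esub> y"] x y mod_homD(2)[OF assms(4), of "s x" "s y"] by (intro eq) simp_all
        then show "f (s (x \<oplus>\<^bsub>X\<^esub> y)) = f (s x) \<oplus>\<^bsub>N\<^esub> f (s y)"
          using s[OF x] s[OF y] mod_homD(2)[OF assms(6)] by simp }
      { fix r assume r: "r \<in> carrier R"
        have "f (s (r \<odot>\<^bsub>X\<^esub> x)) = f (r \<odot>\<^bsub>F\<^esub> s x)"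
          using s[OF x] s[of "r \<odot>\<^bsub>X\<^esub> x"] x r mod_homD(3)[OF assms(4), of r "s x"] by (intro eq) simp_all
        then show "f (s (r \<odot>\<^bsub>X\<^esub> x)) = r \<odot>\<^bsub>N\<^esub> f (s x)"
          using s[OF x] r mod_homD(3)[OF assms(6)] by simp }
    qed
  qed (use 1 in auto)
qed

section \<open>The ring as a module over itself\<close>

lemma ring_module_module:
  assumes "cring R" shows "module R (ring_module R)"
proof -
  interpret R: cring R by fact
  show ?thesis
  proof (rule moduleI[OF assms])
    show "abelian_group (ring_module R)"
      by (rule abelian_groupI)
        (use R.a_ac R.l_neg in \<open>auto simp: ring_module_def intro!: bexI[of _ "\<ominus>\<^bsub>R\<^esub> _"]\<close>)
  qed (auto simp: ring_module_def R.l_distr R.r_distr R.m_assoc)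
qed

lemma ring_module_simps [simp]:
  "carrier (ring_module R) = carrier R" "\<zero>\<^bsub>ring_module R\<^esub> = \<zero>\<^bsub>R\<^esub>"
  "x \<oplus>\<^bsub>ring_module R\<^esub> y = x \<oplus>\<^bsub>R\<^esub> y" "r \<odot>\<^bsub>ring_module R\<^esub> x = r \<otimes>\<^bsub>R\<^esub> x"
  by (simp_all add: ring_module_def)

lemma ring_module_minus [simp]:
  "\<ominus>\<^bsub>ring_module R\<^esub> x = \<ominus>\<^bsub>R\<^esub> x" "x \<ominus>\<^bsub>ring_module R\<^esub> y = x \<ominus>\<^bsub>R\<^esub> y"
  by (simp_all add: a_minus_def a_inv_def m_inv_def ring_module_def)

subsection \<open>Chain conditions\<close>

text \<open>The condition is relative to K so that submodules of M can be treated inside M, without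
  passing to a module with another carrier.\<close>

definition acc :: "('a, 'c) ring_scheme \<Rightarrow> ('a, 'b, 'd) module_scheme \<Rightarrow> 'b set \<Rightarrow> bool" where
  "acc R M K \<longleftrightarrow>
     (\<forall>Y::nat \<Rightarrow> 'b set. (\<forall>n. submodule (Y n) R M \<and> Y n \<subseteq> K \<and> Y n \<subseteq> Y (Suc n)) \<longrightarrow>
        (\<exists>n. \<forall>k\<ge>n. Y k = Y n))"

lemma accI:
  assumes "\<And>Y::nat \<Rightarrow> 'b set. (\<And>n. submodule (Y n) R M) \<Longrightarrow> (\<And>n. Y n \<subseteq> K) \<Longrightarrow> (\<And>n k. n \<le> k \<Longrightarrow> Y n \<subseteq> Y k) \<Longrightarrow>
      \<exists>n. \<forall>k\<ge>n. Y k = Y n"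
  shows "acc R M K"
  unfolding acc_def
proof (intro allI impI)
  fix Y :: "nat \<Rightarrow> 'b set"
  assume Y: "\<forall>n. submodule (Y n) R M \<and> Y n \<subseteq> K \<and> Y n \<subseteq> Y (Suc n)"
  then have "Y n \<subseteq> Y k" if "n \<le> k" for n k using lift_Suc_mono_le[of Y n k] that by blast
  then show "\<exists>n. \<forall>k\<ge>n. Y k = Y n" using assms[of Y] Y by blast
qed

lemma accD:
  assumes "acc R M K" "\<And>n. submodule (Y n) R M" "\<And>n. Y n \<subseteq> K" "\<And>n. Y n \<subseteq> Y (Suc n)"
  shows "\<exists>n. \<forall>k\<ge>n. Y k = Y n"
proof -
  have "\<forall>n. submodule (Y n) R M \<and> Y n \<subseteq> K \<and> Y n \<subseteq> Y (Suc n)" by (intro allI conjI assms(2-4))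
  then show ?thesis using assms(1)[unfolded acc_def] by (elim allE[of _ Y] impE)
qed

lemma acc_mono: "acc R M K \<Longrightarrow> L \<subseteq> K \<Longrightarrow> acc R M L"
  unfolding acc_def by (meson order_trans)

text \<open>Without a maximal member, iterating a choice of strictly larger members gives a strictly
  increasing sequence.\<close>

lemma acc_maximal:
  assumes "acc R M K" "\<A> \<noteq> {}" "\<And>Y. Y \<in> \<A> \<Longrightarrow> submodule Y R M \<and> Y \<subseteq> K"
  shows "\<exists>Y\<in>\<A>. \<forall>Z\<in>\<A>. Y \<subseteq> Z \<longrightarrow> Z = Y"
proof (rule ccontr)
    assume "\<not> ?thesis"
    then have "\<forall>Y. \<exists>Z. Y \<in> \<A> \<longrightarrow> Z \<in> \<A> \<and> Y \<subset> Z" by blast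
    then obtain f where f: "\<And>Y. Y \<in> \<A> \<Longrightarrow> f Y \<in> \<A> \<and> Y \<subset> f Y" by metis
    obtain Y0 where Y0: "Y0 \<in> \<A>" using assms(2) by blast
    define Y where "Y n = (f ^^ n) Y0" for n
    have Y: "Y n \<in> \<A>" for n by (induction n) (use Y0 f in \<open>auto simp: Y_def\<close>)
    have S: "Y n \<subset> Y (Suc n)" for n using f[OF Y[of n]] by (simp add: Y_def)
    have "\<exists>n. \<forall>k\<ge>n. Y k = Y n"
      using assms(3)[OF Y] S by (intro accD[OF assms(1)]) auto
    then obtain n where "\<forall>k\<ge>n. Y k = Y n" by (rule exE)
    then show False using S[of n] by (metis le_SucI order_refl psubset_eq)
qed

text \<open>Images and intersections with the kernel both become stationary. Beyond that point an
  element y of a later member has the same image as some z in the stable one, and y - z lies in the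
  stable part of the kernel.\<close>

lemma acc_extension:
  assumes "module R M" "module R N" "f \<in> mod_hom R M N" "submodule K R M"
    and "acc R N (f ` K)" "acc R M (K \<inter> hom_ker M N f)"
  shows "acc R M K"
proof (rule accI)
  interpret M: module R M by fact
  interpret N: module R N by fact
  fix Y :: "nat \<Rightarrow> _" assume Y: "\<And>n. submodule (Y n) R M" "\<And>n. Y n \<subseteq> K" "\<And>n k. n \<le> k \<Longrightarrow> Y n \<subseteq> Y k"
  have "\<exists>n. \<forall>k\<ge>n. f ` Y k = f ` Y n"
    using submodule_image[OF assms(1-3) Y(1)] Y(2) Y(3)[OF le_SucI[OF order_refl]]
    by (intro accD[OF assms(5)] image_mono)
  then obtain n1 where n1: "\<forall>k\<ge>n1. f ` Y k = f ` Y n1" by (rule exE)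
  have "\<exists>n. \<forall>k\<ge>n. Y k \<inter> hom_ker M N f = Y n \<inter> hom_ker M N f"
  proof (rule accD[OF assms(6), of "\<lambda>n. Y n \<inter> hom_ker M N f"])
    show "submodule (Y n \<inter> hom_ker M N f) R M" for n
      by (rule submodule_Int[OF assms(1) Y(1) hom_ker_submodule[OF assms(1-3)]])
    show "Y n \<inter> hom_ker M N f \<subseteq> K \<inter> hom_ker M N f" for n using Y(2) by blast
    show "Y n \<inter> hom_ker M N f \<subseteq> Y (Suc n) \<inter> hom_ker M N f" for n using Y(3)[OF le_SucI[OF order_refl], of n] by blast
  qed
  then obtain n2 where n2: "\<forall>k\<ge>n2. Y k \<inter> hom_ker M N f = Y n2 \<inter> hom_ker M N f" by (rule exE)
  have "Y k \<subseteq> Y (max n1 n2)" if k: "max n1 n2 \<le> k" for k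
  proof
    let ?m = "max n1 n2"
    fix y assume y: "y \<in> Y k"
    have "f y \<in> f ` Y ?m" using y n1[rule_format, of k] n1[rule_format, of ?m] k by auto
    then obtain z where z: "z \<in> Y ?m" "f z = f y" by auto
    have zk: "z \<in> Y k" using z Y(3)[OF k] by auto
    have c: "y \<in> carrier M" "z \<in> carrier M" using y zk M.submoduleE(1)[OF Y(1)] by blast+
    have "f (y \<ominus>\<^bsub>M\<^esub> z) = \<zero>\<^bsub>N\<^esub>"
      using mod_hom_diff[OF assms(1-3) c] z mod_homD(1)[OF assms(3) c(1)] by (simp add: N.M.minus_eq_zero_iff)
    then have "y \<ominus>\<^bsub>M\<^esub> z \<in> Y k \<inter> hom_ker M N f"
      using submodule_diff[OF assms(1) Y(1) y zk] M.minus_closed[OF c] by (simp add: hom_ker_def)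
    then have "y \<ominus>\<^bsub>M\<^esub> z \<in> Y ?m" using n2[rule_format, of k] n2[rule_format, of ?m] k by auto
    then have "(y \<ominus>\<^bsub>M\<^esub> z) \<oplus>\<^bsub>M\<^esub> z \<in> Y ?m" using z M.submoduleE(5)[OF Y(1)] by blast
    then show "y \<in> Y ?m" using c by (simp add: a_minus_def M.a_assoc M.l_neg)
  qed
  then show "\<exists>n. \<forall>k\<ge>n. Y k = Y n" using Y(3) by (intro exI[of _ "max n1 n2"]) (simp add: subset_antisym)
qed

lemma acc_image:
  assumes "module R M" "module R N" "f \<in> mod_hom R M N" "submodule K R M" "acc R M K"
  shows "acc R N (f ` K)"
proof (rule accI)
  fix Y :: "nat \<Rightarrow> _" assume Y: "\<And>n. submodule (Y n) R N" "\<And>n. Y n \<subseteq> f ` K" "\<And>n k. n \<le> k \<Longrightarrow> Y n \<subseteq> Y k"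
  have "\<exists>n. \<forall>k\<ge>n. K \<inter> {x \<in> carrier M. f x \<in> Y k} = K \<inter> {x \<in> carrier M. f x \<in> Y n}"
  proof (rule accD[OF assms(5), of "\<lambda>n. K \<inter> {x \<in> carrier M. f x \<in> Y n}"])
    show "submodule (K \<inter> {x \<in> carrier M. f x \<in> Y n}) R M" for n
      by (rule submodule_Int[OF assms(1,4) submodule_vimage[OF assms(1-3) Y(1)]])
    show "K \<inter> {x \<in> carrier M. f x \<in> Y n} \<subseteq> K \<inter> {x \<in> carrier M. f x \<in> Y (Suc n)}" for n
      using Y(3)[OF le_SucI[OF order_refl], of n] by blast
  qed blast
  then obtain n where n: "\<forall>k\<ge>n. K \<inter> {x \<in> carrier M. f x \<in> Y k} = K \<inter> {x \<in> carrier M. f x \<in> Y n}" by (rule exE)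
  have KM: "K \<subseteq> carrier M" by (rule module.submoduleE(1)[OF assms(1,4)])
  have eq: "Y k = f ` (K \<inter> {x \<in> carrier M. f x \<in> Y k})" for k using Y(2)[of k] KM by blast
  have "Y k = Y n" if "n \<le> k" for k using eq[of k] eq[of n] n[rule_format, OF that] by simp
  then show "\<exists>n. \<forall>k\<ge>n. Y k = Y n" by blast
qed

text \<open>One map is peeled off at a time: its image has the chain condition inside N, and on its
  kernel the remaining maps are still jointly injective. The lemma is applied to the coordinates of
  a free module, to an inclusion, and to the evaluation of endomorphisms at generators.\<close>

lemma acc_joint:
  assumes "finite A" "module R M" "module R N" "\<And>i. i \<in> A \<Longrightarrow> f i \<in> mod_hom R M N" "acc R N (carrier N)"
    and "submodule K R M" "\<And>y. y \<in> K \<Longrightarrow> (\<And>i. i \<in> A \<Longrightarrow> f i y = \<zero>\<^bsub>N\<^esub>) \<Longrightarrow> y = \<zero>\<^bsub>M\<^esub>"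
  shows "acc R M K"
  using assms(1,4,6,7)
proof (induction A arbitrary: K)
  case empty
  have "Y = {\<zero>\<^bsub>M\<^esub>}" if "submodule Y R M" "Y \<subseteq> K" for Y
    using submodule_zero[OF that(1)] that(2) empty(3) by blast
  then show ?case by (intro accI) (metis order_refl)
next
  case (insert a A)
  have fa: "f a \<in> mod_hom R M N" using insert.prems by simp
  note ker = submodule_Int[OF assms(2) insert.prems(2) hom_ker_submodule[OF assms(2,3) fa]]
  show ?case
  proof (rule acc_extension[OF assms(2,3) fa insert.prems(2)])
    show "acc R N (f a ` K)"
      by (rule acc_mono[OF assms(5)]) (use mod_homD(1)[OF fa] module.submoduleE(1)[OF assms(2) insert.prems(2)] in blast)
    show "acc R M (K \<inter> hom_ker M N (f a))"
      by (rule insert.IH[OF _ ker]) (use insert.prems in \<open>auto simp: hom_ker_def\<close>)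
  qed
qed

section \<open>Ideals as submodules, and Noetherian rings\<close>

lemma submodule_ring_module_iff:
  assumes "cring R" shows "submodule I R (ring_module R) \<longleftrightarrow> ideal I R"
proof -
  interpret R: cring R by fact
  interpret M: module R "ring_module R" by (rule ring_module_module[OF assms])
  show ?thesis
  proof
    assume I: "submodule I R (ring_module R)"
    note E = M.submoduleE[OF I]
    show "ideal I R"
    proof (rule idealI[OF R.ring_axioms])
      show "subgroup I (add_monoid R)"
        using E(1-3) E(5) by (intro R.add.subgroupI) (simp_all flip: a_inv_def)
      fix a x assume a: "a \<in> I" and x: "x \<in> carrier R"
      have "a \<in> carrier R" using a E(1) by auto
      then show "x \<otimes>\<^bsub>R\<^esub> a \<in> I" "a \<otimes>\<^bsub>R\<^esub> x \<in> I" using E(4)[OF x a] R.m_comm x by simp_all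
    qed
  next
    assume "ideal I R"
    then interpret I: ideal I R .
    show "submodule I R (ring_module R)"
      by (intro M.submoduleI) (auto intro: I.I_l_closed)
  qed
qed

lemma (in noetherian_ring) ideal_maximal:
  assumes "\<A> \<noteq> {}" "\<And>I. I \<in> \<A> \<Longrightarrow> ideal I R"
  shows "\<exists>I\<in>\<A>. \<forall>J\<in>\<A>. I \<subseteq> J \<longrightarrow> J = I"
proof (rule subset_Zorn)
    fix C assume C: "subset.chain \<A> C"
    show "\<exists>u\<in>\<A>. \<forall>X\<in>C. X \<subseteq> u"
    proof (cases "C = {}")
      case True then show ?thesis using assms(1) by blast
    next
      case False
      have "subset.chain {I. ideal I R} C" using C assms(2) unfolding pred_on.chain_def by blast
      \<comment> \<open>In a Noetherian ring a nonempty chain of ideals has a largest member, which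
        is the upper bound that Zorn's lemma asks for.\<close>
      then have "\<Union>C \<in> C" by (rule ideal_chain_is_trivial[OF False])
      then have "\<Union>C \<in> \<A>" using C unfolding pred_on.chain_def by blast
      then show ?thesis by (intro bexI[of _ "\<Union>C"]) auto
    qed
qed

lemma acc_ring_module:
  assumes "cring R" "noetherian_ring R"
  shows "acc R (ring_module R) (carrier R)"
proof (rule accI)
  interpret noetherian_ring R by fact
  fix Y :: "nat \<Rightarrow> _" assume Y: "\<And>n. submodule (Y n) R (ring_module R)" "\<And>n k. n \<le> k \<Longrightarrow> Y n \<subseteq> Y k"
  have "\<exists>I\<in>range Y. \<forall>J\<in>range Y. I \<subseteq> J \<longrightarrow> J = I"
    by (rule ideal_maximal) (use Y submodule_ring_module_iff[OF assms(1)] in auto)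
  then obtain n where "\<forall>k. Y n \<subseteq> Y k \<longrightarrow> Y k = Y n" by auto
  then show "\<exists>n. \<forall>k\<ge>n. Y k = Y n" using Y(2) by blast
qed

lemma acc_free_mod:
  assumes "cring R" "noetherian_ring R" "finite I"
  shows "acc R (free_mod R I) (carrier (free_mod R I))"
proof -
  interpret F: module R "free_mod R I" by (rule free_mod_module[OF assms(1)])
  show ?thesis
  proof (rule acc_joint[where f = "\<lambda>i v. v i", OF assms(3) free_mod_module[OF assms(1)] ring_module_module[OF assms(1)]])
    show "(\<lambda>v. v i) \<in> mod_hom R (free_mod R I) (ring_module R)" for i
      by (rule mod_homI) (simp_all add: free_mod_carrier)
    show "acc R (ring_module R) (carrier (ring_module R))" using acc_ring_module[OF assms(1,2)] by simp
    show "submodule (carrier (free_mod R I)) R (free_mod R I)" by (rule F.carrier_is_submodule)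
    fix y assume "y \<in> carrier (free_mod R I)" "\<And>i. i \<in> I \<Longrightarrow> y i = \<zero>\<^bsub>ring_module R\<^esub>"
    then have "y i = \<zero>\<^bsub>R\<^esub>" for i by (cases "i \<in> I") (simp_all add: free_mod_carrier)
    then show "y = \<zero>\<^bsub>free_mod R I\<^esub>" by (simp add: fun_eq_iff)
  qed
qed

section \<open>Finite free covers\<close>

definition cover ::
    "('a, 'c) ring_scheme \<Rightarrow> 'i set \<Rightarrow> (('i \<Rightarrow> 'a) \<Rightarrow> 'b) \<Rightarrow> ('a, 'b, 'd) module_scheme \<Rightarrow> bool" where
  "cover R I p X \<longleftrightarrow> p \<in> mod_hom R (free_mod R I) X \<and> p ` carrier (free_mod R I) = carrier X"

lemma free_mod_mono: "I \<subseteq> J \<Longrightarrow> carrier (free_mod R I) \<subseteq> carrier (free_mod R J)"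
  by (auto simp: free_mod_def)

text \<open>Finite generation from the chain condition: among the images of free modules of finite
  rank in K there is a maximal one, and one more basis vector, sent to an arbitrary x in K, cannot
  enlarge it.\<close>

lemma acc_cover:
  assumes "module R M" "submodule K R M" "acc R M K"
  obtains g :: nat and p where "cover R {..<g} p (M\<lparr>carrier := K\<rparr>)"
proof -
  interpret M: module R M by fact
  let ?K = "M\<lparr>carrier := K\<rparr>"
  have Km: "module R ?K" by (rule submodule_module[OF assms(1,2)])
  interpret K: module R ?K by (rule Km)
  have KM: "K \<subseteq> carrier M" by (rule M.submoduleE(1)[OF assms(2)])
  define \<A> where "\<A> = {p ` carrier (free_mod R {..<g::nat}) | g p. p \<in> mod_hom R (free_mod R {..<g}) ?K}"
  have "(\<lambda>x. \<zero>\<^bsub>M\<^esub>) \<in> mod_hom R (free_mod R {..<0::nat}) ?K"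
    using mod_hom_zero_fun[OF Km] by simp
  then have ne: "\<A> \<noteq> {}" unfolding \<A>_def by blast
  have "\<exists>Y\<in>\<A>. \<forall>Z\<in>\<A>. Y \<subseteq> Z \<longrightarrow> Z = Y"
  proof (rule acc_maximal[OF assms(3) ne])
    fix Y assume "Y \<in> \<A>"
    then obtain g :: nat and p where p: "p \<in> mod_hom R (free_mod R {..<g}) ?K" "Y = p ` carrier (free_mod R {..<g})"
      unfolding \<A>_def by blast
    have "p \<in> mod_hom R (free_mod R {..<g}) M" by (rule mod_hom_extend_codomain[OF p(1) KM])
    then have "submodule Y R M"
      unfolding p(2)
      by (rule submodule_image[OF free_mod_module[OF M.is_cring] assms(1) _
            module.carrier_is_submodule[OF free_mod_module[OF M.is_cring]]])
    moreover have "Y \<subseteq> K" using mod_homD(1)[OF p(1)] p(2) by auto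
    ultimately show "submodule Y R M \<and> Y \<subseteq> K" by blast
  qed
  then obtain Y where Y: "Y \<in> \<A>" "\<And>Z. Z \<in> \<A> \<Longrightarrow> Y \<subseteq> Z \<Longrightarrow> Z = Y" by auto
  then obtain g :: nat and p where p: "p \<in> mod_hom R (free_mod R {..<g}) ?K" "Y = p ` carrier (free_mod R {..<g})"
    unfolding \<A>_def by blast
  have "x \<in> Y" if x: "x \<in> K" for x
  proof -
    have "(if i < g then p (unit_vec R i) else x) \<in> carrier ?K" for i
      using x mod_homD(1)[OF p(1)] unit_vec_carrier[OF M.is_cring, of i "{..<g}"] by simp
    from free_hom_exists[where I = "{..<Suc g}" and x = "\<lambda>i. if i < g then p (unit_vec R i) else x", OF Km this]
    obtain q where
      q: "q \<in> mod_hom R (free_mod R {..<Suc g}) ?K"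
      "\<And>i. i \<in> {..<Suc g} \<Longrightarrow> q (unit_vec R i) = (if i < g then p (unit_vec R i) else x)" by auto
    have sub: "carrier (free_mod R {..<g}) \<subseteq> carrier (free_mod R {..<Suc g})" by (rule free_mod_mono) auto
    have q': "q \<in> mod_hom R (free_mod R {..<g}) ?K"
      using mod_homD[OF q(1)] sub by (intro mod_homI) (simp_all add: subset_iff)
    have "q v = p v" if "v \<in> carrier (free_mod R {..<g})" for v
      by (rule free_hom_eq[OF M.is_cring Km q' p(1) _ that]) (use q(2) in auto)
    then have "Y \<subseteq> q ` carrier (free_mod R {..<Suc g})" using p(2) sub by force
    moreover have "q ` carrier (free_mod R {..<Suc g}) \<in> \<A>" using q(1) unfolding \<A>_def by blast
    ultimately have "q ` carrier (free_mod R {..<Suc g}) = Y" using Y(2) by blast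
    moreover have "q (unit_vec R g) \<in> q ` carrier (free_mod R {..<Suc g})"
      by (rule imageI, rule unit_vec_carrier[OF M.is_cring]) simp
    ultimately show ?thesis using q(2)[of g] by simp
  qed
  then have "Y = K" using mod_homD(1)[OF p(1)] p(2) by auto
  then have "cover R {..<g} p ?K" unfolding cover_def using p by simp
  then show ?thesis by (rule that)
qed

lemma finsum_in_submodule:
  assumes "module R M" "submodule K R M" "finite A" "\<And>a. a \<in> A \<Longrightarrow> f a \<in> K"
  shows "(\<Oplus>\<^bsub>M\<^esub>a\<in>A. f a) \<in> K"
proof -
  interpret M: module R M by fact
  note E = M.submoduleE[OF assms(2)]
  show ?thesis using assms(3,4)
  proof induction
    case empty then show ?case using submodule_zero[OF assms(2)] by simp
  next
    case (insert a A)
    then have "f \<in> A \<rightarrow> carrier M" "f a \<in> carrier M" using E(1) by auto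
    then show ?case using insert E(5) by simp
  qed
qed

lemma fg_module_cover:
  assumes "module R M" "fg_module R M"
  obtains g :: nat and p where "cover R {..<g} p M"
proof -
  interpret M: module R M by fact
  obtain A where A: "finite A" "A \<subseteq> carrier M"
    "\<And>x. x \<in> carrier M \<Longrightarrow> \<exists>c\<in>A \<rightarrow> carrier R. x = (\<Oplus>\<^bsub>M\<^esub>a\<in>A. c a \<odot>\<^bsub>M\<^esub> a)"
    using assms(2) unfolding fg_module_def by blast
  obtain e where e: "bij_betw e {..<card A} A" using A(1) by (metis atLeast0LessThan ex_bij_betw_nat_finite)
  then have eA: "e i \<in> A" if "i < card A" for i using that by (auto simp: bij_betw_def)
  have "e i \<in> carrier M" if "i \<in> {..<card A}" for i using that eA A(2) by auto
  from free_hom_exists[where I = "{..<card A}" and x = e, OF assms(1) this] obtain p where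
    p: "p \<in> mod_hom R (free_mod R {..<card A}) M" "\<And>i. i \<in> {..<card A} \<Longrightarrow> p (unit_vec R i) = e i" by auto
  note Fm = free_mod_module[OF M.is_cring, of "{..<card A}"]
  have sm: "submodule (p ` carrier (free_mod R {..<card A})) R M"
    by (rule submodule_image[OF Fm assms(1) p(1) module.carrier_is_submodule[OF Fm]])
  have "a \<in> p ` carrier (free_mod R {..<card A})" if "a \<in> A" for a
  proof -
    have "a \<in> e ` {..<card A}" using that bij_betw_imp_surj_on[OF e] by simp
    then obtain i where i: "a = e i" "i \<in> {..<card A}" by (rule imageE)
    then show ?thesis using p(2)[OF i(2)] imageI[OF unit_vec_carrier[OF M.is_cring i(2)], of p] by simp
  qed
  then have "x \<in> p ` carrier (free_mod R {..<card A})" if "x \<in> carrier M" for x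
    using A(3)[OF that] finsum_in_submodule[OF assms(1) sm A(1)] M.submoduleE(4)[OF sm] by (auto simp: Pi_iff)
  then have "cover R {..<card A} p M"
    unfolding cover_def using p(1) mod_homD(1)[OF p(1)] by blast
  then show ?thesis by (rule that)
qed

lemma cover_acc:
  assumes "cring R" "noetherian_ring R" "module R X" "cover R I p X" "finite I"
  shows "acc R X (carrier X)"
proof -
  note Fm = free_mod_module[OF assms(1), of I]
  show ?thesis
    using acc_image[OF Fm assms(3) _ module.carrier_is_submodule[OF Fm] acc_free_mod[OF assms(1,2,5)], of p] assms(4)
    unfolding cover_def by simp
qed

subsection \<open>Noetherian rings\<close>

lemma ideal_diff:
  assumes "ideal I R" "x \<in> I" "y \<in> I" shows "x \<ominus>\<^bsub>R\<^esub> y \<in> I"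
proof -
  interpret ideal I R by fact
  show ?thesis using assms a_inv_closed by (simp add: a_minus_def)
qed

definition colon :: "('a, 'c) ring_scheme \<Rightarrow> 'a set \<Rightarrow> 'a \<Rightarrow> 'a set" where
  "colon R I y = {s \<in> carrier R. s \<otimes>\<^bsub>R\<^esub> y \<in> I}"

lemma (in cring) idealI':
  assumes "I \<subseteq> carrier R" "\<zero> \<in> I" "\<And>x y. x \<in> I \<Longrightarrow> y \<in> I \<Longrightarrow> x \<oplus> y \<in> I"
    and "\<And>r x. r \<in> carrier R \<Longrightarrow> x \<in> I \<Longrightarrow> r \<otimes> x \<in> I"
  shows "ideal I R"
proof -
  interpret M: module R "ring_module R" by (rule ring_module_module[OF is_cring])
  have "\<ominus> x \<in> I" if "x \<in> I" for x
    using assms(4)[OF a_inv_closed[OF one_closed] that] assms(1) that by (auto simp: l_minus)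
  then have "submodule I R (ring_module R)" using assms by (intro M.submoduleI) auto
  then show ?thesis using submodule_ring_module_iff[OF is_cring] by blast
qed

lemma (in cring) colon_ideal:
  assumes "ideal I R" "y \<in> carrier R" shows "ideal (colon R I y) R"
proof -
  interpret I: ideal I R by fact
  show ?thesis
    by (rule idealI') (use assms(2) in \<open>auto simp: colon_def l_distr m_assoc I.I_l_closed\<close>)
qed

lemma (in cring) ideal_subset_colon:
  assumes "ideal I R" "y \<in> carrier R" shows "I \<subseteq> colon R I y"
proof -
  interpret I: ideal I R by fact
  show ?thesis using assms(2) by (auto simp: colon_def I.I_r_closed)
qed

lemma (in noetherian_ring) ex_maximalideal:
  assumes "ideal I R" "I \<noteq> carrier R"
  obtains J where "maximalideal J R" "I \<subseteq> J"
proof -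
  let ?A = "{J. ideal J R \<and> I \<subseteq> J \<and> J \<noteq> carrier R}"
  have "\<exists>J\<in>?A. \<forall>L\<in>?A. J \<subseteq> L \<longrightarrow> L = J"
    by (rule ideal_maximal) (use assms in auto)
  then obtain J where J: "J \<in> ?A" "\<forall>L\<in>?A. J \<subseteq> L \<longrightarrow> L = J" by (rule bexE)
  have "maximalideal J R"
  proof (rule maximalidealI)
    show "L = J \<or> L = carrier R" if "ideal L R" "J \<subseteq> L" for L
    proof -
      have "L \<noteq> carrier R \<Longrightarrow> L \<in> ?A" using that J(1) by blast
      then show ?thesis using J(2) that by blast
    qed
  qed (use J(1) in auto)
  then show ?thesis using that[of J] J by simp
qed

text \<open>Among the ideals $(I : y)$ contained in $P$, a maximal one is prime.\<close>

lemma colon_prime: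
  assumes "cring R" "noetherian_ring R" "ideal I R" "primeideal P R" "I \<subseteq> P"
  obtains y where "y \<in> carrier R" "primeideal (colon R I y) R" "colon R I y \<subseteq> P"
proof -
  interpret R: cring R by fact
  interpret N: noetherian_ring R by fact
  interpret P: primeideal P R by fact
  let ?A = "{colon R I y | y. y \<in> carrier R \<and> colon R I y \<subseteq> P}"
  have "colon R I \<one>\<^bsub>R\<^esub> = I" using ideal.Icarr[OF assms(3)] by (auto simp: colon_def)
  then have ne: "?A \<noteq> {}" using assms(5) R.one_closed by blast
  have "\<exists>Q\<in>?A. \<forall>J\<in>?A. Q \<subseteq> J \<longrightarrow> J = Q"
    by (rule N.ideal_maximal[OF ne]) (use R.colon_ideal[OF assms(3)] in auto)
  then obtain Q where Q: "Q \<in> ?A" "\<forall>J\<in>?A. Q \<subseteq> J \<longrightarrow> J = Q" by (rule bexE)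
  then obtain y where y: "y \<in> carrier R" "Q = colon R I y" "Q \<subseteq> P" by auto
  have Qi: "ideal Q R" using R.colon_ideal[OF assms(3)] y by simp
  \<comment> \<open>The ideal (I : uy) contains Q = (I : y); if it still lies in P, maximality makes
    the two equal.\<close>
  have step: "u \<otimes>\<^bsub>R\<^esub> s \<in> Q \<Longrightarrow> s \<in> Q" if "u \<in> carrier R" "s \<in> carrier R" "colon R I (u \<otimes>\<^bsub>R\<^esub> y) \<subseteq> P" for u s
  proof -
    assume us: "u \<otimes>\<^bsub>R\<^esub> s \<in> Q"
    have sub: "Q \<subseteq> colon R I (u \<otimes>\<^bsub>R\<^esub> y)"
    proof
      fix t assume "t \<in> Q"
      then have t: "t \<in> carrier R" "t \<otimes>\<^bsub>R\<^esub> y \<in> I" using y(2) by (auto simp: colon_def)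
      then have "u \<otimes>\<^bsub>R\<^esub> (t \<otimes>\<^bsub>R\<^esub> y) \<in> I" using ideal.I_l_closed[OF assms(3)] that(1) by blast
      then show "t \<in> colon R I (u \<otimes>\<^bsub>R\<^esub> y)" using t y(1) that(1) by (simp add: colon_def R.m_lcomm)
    qed
    have "colon R I (u \<otimes>\<^bsub>R\<^esub> y) \<in> ?A" using that y(1) by auto
    then have "colon R I (u \<otimes>\<^bsub>R\<^esub> y) = Q" using Q(2) sub by blast
    moreover have "s \<in> colon R I (u \<otimes>\<^bsub>R\<^esub> y)"
      using us that y(1,2) R.m_assoc[of s u y] R.m_comm[of s u] by (simp add: colon_def)
    ultimately show "s \<in> Q" by simp
  qed
  have "primeideal Q R"
  proof (rule primeidealI[OF Qi assms(1)])
    show "carrier R \<noteq> Q" using y(3) P.I_notcarr P.a_subset by blast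
    fix s t assume st: "s \<in> carrier R" "t \<in> carrier R" "s \<otimes>\<^bsub>R\<^esub> t \<in> Q"
    show "s \<in> Q \<or> t \<in> Q"
    proof (cases "colon R I (s \<otimes>\<^bsub>R\<^esub> y) \<subseteq> P")
      case True then show ?thesis using step[of s t] st by blast
    next
      \<comment> \<open>Some u outside P satisfies usy in I. Then (I : uy) lies in P, because vu in
        Q and u outside P give v in P, so \<open>step\<close> applies with u in the role of
        s.\<close>
      case False
      then obtain u where u: "u \<in> carrier R" "u \<otimes>\<^bsub>R\<^esub> (s \<otimes>\<^bsub>R\<^esub> y) \<in> I" "u \<notin> P" by (auto simp: colon_def)
      have "colon R I (u \<otimes>\<^bsub>R\<^esub> y) \<subseteq> P"
      proof
        fix v assume "v \<in> colon R I (u \<otimes>\<^bsub>R\<^esub> y)"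
        then have v: "v \<in> carrier R" "v \<otimes>\<^bsub>R\<^esub> u \<in> Q"
          using u y by (auto simp: colon_def R.m_assoc)
        then show "v \<in> P" using y(3) u P.I_prime by blast
      qed
      moreover have "u \<otimes>\<^bsub>R\<^esub> s \<in> Q" using u st y by (simp add: colon_def R.m_assoc)
      ultimately show ?thesis using step[of u s] u st by blast
    qed
  qed
  then show ?thesis using y by (intro that[of y]) simp_all
qed

text \<open>An ideal P that is maximal among those containing I and disjoint from S is prime: if a
  and b lie outside P, then P + Ra and P + Rb both meet S, and the product of two such elements
  would lie in S and, with ab in P, also in P.\<close>

lemma prime_avoiding:
  assumes "cring R" "noetherian_ring R" "ideal I R" "S \<subseteq> carrier R" "\<one>\<^bsub>R\<^esub> \<in> S"
    and "\<And>s t. s \<in> S \<Longrightarrow> t \<in> S \<Longrightarrow> s \<otimes>\<^bsub>R\<^esub> t \<in> S" "I \<inter> S = {}"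
  obtains P where "primeideal P R" "I \<subseteq> P" "P \<inter> S = {}"
proof -
  interpret R: cring R by fact
  interpret N: noetherian_ring R by fact
  let ?A = "{J. ideal J R \<and> I \<subseteq> J \<and> J \<inter> S = {}}"
  have "\<exists>P\<in>?A. \<forall>J\<in>?A. P \<subseteq> J \<longrightarrow> J = P"
    by (rule N.ideal_maximal) (use assms in auto)
  then obtain P where P: "P \<in> ?A" "\<forall>J\<in>?A. P \<subseteq> J \<longrightarrow> J = P" by (rule bexE)
  interpret P: ideal P R using P by simp
  have meets: "\<exists>p\<in>P. \<exists>r\<in>carrier R. p \<oplus>\<^bsub>R\<^esub> r \<otimes>\<^bsub>R\<^esub> a \<in> S" if a: "a \<in> carrier R" "a \<notin> P" for a
  proof (rule ccontr)
    assume neg: "\<not> ?thesis"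
    let ?J = "P <+>\<^bsub>R\<^esub> PIdl\<^bsub>R\<^esub> a"
    have J: "ideal ?J R" by (rule R.add_ideals[OF P.is_ideal R.cgenideal_ideal[OF a(1)]])
    have mem: "x \<in> ?J \<longleftrightarrow> (\<exists>p\<in>P. \<exists>r\<in>carrier R. x = p \<oplus>\<^bsub>R\<^esub> r \<otimes>\<^bsub>R\<^esub> a)" for x
      by (auto simp: set_add_def' cgenideal_def)
    have "P \<subseteq> ?J"
    proof
      fix p assume "p \<in> P"
      then show "p \<in> ?J" unfolding mem using a by (intro bexI[of _ p] bexI[of _ "\<zero>\<^bsub>R\<^esub>"]) auto
    qed
    moreover have "a \<in> ?J" unfolding mem using a by (intro bexI[of _ "\<zero>\<^bsub>R\<^esub>"] bexI[of _ "\<one>\<^bsub>R\<^esub>"]) auto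
    moreover have "x \<notin> S" if "x \<in> ?J" for x using neg that unfolding mem by metis
    ultimately have "?J \<in> ?A" using J P(1) by blast
    then have "?J = P" using P(2) \<open>P \<subseteq> ?J\<close> by blast
    then show False using \<open>a \<in> ?J\<close> a by blast
  qed
  have "primeideal P R"
  proof (rule primeidealI[OF P.is_ideal assms(1)])
    show "carrier R \<noteq> P" using P(1) assms(5) by blast
    fix a b assume ab: "a \<in> carrier R" "b \<in> carrier R" "a \<otimes>\<^bsub>R\<^esub> b \<in> P"
    show "a \<in> P \<or> b \<in> P"
    proof (rule ccontr)
      assume neg: "\<not> ?thesis"
      obtain p r where p: "p \<in> P" "r \<in> carrier R" "p \<oplus>\<^bsub>R\<^esub> r \<otimes>\<^bsub>R\<^esub> a \<in> S" using meets[OF ab(1)] neg by blast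
      obtain q s where q: "q \<in> P" "s \<in> carrier R" "q \<oplus>\<^bsub>R\<^esub> s \<otimes>\<^bsub>R\<^esub> b \<in> S" using meets[OF ab(2)] neg by blast
      have c: "p \<in> carrier R" "q \<in> carrier R" using p q by auto
      have "(p \<oplus>\<^bsub>R\<^esub> r \<otimes>\<^bsub>R\<^esub> a) \<otimes>\<^bsub>R\<^esub> (q \<oplus>\<^bsub>R\<^esub> s \<otimes>\<^bsub>R\<^esub> b) =
          ((q \<oplus>\<^bsub>R\<^esub> s \<otimes>\<^bsub>R\<^esub> b) \<otimes>\<^bsub>R\<^esub> p) \<oplus>\<^bsub>R\<^esub> ((r \<otimes>\<^bsub>R\<^esub> a) \<otimes>\<^bsub>R\<^esub> q \<oplus>\<^bsub>R\<^esub> (r \<otimes>\<^bsub>R\<^esub> s) \<otimes>\<^bsub>R\<^esub> (a \<otimes>\<^bsub>R\<^esub> b))"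
        using c p q ab by algebra
      also have "\<dots> \<in> P"
        using P.I_l_closed[OF p(1), of "q \<oplus>\<^bsub>R\<^esub> s \<otimes>\<^bsub>R\<^esub> b"] P.I_l_closed[OF q(1), of "r \<otimes>\<^bsub>R\<^esub> a"]
          P.I_l_closed[OF ab(3), of "r \<otimes>\<^bsub>R\<^esub> s"] c p q ab P.a_closed by simp
      finally show False using assms(6)[OF p(3) q(3)] P(1) by blast
    qed
  qed
  then show ?thesis using P(1) by (intro that[of P]) simp_all
qed

section \<open>Units and Nakayama's lemma in local rings\<close>

lemma local_unit:
  assumes "local_ring R \<mm>" "noetherian_ring R" "r \<in> carrier R" "r \<notin> \<mm>"
  shows "r \<in> Units R"
proof -
  interpret R: cring R using assms(1) unfolding local_ring_def by simp
  interpret N: noetherian_ring R by fact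
  have "PIdl\<^bsub>R\<^esub> r = carrier R"
  proof (rule ccontr)
    assume "PIdl\<^bsub>R\<^esub> r \<noteq> carrier R"
    then obtain J where "maximalideal J R" "PIdl\<^bsub>R\<^esub> r \<subseteq> J"
      using N.ex_maximalideal[OF R.cgenideal_ideal[OF assms(3)]] by blast
    then show False using assms(1,4) R.cgenideal_self[OF assms(3)] unfolding local_ring_def by blast
  qed
  then have "\<one>\<^bsub>R\<^esub> \<in> PIdl\<^bsub>R\<^esub> r" by simp
  then obtain s where s: "s \<in> carrier R" "\<one>\<^bsub>R\<^esub> = s \<otimes>\<^bsub>R\<^esub> r" unfolding cgenideal_def by blast
  then have "r \<otimes>\<^bsub>R\<^esub> s = \<one>\<^bsub>R\<^esub>" "s \<otimes>\<^bsub>R\<^esub> r = \<one>\<^bsub>R\<^esub>" using R.m_comm[OF s(1) assms(3)] by simp_all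
  then show ?thesis using s(1) assms(3) unfolding Units_def by blast
qed

lemma local_ringD:
  assumes "local_ring R \<mm>"
  shows "cring R" "maximalideal \<mm> R" "primeideal \<mm> R" "ideal \<mm> R" "\<mm> \<subseteq> carrier R" "\<one>\<^bsub>R\<^esub> \<notin> \<mm>"
proof -
  show c: "cring R" and m: "maximalideal \<mm> R" using assms unfolding local_ring_def by auto
  interpret maximalideal \<mm> R by fact
  show "primeideal \<mm> R" using cring.maximalideal_prime[OF c m] .
  show "ideal \<mm> R" "\<mm> \<subseteq> carrier R" by (rule is_ideal, rule a_subset)
  show "\<one>\<^bsub>R\<^esub> \<notin> \<mm>" using I_notcarr one_imp_carrier by blast
qed

lemma local_one_minus_unit:
  assumes "local_ring R \<mm>" "noetherian_ring R" "r \<in> \<mm>"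
  shows "\<one>\<^bsub>R\<^esub> \<ominus>\<^bsub>R\<^esub> r \<in> Units R"
proof -
  note L = local_ringD[OF assms(1)]
  interpret R: cring R by (rule L)
  interpret m: ideal \<mm> R by (rule L)
  have r: "r \<in> carrier R" using L assms by blast
  have "\<one>\<^bsub>R\<^esub> \<ominus>\<^bsub>R\<^esub> r \<notin> \<mm>"
  proof
    assume "\<one>\<^bsub>R\<^esub> \<ominus>\<^bsub>R\<^esub> r \<in> \<mm>"
    then have "(\<one>\<^bsub>R\<^esub> \<ominus>\<^bsub>R\<^esub> r) \<oplus>\<^bsub>R\<^esub> r \<in> \<mm>" using assms(3) by (rule m.a_closed)
    then show False using L(6) r by (simp add: a_minus_def R.a_assoc R.l_neg)
  qed
  then show ?thesis using local_unit[OF assms(1,2)] r by simp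
qed

text \<open>X/Z is simple, hence generated by any element outside Z and killed by \<mm>. For the
  latter, if rx were outside Z with r in \<mm>, then x = z + s(rx) for some z in Z, so (1 - sr)x
  lies in Z, and 1 - sr is a unit.\<close>

lemma nakayama_maximal:
  assumes "local_ring R \<mm>" "noetherian_ring R" "module R X" "acc R X (carrier X)"
    and "submodule Y R X" "Y \<noteq> carrier X"
  obtains Z where "submodule Z R X" "Y \<subseteq> Z" "Z \<noteq> carrier X"
    "\<And>r x. r \<in> \<mm> \<Longrightarrow> x \<in> carrier X \<Longrightarrow> r \<odot>\<^bsub>X\<^esub> x \<in> Z"
    "\<And>w x. w \<in> carrier X \<Longrightarrow> w \<notin> Z \<Longrightarrow> x \<in> carrier X \<Longrightarrow> \<exists>z\<in>Z. \<exists>r\<in>carrier R. x = z \<oplus>\<^bsub>X\<^esub> r \<odot>\<^bsub>X\<^esub> w"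
proof -
  interpret X: module R X by fact
  note L = local_ringD[OF assms(1)]
  let ?A = "{Z. submodule Z R X \<and> Y \<subseteq> Z \<and> Z \<noteq> carrier X}"
  have "\<exists>Z\<in>?A. \<forall>W\<in>?A. Z \<subseteq> W \<longrightarrow> W = Z"
    using assms(5,6) X.submoduleE(1) by (intro acc_maximal[OF assms(4)]) auto
  then obtain Z where Z: "Z \<in> ?A" "\<forall>W\<in>?A. Z \<subseteq> W \<longrightarrow> W = Z" by (rule bexE)
  have Zs: "submodule Z R X" using Z by simp
  note E = X.submoduleE[OF Zs]
  have gen: "\<exists>z\<in>Z. \<exists>r\<in>carrier R. x = z \<oplus>\<^bsub>X\<^esub> r \<odot>\<^bsub>X\<^esub> w" if w: "w \<in> carrier X" "w \<notin> Z" and x: "x \<in> carrier X" for w x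
  proof -
    let ?W = "{z \<oplus>\<^bsub>X\<^esub> r \<odot>\<^bsub>X\<^esub> w | z r. z \<in> Z \<and> r \<in> carrier R}"
    have zc: "z \<in> carrier X" if "z \<in> Z" for z using E(1) that by blast
    have W: "submodule ?W R X"
    proof (rule X.submoduleI)
      show "?W \<subseteq> carrier X" using zc w by auto
      show "\<zero>\<^bsub>X\<^esub> \<in> ?W" using submodule_zero[OF Zs] w X.zero_closed
        by (auto intro!: exI[of _ "\<zero>\<^bsub>X\<^esub>"] exI[of _ "\<zero>\<^bsub>R\<^esub>"])
      fix a assume "a \<in> ?W"
      then obtain z r where a: "a = z \<oplus>\<^bsub>X\<^esub> r \<odot>\<^bsub>X\<^esub> w" "z \<in> Z" "r \<in> carrier R" by auto
      have "\<ominus>\<^bsub>X\<^esub> a = (\<ominus>\<^bsub>X\<^esub> z) \<oplus>\<^bsub>X\<^esub> (\<ominus>\<^bsub>R\<^esub> r) \<odot>\<^bsub>X\<^esub> w"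
        using a zc[OF a(2)] w by (simp add: X.minus_add X.smult_l_minus)
      then show "\<ominus>\<^bsub>X\<^esub> a \<in> ?W" using a E(3) X.R.a_inv_closed by blast
      { fix b assume "b \<in> ?W"
        then obtain z' r' where b: "b = z' \<oplus>\<^bsub>X\<^esub> r' \<odot>\<^bsub>X\<^esub> w" "z' \<in> Z" "r' \<in> carrier R" by auto
        have "a \<oplus>\<^bsub>X\<^esub> b = (z \<oplus>\<^bsub>X\<^esub> z') \<oplus>\<^bsub>X\<^esub> (r \<oplus>\<^bsub>R\<^esub> r') \<odot>\<^bsub>X\<^esub> w"
          using a b zc w by (simp add: X.smult_l_distr X.a_ac)
        then show "a \<oplus>\<^bsub>X\<^esub> b \<in> ?W" using a b E(5) X.R.a_closed by blast }
      { fix s assume s: "s \<in> carrier R"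
        have "s \<odot>\<^bsub>X\<^esub> a = (s \<odot>\<^bsub>X\<^esub> z) \<oplus>\<^bsub>X\<^esub> (s \<otimes>\<^bsub>R\<^esub> r) \<odot>\<^bsub>X\<^esub> w"
          using a s zc w by (simp add: X.smult_r_distr X.smult_assoc1)
        then show "s \<odot>\<^bsub>X\<^esub> a \<in> ?W" using a s E(4) X.R.m_closed by blast }
    qed
    have ZW: "Z \<subseteq> ?W"
    proof
      fix z assume "z \<in> Z"
      moreover from this have "z = z \<oplus>\<^bsub>X\<^esub> \<zero>\<^bsub>R\<^esub> \<odot>\<^bsub>X\<^esub> w" using zc w by simp
      ultimately show "z \<in> ?W" using X.R.zero_closed by blast
    qed
    have "w = \<zero>\<^bsub>X\<^esub> \<oplus>\<^bsub>X\<^esub> \<one>\<^bsub>R\<^esub> \<odot>\<^bsub>X\<^esub> w" using w by simp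
    then have "w \<in> ?W" using submodule_zero[OF Zs] X.R.one_closed by blast
    then have "?W = carrier X" using Z W ZW w by blast
    then show ?thesis using x by blast
  qed
  have "r \<odot>\<^bsub>X\<^esub> x \<in> Z" if r: "r \<in> \<mm>" and x: "x \<in> carrier X" for r x
  proof (rule ccontr)
    assume n: "r \<odot>\<^bsub>X\<^esub> x \<notin> Z"
    have rc: "r \<in> carrier R" using r L by blast
    obtain z s where z: "z \<in> Z" "s \<in> carrier R" "x = z \<oplus>\<^bsub>X\<^esub> s \<odot>\<^bsub>X\<^esub> (r \<odot>\<^bsub>X\<^esub> x)"
      using gen[of "r \<odot>\<^bsub>X\<^esub> x" x] n rc x by auto
    have zc: "z \<in> carrier X" using E(1) z by blast
    let ?u = "\<one>\<^bsub>R\<^esub> \<ominus>\<^bsub>R\<^esub> s \<otimes>\<^bsub>R\<^esub> r"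
    have u: "?u \<in> Units R"
      by (rule local_one_minus_unit[OF assms(1,2)]) (use ideal.I_l_closed[OF L(4) r z(2)] in simp)
    have "?u \<odot>\<^bsub>X\<^esub> x = x \<ominus>\<^bsub>X\<^esub> s \<odot>\<^bsub>X\<^esub> (r \<odot>\<^bsub>X\<^esub> x)"
      using x rc z(2) by (simp add: a_minus_def X.smult_l_distr X.smult_l_minus X.smult_assoc1)
    also have "\<dots> = (z \<oplus>\<^bsub>X\<^esub> s \<odot>\<^bsub>X\<^esub> (r \<odot>\<^bsub>X\<^esub> x)) \<ominus>\<^bsub>X\<^esub> s \<odot>\<^bsub>X\<^esub> (r \<odot>\<^bsub>X\<^esub> x)" using z(3) by simp
    also have "\<dots> = z" using zc rc z(2) x by (simp add: a_minus_def X.a_assoc X.r_neg)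
    finally have ux: "?u \<odot>\<^bsub>X\<^esub> x = z" .
    have "x = inv\<^bsub>R\<^esub> ?u \<odot>\<^bsub>X\<^esub> (?u \<odot>\<^bsub>X\<^esub> x)"
      using u x X.R.Units_l_inv[OF u] X.smult_assoc1[of "inv\<^bsub>R\<^esub> ?u" ?u x] by (simp add: X.R.Units_closed)
    then have "x \<in> Z" using ux z(1) E(4) X.R.Units_inv_closed[OF u] by metis
    then show False using n rc E(4) by blast
  qed
  then show ?thesis using Z gen by (intro that[of Z]) simp_all
qed

subsection \<open>Vanishing of Ext by iterated syzygies\<close>

text \<open>
  \<open>ext_van n R I K\<close> says that $\mathrm{Ext}^{n+1}_R(F/K, R) = 0$, where \<open>F\<close> is the free module on \<open>I\<close>.
\<close>

primrec ext_van :: "nat \<Rightarrow> ('a, 'c) ring_scheme \<Rightarrow> 'i set \<Rightarrow> ('i \<Rightarrow> 'a) set \<Rightarrow> bool" where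
  "ext_van 0 R I K =
     (\<forall>f\<in>mod_hom R (free_mod R I\<lparr>carrier := K\<rparr>) (ring_module R).
        \<exists>g\<in>mod_hom R (free_mod R I) (ring_module R). \<forall>v\<in>K. g v = f v)"
| "ext_van (Suc n) R I K =
     (\<exists>J p. cover R J p (free_mod R I\<lparr>carrier := K\<rparr>) \<and>
        ext_van n R J (hom_ker (free_mod R J) (free_mod R I\<lparr>carrier := K\<rparr>) p))"

text \<open>The error term \<open>d\<close> is defined on the whole free module and takes values in
  K. Hence for a map f on K the composite of f with \<open>d\<close> extends to the free module
  automatically, which makes the error invisible to Ext.\<close>

definition syz_retract ::
    "('a, 'c) ring_scheme \<Rightarrow> 'i set \<Rightarrow> ('i \<Rightarrow> 'a) set \<Rightarrow> 'j set \<Rightarrow> ('j \<Rightarrow> 'a) set \<Rightarrow> bool" where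
  "syz_retract R I K J L \<longleftrightarrow>
     (\<exists>a\<in>mod_hom R (free_mod R I) (free_mod R J). \<exists>b\<in>mod_hom R (free_mod R J) (free_mod R I).
      \<exists>d\<in>mod_hom R (free_mod R I) (free_mod R I).
        a ` K \<subseteq> L \<and> b ` L \<subseteq> K \<and> d ` carrier (free_mod R I) \<subseteq> K \<and>
        (\<forall>v\<in>K. v = b (a v) \<oplus>\<^bsub>free_mod R I\<^esub> d v))"

text \<open>
  \<open>X\<close> is a retract of \<open>Z\<close> up to maps that factor through a free module. This relation passes to
  syzygies for arbitrary choices of the covers, and so yields both the independence of
  the vanishing of Ext from the resolution and its invariance under retracts.
\<close>

definition stable_retract :: "('a, 'c) ring_scheme \<Rightarrow> ('a, 'b, 'd) module_scheme \<Rightarrow> ('a, 'e, 'f) module_scheme \<Rightarrow> bool" where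
  "stable_retract R X Z \<longleftrightarrow>
     (\<exists>L::nat set. \<exists>i\<in>mod_hom R X Z. \<exists>q\<in>mod_hom R Z X. \<exists>\<alpha>\<in>mod_hom R X (free_mod R L). \<exists>\<beta>\<in>mod_hom R (free_mod R L) X.
        \<forall>x\<in>carrier X. x = q (i x) \<oplus>\<^bsub>X\<^esub> \<beta> (\<alpha> x))"

lemma stable_retractI:
  assumes "module R X" "i \<in> mod_hom R X Z" "q \<in> mod_hom R Z X" "\<And>x. x \<in> carrier X \<Longrightarrow> q (i x) = x"
  shows "stable_retract R X Z"
proof -
  interpret X: module R X by fact
  have "(\<lambda>x. \<zero>\<^bsub>free_mod R {}\<^esub>) \<in> mod_hom R X (free_mod R ({}::nat set))"
    by (rule mod_hom_zero_fun[OF free_mod_module[OF X.is_cring]])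
  moreover have "(\<lambda>x. \<zero>\<^bsub>X\<^esub>) \<in> mod_hom R (free_mod R ({}::nat set)) X"
    by (rule mod_hom_zero_fun[OF assms(1)])
  ultimately show ?thesis
    unfolding stable_retract_def
    by (intro exI[of _ "{}"] bexI[of _ i] bexI[of _ q] bexI[of _ "\<lambda>x. \<zero>\<^bsub>free_mod R {}\<^esub>"] bexI[of _ "\<lambda>x. \<zero>\<^bsub>X\<^esub>"])
      (use assms in simp_all)
qed

lemma stable_retract_refl: "module R X \<Longrightarrow> stable_retract R X X"
  by (rule stable_retractI[OF _ mod_hom_id mod_hom_id refl])

lemma coverD:
  assumes "cover R I p X"
  shows "p \<in> mod_hom R (free_mod R I) X" "p ` carrier (free_mod R I) = carrier X"
  using assms unfolding cover_def by auto

lemma cover_kernel_submodule: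
  assumes "module R X" "cover R I p X"
  shows "submodule (hom_ker (free_mod R I) X p) R (free_mod R I)"
proof -
  interpret X: module R X by fact
  show ?thesis by (rule hom_ker_submodule[OF free_mod_module[OF X.is_cring] assms(1) coverD(1)[OF assms(2)]])
qed

text \<open>Comparison of resolutions in one degree: \<open>i\<close>, \<open>r\<close> and
  \<open>\<beta>\<close> lift along the covers to \<open>a\<close>, \<open>b\<close> and
  \<open>t\<close>. The error term is v - b(a v) - t(\<alpha>(p v)). It is killed by p since r i +
  \<beta> \<alpha> is the identity, and its last summand vanishes on the kernel of p.\<close>

lemma syz_retract_cover:
  assumes "module R X" "module R Z" "cover R I p X" "cover R J q Z" "stable_retract R X Z"
  shows "syz_retract R I (hom_ker (free_mod R I) X p) J (hom_ker (free_mod R J) Z q)"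
proof -
  interpret X: module R X by fact
  interpret Z: module R Z by fact
  let ?FI = "free_mod R I" and ?FJ = "free_mod R J"
  note FI = free_mod_module[OF X.is_cring, of I] and FJ = free_mod_module[OF X.is_cring, of J]
  interpret FI: module R ?FI by (rule FI)
  note p = coverD[OF assms(3)] and q = coverD[OF assms(4)]
  obtain L :: "nat set" and i r \<alpha> \<beta> where
    i: "i \<in> mod_hom R X Z" and r: "r \<in> mod_hom R Z X" and \<alpha>: "\<alpha> \<in> mod_hom R X (free_mod R L)"
    and \<beta>: "\<beta> \<in> mod_hom R (free_mod R L) X" and id: "\<forall>x\<in>carrier X. x = r (i x) \<oplus>\<^bsub>X\<^esub> \<beta> (\<alpha> x)"
    using assms(5) unfolding stable_retract_def by (elim exE bexE) (assumption | rule that)+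
  have iX: "(\<lambda>v. i (p v)) ` carrier ?FI \<subseteq> q ` carrier ?FJ"
    using q(2) mod_homD(1)[OF i] mod_homD(1)[OF p(1)] by auto
  obtain a where a: "a \<in> mod_hom R ?FI ?FJ" and qa: "\<And>v. v \<in> carrier ?FI \<Longrightarrow> q (a v) = i (p v)"
    by (rule free_hom_lift[OF assms(2) FJ mod_hom_comp[OF p(1) i] q(1) iX]) (assumption | rule that)+
  have rZ: "(\<lambda>v. r (q v)) ` carrier ?FJ \<subseteq> p ` carrier ?FI"
    using p(2) mod_homD(1)[OF r] mod_homD(1)[OF q(1)] by auto
  obtain b where b: "b \<in> mod_hom R ?FJ ?FI" and pb: "\<And>v. v \<in> carrier ?FJ \<Longrightarrow> p (b v) = r (q v)"
    by (rule free_hom_lift[OF assms(1) FI mod_hom_comp[OF q(1) r] p(1) rZ]) (assumption | rule that)+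
  have "\<beta> ` carrier (free_mod R L) \<subseteq> p ` carrier ?FI" using p(2) mod_homD(1)[OF \<beta>] by auto
  then obtain t where t: "t \<in> mod_hom R (free_mod R L) ?FI" and pt: "\<And>v. v \<in> carrier (free_mod R L) \<Longrightarrow> p (t v) = \<beta> v"
    by (rule free_hom_lift[OF assms(1) FI \<beta> p(1)]) (assumption | rule that)+
  define s where "s v = b (a v) \<oplus>\<^bsub>?FI\<^esub> t (\<alpha> (p v))" for v
  have s: "s \<in> mod_hom R ?FI ?FI"
    unfolding s_def by (rule mod_hom_add_fun[OF FI mod_hom_comp[OF a b] mod_hom_comp[OF mod_hom_comp[OF p(1) \<alpha>] t]])
  define d where "d v = v \<ominus>\<^bsub>?FI\<^esub> s v" for v
  have d: "d \<in> mod_hom R ?FI ?FI"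
    unfolding d_def by (rule mod_hom_diff_fun[OF FI mod_hom_id s])
  have ps: "p (s v) = p v" if v: "v \<in> carrier ?FI" for v
  proof -
    have c: "b (a v) \<in> carrier ?FI" "t (\<alpha> (p v)) \<in> carrier ?FI" "a v \<in> carrier ?FJ"
      "\<alpha> (p v) \<in> carrier (free_mod R L)" "p v \<in> carrier X"
      using mod_homD(1)[OF a v] mod_homD(1)[OF p(1) v] mod_homD(1)[OF b] mod_homD(1)[OF t] mod_homD(1)[OF \<alpha>] by auto
    have "p (s v) = p (b (a v)) \<oplus>\<^bsub>X\<^esub> p (t (\<alpha> (p v)))"
      unfolding s_def by (rule mod_homD(2)[OF p(1) c(1,2)])
    also have "\<dots> = r (i (p v)) \<oplus>\<^bsub>X\<^esub> \<beta> (\<alpha> (p v))" using pb[OF c(3)] qa[OF v] pt[OF c(4)] by simp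
    also have "\<dots> = p v" using id[rule_format, OF c(5)] by simp
    finally show ?thesis .
  qed
  have pd: "d v \<in> hom_ker ?FI X p" if v: "v \<in> carrier ?FI" for v
  proof -
    have "p (d v) = p v \<ominus>\<^bsub>X\<^esub> p (s v)"
      unfolding d_def by (rule mod_hom_diff[OF FI assms(1) p(1) v mod_homD(1)[OF s v]])
    then have "p (d v) = \<zero>\<^bsub>X\<^esub>" using ps[OF v] mod_homD(1)[OF p(1) v] X.M.minus_eq_zero_iff by simp
    then show ?thesis using mod_homD(1)[OF d v] by (simp add: hom_ker_def)
  qed
  have ker: "v = b (a v) \<oplus>\<^bsub>?FI\<^esub> d v" if "v \<in> hom_ker ?FI X p" for v
  proof -
    have v: "v \<in> carrier ?FI" "p v = \<zero>\<^bsub>X\<^esub>" using that by (auto simp: hom_ker_def)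
    have c: "b (a v) \<in> carrier ?FI" using mod_homD(1)[OF b mod_homD(1)[OF a v(1)]] .
    have "t (\<alpha> (p v)) = \<zero>\<^bsub>?FI\<^esub>"
      using v(2) mod_hom_zero[OF assms(1) free_mod_module[OF X.is_cring] \<alpha>] mod_hom_zero[OF free_mod_module[OF X.is_cring] FI t] by simp
    then have "s v = b (a v)" unfolding s_def using c FI.r_zero by simp
    then have "d v = v \<ominus>\<^bsub>?FI\<^esub> b (a v)" unfolding d_def by simp
    moreover have "b (a v) \<oplus>\<^bsub>?FI\<^esub> (v \<ominus>\<^bsub>?FI\<^esub> b (a v)) = v"
      unfolding a_minus_def using c v(1) FI.a_assoc FI.a_comm FI.l_neg FI.r_zero FI.a_inv_closed by metis
    ultimately show ?thesis by simp
  qed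
  have "a ` hom_ker ?FI X p \<subseteq> hom_ker ?FJ Z q"
    using qa mod_hom_zero[OF assms(1,2) i] mod_homD(1)[OF a] by (auto simp: hom_ker_def)
  moreover have "b ` hom_ker ?FJ Z q \<subseteq> hom_ker ?FI X p"
    using pb mod_hom_zero[OF assms(2,1) r] mod_homD(1)[OF b] by (auto simp: hom_ker_def)
  moreover have "d ` carrier ?FI \<subseteq> hom_ker ?FI X p" using pd by blast
  moreover have "\<forall>v\<in>hom_ker ?FI X p. v = b (a v) \<oplus>\<^bsub>?FI\<^esub> d v" using ker by blast
  ultimately show ?thesis unfolding syz_retract_def by (intro bexI[OF _ a] bexI[OF _ b] bexI[OF _ d] conjI)
qed

text \<open>In degree 0 the map f extends by g a + f d, where g extends f b. In higher degrees K is
  a stable retract of L, with the inclusion of K and \<open>d\<close> as the maps through a free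
  module, so the comparison repeats for the next syzygies. The chain condition gives K a cover
  indexed by natural numbers, whatever index type the resolution behind L uses.\<close>

lemma ext_van_syz_retract:
  fixes I :: "nat set" and J :: "'j set"
  assumes "cring R" "noetherian_ring R" "finite I" "submodule K R (free_mod R I)" "submodule L R (free_mod R J)"
    and "syz_retract R I K J L" "ext_van n R J L"
  shows "ext_van n R I K"
  using assms(3-7)
proof (induction n arbitrary: I K J L)
  case 0
  note FI = free_mod_module[OF assms(1), of I] and FJ = free_mod_module[OF assms(1), of J]
  have KI: "K \<subseteq> carrier (free_mod R I)" by (rule module.submoduleE(1)[OF FI 0(2)])
  have LJ: "L \<subseteq> carrier (free_mod R J)" by (rule module.submoduleE(1)[OF FJ 0(3)])
  obtain a b d where a: "a \<in> mod_hom R (free_mod R I) (free_mod R J)" "a ` K \<subseteq> L"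
    and b: "b \<in> mod_hom R (free_mod R J) (free_mod R I)" "b ` L \<subseteq> K"
    and d: "d \<in> mod_hom R (free_mod R I) (free_mod R I)" "d ` carrier (free_mod R I) \<subseteq> K"
    and id: "\<forall>v\<in>K. v = b (a v) \<oplus>\<^bsub>free_mod R I\<^esub> d v"
    using 0(4) unfolding syz_retract_def by (elim bexE conjE) (assumption | rule that)+
  show ?case unfolding ext_van.simps
  proof
    fix f assume f: "f \<in> mod_hom R (free_mod R I\<lparr>carrier := K\<rparr>) (ring_module R)"
    have bL: "b \<in> mod_hom R (free_mod R J\<lparr>carrier := L\<rparr>) (free_mod R I\<lparr>carrier := K\<rparr>)"
      by (rule mod_hom_restrict_codomain[OF mod_hom_restrict_domain[OF b(1) LJ]]) (use b(2) in simp)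
    obtain g where g: "g \<in> mod_hom R (free_mod R J) (ring_module R)" "\<And>v. v \<in> L \<Longrightarrow> g v = f (b v)"
      using bspec[OF 0(5)[unfolded ext_van.simps] mod_hom_comp[OF bL f]] by auto
    have dK: "d \<in> mod_hom R (free_mod R I) (free_mod R I\<lparr>carrier := K\<rparr>)"
      by (rule mod_hom_restrict_codomain[OF d])
    have h: "(\<lambda>v. g (a v) \<oplus>\<^bsub>ring_module R\<^esub> f (d v)) \<in> mod_hom R (free_mod R I) (ring_module R)"
      by (rule mod_hom_add_fun[OF ring_module_module[OF assms(1)] mod_hom_comp[OF a(1) g(1)] mod_hom_comp[OF dK f]])
    show "\<exists>g\<in>mod_hom R (free_mod R I) (ring_module R). \<forall>v\<in>K. g v = f v"
    proof (rule bexI[OF _ h], rule ballI)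
      fix v assume v: "v \<in> K"
      have "a v \<in> L" using a(2) v by blast
      moreover have "b (a v) \<in> K" using b(2) \<open>a v \<in> L\<close> by blast
      moreover have "d v \<in> K" using d(2) KI v by blast
      moreover have "f v = f (b (a v) \<oplus>\<^bsub>free_mod R I\<lparr>carrier := K\<rparr>\<^esub> d v)" using id[rule_format, OF v] by simp
      ultimately show "g (a v) \<oplus>\<^bsub>ring_module R\<^esub> f (d v) = f v"
        using mod_homD(2)[OF f, of "b (a v)" "d v"] g(2)[of "a v"] by simp
    qed
  qed
next
  case (Suc n)
  note FI = free_mod_module[OF assms(1), of I] and FJ = free_mod_module[OF assms(1), of J]
  have KI: "K \<subseteq> carrier (free_mod R I)" by (rule module.submoduleE(1)[OF FI Suc.prems(2)])
  have LJ: "L \<subseteq> carrier (free_mod R J)" by (rule module.submoduleE(1)[OF FJ Suc.prems(3)])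
  obtain a b d where a: "a \<in> mod_hom R (free_mod R I) (free_mod R J)" "a ` K \<subseteq> L"
    and b: "b \<in> mod_hom R (free_mod R J) (free_mod R I)" "b ` L \<subseteq> K"
    and d: "d \<in> mod_hom R (free_mod R I) (free_mod R I)" "d ` carrier (free_mod R I) \<subseteq> K"
    and id: "\<forall>v\<in>K. v = b (a v) \<oplus>\<^bsub>free_mod R I\<^esub> d v"
    using Suc.prems(4) unfolding syz_retract_def by (elim bexE conjE) (assumption | rule that)+
  let ?K = "free_mod R I\<lparr>carrier := K\<rparr>" and ?L = "free_mod R J\<lparr>carrier := L\<rparr>"
  have Km: "module R ?K" by (rule submodule_module[OF FI Suc.prems(2)])
  have Lm: "module R ?L" by (rule submodule_module[OF FJ Suc.prems(3)])
  obtain J' and q :: "('j \<Rightarrow> 'a) \<Rightarrow> 'j \<Rightarrow> 'a" where q: "cover R J' q ?L" "ext_van n R J' (hom_ker (free_mod R J') ?L q)"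
    using Suc.prems(5) unfolding ext_van.simps by blast
  have "acc R (free_mod R I) K"
    by (rule acc_mono[OF acc_free_mod[OF assms(1,2) Suc.prems(1)] KI])
  then obtain g :: nat and p where p: "cover R {..<g} p ?K"
    by (rule acc_cover[OF FI Suc.prems(2)]) (assumption | rule that)+
  have 1: "a \<in> mod_hom R ?K ?L"
    by (rule mod_hom_restrict_codomain[OF mod_hom_restrict_domain[OF a(1) KI]]) (use a(2) in simp)
  have 2: "b \<in> mod_hom R ?L ?K"
    by (rule mod_hom_restrict_codomain[OF mod_hom_restrict_domain[OF b(1) LJ]]) (use b(2) in simp)
  have 3: "(\<lambda>v. v) \<in> mod_hom R ?K (free_mod R I)" by (rule mod_hom_restrict_domain[OF mod_hom_id KI])
  have 4: "d \<in> mod_hom R (free_mod R I) ?K" by (rule mod_hom_restrict_codomain[OF d])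
  have "stable_retract R ?K ?L"
    unfolding stable_retract_def
    by (rule exI[of _ I], rule bexI[OF _ 1], rule bexI[OF _ 2], rule bexI[OF _ 3], rule bexI[OF _ 4]) (use id in simp)
  then have "syz_retract R {..<g} (hom_ker (free_mod R {..<g}) ?K p) J' (hom_ker (free_mod R J') ?L q)"
    by (rule syz_retract_cover[OF Km Lm p q(1)])
  then have "ext_van n R {..<g} (hom_ker (free_mod R {..<g}) ?K p)"
    by (rule Suc.IH[OF finite_lessThan cover_kernel_submodule[OF Km p] cover_kernel_submodule[OF Lm q(1)] _ q(2)])
  then show ?case using p unfolding ext_van.simps by blast
qed

text \<open>This stands for Ext^(n+1)(X, R) = 0. The index type is fixed so that covers of different
  modules can be combined into one.\<close>

definition ext_van_mod :: "nat \<Rightarrow> ('a, 'c) ring_scheme \<Rightarrow> ('a, 'b, 'd) module_scheme \<Rightarrow> bool" where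
  "ext_van_mod n R X \<longleftrightarrow> (\<exists>(I::nat set) p. cover R I p X \<and> ext_van n R I (hom_ker (free_mod R I) X p))"

lemma ext_van_stable_retract:
  fixes I :: "nat set"
  assumes "noetherian_ring R" "module R X" "module R Z" "stable_retract R X Z" "finite I" "cover R I p X"
    and "cover R J q Z" "ext_van n R J (hom_ker (free_mod R J) Z q)"
  shows "ext_van n R I (hom_ker (free_mod R I) X p)"
proof -
  interpret X: module R X by fact
  show ?thesis
    by (rule ext_van_syz_retract[OF X.is_cring assms(1,5) cover_kernel_submodule[OF assms(2,6)]
          cover_kernel_submodule[OF assms(3,7)] syz_retract_cover[OF assms(2,3,6,7,4)] assms(8)])
qed

lemma ext_van_mod_retract:
  assumes "noetherian_ring R" "module R X" "module R Z" "ext_van_mod n R Z" "acc R X (carrier X)"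
    and "stable_retract R X Z"
  shows "ext_van_mod n R X"
proof -
  interpret X: module R X by fact
  obtain J :: "nat set" and q where q: "cover R J q Z" "ext_van n R J (hom_ker (free_mod R J) Z q)"
    using assms(4) unfolding ext_van_mod_def by blast
  obtain g :: nat and p where "cover R {..<g} p (X\<lparr>carrier := carrier X\<rparr>)"
    by (rule acc_cover[OF assms(2) X.carrier_is_submodule assms(5)]) (assumption | rule that)+
  then have p: "cover R {..<g} p X" by simp
  show ?thesis
    unfolding ext_van_mod_def using p ext_van_stable_retract[OF assms(1-3,6) _ p q] by blast
qed

text \<open>Independence of the cover, obtained by comparing X with itself.\<close>

lemma ext_van_modD:
  fixes I :: "nat set"
  assumes "noetherian_ring R" "module R X" "ext_van_mod n R X" "finite I" "cover R I p X"
  shows "ext_van n R I (hom_ker (free_mod R I) X p)"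
proof -
  obtain J :: "nat set" and q where q: "cover R J q X" "ext_van n R J (hom_ker (free_mod R J) X q)"
    using assms(3) unfolding ext_van_mod_def by blast
  show ?thesis
    by (rule ext_van_stable_retract[OF assms(1,2,2) stable_retract_refl[OF assms(2)] assms(4,5) q])
qed

lemma ext_van_mod_syzygy:
  fixes I :: "nat set"
  assumes "noetherian_ring R" "module R X" "ext_van_mod (Suc n) R X" "finite I" "cover R I p X"
  shows "ext_van_mod n R (free_mod R I\<lparr>carrier := hom_ker (free_mod R I) X p\<rparr>)"
  using ext_van_modD[OF assms] unfolding ext_van_mod_def ext_van.simps by blast

subsection \<open>Extensions\<close>

text \<open>The sum of two free modules on sets of natural numbers, again on a set of natural
  numbers: even positions carry the first summand and odd positions the second. A sum type for the
  indices would not do, since \<open>ext_van\<close> keeps one index type in all degrees.\<close>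

definition even_part :: "(nat \<Rightarrow> 'a) \<Rightarrow> nat \<Rightarrow> 'a" where "even_part w = (\<lambda>i. w (2 * i))"
definition odd_part :: "(nat \<Rightarrow> 'a) \<Rightarrow> nat \<Rightarrow> 'a" where "odd_part w = (\<lambda>i. w (2 * i + 1))"
definition interleave :: "(nat \<Rightarrow> 'a) \<Rightarrow> (nat \<Rightarrow> 'a) \<Rightarrow> nat \<Rightarrow> 'a" where
  "interleave u v = (\<lambda>k. if even k then u (k div 2) else v (k div 2))"
definition nat_sum :: "nat set \<Rightarrow> nat set \<Rightarrow> nat set" where
  "nat_sum I J = {k. if even k then k div 2 \<in> I else k div 2 \<in> J}"

lemma interleave_simps [simp]:
  "even_part (interleave u v) = u" "odd_part (interleave u v) = v"
  by (auto simp: interleave_def even_part_def odd_part_def)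

lemma interleave_parts [simp]: "interleave (even_part w) (odd_part w) = w"
  by (auto simp: interleave_def even_part_def odd_part_def fun_eq_iff elim!: oddE)

lemma even_part_carrier:
  assumes "w \<in> carrier (free_mod R (nat_sum I J))" shows "even_part w \<in> carrier (free_mod R I)"
proof -
  have "{i. even_part w i \<noteq> \<zero>\<^bsub>R\<^esub>} = (\<lambda>i. 2 * i) -` {k. w k \<noteq> \<zero>\<^bsub>R\<^esub>}" by (auto simp: even_part_def)
  moreover have "finite ((\<lambda>i::nat. 2 * i) -` {k. w k \<noteq> \<zero>\<^bsub>R\<^esub>})"
    by (rule finite_vimageI) (use assms in \<open>auto simp: free_mod_carrier inj_on_def\<close>)
  ultimately show ?thesis using assms by (simp add: free_mod_carrier even_part_def nat_sum_def)
qed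

lemma odd_part_carrier:
  assumes "w \<in> carrier (free_mod R (nat_sum I J))" shows "odd_part w \<in> carrier (free_mod R J)"
proof -
  have "{i. odd_part w i \<noteq> \<zero>\<^bsub>R\<^esub>} = (\<lambda>i. 2 * i + 1) -` {k. w k \<noteq> \<zero>\<^bsub>R\<^esub>}" by (auto simp: odd_part_def)
  moreover have "finite ((\<lambda>i::nat. 2 * i + 1) -` {k. w k \<noteq> \<zero>\<^bsub>R\<^esub>})"
    by (rule finite_vimageI) (use assms in \<open>auto simp: free_mod_carrier inj_on_def\<close>)
  ultimately show ?thesis using assms by (simp add: free_mod_carrier odd_part_def nat_sum_def)
qed

lemma interleave_carrier:
  assumes "u \<in> carrier (free_mod R I)" "v \<in> carrier (free_mod R J)"
  shows "interleave u v \<in> carrier (free_mod R (nat_sum I J))"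
proof -
  have "{k. interleave u v k \<noteq> \<zero>\<^bsub>R\<^esub>} \<subseteq> (\<lambda>i. 2 * i) ` {i. u i \<noteq> \<zero>\<^bsub>R\<^esub>} \<union> (\<lambda>i. 2 * i + 1) ` {i. v i \<noteq> \<zero>\<^bsub>R\<^esub>}"
  proof
    fix k assume "k \<in> {k. interleave u v k \<noteq> \<zero>\<^bsub>R\<^esub>}"
    then show "k \<in> (\<lambda>i. 2 * i) ` {i. u i \<noteq> \<zero>\<^bsub>R\<^esub>} \<union> (\<lambda>i. 2 * i + 1) ` {i. v i \<noteq> \<zero>\<^bsub>R\<^esub>}"
      by (cases "even k") (auto simp: interleave_def elim!: evenE oddE)
  qed
  moreover have "finite \<dots>" using assms by (simp add: free_mod_carrier)
  ultimately have "finite {k. interleave u v k \<noteq> \<zero>\<^bsub>R\<^esub>}" by (rule finite_subset)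
  then show ?thesis using assms by (simp add: free_mod_carrier interleave_def nat_sum_def)
qed

lemma even_part_hom: "even_part \<in> mod_hom R (free_mod R (nat_sum I J)) (free_mod R I)"
  by (rule mod_homI, erule even_part_carrier) (simp_all add: even_part_def)

lemma odd_part_hom: "odd_part \<in> mod_hom R (free_mod R (nat_sum I J)) (free_mod R J)"
  by (rule mod_homI, erule odd_part_carrier) (simp_all add: odd_part_def)

definition even_inj :: "('a, 'c) ring_scheme \<Rightarrow> (nat \<Rightarrow> 'a) \<Rightarrow> nat \<Rightarrow> 'a" where
  "even_inj R u = interleave u (\<lambda>i. \<zero>\<^bsub>R\<^esub>)"

lemma even_inj_hom:
  assumes "cring R" shows "even_inj R \<in> mod_hom R (free_mod R I) (free_mod R (nat_sum I J))"
proof -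
  interpret R: cring R by fact
  have z: "(\<lambda>i. \<zero>\<^bsub>R\<^esub>) \<in> carrier (free_mod R J)" by (simp add: free_mod_carrier)
  show ?thesis
  proof (rule mod_homI)
    show "even_inj R u \<in> carrier (free_mod R (nat_sum I J))" if "u \<in> carrier (free_mod R I)" for u
      unfolding even_inj_def by (rule interleave_carrier[OF that z])
  qed (simp_all add: even_inj_def interleave_def fun_eq_iff)
qed

text \<open>The cover of X combines i p' with a lift l of p'' along r. The last two conclusions say
  that the three kernels form an exact sequence inside the split sequence of free modules, which is
  the form in which \<open>ext_van_extension\<close> takes them.\<close>

lemma horseshoe:
  assumes "module R X'" "module R X" "module R X''"
    and i: "i \<in> mod_hom R X' X" "\<And>x. x \<in> carrier X' \<Longrightarrow> i x = \<zero>\<^bsub>X\<^esub> \<Longrightarrow> x = \<zero>\<^bsub>X'\<^esub>"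
    and r: "r \<in> mod_hom R X X''" "r ` carrier X = carrier X''"
    and exact: "i ` carrier X' = {x \<in> carrier X. r x = \<zero>\<^bsub>X''\<^esub>}"
    and p': "cover R I p' X'" and p'': "cover R J p'' X''"
  obtains p where "cover R (nat_sum I J) p X"
    "\<And>u. u \<in> carrier (free_mod R I) \<Longrightarrow>
       even_inj R u \<in> hom_ker (free_mod R (nat_sum I J)) X p \<longleftrightarrow> u \<in> hom_ker (free_mod R I) X' p'"
    "odd_part ` hom_ker (free_mod R (nat_sum I J)) X p = hom_ker (free_mod R J) X'' p''"
proof -
  interpret X': module R X' by fact
  interpret X: module R X by fact
  interpret X'': module R X'' by fact
  note cr = X'.is_cring
  note q' = coverD[OF p'] and q'' = coverD[OF p'']
  let ?F' = "free_mod R I" and ?F'' = "free_mod R J" and ?F = "free_mod R (nat_sum I J)"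
  note F' = free_mod_module[OF cr, of I] and F'' = free_mod_module[OF cr, of J] and F = free_mod_module[OF cr, of "nat_sum I J"]
  interpret F': module R ?F' by (rule F')
  have "p'' ` carrier ?F'' \<subseteq> r ` carrier X" using q''(2) r(2) by simp
  then obtain l where l: "l \<in> mod_hom R ?F'' X" and rl: "\<And>v. v \<in> carrier ?F'' \<Longrightarrow> r (l v) = p'' v"
    by (rule free_hom_lift[OF assms(3,2) q''(1) r(1)]) (assumption | rule that)+
  define p where "p w = i (p' (even_part w)) \<oplus>\<^bsub>X\<^esub> l (odd_part w)" for w
  have p: "p \<in> mod_hom R ?F X"
    unfolding p_def
    by (rule mod_hom_add_fun[OF assms(2) mod_hom_comp[OF mod_hom_comp[OF even_part_hom q'(1)] i(1)] mod_hom_comp[OF odd_part_hom l]])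
  have ri: "r (i x) = \<zero>\<^bsub>X''\<^esub>" if "x \<in> carrier X'" for x using exact that by blast
  have pint: "p (interleave u v) = i (p' u) \<oplus>\<^bsub>X\<^esub> l v" for u v by (simp add: p_def)
  have rp: "r (p w) = p'' (odd_part w)" if w: "w \<in> carrier ?F" for w
  proof -
    have c: "p' (even_part w) \<in> carrier X'" "l (odd_part w) \<in> carrier X" "odd_part w \<in> carrier ?F''"
      using mod_homD(1)[OF q'(1) even_part_carrier[OF w]] mod_homD(1)[OF l odd_part_carrier[OF w]] odd_part_carrier[OF w] by auto
    have "r (p w) = r (i (p' (even_part w))) \<oplus>\<^bsub>X''\<^esub> r (l (odd_part w))"
      unfolding p_def by (rule mod_homD(2)[OF r(1) mod_homD(1)[OF i(1) c(1)] c(2)])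
    then show ?thesis using ri[OF c(1)] rl[OF c(3)] mod_homD(1)[OF q''(1) c(3)] by simp
  qed
  show ?thesis
  proof (rule that[of p])
    show "cover R (nat_sum I J) p X"
      unfolding cover_def
    proof (intro conjI p subset_antisym subsetI)
      show "x \<in> carrier X" if "x \<in> p ` carrier ?F" for x using that mod_homD(1)[OF p] by blast
      fix x assume x: "x \<in> carrier X"
      have "r x \<in> p'' ` carrier ?F''" using mod_homD(1)[OF r(1) x] q''(2) by simp
      then obtain v where v: "v \<in> carrier ?F''" "r x = p'' v" by blast
      have lv: "l v \<in> carrier X" by (rule mod_homD(1)[OF l v(1)])
      have "r (x \<ominus>\<^bsub>X\<^esub> l v) = r x \<ominus>\<^bsub>X''\<^esub> r (l v)" by (rule mod_hom_diff[OF assms(2,3) r(1) x lv])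
      also have "\<dots> = \<zero>\<^bsub>X''\<^esub>"
        using v rl[OF v(1)] mod_homD(1)[OF q''(1) v(1)] X''.M.minus_eq_zero_iff by simp
      finally have "x \<ominus>\<^bsub>X\<^esub> l v \<in> i ` carrier X'" using exact x lv by simp
      then have "x \<ominus>\<^bsub>X\<^esub> l v \<in> i ` p' ` carrier ?F'" using q'(2) by simp
      then obtain u where u: "u \<in> carrier ?F'" "x \<ominus>\<^bsub>X\<^esub> l v = i (p' u)" by blast
      have "p (interleave u v) = (x \<ominus>\<^bsub>X\<^esub> l v) \<oplus>\<^bsub>X\<^esub> l v" using pint u(2) by simp
      also have "\<dots> = x" using x lv by (simp add: a_minus_def X.a_assoc X.l_neg)
      finally show "x \<in> p ` carrier ?F" using interleave_carrier[OF u(1) v(1)] by force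
    qed
    show "even_inj R u \<in> hom_ker ?F X p \<longleftrightarrow> u \<in> hom_ker ?F' X' p'" if u: "u \<in> carrier ?F'" for u
    proof -
      have "l (\<lambda>i. \<zero>\<^bsub>R\<^esub>) = \<zero>\<^bsub>X\<^esub>" using mod_hom_zero[OF F'' assms(2) l] by simp
      moreover have c: "p' u \<in> carrier X'" by (rule mod_homD(1)[OF q'(1) u])
      ultimately have "p (even_inj R u) = i (p' u)"
        unfolding even_inj_def pint using mod_homD(1)[OF i(1) c] by simp
      then have "even_inj R u \<in> hom_ker ?F X p \<longleftrightarrow> i (p' u) = \<zero>\<^bsub>X\<^esub>"
        using mod_homD(1)[OF even_inj_hom[OF cr] u, of J] by (simp add: hom_ker_def)
      moreover have "i (p' u) = \<zero>\<^bsub>X\<^esub> \<longleftrightarrow> p' u = \<zero>\<^bsub>X'\<^esub>"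
        using i(2)[OF c] mod_hom_zero[OF assms(1,2) i(1)] by metis
      ultimately show ?thesis using u by (simp add: hom_ker_def)
    qed
    show "odd_part ` hom_ker ?F X p = hom_ker ?F'' X'' p''"
    proof (intro subset_antisym subsetI)
      fix v assume "v \<in> odd_part ` hom_ker ?F X p"
      then obtain w where w: "w \<in> carrier ?F" "p w = \<zero>\<^bsub>X\<^esub>" "v = odd_part w" by (auto simp: hom_ker_def)
      then have "p'' v = \<zero>\<^bsub>X''\<^esub>" using rp[OF w(1)] mod_hom_zero[OF assms(2,3) r(1)] by simp
      then show "v \<in> hom_ker ?F'' X'' p''" using odd_part_carrier[OF w(1)] w(3) by (simp add: hom_ker_def)
    next
      fix v assume "v \<in> hom_ker ?F'' X'' p''"
      then have v: "v \<in> carrier ?F''" "p'' v = \<zero>\<^bsub>X''\<^esub>" by (auto simp: hom_ker_def)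
      have lv: "l v \<in> carrier X" by (rule mod_homD(1)[OF l v(1)])
      have "l v \<in> i ` p' ` carrier ?F'" using exact q'(2) rl[OF v(1)] v lv by simp
      \<comment> \<open>A relation v of X'' need not be a relation of X, but l v comes from X'; its
        preimage u with the opposite sign completes v to an element of the kernel of p.\<close>
      then obtain u where u: "u \<in> carrier ?F'" "l v = i (p' u)" by blast
      have u': "\<ominus>\<^bsub>?F'\<^esub> u \<in> carrier ?F'" by (rule F'.a_inv_closed[OF u(1)])
      have "i (p' (\<ominus>\<^bsub>?F'\<^esub> u)) = \<ominus>\<^bsub>X\<^esub> i (p' u)"
        using mod_hom_minus[OF F' assms(2) mod_hom_comp[OF q'(1) i(1)] u(1)] .
      then have "p (interleave (\<ominus>\<^bsub>?F'\<^esub> u) v) = \<zero>\<^bsub>X\<^esub>" using pint u(2) lv by (simp add: X.l_neg)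
      then have "interleave (\<ominus>\<^bsub>?F'\<^esub> u) v \<in> hom_ker ?F X p"
        using interleave_carrier[OF u' v(1)] by (simp add: hom_ker_def)
      then show "v \<in> odd_part ` hom_ker ?F X p" by (intro image_eqI[of _ _ "interleave (\<ominus>\<^bsub>?F'\<^esub> u) v"]) simp_all
    qed
  qed
qed

text \<open>The middle term of the long exact sequence. In degree 0, extend the restriction of f to
  K', subtract the extension, descend the difference to K'' and extend it there. In higher degrees
  the horseshoe cover of K reduces the claim to the syzygies.\<close>

lemma ext_van_extension:
  assumes "cring R"
    and "submodule K' R (free_mod R I)" "submodule K'' R (free_mod R J)" "submodule K R (free_mod R (nat_sum I J))"
    and "\<And>u. u \<in> carrier (free_mod R I) \<Longrightarrow> even_inj R u \<in> K \<longleftrightarrow> u \<in> K'" "odd_part ` K = K''"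
    and "ext_van n R I K'" "ext_van n R J K''"
  shows "ext_van n R (nat_sum I J) K"
  using assms(2-8)
proof (induction n arbitrary: I J K K' K'')
  case 0
  let ?F' = "free_mod R I" and ?F'' = "free_mod R J" and ?F = "free_mod R (nat_sum I J)"
  note F' = free_mod_module[OF assms(1), of I] and F'' = free_mod_module[OF assms(1), of J] and F = free_mod_module[OF assms(1), of "nat_sum I J"]
  note Rm = ring_module_module[OF assms(1)]
  interpret R: cring R by fact
  have K'F: "K' \<subseteq> carrier ?F'" by (rule module.submoduleE(1)[OF F' 0(1)])
  have K''F: "K'' \<subseteq> carrier ?F''" by (rule module.submoduleE(1)[OF F'' 0(2)])
  have KF: "K \<subseteq> carrier ?F" by (rule module.submoduleE(1)[OF F 0(3)])
  have Km: "module R (?F\<lparr>carrier := K\<rparr>)" by (rule submodule_module[OF F 0(3)])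
  have K''m: "module R (?F''\<lparr>carrier := K''\<rparr>)" by (rule submodule_module[OF F'' 0(2)])
  show ?case unfolding ext_van.simps
  proof
    fix f assume f: "f \<in> mod_hom R (?F\<lparr>carrier := K\<rparr>) (ring_module R)"
    have "even_inj R \<in> mod_hom R (?F'\<lparr>carrier := K'\<rparr>) (?F\<lparr>carrier := K\<rparr>)"
      by (rule mod_hom_restrict_codomain[OF mod_hom_restrict_domain[OF even_inj_hom[OF assms(1)] K'F]])
        (use 0(4) K'F in auto)
    note fe = mod_hom_comp[OF this f]
    obtain g' where g': "g' \<in> mod_hom R ?F' (ring_module R)"
      and g'f: "\<And>u. u \<in> K' \<Longrightarrow> g' u = f (even_inj R u)"
      using bspec[OF 0(6)[unfolded ext_van.simps] fe] by auto
    have ge: "(\<lambda>w. g' (even_part w)) \<in> mod_hom R ?F (ring_module R)" by (rule mod_hom_comp[OF even_part_hom g'])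
    have h: "(\<lambda>w. f w \<ominus>\<^bsub>ring_module R\<^esub> g' (even_part w)) \<in> mod_hom R (?F\<lparr>carrier := K\<rparr>) (ring_module R)"
      by (rule mod_hom_diff_fun[OF Rm f mod_hom_restrict_domain[OF ge KF]])
    have o: "odd_part \<in> mod_hom R (?F\<lparr>carrier := K\<rparr>) (?F''\<lparr>carrier := K''\<rparr>)"
      by (rule mod_hom_restrict_codomain[OF mod_hom_restrict_domain[OF odd_part_hom KF]]) (use 0(5) in simp)
    have o2: "odd_part ` carrier (?F\<lparr>carrier := K\<rparr>) = carrier (?F''\<lparr>carrier := K''\<rparr>)" using 0(5) by simp
    have h0: "f w \<ominus>\<^bsub>ring_module R\<^esub> g' (even_part w) = \<zero>\<^bsub>ring_module R\<^esub>"
      if "w \<in> carrier (?F\<lparr>carrier := K\<rparr>)" "odd_part w = \<zero>\<^bsub>?F''\<lparr>carrier := K''\<rparr>\<^esub>" for w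
    proof -
      have w: "w \<in> K" "w \<in> carrier ?F" using that(1) KF by auto
      have "even_inj R (even_part w) = interleave (even_part w) (odd_part w)"
        unfolding even_inj_def using that(2) by simp
      then have e: "even_inj R (even_part w) = w" by simp
      then have "even_part w \<in> K'" using 0(4)[OF even_part_carrier[OF w(2)]] w(1) by simp
      then have "g' (even_part w) = f w" using g'f e by simp
      then show ?thesis using mod_homD(1)[OF f] w(1) by (simp add: R.minus_eq_zero_iff)
    qed
    obtain f'' where f'': "f'' \<in> mod_hom R (?F''\<lparr>carrier := K''\<rparr>) (ring_module R)"
      and f''f: "\<And>w. w \<in> carrier (?F\<lparr>carrier := K\<rparr>) \<Longrightarrow> f'' (odd_part w) = f w \<ominus>\<^bsub>ring_module R\<^esub> g' (even_part w)"
      by (rule mod_hom_descend[OF Km K''m Rm o o2 h h0]) (assumption | rule that)+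
    obtain g'' where g'': "g'' \<in> mod_hom R ?F'' (ring_module R)" and g''f: "\<And>u. u \<in> K'' \<Longrightarrow> g'' u = f'' u"
      using bspec[OF 0(7)[unfolded ext_van.simps] f''] by auto
    have g: "(\<lambda>w. g' (even_part w) \<oplus>\<^bsub>ring_module R\<^esub> g'' (odd_part w)) \<in> mod_hom R ?F (ring_module R)"
      by (rule mod_hom_add_fun[OF Rm ge mod_hom_comp[OF odd_part_hom g'']])
    show "\<exists>g\<in>mod_hom R ?F (ring_module R). \<forall>v\<in>K. g v = f v"
    proof (rule bexI[OF _ g], rule ballI)
      fix w assume w: "w \<in> K"
      have c: "f w \<in> carrier R" "g' (even_part w) \<in> carrier R"
        using mod_homD(1)[OF f, of w] w mod_homD(1)[OF ge, of w] KF by auto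
      have "g'' (odd_part w) = f w \<ominus>\<^bsub>R\<^esub> g' (even_part w)"
        using g''f[of "odd_part w"] f''f[of w] w 0(5) by auto
      then show "g' (even_part w) \<oplus>\<^bsub>ring_module R\<^esub> g'' (odd_part w) = f w"
        using c by (simp add: a_minus_def R.a_lcomm R.r_neg)
    qed
  qed
next
  case (Suc n)
  let ?F' = "free_mod R I" and ?F'' = "free_mod R J" and ?F = "free_mod R (nat_sum I J)"
  note F' = free_mod_module[OF assms(1), of I] and F'' = free_mod_module[OF assms(1), of J] and F = free_mod_module[OF assms(1), of "nat_sum I J"]
  let ?X' = "?F'\<lparr>carrier := K'\<rparr>" and ?X'' = "?F''\<lparr>carrier := K''\<rparr>" and ?X = "?F\<lparr>carrier := K\<rparr>"
  have K'F: "K' \<subseteq> carrier ?F'" by (rule module.submoduleE(1)[OF F' Suc.prems(1)])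
  have KF: "K \<subseteq> carrier ?F" by (rule module.submoduleE(1)[OF F Suc.prems(3)])
  have X': "module R ?X'" by (rule submodule_module[OF F' Suc.prems(1)])
  have X'': "module R ?X''" by (rule submodule_module[OF F'' Suc.prems(2)])
  have X: "module R ?X" by (rule submodule_module[OF F Suc.prems(3)])
  have i: "even_inj R \<in> mod_hom R ?X' ?X"
    by (rule mod_hom_restrict_codomain[OF mod_hom_restrict_domain[OF even_inj_hom[OF assms(1)] K'F]])
      (use Suc.prems(4) K'F in auto)
  have i0: "x = \<zero>\<^bsub>?X'\<^esub>" if "even_inj R x = \<zero>\<^bsub>?X\<^esub>" for x
  proof -
    have "even_part (even_inj R x) = even_part (\<lambda>i. \<zero>\<^bsub>R\<^esub>)" using that by simp
    then show ?thesis by (simp add: even_inj_def) (simp add: even_part_def)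
  qed
  have r: "odd_part \<in> mod_hom R ?X ?X''"
    by (rule mod_hom_restrict_codomain[OF mod_hom_restrict_domain[OF odd_part_hom KF]]) (use Suc.prems(5) in simp)
  have r2: "odd_part ` carrier ?X = carrier ?X''" using Suc.prems(5) by simp
  have exact: "even_inj R ` carrier ?X' = {x \<in> carrier ?X. odd_part x = \<zero>\<^bsub>?X''\<^esub>}"
  proof (intro subset_antisym subsetI)
    fix w assume "w \<in> even_inj R ` carrier ?X'"
    then obtain u where u: "u \<in> K'" "w = even_inj R u" by auto
    then show "w \<in> {x \<in> carrier ?X. odd_part x = \<zero>\<^bsub>?X''\<^esub>}"
      using Suc.prems(4)[of u] K'F by (auto simp: even_inj_def)
  next
    fix w assume "w \<in> {x \<in> carrier ?X. odd_part x = \<zero>\<^bsub>?X''\<^esub>}"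
    then have w: "w \<in> K" "odd_part w = (\<lambda>i. \<zero>\<^bsub>R\<^esub>)" by auto
    have "even_inj R (even_part w) = interleave (even_part w) (odd_part w)" unfolding even_inj_def w(2) ..
    then have e: "even_inj R (even_part w) = w" by simp
    moreover have "even_part w \<in> K'" using Suc.prems(4)[OF even_part_carrier, of w J] e w(1) KF by auto
    ultimately have "w \<in> even_inj R ` K'" by (intro image_eqI[of _ _ "even_part w"]) simp_all
    then show "w \<in> even_inj R ` carrier ?X'" by simp
  qed
  obtain I' :: "nat set" and p' where p': "cover R I' p' ?X'" "ext_van n R I' (hom_ker (free_mod R I') ?X' p')"
    using Suc.prems(6) unfolding ext_van.simps by blast
  obtain J' :: "nat set" and p'' where p'': "cover R J' p'' ?X''" "ext_van n R J' (hom_ker (free_mod R J') ?X'' p'')"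
    using Suc.prems(7) unfolding ext_van.simps by blast
  obtain p where p: "cover R (nat_sum I' J') p ?X"
    and p1: "\<And>u. u \<in> carrier (free_mod R I') \<Longrightarrow>
       even_inj R u \<in> hom_ker (free_mod R (nat_sum I' J')) ?X p \<longleftrightarrow> u \<in> hom_ker (free_mod R I') ?X' p'"
    and p2: "odd_part ` hom_ker (free_mod R (nat_sum I' J')) ?X p = hom_ker (free_mod R J') ?X'' p''"
    by (rule horseshoe[OF X' X X'' i i0 r r2 exact p'(1) p''(1)]) (assumption | rule that)+
  have "ext_van n R (nat_sum I' J') (hom_ker (free_mod R (nat_sum I' J')) ?X p)"
    by (rule Suc.IH[OF cover_kernel_submodule[OF X' p'(1)] cover_kernel_submodule[OF X'' p''(1)]
          cover_kernel_submodule[OF X p] p1 p2 p'(2) p''(2)])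
  then show ?case using p unfolding ext_van.simps by blast
qed

lemma ext_van_mod_extension:
  assumes "module R X'" "module R X" "module R X''"
    and "i \<in> mod_hom R X' X" "\<And>x. x \<in> carrier X' \<Longrightarrow> i x = \<zero>\<^bsub>X\<^esub> \<Longrightarrow> x = \<zero>\<^bsub>X'\<^esub>"
    and "r \<in> mod_hom R X X''" "r ` carrier X = carrier X''"
    and "i ` carrier X' = {x \<in> carrier X. r x = \<zero>\<^bsub>X''\<^esub>}"
    and "ext_van_mod n R X'" "ext_van_mod n R X''"
  shows "ext_van_mod n R X"
proof -
  interpret X: module R X by fact
  obtain I p' where p': "cover R (I::nat set) p' X'" "ext_van n R I (hom_ker (free_mod R I) X' p')"
    using assms(9) unfolding ext_van_mod_def by blast
  obtain J p'' where p'': "cover R (J::nat set) p'' X''" "ext_van n R J (hom_ker (free_mod R J) X'' p'')"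
    using assms(10) unfolding ext_van_mod_def by blast
  obtain p where p: "cover R (nat_sum I J) p X"
    and p1: "\<And>u. u \<in> carrier (free_mod R I) \<Longrightarrow>
       even_inj R u \<in> hom_ker (free_mod R (nat_sum I J)) X p \<longleftrightarrow> u \<in> hom_ker (free_mod R I) X' p'"
    and p2: "odd_part ` hom_ker (free_mod R (nat_sum I J)) X p = hom_ker (free_mod R J) X'' p''"
    by (rule horseshoe[OF assms(1-8) p'(1) p''(1)]) (assumption | rule that)+
  have "ext_van n R (nat_sum I J) (hom_ker (free_mod R (nat_sum I J)) X p)"
    by (rule ext_van_extension[OF X.is_cring cover_kernel_submodule[OF assms(1) p'(1)] cover_kernel_submodule[OF assms(3) p''(1)]
          cover_kernel_submodule[OF assms(2) p] p1 p2 p'(2) p''(2)])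
  then show ?thesis using p unfolding ext_van_mod_def by blast
qed

subsection \<open>Ideals as modules\<close>

abbreviation ideal_mod :: "('a, 'c) ring_scheme \<Rightarrow> 'a set \<Rightarrow> ('a, 'a) module" where
  "ideal_mod R I \<equiv> ring_module R\<lparr>carrier := I\<rparr>"

lemma ideal_mod_module: "cring R \<Longrightarrow> ideal I R \<Longrightarrow> module R (ideal_mod R I)"
  by (rule submodule_module[OF ring_module_module]) (simp_all add: submodule_ring_module_iff)

lemma acc_submodule:
  assumes "module R M" "submodule K R M" "acc R M (carrier M)"
  shows "acc R (M\<lparr>carrier := K\<rparr>) K"
proof (rule acc_joint[where A = "{()}" and f = "\<lambda>_ x. x" and N = M])
  have Km: "module R (M\<lparr>carrier := K\<rparr>)" by (rule submodule_module[OF assms(1,2)])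
  then show "module R (M\<lparr>carrier := K\<rparr>)" .
  show "(\<lambda>x. x) \<in> mod_hom R (M\<lparr>carrier := K\<rparr>) M"
    by (rule mod_hom_restrict_domain[OF mod_hom_id module.submoduleE(1)[OF assms(1,2)]])
  show "submodule K R (M\<lparr>carrier := K\<rparr>)" using module.carrier_is_submodule[OF Km] by simp
qed (use assms in simp_all)

lemma acc_ideal_mod:
  assumes "cring R" "noetherian_ring R" "ideal I R"
  shows "acc R (ideal_mod R I) I"
  by (rule acc_submodule[OF ring_module_module[OF assms(1)]])
    (use assms in \<open>simp_all add: submodule_ring_module_iff acc_ring_module\<close>)

lemma ext_van_mod_ideal_retract:
  assumes "cring R" "noetherian_ring R" "ideal I R" "module R Z" "ext_van_mod n R Z"
    and "i \<in> mod_hom R (ideal_mod R I) Z" "r \<in> mod_hom R Z (ideal_mod R I)" "\<And>x. x \<in> I \<Longrightarrow> r (i x) = x"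
  shows "ext_van_mod n R (ideal_mod R I)"
proof (rule ext_van_mod_retract[OF assms(2) ideal_mod_module[OF assms(1,3)] assms(4,5)])
  show "acc R (ideal_mod R I) (carrier (ideal_mod R I))" using acc_ideal_mod[OF assms(1-3)] by simp
  show "stable_retract R (ideal_mod R I) Z"
    by (rule stable_retractI[OF ideal_mod_module[OF assms(1,3)] assms(6,7)]) (use assms(8) in simp)
qed

lemma ext_van_zero:
  assumes "cring R"
  shows "ext_van n R (I::nat set) {\<lambda>i. \<zero>\<^bsub>R\<^esub>}"
proof (induction n arbitrary: I)
  case 0
  interpret R: cring R by fact
  note F = free_mod_module[OF assms, of I] and Rm = ring_module_module[OF assms]
  have z: "submodule {\<lambda>i. \<zero>\<^bsub>R\<^esub>} R (free_mod R I)" using zero_submodule[OF F] by simp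
  have "\<forall>v\<in>{\<lambda>i. \<zero>\<^bsub>R\<^esub>}. \<zero>\<^bsub>R\<^esub> = f v"
    if "f \<in> mod_hom R (free_mod R I\<lparr>carrier := {\<lambda>i. \<zero>\<^bsub>R\<^esub>}\<rparr>) (ring_module R)" for f
    using mod_hom_zero[OF submodule_module[OF F z] Rm that] by simp
  moreover have "(\<lambda>x. \<zero>\<^bsub>R\<^esub>) \<in> mod_hom R (free_mod R I) (ring_module R)"
    using mod_hom_zero_fun[OF Rm, of "free_mod R I"] by simp
  ultimately show ?case unfolding ext_van.simps
    by (intro ballI bexI[of _ "\<lambda>x. \<zero>\<^bsub>R\<^esub>"]) auto
next
  case (Suc n)
  note F = free_mod_module[OF assms, of I]
  let ?Z = "free_mod R I\<lparr>carrier := {\<lambda>i. \<zero>\<^bsub>R\<^esub>}\<rparr>"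
  have z: "submodule {\<lambda>i. \<zero>\<^bsub>R\<^esub>} R (free_mod R I)" using zero_submodule[OF F] by simp
  interpret R: cring R by fact
  have e: "carrier (free_mod R ({}::nat set)) = {\<lambda>i. \<zero>\<^bsub>R\<^esub>}" by (auto simp: free_mod_def)
  have c: "cover R ({}::nat set) (\<lambda>x i. \<zero>\<^bsub>R\<^esub>) ?Z"
    unfolding cover_def using mod_hom_zero_fun[OF submodule_module[OF F z]] e by simp
  have k: "hom_ker (free_mod R ({}::nat set)) ?Z (\<lambda>x i. \<zero>\<^bsub>R\<^esub>) = {\<lambda>i. \<zero>\<^bsub>R\<^esub>}"
    unfolding hom_ker_def e by simp
  show ?case unfolding ext_van.simps
    by (rule exI[of _ "{}"], rule exI[of _ "\<lambda>x i. \<zero>\<^bsub>R\<^esub>"]) (use c k Suc in simp)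
qed

lemma sing_free_mod_mem:
  assumes "cring R" "x \<in> carrier R"
  shows "(\<lambda>i. if i = 0 then x else \<zero>\<^bsub>R\<^esub>) \<in> carrier (free_mod R {0::nat})"
proof -
  interpret R: cring R by fact
  have "{i::nat. (if i = 0 then x else \<zero>\<^bsub>R\<^esub>) \<noteq> \<zero>\<^bsub>R\<^esub>} \<subseteq> {0}" by auto
  then have "finite {i::nat. (if i = 0 then x else \<zero>\<^bsub>R\<^esub>) \<noteq> \<zero>\<^bsub>R\<^esub>}" using finite_subset by blast
  then show ?thesis using assms(2) by (simp add: free_mod_carrier)
qed

lemma coord_hom: "(\<lambda>v. v i) \<in> mod_hom R (free_mod R I) (ring_module R)"
  by (rule mod_homI) (simp_all add: free_mod_carrier)

lemma ext_van_mod_ring: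
  assumes "cring R" shows "ext_van_mod n R (ring_module R)"
proof -
  interpret R: cring R by fact
  have c: "cover R {0::nat} (\<lambda>v. v 0) (ring_module R)"
    unfolding cover_def
  proof (intro conjI coord_hom subset_antisym subsetI)
    fix x assume "x \<in> carrier (ring_module R)"
    then show "x \<in> (\<lambda>v. v 0) ` carrier (free_mod R {0::nat})"
      by (intro image_eqI[OF _ sing_free_mod_mem[OF assms, of x]]) simp_all
  qed (auto simp: free_mod_carrier)
  have "v = (\<lambda>i. \<zero>\<^bsub>R\<^esub>)" if "v \<in> hom_ker (free_mod R {0::nat}) (ring_module R) (\<lambda>v. v 0)" for v
  proof
    show "v i = \<zero>\<^bsub>R\<^esub>" for i using that by (cases "i = 0") (simp_all add: hom_ker_def free_mod_carrier)
  qed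
  moreover have "(\<lambda>i. \<zero>\<^bsub>R\<^esub>) \<in> hom_ker (free_mod R {0::nat}) (ring_module R) (\<lambda>v. v 0)"
    by (simp add: hom_ker_def free_mod_carrier)
  ultimately have "hom_ker (free_mod R {0::nat}) (ring_module R) (\<lambda>v. v 0) = {\<lambda>i. \<zero>\<^bsub>R\<^esub>}" by blast
  then show ?thesis unfolding ext_van_mod_def using c ext_van_zero[OF assms] by metis
qed

text \<open>The ideal I inside the free module of rank one, because \<open>ext_van\<close> and its
  syzygies are about submodules of free modules; the quotient is R/I.\<close>

definition sing_sub :: "('a, 'c) ring_scheme \<Rightarrow> 'a set \<Rightarrow> (nat \<Rightarrow> 'a) set" where
  "sing_sub R I = {v \<in> carrier (free_mod R {0::nat}). v 0 \<in> I}"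

lemma sing_sub_submodule:
  assumes "cring R" "ideal I R" shows "submodule (sing_sub R I) R (free_mod R {0::nat})"
  unfolding sing_sub_def
  using submodule_vimage[OF free_mod_module[OF assms(1)] ring_module_module[OF assms(1)] coord_hom] assms
  by (simp add: submodule_ring_module_iff)

lemma sing_inj_hom:
  assumes "cring R" "ideal I R"
  shows "(\<lambda>x i. if i = 0 then x else \<zero>\<^bsub>R\<^esub>) \<in> mod_hom R (ideal_mod R I) (free_mod R {0::nat}\<lparr>carrier := sing_sub R I\<rparr>)"
proof -
  interpret R: cring R by fact
  show ?thesis
  proof (rule mod_homI)
    fix x assume "x \<in> carrier (ideal_mod R I)"
    then have "x \<in> I" "x \<in> carrier R" using ideal.Icarr[OF assms(2)] by auto
    then show "(\<lambda>i. if i = 0 then x else \<zero>\<^bsub>R\<^esub>) \<in> carrier (free_mod R {0::nat}\<lparr>carrier := sing_sub R I\<rparr>)"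
      using sing_free_mod_mem[OF assms(1), of x] by (simp add: sing_sub_def)
  qed (auto simp: fun_eq_iff)
qed

lemma sing_proj_hom:
  assumes "cring R" "ideal I R"
  shows "(\<lambda>v. v 0) \<in> mod_hom R (free_mod R {0::nat}\<lparr>carrier := sing_sub R I\<rparr>) (ideal_mod R I)"
  by (rule mod_homI) (auto simp: sing_sub_def)

lemma ext_van_mod_sing:
  assumes "cring R" "noetherian_ring R" "ideal I R"
    and "ext_van_mod n R (free_mod R {0::nat}\<lparr>carrier := sing_sub R I\<rparr>)"
  shows "ext_van_mod n R (ideal_mod R I)"
  by (rule ext_van_mod_ideal_retract[OF assms(1-3) submodule_module[OF free_mod_module[OF assms(1)]
          sing_sub_submodule[OF assms(1,3)]] assms(4) sing_inj_hom[OF assms(1,3)] sing_proj_hom[OF assms(1,3)]]) simp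

subsection \<open>Local rings with a parameter\<close>

definition sum_ideal :: "('a, 'c) ring_scheme \<Rightarrow> 'a set \<Rightarrow> 'a \<Rightarrow> 'a set" where
  "sum_ideal R I y = {x \<oplus>\<^bsub>R\<^esub> r \<otimes>\<^bsub>R\<^esub> y | x r. x \<in> I \<and> r \<in> carrier R}"

lemma sum_ideal:
  assumes "cring R" "ideal I R" "y \<in> carrier R"
  shows "ideal (sum_ideal R I y) R" "I \<subseteq> sum_ideal R I y" "y \<in> sum_ideal R I y"
proof -
  interpret R: cring R by fact
  interpret I: ideal I R by fact
  show "ideal (sum_ideal R I y) R"
  proof (rule R.idealI')
    show "sum_ideal R I y \<subseteq> carrier R" using assms(3) I.Icarr by (auto simp: sum_ideal_def)
    have "\<zero>\<^bsub>R\<^esub> = \<zero>\<^bsub>R\<^esub> \<oplus>\<^bsub>R\<^esub> \<zero>\<^bsub>R\<^esub> \<otimes>\<^bsub>R\<^esub> y" using assms(3) by simp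
    then show "\<zero>\<^bsub>R\<^esub> \<in> sum_ideal R I y" unfolding sum_ideal_def using I.zero_closed R.zero_closed by blast
    fix u assume "u \<in> sum_ideal R I y"
    then obtain x r where u: "u = x \<oplus>\<^bsub>R\<^esub> r \<otimes>\<^bsub>R\<^esub> y" "x \<in> I" "r \<in> carrier R" by (auto simp: sum_ideal_def)
    { fix v assume "v \<in> sum_ideal R I y"
      then obtain x' r' where v: "v = x' \<oplus>\<^bsub>R\<^esub> r' \<otimes>\<^bsub>R\<^esub> y" "x' \<in> I" "r' \<in> carrier R" by (auto simp: sum_ideal_def)
      have "u \<oplus>\<^bsub>R\<^esub> v = (x \<oplus>\<^bsub>R\<^esub> x') \<oplus>\<^bsub>R\<^esub> (r \<oplus>\<^bsub>R\<^esub> r') \<otimes>\<^bsub>R\<^esub> y"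
        using u v I.Icarr[OF u(2)] I.Icarr[OF v(2)] assms(3) by (simp add: R.l_distr R.a_ac)
      then show "u \<oplus>\<^bsub>R\<^esub> v \<in> sum_ideal R I y"
        unfolding sum_ideal_def using I.a_closed[OF u(2) v(2)] R.a_closed[OF u(3) v(3)] by blast }
    { fix s assume s: "s \<in> carrier R"
      have "s \<otimes>\<^bsub>R\<^esub> u = s \<otimes>\<^bsub>R\<^esub> x \<oplus>\<^bsub>R\<^esub> (s \<otimes>\<^bsub>R\<^esub> r) \<otimes>\<^bsub>R\<^esub> y"
        using u s I.Icarr[OF u(2)] assms(3) by (simp add: R.r_distr R.m_assoc)
      then show "s \<otimes>\<^bsub>R\<^esub> u \<in> sum_ideal R I y"
        unfolding sum_ideal_def using I.I_l_closed[OF u(2) s] R.m_closed[OF s u(3)] by blast }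
  qed
  show "I \<subseteq> sum_ideal R I y"
  proof
    fix x assume x: "x \<in> I"
    then have "x = x \<oplus>\<^bsub>R\<^esub> \<zero>\<^bsub>R\<^esub> \<otimes>\<^bsub>R\<^esub> y" using assms(3) I.Icarr by simp
    then show "x \<in> sum_ideal R I y" unfolding sum_ideal_def using x R.zero_closed by blast
  qed
  have "y = \<zero>\<^bsub>R\<^esub> \<oplus>\<^bsub>R\<^esub> \<one>\<^bsub>R\<^esub> \<otimes>\<^bsub>R\<^esub> y" using assms(3) by simp
  then show "y \<in> sum_ideal R I y" unfolding sum_ideal_def using I.zero_closed R.one_closed by blast
qed

definition pair_sub :: "('a, 'c) ring_scheme \<Rightarrow> 'a set \<Rightarrow> (nat \<Rightarrow> 'a) set" where
  "pair_sub R I = {w \<in> carrier (free_mod R {0, 1::nat}). w 1 \<in> I}"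

definition pair :: "('a, 'c) ring_scheme \<Rightarrow> 'a \<Rightarrow> 'a \<Rightarrow> nat \<Rightarrow> 'a" where
  "pair R x y = (\<lambda>i. if i = 0 then x else if i = 1 then y else \<zero>\<^bsub>R\<^esub>)"

lemma pair_simps [simp]: "pair R x y 0 = x" "pair R x y 1 = y" "pair R x y (Suc 0) = y"
  by (simp_all add: pair_def)

lemma pair_carrier:
  assumes "cring R" "x \<in> carrier R" "y \<in> carrier R"
  shows "pair R x y \<in> carrier (free_mod R {0, 1::nat})"
proof -
  interpret R: cring R by fact
  have "{i. pair R x y i \<noteq> \<zero>\<^bsub>R\<^esub>} \<subseteq> {0, 1}" by (auto simp: pair_def)
  then have "finite {i. pair R x y i \<noteq> \<zero>\<^bsub>R\<^esub>}" using finite_subset by blast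
  then show ?thesis using assms by (simp add: free_mod_carrier pair_def)
qed

lemma pair_sub_submodule:
  assumes "cring R" "ideal I R" shows "submodule (pair_sub R I) R (free_mod R {0, 1::nat})"
  unfolding pair_sub_def
  using submodule_vimage[OF free_mod_module[OF assms(1)] ring_module_module[OF assms(1)] coord_hom] assms
  by (simp add: submodule_ring_module_iff)

lemma pair_sum_hom:
  assumes "cring R" "ideal I R" "y \<in> carrier R"
  shows "(\<lambda>w. w 1 \<oplus>\<^bsub>R\<^esub> w 0 \<otimes>\<^bsub>R\<^esub> y) \<in>
      mod_hom R (free_mod R {0, 1::nat}\<lparr>carrier := pair_sub R I\<rparr>) (ideal_mod R (sum_ideal R I y))"
proof -
  interpret R: cring R by fact
  have c: "w i \<in> carrier R" if "w \<in> pair_sub R I" for w i using that by (auto simp: pair_sub_def free_mod_carrier)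
  show ?thesis
  proof (rule mod_homI)
    fix w assume "w \<in> carrier (free_mod R {0, 1::nat}\<lparr>carrier := pair_sub R I\<rparr>)"
    then have w: "w \<in> pair_sub R I" by simp
    then show "w 1 \<oplus>\<^bsub>R\<^esub> w 0 \<otimes>\<^bsub>R\<^esub> y \<in> carrier (ideal_mod R (sum_ideal R I y))"
      using c[OF w, of 0] by (auto simp: sum_ideal_def pair_sub_def)
  qed (use c assms(3) in \<open>simp_all add: R.l_distr R.a_ac R.r_distr R.m_assoc\<close>)
qed

lemma pair_sum_onto:
  assumes "cring R" "ideal I R" "y \<in> carrier R"
  shows "(\<lambda>w. w 1 \<oplus>\<^bsub>R\<^esub> w 0 \<otimes>\<^bsub>R\<^esub> y) ` pair_sub R I = sum_ideal R I y"
proof (intro subset_antisym subsetI)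
  fix x assume "x \<in> (\<lambda>w. w 1 \<oplus>\<^bsub>R\<^esub> w 0 \<otimes>\<^bsub>R\<^esub> y) ` pair_sub R I"
  then show "x \<in> sum_ideal R I y" using mod_homD(1)[OF pair_sum_hom[OF assms]] by auto
next
  fix x assume "x \<in> sum_ideal R I y"
  then obtain z r where x: "x = z \<oplus>\<^bsub>R\<^esub> r \<otimes>\<^bsub>R\<^esub> y" "z \<in> I" "r \<in> carrier R" by (auto simp: sum_ideal_def)
  have "pair R r z \<in> pair_sub R I"
    using pair_carrier[OF assms(1) x(3) ideal.Icarr[OF assms(2) x(2)]] x(2) by (simp add: pair_sub_def)
  then show "x \<in> (\<lambda>w. w 1 \<oplus>\<^bsub>R\<^esub> w 0 \<otimes>\<^bsub>R\<^esub> y) ` pair_sub R I"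
    by (intro image_eqI[of _ _ "pair R r z"]) (simp_all add: x)
qed

text \<open>The exact sequence $0 \to P \to R \oplus I \to I + Ry \to 0$ with $P = (I : y)$.\<close>

lemma ext_van_mod_step:
  assumes "cring R" "noetherian_ring R" "ideal I R" "y \<in> carrier R"
    and "ext_van_mod n R (ideal_mod R (colon R I y))" "ext_van_mod n R (ideal_mod R (sum_ideal R I y))"
  shows "ext_van_mod n R (ideal_mod R I)"
proof -
  interpret R: cring R by fact
  interpret I: ideal I R by fact
  let ?P = "colon R I y" and ?X = "free_mod R {0, 1::nat}\<lparr>carrier := pair_sub R I\<rparr>"
  have P: "ideal ?P R" by (rule R.colon_ideal[OF assms(3,4)])
  have X: "module R ?X" by (rule submodule_module[OF free_mod_module[OF assms(1)] pair_sub_submodule[OF assms(1,3)]])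
  have i: "(\<lambda>t. pair R t (\<ominus>\<^bsub>R\<^esub> (t \<otimes>\<^bsub>R\<^esub> y))) \<in> mod_hom R (ideal_mod R ?P) ?X"
  proof (rule mod_homI)
    fix t assume "t \<in> carrier (ideal_mod R ?P)"
    then have t: "t \<in> carrier R" "t \<otimes>\<^bsub>R\<^esub> y \<in> I" by (auto simp: colon_def)
    then have "pair R t (\<ominus>\<^bsub>R\<^esub> (t \<otimes>\<^bsub>R\<^esub> y)) \<in> carrier (free_mod R {0, 1::nat})"
      by (intro pair_carrier[OF assms(1)]) (simp_all add: assms(4))
    then show "pair R t (\<ominus>\<^bsub>R\<^esub> (t \<otimes>\<^bsub>R\<^esub> y)) \<in> carrier ?X"
      using I.a_inv_closed[OF t(2)] by (simp add: pair_sub_def)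
  qed (auto simp: colon_def pair_def fun_eq_iff R.l_distr R.minus_add R.m_assoc R.r_minus assms(4))
  have ext: "ext_van_mod n R ?X"
  proof (rule ext_van_mod_extension[OF ideal_mod_module[OF assms(1) P] X
        ideal_mod_module[OF assms(1) sum_ideal(1)[OF assms(1,3,4)]] i _ pair_sum_hom[OF assms(1,3,4)] _ _ assms(5,6)])
    fix t assume "t \<in> carrier (ideal_mod R ?P)" "pair R t (\<ominus>\<^bsub>R\<^esub> (t \<otimes>\<^bsub>R\<^esub> y)) = \<zero>\<^bsub>?X\<^esub>"
    then show "t = \<zero>\<^bsub>ideal_mod R ?P\<^esub>" by (auto dest: fun_cong[of _ _ 0])
  next
    show "(\<lambda>w. w 1 \<oplus>\<^bsub>R\<^esub> w 0 \<otimes>\<^bsub>R\<^esub> y) ` carrier ?X = carrier (ideal_mod R (sum_ideal R I y))"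
      using pair_sum_onto[OF assms(1,3,4)] by simp
  next
    show "(\<lambda>t. pair R t (\<ominus>\<^bsub>R\<^esub> (t \<otimes>\<^bsub>R\<^esub> y))) ` carrier (ideal_mod R ?P) =
        {w \<in> carrier ?X. w 1 \<oplus>\<^bsub>R\<^esub> w 0 \<otimes>\<^bsub>R\<^esub> y = \<zero>\<^bsub>ideal_mod R (sum_ideal R I y)\<^esub>}"
    proof (intro subset_antisym subsetI)
      fix w assume "w \<in> (\<lambda>t. pair R t (\<ominus>\<^bsub>R\<^esub> (t \<otimes>\<^bsub>R\<^esub> y))) ` carrier (ideal_mod R ?P)"
      then obtain t where t: "t \<in> ?P" "w = pair R t (\<ominus>\<^bsub>R\<^esub> (t \<otimes>\<^bsub>R\<^esub> y))" by auto
      then have "t \<in> carrier R" by (simp add: colon_def)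
      then show "w \<in> {w \<in> carrier ?X. w 1 \<oplus>\<^bsub>R\<^esub> w 0 \<otimes>\<^bsub>R\<^esub> y = \<zero>\<^bsub>ideal_mod R (sum_ideal R I y)\<^esub>}"
        using mod_homD(1)[OF i, of t] t assms(4) by (simp add: R.l_neg)
    next
      fix w assume "w \<in> {w \<in> carrier ?X. w 1 \<oplus>\<^bsub>R\<^esub> w 0 \<otimes>\<^bsub>R\<^esub> y = \<zero>\<^bsub>ideal_mod R (sum_ideal R I y)\<^esub>}"
      then have w: "w \<in> carrier (free_mod R {0, 1::nat})" "w 1 \<in> I" "w 1 \<oplus>\<^bsub>R\<^esub> w 0 \<otimes>\<^bsub>R\<^esub> y = \<zero>\<^bsub>R\<^esub>"
        by (auto simp: pair_sub_def)
      have c: "w 0 \<in> carrier R" "w 1 \<in> carrier R" using w(1) by (auto simp: free_mod_carrier)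
      have 1: "w 1 = \<ominus>\<^bsub>R\<^esub> (w 0 \<otimes>\<^bsub>R\<^esub> y)" using R.minus_equality[OF w(3)] c assms(4) by simp
      then have "\<ominus>\<^bsub>R\<^esub> w 1 = w 0 \<otimes>\<^bsub>R\<^esub> y" using c assms(4) by simp
      then have "w 0 \<in> ?P" using I.a_inv_closed[OF w(2)] c by (simp add: colon_def)
      moreover have "w = pair R (w 0) (\<ominus>\<^bsub>R\<^esub> (w 0 \<otimes>\<^bsub>R\<^esub> y))"
        using w(1) 1 by (auto simp: fun_eq_iff pair_def free_mod_carrier)
      ultimately show "w \<in> (\<lambda>t. pair R t (\<ominus>\<^bsub>R\<^esub> (t \<otimes>\<^bsub>R\<^esub> y))) ` carrier (ideal_mod R ?P)" by simp
    qed
  qed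
  \<comment> \<open>The extension gives the vanishing for the sum of R and I, and I is a direct
    summand of it.\<close>
  show ?thesis
  proof (rule ext_van_mod_ideal_retract[OF assms(1-3) X ext])
    show "(\<lambda>z. pair R \<zero>\<^bsub>R\<^esub> z) \<in> mod_hom R (ideal_mod R I) ?X"
    proof (rule mod_homI)
      fix z assume "z \<in> carrier (ideal_mod R I)"
      then have z: "z \<in> I" by simp
      show "pair R \<zero>\<^bsub>R\<^esub> z \<in> carrier ?X"
        using pair_carrier[OF assms(1) R.zero_closed I.Icarr[OF z]] z by (simp add: pair_sub_def)
    qed (auto simp: pair_def fun_eq_iff)
    show "(\<lambda>w. w 1) \<in> mod_hom R ?X (ideal_mod R I)"
      by (rule mod_homI) (auto simp: pair_sub_def)
  qed simp
qed

section \<open>Ideals primary to the maximal ideal\<close>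

text \<open>The unit ideal satisfies this vacuously and serves as the base of the induction
  below.\<close>

definition primary_to :: "('a, 'c) ring_scheme \<Rightarrow> 'a set \<Rightarrow> 'a set \<Rightarrow> bool" where
  "primary_to R \<mm> I \<longleftrightarrow> ideal I R \<and> (\<forall>Q. primeideal Q R \<longrightarrow> I \<subseteq> Q \<longrightarrow> Q = \<mm>)"

text \<open>Some ideal (I : y) inside \<mm> is prime, and as it contains I it can only be \<mm>.
  Thus y spans a copy of the residue field in R/I.\<close>

lemma primary_to_colon:
  assumes "local_ring R \<mm>" "noetherian_ring R" "primary_to R \<mm> I" "I \<noteq> carrier R"
  obtains y where "y \<in> carrier R" "y \<notin> I" "colon R I y = \<mm>"
proof -
  note L = local_ringD[OF assms(1)]
  interpret R: cring R by (rule L)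
  interpret N: noetherian_ring R by fact
  have I: "ideal I R" using assms(3) by (simp add: primary_to_def)
  obtain J where "maximalideal J R" "I \<subseteq> J" by (rule N.ex_maximalideal[OF I assms(4)]) (assumption | rule that)+
  then have Im: "I \<subseteq> \<mm>" using assms(1) by (simp add: local_ring_def)
  obtain y where y: "y \<in> carrier R" "primeideal (colon R I y) R" "colon R I y \<subseteq> \<mm>"
    by (rule colon_prime[OF L(1) assms(2) I L(3) Im]) (assumption | rule that)+
  have "colon R I y = \<mm>"
    using assms(3) y(2) R.ideal_subset_colon[OF I y(1)] unfolding primary_to_def by blast
  moreover have "y \<notin> I"
  proof
    assume "y \<in> I"
    then have "\<one>\<^bsub>R\<^esub> \<in> colon R I y" using y(1) by (simp add: colon_def)
    then show False using y(3) L(6) by blast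
  qed
  ultimately show ?thesis using y(1) by (intro that)
qed

lemma primary_to_sum:
  assumes "cring R" "primary_to R \<mm> I" "y \<in> carrier R"
  shows "primary_to R \<mm> (sum_ideal R I y)"
  using assms sum_ideal[OF assms(1) _ assms(3), of I] unfolding primary_to_def by blast

text \<open>Induction along a composition series of R/I, without lengths: a maximal counterexample I
  is proper, and I + Ry with (I : y) = \<mm> is a strictly larger primary ideal.\<close>

lemma primary_to_induct [consumes 3, case_names carrier step]:
  assumes "local_ring R \<mm>" "noetherian_ring R" "primary_to R \<mm> I"
    and "P (carrier R)"
    and step: "\<And>I y. primary_to R \<mm> I \<Longrightarrow> y \<in> carrier R \<Longrightarrow> colon R I y = \<mm> \<Longrightarrow> P (sum_ideal R I y) \<Longrightarrow> P I"
  shows "P I"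
proof (rule ccontr)
  assume nP: "\<not> P I"
  note L = local_ringD[OF assms(1)]
  interpret R: cring R by (rule L)
  interpret N: noetherian_ring R by fact
  let ?A = "{I. primary_to R \<mm> I \<and> \<not> P I}"
  have "\<exists>I\<in>?A. \<forall>J\<in>?A. I \<subseteq> J \<longrightarrow> J = I"
    by (rule N.ideal_maximal) (use nP assms(3) in \<open>auto simp: primary_to_def\<close>)
  then obtain J where J: "J \<in> ?A" "\<forall>K\<in>?A. J \<subseteq> K \<longrightarrow> K = J" by (rule bexE)
  then have Jp: "primary_to R \<mm> J" and Ji: "ideal J R" and ne: "J \<noteq> carrier R" using assms(4) by (auto simp: primary_to_def)
  obtain y where y: "y \<in> carrier R" "y \<notin> J" "colon R J y = \<mm>"
    by (rule primary_to_colon[OF assms(1,2) Jp ne]) (assumption | rule that)+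
  note S = sum_ideal[OF L(1) Ji y(1)]
  have "P (sum_ideal R J y)"
  proof (rule ccontr)
    assume "\<not> P (sum_ideal R J y)"
    then have "sum_ideal R J y \<in> ?A" using primary_to_sum[OF L(1) Jp y(1)] by simp
    then show False using J(2) S(2,3) y(2) by blast
  qed
  then show False using step[OF Jp y(1,3)] J(1) by simp
qed

text \<open>In the exact sequence of \<open>ext_van_mod_step\<close> both outer terms are known: the
  left one is \<mm> itself, the right one is the larger ideal of the induction.\<close>

lemma ext_van_mod_primary:
  assumes "local_ring R \<mm>" "noetherian_ring R" "ext_van_mod n R (ideal_mod R \<mm>)" "primary_to R \<mm> I"
  shows "ext_van_mod n R (ideal_mod R I)"
  using assms(1,2,4)
proof (induction rule: primary_to_induct)
  case carrier
  have "ideal_mod R (carrier R) = ring_module R" by (simp add: ring_module_def)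
  then show ?case using ext_van_mod_ring[OF local_ringD(1)[OF assms(1)]] by metis
next
  case (step I y)
  then show ?case
    using ext_van_mod_step[OF local_ringD(1)[OF assms(1)] assms(2) _ step(2) _ step(4)] assms(3)
    by (simp add: primary_to_def)
qed

lemma primary_to_principal:
  assumes "cring R" "a \<in> carrier R" "\<And>Q. primeideal Q R \<Longrightarrow> a \<in> Q \<Longrightarrow> Q = \<mm>"
  shows "primary_to R \<mm> (PIdl\<^bsub>R\<^esub> a)"
proof -
  interpret R: cring R by fact
  show ?thesis
    unfolding primary_to_def
  proof (intro conjI allI impI)
    fix Q assume Q: "primeideal Q R" "PIdl\<^bsub>R\<^esub> a \<subseteq> Q"
    have "a \<in> Q" by (rule subsetD[OF Q(2) R.cgenideal_self[OF assms(2)]])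
    then show "Q = \<mm>" by (rule assms(3)[OF Q(1)])
  qed (rule R.cgenideal_ideal[OF assms(2)])
qed

lemma nonzerodivisor_cancel:
  assumes "cring R" "nonzerodivisor R a" "x \<in> carrier R" "y \<in> carrier R" "x \<otimes>\<^bsub>R\<^esub> a = y \<otimes>\<^bsub>R\<^esub> a"
  shows "x = y"
proof -
  interpret R: cring R by fact
  have a: "a \<in> carrier R" using assms(2) by (simp add: nonzerodivisor_def)
  have "a \<otimes>\<^bsub>R\<^esub> (x \<ominus>\<^bsub>R\<^esub> y) = a \<otimes>\<^bsub>R\<^esub> x \<ominus>\<^bsub>R\<^esub> a \<otimes>\<^bsub>R\<^esub> y"
    using assms(3,4) a by (simp add: a_minus_def R.r_distr R.r_minus)
  also have "\<dots> = \<zero>\<^bsub>R\<^esub>" using assms(3-5) a by (simp add: R.minus_eq_zero_iff R.m_comm[of a])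
  finally have "x \<ominus>\<^bsub>R\<^esub> y = \<zero>\<^bsub>R\<^esub>"
    using assms(2) R.minus_closed[OF assms(3,4)] unfolding nonzerodivisor_def by blast
  then show ?thesis using R.minus_eq_zero_iff[OF assms(3,4)] by simp
qed

text \<open>
  If $\mathfrak m = (aR : b)$ with \<open>a\<close> a nonzerodivisor, then the first syzygy of the ideal
  generated by \<open>a\<close> and \<open>b\<close> is isomorphic to $\mathfrak m$.
\<close>

lemma ext_van_mod_descend:
  assumes "local_ring R \<mm>" "noetherian_ring R" "ext_van_mod (Suc n) R (ideal_mod R \<mm>)"
    and "nonzerodivisor R a" "a \<in> \<mm>" "\<And>Q. primeideal Q R \<Longrightarrow> a \<in> Q \<Longrightarrow> Q = \<mm>"
  shows "ext_van_mod n R (ideal_mod R \<mm>)"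
proof -
  note L = local_ringD[OF assms(1)]
  interpret R: cring R by (rule L)
  have a: "a \<in> carrier R" using assms(4) by (simp add: nonzerodivisor_def)
  let ?A = "PIdl\<^bsub>R\<^esub> a"
  have Ai: "ideal ?A R" by (rule R.cgenideal_ideal[OF a])
  have Ap: "primary_to R \<mm> ?A" by (rule primary_to_principal[OF L(1) a assms(6)])
  have "?A \<subseteq> \<mm>" by (rule R.cgenideal_minimal[OF L(4) assms(5)])
  then have Ane: "?A \<noteq> carrier R" using L(6) R.one_closed by blast
  obtain b where b: "b \<in> carrier R" "b \<notin> ?A" "colon R ?A b = \<mm>"
    by (rule primary_to_colon[OF assms(1,2) Ap Ane]) (assumption | rule that)+
  let ?J = "sum_ideal R ?A b" and ?F = "free_mod R {0, 1::nat}"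
  note J = sum_ideal[OF L(1) Ai b(1)]
  \<comment> \<open>The ideal Ra + Rb is again primary, so it inherits the vanishing from \<mm>, and
    its first syzygy has it one degree lower.\<close>
  have EJ: "ext_van_mod (Suc n) R (ideal_mod R ?J)"
    by (rule ext_van_mod_primary[OF assms(1-3) primary_to_sum[OF L(1) Ap b(1)]])
  define p where "p w = w 1 \<otimes>\<^bsub>R\<^esub> a \<oplus>\<^bsub>R\<^esub> w 0 \<otimes>\<^bsub>R\<^esub> b" for w :: "nat \<Rightarrow> _"
  have pJ: "p w \<in> ?J" if "w \<in> carrier ?F" for w
  proof -
    have w: "w 0 \<in> carrier R" "w 1 \<in> carrier R" using that by (auto simp: free_mod_carrier)
    then have "w 1 \<otimes>\<^bsub>R\<^esub> a \<in> ?A" unfolding cgenideal_def by blast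
    then show ?thesis using w(1) unfolding p_def sum_ideal_def by blast
  qed
  have ph: "p \<in> mod_hom R ?F (ideal_mod R ?J)"
  proof (rule mod_homI)
    show "p w \<in> carrier (ideal_mod R ?J)" if "w \<in> carrier ?F" for w using pJ[OF that] by simp
  qed (use a b in \<open>simp_all add: p_def free_mod_carrier R.l_distr R.r_distr R.m_assoc R.a_ac\<close>)
  have cov: "cover R {0, 1::nat} p (ideal_mod R ?J)"
    unfolding cover_def
  proof (intro conjI ph subset_antisym subsetI)
    fix x assume "x \<in> carrier (ideal_mod R ?J)"
    then obtain z r where x: "x = z \<otimes>\<^bsub>R\<^esub> a \<oplus>\<^bsub>R\<^esub> r \<otimes>\<^bsub>R\<^esub> b" "z \<in> carrier R" "r \<in> carrier R"
      by (auto simp: sum_ideal_def cgenideal_def)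
    then show "x \<in> p ` carrier ?F"
      by (intro image_eqI[OF _ pair_carrier[OF L(1) x(3,2)]]) (simp add: p_def)
  qed (use pJ in auto)
  let ?K = "hom_ker ?F (ideal_mod R ?J) p"
  have EK: "ext_van_mod n R (?F\<lparr>carrier := ?K\<rparr>)"
    by (rule ext_van_mod_syzygy[OF assms(2) ideal_mod_module[OF L(1) J(1)] EJ _ cov]) simp
  have Km: "module R (?F\<lparr>carrier := ?K\<rparr>)"
    by (rule submodule_module[OF free_mod_module[OF L(1)] cover_kernel_submodule[OF ideal_mod_module[OF L(1) J(1)] cov]])
  \<comment> \<open>The quotient tb/a, unique because a is a nonzerodivisor. An element t of \<mm>
    corresponds to the relation with coefficient t at b and -tb/a at a.\<close>
  define c where "c t = (SOME c. c \<in> carrier R \<and> c \<otimes>\<^bsub>R\<^esub> a = t \<otimes>\<^bsub>R\<^esub> b)" for t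
  have c: "c t \<in> carrier R \<and> c t \<otimes>\<^bsub>R\<^esub> a = t \<otimes>\<^bsub>R\<^esub> b" if "t \<in> \<mm>" for t
  proof -
    have "t \<in> colon R ?A b" using that b(3) by simp
    then have "t \<otimes>\<^bsub>R\<^esub> b \<in> ?A" by (simp add: colon_def)
    then have "\<exists>c. c \<in> carrier R \<and> c \<otimes>\<^bsub>R\<^esub> a = t \<otimes>\<^bsub>R\<^esub> b" by (auto simp: cgenideal_def)
    then show ?thesis unfolding c_def by (rule someI_ex)
  qed
  have mc: "t \<in> carrier R" if "t \<in> \<mm>" for t using that L(5) by blast
  have cu: "c t = u" if "t \<in> \<mm>" "u \<in> carrier R" "u \<otimes>\<^bsub>R\<^esub> a = t \<otimes>\<^bsub>R\<^esub> b" for t u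
    using nonzerodivisor_cancel[OF L(1) assms(4), of "c t" u] c[OF that(1)] that by simp
  interpret m: ideal \<mm> R by (rule L)
  have i: "(\<lambda>t. pair R t (\<ominus>\<^bsub>R\<^esub> c t)) \<in> mod_hom R (ideal_mod R \<mm>) (?F\<lparr>carrier := ?K\<rparr>)"
  proof (rule mod_homI)
    fix t assume "t \<in> carrier (ideal_mod R \<mm>)"
    then have t: "t \<in> \<mm>" by simp
    have "pair R t (\<ominus>\<^bsub>R\<^esub> c t) \<in> carrier ?F" using pair_carrier[OF L(1) mc[OF t]] c[OF t] by simp
    moreover have "p (pair R t (\<ominus>\<^bsub>R\<^esub> c t)) = \<zero>\<^bsub>R\<^esub>"
      using c[OF t] a b(1) mc[OF t] by (simp add: p_def R.l_minus R.l_neg)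
    ultimately show "pair R t (\<ominus>\<^bsub>R\<^esub> c t) \<in> carrier (?F\<lparr>carrier := ?K\<rparr>)" by (simp add: hom_ker_def)
    { fix s assume "s \<in> carrier (ideal_mod R \<mm>)"
      then have s: "s \<in> \<mm>" by simp
      have "c (t \<oplus>\<^bsub>R\<^esub> s) = c t \<oplus>\<^bsub>R\<^esub> c s"
        by (rule cu) (use c[OF t] c[OF s] mc t s a b(1) in \<open>simp_all add: R.l_distr\<close>)
      then show "pair R (t \<oplus>\<^bsub>ideal_mod R \<mm>\<^esub> s) (\<ominus>\<^bsub>R\<^esub> c (t \<oplus>\<^bsub>ideal_mod R \<mm>\<^esub> s)) =
          pair R t (\<ominus>\<^bsub>R\<^esub> c t) \<oplus>\<^bsub>?F\<lparr>carrier := ?K\<rparr>\<^esub> pair R s (\<ominus>\<^bsub>R\<^esub> c s)"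
        using c[OF t] c[OF s] by (auto simp: pair_def fun_eq_iff R.minus_add) }
    { fix r assume r: "r \<in> carrier R"
      have "c (r \<otimes>\<^bsub>R\<^esub> t) = r \<otimes>\<^bsub>R\<^esub> c t"
        by (rule cu) (use c[OF t] mc t r a b(1) m.I_l_closed in \<open>simp_all add: R.m_assoc\<close>)
      then show "pair R (r \<odot>\<^bsub>ideal_mod R \<mm>\<^esub> t) (\<ominus>\<^bsub>R\<^esub> c (r \<odot>\<^bsub>ideal_mod R \<mm>\<^esub> t)) =
          r \<odot>\<^bsub>?F\<lparr>carrier := ?K\<rparr>\<^esub> pair R t (\<ominus>\<^bsub>R\<^esub> c t)"
        using c[OF t] r by (auto simp: pair_def fun_eq_iff R.r_minus) }
  qed
  have r: "(\<lambda>w. w 0) \<in> mod_hom R (?F\<lparr>carrier := ?K\<rparr>) (ideal_mod R \<mm>)"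
  proof (rule mod_homI)
    fix w assume "w \<in> carrier (?F\<lparr>carrier := ?K\<rparr>)"
    then have w: "w 0 \<in> carrier R" "w 1 \<in> carrier R" "w 1 \<otimes>\<^bsub>R\<^esub> a \<oplus>\<^bsub>R\<^esub> w 0 \<otimes>\<^bsub>R\<^esub> b = \<zero>\<^bsub>R\<^esub>"
      by (auto simp: hom_ker_def free_mod_carrier p_def)
    have "w 0 \<otimes>\<^bsub>R\<^esub> b \<oplus>\<^bsub>R\<^esub> w 1 \<otimes>\<^bsub>R\<^esub> a = \<zero>\<^bsub>R\<^esub>" using w a b(1) by (simp add: R.a_comm)
    then have "w 0 \<otimes>\<^bsub>R\<^esub> b = \<ominus>\<^bsub>R\<^esub> (w 1 \<otimes>\<^bsub>R\<^esub> a)" using w a b(1) R.minus_equality by simp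
    also have "\<dots> = (\<ominus>\<^bsub>R\<^esub> w 1) \<otimes>\<^bsub>R\<^esub> a" using w a by (simp add: R.l_minus)
    finally have "w 0 \<otimes>\<^bsub>R\<^esub> b \<in> ?A" unfolding cgenideal_def using w(2) by blast
    then have "w 0 \<in> colon R ?A b" using w(1) by (simp add: colon_def)
    then show "w 0 \<in> carrier (ideal_mod R \<mm>)" using b(3) by simp
  qed simp_all
  show ?thesis by (rule ext_van_mod_ideal_retract[OF L(1) assms(2) L(4) Km EK i r]) simp
qed

subsection \<open>Depth zero\<close>

text \<open>The projection of the sum of I and J onto J along I; when the two meet in zero, u is
  unique.\<close>

definition sum_proj :: "('a, 'c) ring_scheme \<Rightarrow> 'a set \<Rightarrow> 'a set \<Rightarrow> 'a \<Rightarrow> 'a" where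
  "sum_proj R I J z = (SOME u. u \<in> J \<and> z \<ominus>\<^bsub>R\<^esub> u \<in> I)"

lemma sum_proj:
  assumes "cring R" "ideal I R" "b \<in> carrier R" "I \<inter> PIdl\<^bsub>R\<^esub> b = {\<zero>\<^bsub>R\<^esub>}"
  shows "sum_proj R I (PIdl\<^bsub>R\<^esub> b) \<in> mod_hom R (ideal_mod R (sum_ideal R I b)) (ideal_mod R (PIdl\<^bsub>R\<^esub> b))"
    and "u \<in> PIdl\<^bsub>R\<^esub> b \<Longrightarrow> sum_proj R I (PIdl\<^bsub>R\<^esub> b) u = u"
    and "u \<in> I \<Longrightarrow> sum_proj R I (PIdl\<^bsub>R\<^esub> b) u = \<zero>\<^bsub>R\<^esub>"
proof -
  interpret R: cring R by fact
  interpret I: ideal I R by fact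
  let ?B = "PIdl\<^bsub>R\<^esub> b"
  interpret B: ideal ?B R by (rule R.cgenideal_ideal[OF assms(3)])
  let ?r = "sum_proj R I ?B"
  have u: "?r z = u" if "z \<in> carrier R" "u \<in> ?B" "z \<ominus>\<^bsub>R\<^esub> u \<in> I" for z u
  proof -
    have "?r z \<in> ?B \<and> z \<ominus>\<^bsub>R\<^esub> ?r z \<in> I"
      unfolding sum_proj_def by (rule someI[of _ u]) (use that in simp)
    then have r: "?r z \<in> ?B" "z \<ominus>\<^bsub>R\<^esub> ?r z \<in> I" by auto
    have c: "?r z \<in> carrier R" "u \<in> carrier R" using r(1) that(2) by auto
    have "?r z \<ominus>\<^bsub>R\<^esub> u = (z \<ominus>\<^bsub>R\<^esub> u) \<ominus>\<^bsub>R\<^esub> (z \<ominus>\<^bsub>R\<^esub> ?r z)"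
      using c that(1) by algebra
    then have "?r z \<ominus>\<^bsub>R\<^esub> u \<in> I" using ideal_diff[OF assms(2) that(3) r(2)] by simp
    moreover have "?r z \<ominus>\<^bsub>R\<^esub> u \<in> ?B" by (rule ideal_diff[OF B.is_ideal r(1) that(2)])
    ultimately have "?r z \<ominus>\<^bsub>R\<^esub> u = \<zero>\<^bsub>R\<^esub>" using assms(4) by blast
    then show ?thesis using R.minus_eq_zero_iff[OF c] by simp
  qed
  have dec: "\<exists>x v. x \<in> I \<and> v \<in> ?B \<and> z = x \<oplus>\<^bsub>R\<^esub> v" if "z \<in> sum_ideal R I b" for z
    using that unfolding sum_ideal_def cgenideal_def by blast
  have rs: "?r (x \<oplus>\<^bsub>R\<^esub> v) = v" if "x \<in> I" "v \<in> ?B" for x v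
  proof (rule u)
    have c: "x \<in> carrier R" "v \<in> carrier R" using that by auto
    then show "x \<oplus>\<^bsub>R\<^esub> v \<in> carrier R" by simp
    have "(x \<oplus>\<^bsub>R\<^esub> v) \<ominus>\<^bsub>R\<^esub> v = x" using c by (simp add: a_minus_def R.a_assoc R.r_neg)
    then show "(x \<oplus>\<^bsub>R\<^esub> v) \<ominus>\<^bsub>R\<^esub> v \<in> I" using that by simp
  qed (rule that(2))
  show "?r \<in> mod_hom R (ideal_mod R (sum_ideal R I b)) (ideal_mod R ?B)"
  proof (rule mod_homI)
    fix z assume "z \<in> carrier (ideal_mod R (sum_ideal R I b))"
    then have "z \<in> sum_ideal R I b" by simp
    from dec[OF this] obtain x v where z: "x \<in> I" "v \<in> ?B" "z = x \<oplus>\<^bsub>R\<^esub> v"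
      by (elim exE conjE) (rule that)
    have c: "x \<in> carrier R" "v \<in> carrier R" using z by auto
    show "?r z \<in> carrier (ideal_mod R ?B)" using rs[OF z(1,2)] z by simp
    { fix z' assume "z' \<in> carrier (ideal_mod R (sum_ideal R I b))"
      then have "z' \<in> sum_ideal R I b" by simp
      from dec[OF this] obtain x' v' where z': "x' \<in> I" "v' \<in> ?B" "z' = x' \<oplus>\<^bsub>R\<^esub> v'"
        by (elim exE conjE) (rule that)
      have c': "x' \<in> carrier R" "v' \<in> carrier R" using z' by auto
      have "z \<oplus>\<^bsub>R\<^esub> z' = (x \<oplus>\<^bsub>R\<^esub> x') \<oplus>\<^bsub>R\<^esub> (v \<oplus>\<^bsub>R\<^esub> v')" using c c' z z' by (simp add: R.a_ac)
      then show "?r (z \<oplus>\<^bsub>ideal_mod R (sum_ideal R I b)\<^esub> z') = ?r z \<oplus>\<^bsub>ideal_mod R ?B\<^esub> ?r z'"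
        using rs[OF I.a_closed[OF z(1) z'(1)] B.a_closed[OF z(2) z'(2)]] rs[OF z(1,2)] rs[OF z'(1,2)] z(3) z'(3) by simp }
    { fix r assume r: "r \<in> carrier R"
      have "r \<otimes>\<^bsub>R\<^esub> z = r \<otimes>\<^bsub>R\<^esub> x \<oplus>\<^bsub>R\<^esub> r \<otimes>\<^bsub>R\<^esub> v" using c r z by (simp add: R.r_distr)
      then show "?r (r \<odot>\<^bsub>ideal_mod R (sum_ideal R I b)\<^esub> z) = r \<odot>\<^bsub>ideal_mod R ?B\<^esub> ?r z"
        using rs[OF I.I_l_closed[OF z(1) r] B.I_l_closed[OF z(2) r]] rs[OF z(1,2)] z(3) by simp }
  qed
  show "?r u = u" if "u \<in> ?B"
    using rs[OF I.zero_closed that] B.Icarr[OF that] by simp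
  show "?r u = \<zero>\<^bsub>R\<^esub>" if "u \<in> I"
    using rs[OF that B.zero_closed] I.Icarr[OF that] by simp
qed

text \<open>As Ra and Rb meet in zero, Rb is a direct summand of the primary ideal Ra + Rb and
  inherits the vanishing; as (0 : b) = \<mm>, it is a copy of R/\<mm>. So Ext^(n+1)(\<mm>, R) = 0
  gives Ext^(n+1)(R/\<mm>, R) = 0, whereas dimension shifting alone would only give it in degree n +
  2. This gain of one degree drives the descent in \<open>no_socle\<close>.\<close>

lemma ext_van_socle:
  assumes "local_ring R \<mm>" "noetherian_ring R" "ext_van_mod n R (ideal_mod R \<mm>)"
    and "a \<in> carrier R" "\<And>Q. primeideal Q R \<Longrightarrow> a \<in> Q \<Longrightarrow> Q = \<mm>"
    and "b \<in> carrier R" "colon R {\<zero>\<^bsub>R\<^esub>} b = \<mm>" "PIdl\<^bsub>R\<^esub> a \<inter> PIdl\<^bsub>R\<^esub> b = {\<zero>\<^bsub>R\<^esub>}"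
  shows "ext_van n R {0::nat} (sing_sub R \<mm>)"
proof -
  note L = local_ringD[OF assms(1)]
  interpret R: cring R by (rule L)
  let ?A = "PIdl\<^bsub>R\<^esub> a" and ?B = "PIdl\<^bsub>R\<^esub> b" and ?F = "free_mod R {0::nat}"
  have Ai: "ideal ?A R" and Bi: "ideal ?B R" by (rule R.cgenideal_ideal[OF assms(4)], rule R.cgenideal_ideal[OF assms(6)])
  let ?J = "sum_ideal R ?A b"
  note J = sum_ideal[OF L(1) Ai assms(6)]
  have EJ: "ext_van_mod n R (ideal_mod R ?J)"
    by (rule ext_van_mod_primary[OF assms(1-3) primary_to_sum[OF L(1) primary_to_principal[OF L(1) assms(4,5)] assms(6)]])
  have BJ: "?B \<subseteq> ?J" by (rule R.cgenideal_minimal[OF J(1,3)])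
  note P = sum_proj[OF L(1) Ai assms(6,8)]
  have inc: "(\<lambda>x. x) \<in> mod_hom R (ideal_mod R ?B) (ideal_mod R ?J)"
    by (rule mod_homI) (use BJ in auto)
  have EB: "ext_van_mod n R (ideal_mod R ?B)"
    by (rule ext_van_mod_ideal_retract[OF L(1) assms(2) Bi ideal_mod_module[OF L(1) J(1)] EJ inc P(1) P(2)])
  define p where "p v = v 0 \<otimes>\<^bsub>R\<^esub> b" for v :: "nat \<Rightarrow> _"
  have ph: "p \<in> mod_hom R ?F (ideal_mod R ?B)"
  proof (rule mod_homI)
    show "p v \<in> carrier (ideal_mod R ?B)" if "v \<in> carrier ?F" for v
      using that unfolding p_def cgenideal_def by (auto simp: free_mod_carrier)
  qed (simp_all add: p_def free_mod_carrier R.l_distr R.m_assoc assms(6))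
  have cov: "cover R {0::nat} p (ideal_mod R ?B)"
    unfolding cover_def
  proof (intro conjI ph subset_antisym subsetI)
    fix x assume "x \<in> carrier (ideal_mod R ?B)"
    then obtain r where r: "r \<in> carrier R" "x = r \<otimes>\<^bsub>R\<^esub> b" by (auto simp: cgenideal_def)
    then show "x \<in> p ` carrier ?F"
      by (intro image_eqI[OF _ sing_free_mod_mem[OF L(1) r(1)]]) (simp add: p_def)
  next
    show "x \<in> carrier (ideal_mod R ?B)" if "x \<in> p ` carrier ?F" for x using that mod_homD(1)[OF ph] by blast
  qed
  have "v 0 \<in> \<mm> \<longleftrightarrow> v 0 \<otimes>\<^bsub>R\<^esub> b = \<zero>\<^bsub>R\<^esub>" if "v \<in> carrier ?F" for v
  proof -
    have "v 0 \<in> carrier R" using that by (simp add: free_mod_carrier)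
    then have "v 0 \<in> colon R {\<zero>\<^bsub>R\<^esub>} b \<longleftrightarrow> v 0 \<otimes>\<^bsub>R\<^esub> b = \<zero>\<^bsub>R\<^esub>" by (simp add: colon_def)
    then show ?thesis using assms(7) by simp
  qed
  then have "hom_ker ?F (ideal_mod R ?B) p = sing_sub R \<mm>"
    by (auto simp: hom_ker_def sing_sub_def p_def)
  then show ?thesis using ext_van_modD[OF assms(2) ideal_mod_module[OF L(1) Bi] EB _ cov] by simp
qed

text \<open>For f on I, the map sending t to f(ty) on (I : y) = \<mm> is multiplication by some c.
  Letting y go to c extends f to I + Ry, where the induction hypothesis applies.\<close>

lemma hom_extension_primary:
  assumes "local_ring R \<mm>" "noetherian_ring R" "primary_to R \<mm> I"
    and "\<And>f. f \<in> mod_hom R (ideal_mod R \<mm>) (ring_module R) \<Longrightarrow> \<exists>c\<in>carrier R. \<forall>x\<in>\<mm>. f x = x \<otimes>\<^bsub>R\<^esub> c"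
  shows "\<forall>f\<in>mod_hom R (ideal_mod R I) (ring_module R). \<exists>c\<in>carrier R. \<forall>x\<in>I. f x = x \<otimes>\<^bsub>R\<^esub> c"
  using assms(1-3)
proof (induction rule: primary_to_induct)
  case carrier
  interpret R: cring R by (rule local_ringD(1)[OF assms(1)])
  show ?case
  proof
    fix f assume f: "f \<in> mod_hom R (ideal_mod R (carrier R)) (ring_module R)"
    have "f x = x \<otimes>\<^bsub>R\<^esub> f \<one>\<^bsub>R\<^esub>" if "x \<in> carrier R" for x
      using mod_homD(3)[OF f that, of "\<one>\<^bsub>R\<^esub>"] that by simp
    moreover have "f \<one>\<^bsub>R\<^esub> \<in> carrier R" using mod_homD(1)[OF f, of "\<one>\<^bsub>R\<^esub>"] by simp
    ultimately show "\<exists>c\<in>carrier R. \<forall>x\<in>carrier R. f x = x \<otimes>\<^bsub>R\<^esub> c" by (intro bexI[of _ "f \<one>\<^bsub>R\<^esub>"] ballI)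
  qed
next
  case (step I y)
  note L = local_ringD[OF assms(1)]
  interpret R: cring R by (rule L)
  have Ii: "ideal I R" using step(1) by (simp add: primary_to_def)
  interpret I: ideal I R by (rule Ii)
  note Im = ideal_mod_module[OF L(1) Ii] and Rm = ring_module_module[OF L(1)]
  let ?X = "free_mod R {0, 1::nat}\<lparr>carrier := pair_sub R I\<rparr>" and ?J = "sum_ideal R I y"
  note J = sum_ideal[OF L(1) Ii step(2)]
  have X: "module R ?X" by (rule submodule_module[OF free_mod_module[OF L(1)] pair_sub_submodule[OF L(1) Ii]])
  show ?case
  proof
    fix f assume f: "f \<in> mod_hom R (ideal_mod R I) (ring_module R)"
    have tm: "t \<in> carrier R \<and> t \<otimes>\<^bsub>R\<^esub> y \<in> I" if "t \<in> \<mm>" for t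
    proof -
      have "t \<in> colon R I y" using that step(3) by simp
      then show ?thesis by (simp add: colon_def)
    qed
    have "(\<lambda>t. f (t \<otimes>\<^bsub>R\<^esub> y)) \<in> mod_hom R (ideal_mod R \<mm>) (ring_module R)"
    proof (rule mod_homI)
      fix t assume "t \<in> carrier (ideal_mod R \<mm>)"
      then have t: "t \<in> carrier R" "t \<otimes>\<^bsub>R\<^esub> y \<in> I" using tm by auto
      then show "f (t \<otimes>\<^bsub>R\<^esub> y) \<in> carrier (ring_module R)" using mod_homD(1)[OF f] by simp
      { fix s assume "s \<in> carrier (ideal_mod R \<mm>)"
        then have s: "s \<in> carrier R" "s \<otimes>\<^bsub>R\<^esub> y \<in> I" using tm by auto
        then show "f ((t \<oplus>\<^bsub>ideal_mod R \<mm>\<^esub> s) \<otimes>\<^bsub>R\<^esub> y) = f (t \<otimes>\<^bsub>R\<^esub> y) \<oplus>\<^bsub>ring_module R\<^esub> f (s \<otimes>\<^bsub>R\<^esub> y)"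
          using mod_homD(2)[OF f, of "t \<otimes>\<^bsub>R\<^esub> y" "s \<otimes>\<^bsub>R\<^esub> y"] t step(2) by (simp add: R.l_distr) }
      { fix r assume r: "r \<in> carrier R"
        then show "f ((r \<odot>\<^bsub>ideal_mod R \<mm>\<^esub> t) \<otimes>\<^bsub>R\<^esub> y) = r \<odot>\<^bsub>ring_module R\<^esub> f (t \<otimes>\<^bsub>R\<^esub> y)"
          using mod_homD(3)[OF f r, of "t \<otimes>\<^bsub>R\<^esub> y"] t step(2) by (simp add: R.m_assoc) }
    qed
    from assms(4)[OF this] obtain c where c: "c \<in> carrier R" "\<forall>t\<in>\<mm>. f (t \<otimes>\<^bsub>R\<^esub> y) = t \<otimes>\<^bsub>R\<^esub> c" by (rule bexE)
    define g where "g w = f (w 1) \<oplus>\<^bsub>R\<^esub> w 0 \<otimes>\<^bsub>R\<^esub> c" for w :: "nat \<Rightarrow> _"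
    have w: "w 0 \<in> carrier R" "w 1 \<in> carrier R" "w 1 \<in> I" "f (w 1) \<in> carrier R" if "w \<in> carrier ?X" for w
      using that mod_homD(1)[OF f, of "w 1"] by (auto simp: pair_sub_def free_mod_carrier)
    have g: "g \<in> mod_hom R ?X (ring_module R)"
    proof (rule mod_homI)
      fix v assume v: "v \<in> carrier ?X"
      note v' = w[OF v]
      show "g v \<in> carrier (ring_module R)" using v' c by (simp add: g_def)
      { fix u assume u: "u \<in> carrier ?X"
        note u' = w[OF u]
        have "f (v 1 \<oplus>\<^bsub>R\<^esub> u 1) = f (v 1) \<oplus>\<^bsub>R\<^esub> f (u 1)" using mod_homD(2)[OF f, of "v 1" "u 1"] v' u' by simp
        then show "g (v \<oplus>\<^bsub>?X\<^esub> u) = g v \<oplus>\<^bsub>ring_module R\<^esub> g u"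
          using v' u' c by (simp add: g_def R.l_distr R.a_ac) }
      { fix r assume r: "r \<in> carrier R"
        have "f (r \<otimes>\<^bsub>R\<^esub> v 1) = r \<otimes>\<^bsub>R\<^esub> f (v 1)" using mod_homD(3)[OF f r, of "v 1"] v' by simp
        then show "g (r \<odot>\<^bsub>?X\<^esub> v) = r \<odot>\<^bsub>ring_module R\<^esub> g v"
          using v' r c by (simp add: g_def R.r_distr R.m_assoc) }
    qed
    have g0: "g v = \<zero>\<^bsub>ring_module R\<^esub>"
      if v: "v \<in> carrier ?X" and "v 1 \<oplus>\<^bsub>R\<^esub> v 0 \<otimes>\<^bsub>R\<^esub> y = \<zero>\<^bsub>ideal_mod R ?J\<^esub>" for v
    proof -
      note v' = w[OF v]
      have s: "v 1 \<oplus>\<^bsub>R\<^esub> v 0 \<otimes>\<^bsub>R\<^esub> y = \<zero>\<^bsub>R\<^esub>" using that(2) by simp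
      have "v 1 = \<ominus>\<^bsub>R\<^esub> (v 0 \<otimes>\<^bsub>R\<^esub> y)" using R.minus_equality[OF s] v' step(2) by simp
      then have "\<ominus>\<^bsub>R\<^esub> v 1 = v 0 \<otimes>\<^bsub>R\<^esub> y" using v' step(2) by simp
      then have yI: "v 0 \<otimes>\<^bsub>R\<^esub> y \<in> I" using I.a_inv_closed[OF v'(3)] by simp
      then have "v 0 \<in> colon R I y" using v'(1) by (simp add: colon_def)
      then have "v 0 \<in> \<mm>" using step(3) by simp
      then have "f (v 0 \<otimes>\<^bsub>R\<^esub> y) = v 0 \<otimes>\<^bsub>R\<^esub> c" using c(2) by blast
      then have "g v = f (v 1 \<oplus>\<^bsub>R\<^esub> v 0 \<otimes>\<^bsub>R\<^esub> y)"
        using mod_homD(2)[OF f, of "v 1" "v 0 \<otimes>\<^bsub>R\<^esub> y"] v' yI by (simp add: g_def)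
      also have "\<dots> = \<zero>\<^bsub>R\<^esub>" using s mod_hom_zero[OF Im Rm f] by simp
      finally show ?thesis by simp
    qed
    have onto: "(\<lambda>w. w 1 \<oplus>\<^bsub>R\<^esub> w 0 \<otimes>\<^bsub>R\<^esub> y) ` carrier ?X = carrier (ideal_mod R ?J)"
      using pair_sum_onto[OF L(1) Ii step(2)] by simp
    obtain h where h: "h \<in> mod_hom R (ideal_mod R ?J) (ring_module R)"
      and hg: "\<And>v. v \<in> carrier ?X \<Longrightarrow> h (v 1 \<oplus>\<^bsub>R\<^esub> v 0 \<otimes>\<^bsub>R\<^esub> y) = g v"
      by (rule mod_hom_descend[OF X ideal_mod_module[OF L(1) J(1)] Rm pair_sum_hom[OF L(1) Ii step(2)] onto g g0])
        (assumption | rule that)+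
    obtain e where e: "e \<in> carrier R" "\<forall>x\<in>?J. h x = x \<otimes>\<^bsub>R\<^esub> e"
      using bspec[OF step(4) h] by (rule bexE)
    have "f x = x \<otimes>\<^bsub>R\<^esub> e" if x: "x \<in> I" for x
    proof -
      have xc: "x \<in> carrier R" "f x \<in> carrier R" using x mod_homD(1)[OF f, of x] by auto
      have "pair R \<zero>\<^bsub>R\<^esub> x \<in> carrier ?X"
        using pair_carrier[OF L(1) R.zero_closed xc(1)] x by (simp add: pair_sub_def)
      from hg[OF this] have "h x = f x" using xc step(2) c(1) by (simp add: g_def)
      then show ?thesis using e(2) J(2) x by (metis subsetD)
    qed
    then show "\<exists>c\<in>carrier R. \<forall>x\<in>I. f x = x \<otimes>\<^bsub>R\<^esub> c" using e(1) by (intro bexI[of _ e]) auto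
  qed
qed

text \<open>The degree descends until Ext^1(R/\<mm>, R) = 0, and then every map from a primary ideal
  to R is a multiplication. The projection of Ra + Rb onto Rb would be multiplication by some c with
  ac = 0 and bc = b. If c lies in \<mm> then b = 0, and if c is a unit then a = 0.\<close>

lemma no_socle:
  assumes "local_ring R \<mm>" "noetherian_ring R" "ext_van_mod n R (ideal_mod R \<mm>)"
    and a: "a \<in> carrier R" "a \<noteq> \<zero>\<^bsub>R\<^esub>" "\<And>Q. primeideal Q R \<Longrightarrow> a \<in> Q \<Longrightarrow> Q = \<mm>"
    and b: "b \<in> carrier R" "b \<noteq> \<zero>\<^bsub>R\<^esub>" "colon R {\<zero>\<^bsub>R\<^esub>} b = \<mm>" "PIdl\<^bsub>R\<^esub> a \<inter> PIdl\<^bsub>R\<^esub> b = {\<zero>\<^bsub>R\<^esub>}"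
  shows False
proof -
  note L = local_ringD[OF assms(1)]
  interpret R: cring R by (rule L)
  let ?F = "free_mod R {0::nat}" and ?A = "PIdl\<^bsub>R\<^esub> a" and ?B = "PIdl\<^bsub>R\<^esub> b"
  have E0: "ext_van_mod 0 R (ideal_mod R \<mm>)"
    using assms(3)
  proof (induction n)
    case (Suc n)
    have "ext_van (Suc n) R {0::nat} (sing_sub R \<mm>)"
      by (rule ext_van_socle[OF assms(1,2) Suc.prems a(1,3) b(1,3,4)])
    then have "ext_van_mod n R (?F\<lparr>carrier := sing_sub R \<mm>\<rparr>)"
      unfolding ext_van.simps ext_van_mod_def .
    then show ?case using Suc.IH ext_van_mod_sing[OF L(1) assms(2) L(4)] by blast
  qed
  have E: "ext_van 0 R {0::nat} (sing_sub R \<mm>)"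
    by (rule ext_van_socle[OF assms(1,2) E0 a(1,3) b(1,3,4)])
  have ext: "\<exists>c\<in>carrier R. \<forall>x\<in>\<mm>. f x = x \<otimes>\<^bsub>R\<^esub> c" if f: "f \<in> mod_hom R (ideal_mod R \<mm>) (ring_module R)" for f
  proof -
    note fv = mod_hom_comp[OF sing_proj_hom[OF L(1,4)] f]
    obtain g where g: "g \<in> mod_hom R ?F (ring_module R)" "\<forall>v\<in>sing_sub R \<mm>. g v = f (v 0)"
      using bspec[OF E[unfolded ext_van.simps] fv] by (rule bexE)
    let ?e = "unit_vec R (0::nat)"
    have e: "?e \<in> carrier ?F" by (rule unit_vec_carrier[OF L(1)]) simp
    have "f x = x \<otimes>\<^bsub>R\<^esub> g ?e" if x: "x \<in> \<mm>" for x
    proof -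
      have xc: "x \<in> carrier R" using x L(5) by blast
      have v: "x \<odot>\<^bsub>?F\<^esub> ?e \<in> sing_sub R \<mm>"
        using module.smult_closed[OF free_mod_module[OF L(1)] xc e] x xc by (simp add: sing_sub_def unit_vec_def)
      have "f x = g (x \<odot>\<^bsub>?F\<^esub> ?e)" using g(2)[rule_format, OF v] xc by (simp add: unit_vec_def)
      then show ?thesis using mod_homD(3)[OF g(1) xc e] by simp
    qed
    moreover have "g ?e \<in> carrier R" using mod_homD(1)[OF g(1) e] by simp
    ultimately show ?thesis by (intro bexI[of _ "g ?e"]) auto
  qed
  have Ai: "ideal ?A R" by (rule R.cgenideal_ideal[OF a(1)])
  have Bi: "ideal ?B R" by (rule R.cgenideal_ideal[OF b(1)])
  let ?J = "sum_ideal R ?A b"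
  note J = sum_ideal[OF L(1) Ai b(1)] and P = sum_proj[OF L(1) Ai b(1,4)]
  have Jp: "primary_to R \<mm> ?J"
    by (rule primary_to_sum[OF L(1) primary_to_principal[OF L(1) a(1,3)] b(1)])
  have "sum_proj R ?A ?B \<in> mod_hom R (ideal_mod R ?J) (ring_module R)"
    by (rule mod_hom_extend_codomain[OF P(1)]) (use ideal.Icarr[OF Bi] in auto)
  from bspec[OF hom_extension_primary[OF assms(1,2) Jp ext] this] obtain c where
    c: "c \<in> carrier R" "\<forall>x\<in>?J. sum_proj R ?A ?B x = x \<otimes>\<^bsub>R\<^esub> c" by (rule bexE)
  have aA: "a \<in> ?A" and bB: "b \<in> ?B" by (rule R.cgenideal_self[OF a(1)], rule R.cgenideal_self[OF b(1)])
  have ac: "a \<otimes>\<^bsub>R\<^esub> c = \<zero>\<^bsub>R\<^esub>" using P(3)[OF aA] c(2) J(2) aA by (metis subsetD)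
  have bc: "b \<otimes>\<^bsub>R\<^esub> c = b" using P(2)[OF bB] c(2) J(3) by metis
  show False
  proof (cases "c \<in> \<mm>")
    case True
    then have "c \<in> colon R {\<zero>\<^bsub>R\<^esub>} b" using b(3) by simp
    then have "c \<otimes>\<^bsub>R\<^esub> b = \<zero>\<^bsub>R\<^esub>" by (simp add: colon_def)
    then show False using bc b(1,2) c(1) R.m_comm by metis
  next
    case False
    have u: "c \<in> Units R" by (rule local_unit[OF assms(1,2) c(1) False])
    have "a = a \<otimes>\<^bsub>R\<^esub> (c \<otimes>\<^bsub>R\<^esub> inv\<^bsub>R\<^esub> c)" using R.Units_r_inv[OF u] a(1) by simp
    also have "\<dots> = (a \<otimes>\<^bsub>R\<^esub> c) \<otimes>\<^bsub>R\<^esub> inv\<^bsub>R\<^esub> c" using R.m_assoc[OF a(1) c(1) R.Units_inv_closed[OF u]] by simp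
    also have "\<dots> = \<zero>\<^bsub>R\<^esub>" using ac R.Units_inv_closed[OF u] by simp
    finally show False using a(2) by simp
  qed
qed

subsection \<open>Parameters in one-dimensional local rings\<close>

lemma krull_dim_chain:
  assumes "primeideal P R" "primeideal Q R" "P \<subset> Q" shows "1 \<le> krull_dim R"
proof -
  have "enat 1 \<in> {enat n | n. \<exists>P. (\<forall>i\<le>n. primeideal (P i) R) \<and> (\<forall>i<n. P i \<subset> P (Suc i))}"
    by (rule CollectI, rule exI[of _ 1], rule conjI[OF refl], rule exI[of _ "\<lambda>i. if i = 0 then P else Q"])
      (use assms in auto)
  then have "enat 1 \<le> krull_dim R" unfolding krull_dim_def by (rule Sup_upper)
  then show ?thesis by (simp add: one_enat_def)
qed

lemma krull_dim_one:
  assumes "krull_dim R = 1"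
  shows "\<exists>P Q. primeideal P R \<and> primeideal Q R \<and> P \<subset> Q"
    and "primeideal P R \<Longrightarrow> primeideal Q R \<Longrightarrow> primeideal N R \<Longrightarrow> P \<subset> Q \<Longrightarrow> Q \<subset> N \<Longrightarrow> False"
proof -
  let ?A = "{enat n | n. \<exists>P. (\<forall>i\<le>n. primeideal (P i) R) \<and> (\<forall>i<n. P i \<subset> P (Suc i))}"
  show "\<exists>P Q. primeideal P R \<and> primeideal Q R \<and> P \<subset> Q"
  proof (rule ccontr)
    assume neg: "\<not> ?thesis"
    have "x \<le> 0" if x: "x \<in> ?A" for x
    proof -
      obtain n P where n: "x = enat n" "\<forall>i\<le>n. primeideal (P i) R" "\<forall>i<n. P i \<subset> P (Suc i)"
        using x by blast
      have "n = 0"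
      proof (rule ccontr)
        assume "n \<noteq> 0"
        then have "primeideal (P 0) R" "primeideal (P (Suc 0)) R" "P 0 \<subset> P (Suc 0)" using n by auto
        then show False using neg by blast
      qed
      then show ?thesis using n(1) by (simp add: zero_enat_def)
    qed
    then have "krull_dim R \<le> 0" unfolding krull_dim_def by (rule Sup_least)
    then show False using assms by simp
  qed
  assume h: "primeideal P R" "primeideal Q R" "primeideal N R" "P \<subset> Q" "Q \<subset> N"
  have "enat 2 \<in> ?A"
    by (rule CollectI, rule exI[of _ 2], rule conjI[OF refl], rule exI[of _ "\<lambda>i. if i = 0 then P else if i = 1 then Q else N"])
      (use h in \<open>auto simp: less_2_cases_iff\<close>)
  then have "enat 2 \<le> krull_dim R" unfolding krull_dim_def by (rule Sup_upper)
  then show False using assms by (simp add: one_enat_def)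
qed

lemma primeideal_power:
  assumes "primeideal P R" "x \<in> carrier R" "x [^]\<^bsub>R\<^esub> (k::nat) \<in> P"
  shows "x \<in> P"
proof -
  interpret primeideal P R by fact
  show ?thesis using assms(3)
  proof (induction k)
    case 0
    then have "\<one>\<^bsub>R\<^esub> \<in> P" by simp
    then show ?case using one_imp_carrier I_notcarr by blast
  next
    case (Suc k)
    then have "x [^]\<^bsub>R\<^esub> k \<otimes>\<^bsub>R\<^esub> x \<in> P" by simp
    then show ?case using I_prime[OF nat_pow_closed[OF assms(2)] assms(2)] Suc.IH by blast
  qed
qed

lemma local_primeideal_subset:
  assumes "local_ring R \<mm>" "noetherian_ring R" "primeideal P R" shows "P \<subseteq> \<mm>"
proof -
  interpret noetherian_ring R by fact
  interpret P: primeideal P R by fact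
  obtain J where "maximalideal J R" "P \<subseteq> J"
    by (rule ex_maximalideal[OF P.is_ideal P.I_notcarr[symmetric]]) (assumption | rule that)+
  then show ?thesis using assms(1) by (simp add: local_ring_def)
qed

text \<open>
  The parameter is an element \<open>a\<close> with $\mathrm{Ann}(a) = \mathrm{Ann}(a^2)$ and a maximal double
  annihilator. Adding a power of a non-nilpotent element of $\mathrm{Ann}(a)$ would enlarge the latter,
  so $\mathrm{Ann}(a)$ is nil and \<open>a\<close> avoids the minimal primes.
\<close>

lemma parameter_exists:
  assumes "local_ring R \<mm>" "noetherian_ring R" "krull_dim R = 1"
  obtains a where "a \<in> \<mm>" "a \<noteq> \<zero>\<^bsub>R\<^esub>" "\<And>Q. primeideal Q R \<Longrightarrow> a \<in> Q \<Longrightarrow> Q = \<mm>"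
    "nonzerodivisor R a \<or> (\<exists>b\<in>carrier R. b \<noteq> \<zero>\<^bsub>R\<^esub> \<and> colon R {\<zero>\<^bsub>R\<^esub>} b = \<mm> \<and>
       PIdl\<^bsub>R\<^esub> a \<inter> PIdl\<^bsub>R\<^esub> b = {\<zero>\<^bsub>R\<^esub>})"
proof -
  note L = local_ringD[OF assms(1)]
  interpret R: cring R by (rule L)
  interpret N: noetherian_ring R by fact
  interpret m: ideal \<mm> R by (rule L)
  have mc: "x \<in> carrier R" if "x \<in> \<mm>" for x using that L(5) by blast
  define ann where "ann x = colon R {\<zero>\<^bsub>R\<^esub>} x" for x
  have ann: "s \<in> ann x \<longleftrightarrow> s \<in> carrier R \<and> s \<otimes>\<^bsub>R\<^esub> x = \<zero>\<^bsub>R\<^esub>" for s x by (simp add: ann_def colon_def)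
  have ann_ideal: "ideal (ann x) R" if "x \<in> carrier R" for x
    unfolding ann_def by (rule R.colon_ideal[OF R.zeroideal that])
  \<comment> \<open>The double annihilator. It grows as \<open>ann x\<close> shrinks, so a maximal
    double annihilator stands in for a minimal annihilator, which the ascending chain condition
    would not provide.\<close>
  define bi where "bi x = {t \<in> carrier R. \<forall>s\<in>ann x. t \<otimes>\<^bsub>R\<^esub> s = \<zero>\<^bsub>R\<^esub>}" for x
  have annc: "s \<in> carrier R" if "s \<in> ann x" for s x using that ann by blast
  have bi_ideal: "ideal (bi x) R" for x
    by (rule R.idealI') (use annc in \<open>auto simp: bi_def R.l_distr R.m_assoc\<close>)
  have unit0: "x = \<zero>\<^bsub>R\<^esub>" if "u \<in> carrier R" "u \<notin> \<mm>" "x \<in> carrier R" "u \<otimes>\<^bsub>R\<^esub> x = \<zero>\<^bsub>R\<^esub>" for u x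
  proof -
    have u: "u \<in> Units R" by (rule local_unit[OF assms(1,2) that(1,2)])
    have "x = (inv\<^bsub>R\<^esub> u \<otimes>\<^bsub>R\<^esub> u) \<otimes>\<^bsub>R\<^esub> x" using R.Units_l_inv[OF u] that(3) by simp
    also have "\<dots> = inv\<^bsub>R\<^esub> u \<otimes>\<^bsub>R\<^esub> (u \<otimes>\<^bsub>R\<^esub> x)" by (rule R.m_assoc[OF R.Units_inv_closed[OF u] that(1,3)])
    finally show ?thesis using that(4) R.Units_inv_closed[OF u] by simp
  qed
  \<comment> \<open>The annihilators of the powers of y ascend; at a maximal one, doubling the
    exponent changes nothing. Positivity of k keeps the power in \<mm> when y lies there.\<close>
  have stable: "\<exists>k::nat. 0 < k \<and> ann (y [^]\<^bsub>R\<^esub> k) = ann (y [^]\<^bsub>R\<^esub> k \<otimes>\<^bsub>R\<^esub> y [^]\<^bsub>R\<^esub> k)"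
    if y: "y \<in> carrier R" for y
  proof -
    let ?A = "{ann (y [^]\<^bsub>R\<^esub> k) | k::nat. 0 < k}"
    have "\<exists>J\<in>?A. \<forall>K\<in>?A. J \<subseteq> K \<longrightarrow> K = J"
      by (rule N.ideal_maximal) (use ann_ideal y in auto)
    then obtain k :: nat where k: "0 < k" "\<forall>K\<in>?A. ann (y [^]\<^bsub>R\<^esub> k) \<subseteq> K \<longrightarrow> K = ann (y [^]\<^bsub>R\<^esub> k)" by auto
    have yk: "y [^]\<^bsub>R\<^esub> k \<in> carrier R" using y by simp
    have e: "y [^]\<^bsub>R\<^esub> (k + k) = y [^]\<^bsub>R\<^esub> k \<otimes>\<^bsub>R\<^esub> y [^]\<^bsub>R\<^esub> k" using R.nat_pow_mult[OF y, of k k] by simp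
    have sub: "ann (y [^]\<^bsub>R\<^esub> k) \<subseteq> ann (y [^]\<^bsub>R\<^esub> (k + k))"
    proof
      fix s assume "s \<in> ann (y [^]\<^bsub>R\<^esub> k)"
      then have s: "s \<in> carrier R" "s \<otimes>\<^bsub>R\<^esub> y [^]\<^bsub>R\<^esub> k = \<zero>\<^bsub>R\<^esub>" by (simp_all add: ann)
      then have "s \<otimes>\<^bsub>R\<^esub> (y [^]\<^bsub>R\<^esub> k \<otimes>\<^bsub>R\<^esub> y [^]\<^bsub>R\<^esub> k) = \<zero>\<^bsub>R\<^esub>" using yk by (simp flip: R.m_assoc)
      then show "s \<in> ann (y [^]\<^bsub>R\<^esub> (k + k))" using s(1) by (simp add: ann e)
    qed
    have "ann (y [^]\<^bsub>R\<^esub> (k + k)) \<in> ?A" using k(1) by force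
    then have "ann (y [^]\<^bsub>R\<^esub> (k + k)) = ann (y [^]\<^bsub>R\<^esub> k)" using k(2) sub by blast
    then show ?thesis using k(1) e by (intro exI[of _ k]) simp
  qed
  let ?A = "{bi a | a. a \<in> \<mm> \<and> ann a = ann (a \<otimes>\<^bsub>R\<^esub> a)}"
  have "bi \<zero>\<^bsub>R\<^esub> \<in> ?A" by (rule CollectI, rule exI[of _ "\<zero>\<^bsub>R\<^esub>"]) simp
  then have ne: "?A \<noteq> {}" by blast
  have "\<exists>J\<in>?A. \<forall>K\<in>?A. J \<subseteq> K \<longrightarrow> K = J"
    by (rule N.ideal_maximal[OF ne]) (use bi_ideal in auto)
  then obtain a where a: "a \<in> \<mm>" "ann a = ann (a \<otimes>\<^bsub>R\<^esub> a)" and amax: "\<forall>K\<in>?A. bi a \<subseteq> K \<longrightarrow> K = bi a" by auto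
  have ac: "a \<in> carrier R" by (rule mc[OF a(1)])
  have red: "s \<otimes>\<^bsub>R\<^esub> a = \<zero>\<^bsub>R\<^esub>" if "s \<in> carrier R" "(s \<otimes>\<^bsub>R\<^esub> a) \<otimes>\<^bsub>R\<^esub> a = \<zero>\<^bsub>R\<^esub>" for s
  proof -
    have "s \<in> ann (a \<otimes>\<^bsub>R\<^esub> a)" using that ac by (simp add: ann R.m_assoc)
    then have "s \<in> ann a" using a(2) by simp
    then show ?thesis by (simp add: ann)
  qed
  have nil: "\<exists>k::nat. y [^]\<^bsub>R\<^esub> k = \<zero>\<^bsub>R\<^esub>" if y: "y \<in> \<mm>" "y \<otimes>\<^bsub>R\<^esub> a = \<zero>\<^bsub>R\<^esub>" for y
  proof (rule ccontr)
    assume nn: "\<not> ?thesis"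
    have yc: "y \<in> carrier R" by (rule mc[OF y(1)])
    obtain k :: nat where k: "0 < k" "ann (y [^]\<^bsub>R\<^esub> k) = ann (y [^]\<^bsub>R\<^esub> k \<otimes>\<^bsub>R\<^esub> y [^]\<^bsub>R\<^esub> k)"
      using stable[OF yc] by (elim exE conjE) (rule that)
    define z where "z = y [^]\<^bsub>R\<^esub> k"
    obtain l where l: "k = Suc l" using k(1) by (cases k) auto
    have zl: "z = y [^]\<^bsub>R\<^esub> l \<otimes>\<^bsub>R\<^esub> y" unfolding z_def l by simp
    have zm: "z \<in> \<mm>" unfolding zl by (rule m.I_l_closed[OF y(1)]) (use yc in simp)
    have zc: "z \<in> carrier R" by (rule mc[OF zm])
    have za: "z \<otimes>\<^bsub>R\<^esub> a = \<zero>\<^bsub>R\<^esub>" unfolding zl using y(2) yc ac by (simp add: R.m_assoc)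
    have zz: "z \<otimes>\<^bsub>R\<^esub> z \<noteq> \<zero>\<^bsub>R\<^esub>"
      using nn R.nat_pow_mult[OF yc, of k k] unfolding z_def by metis
    have annz: "ann z = ann (z \<otimes>\<^bsub>R\<^esub> z)" unfolding z_def by (rule k(2))
    let ?a = "a \<oplus>\<^bsub>R\<^esub> z"
    \<comment> \<open>Since za = 0, the square of a + z is a^2 + z^2. Multiplying s(a + z)^2 = 0 by
      a leaves s a^3 = 0, hence sa = 0 by \<open>red\<close>; what remains is s z^2 = 0, and the
      choice of the power z gives sz = 0.\<close>
    have split: "s \<otimes>\<^bsub>R\<^esub> a = \<zero>\<^bsub>R\<^esub> \<and> s \<otimes>\<^bsub>R\<^esub> z = \<zero>\<^bsub>R\<^esub>" if s: "s \<in> carrier R" and h: "s \<otimes>\<^bsub>R\<^esub> (?a \<otimes>\<^bsub>R\<^esub> ?a) = \<zero>\<^bsub>R\<^esub>" for s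
    proof -
      have "((s \<otimes>\<^bsub>R\<^esub> a) \<otimes>\<^bsub>R\<^esub> a) \<otimes>\<^bsub>R\<^esub> a =
          a \<otimes>\<^bsub>R\<^esub> (s \<otimes>\<^bsub>R\<^esub> (?a \<otimes>\<^bsub>R\<^esub> ?a)) \<ominus>\<^bsub>R\<^esub> (z \<otimes>\<^bsub>R\<^esub> a) \<otimes>\<^bsub>R\<^esub> (s \<otimes>\<^bsub>R\<^esub> (a \<oplus>\<^bsub>R\<^esub> a \<oplus>\<^bsub>R\<^esub> z))"
        using s ac zc by algebra
      also have "\<dots> = \<zero>\<^bsub>R\<^esub>" using h za s ac zc by (simp add: a_minus_def)
      finally have 1: "((s \<otimes>\<^bsub>R\<^esub> a) \<otimes>\<^bsub>R\<^esub> a) \<otimes>\<^bsub>R\<^esub> a = \<zero>\<^bsub>R\<^esub>" .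
      have sa: "s \<otimes>\<^bsub>R\<^esub> a = \<zero>\<^bsub>R\<^esub>" using red[of s] red[of "s \<otimes>\<^bsub>R\<^esub> a"] 1 s ac by simp
      have "s \<otimes>\<^bsub>R\<^esub> (z \<otimes>\<^bsub>R\<^esub> z) = s \<otimes>\<^bsub>R\<^esub> (?a \<otimes>\<^bsub>R\<^esub> ?a) \<ominus>\<^bsub>R\<^esub> (s \<otimes>\<^bsub>R\<^esub> a) \<otimes>\<^bsub>R\<^esub> (a \<oplus>\<^bsub>R\<^esub> z \<oplus>\<^bsub>R\<^esub> z)"
        using s ac zc by algebra
      also have "\<dots> = \<zero>\<^bsub>R\<^esub>" using h sa s ac zc by (simp add: a_minus_def)
      finally have "s \<in> ann (z \<otimes>\<^bsub>R\<^esub> z)" using s by (simp add: ann)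
      then have "s \<in> ann z" using annz by simp
      then show ?thesis using sa by (simp add: ann)
    qed
    have mem: "s \<in> ann (?a \<otimes>\<^bsub>R\<^esub> ?a)" if "s \<in> ann ?a" for s
    proof -
      have s: "s \<in> carrier R" "s \<otimes>\<^bsub>R\<^esub> ?a = \<zero>\<^bsub>R\<^esub>" using that by (simp_all add: ann)
      then have "(s \<otimes>\<^bsub>R\<^esub> ?a) \<otimes>\<^bsub>R\<^esub> ?a = \<zero>\<^bsub>R\<^esub>" using ac zc by simp
      then show ?thesis using s(1) ac zc by (simp add: ann R.m_assoc)
    qed
    have both: "s \<otimes>\<^bsub>R\<^esub> a = \<zero>\<^bsub>R\<^esub> \<and> s \<otimes>\<^bsub>R\<^esub> z = \<zero>\<^bsub>R\<^esub>" if "s \<in> ann (?a \<otimes>\<^bsub>R\<^esub> ?a)" for s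
      using split[of s] that by (simp add: ann)
    have "ann (?a \<otimes>\<^bsub>R\<^esub> ?a) \<subseteq> ann ?a"
    proof
      fix s assume s: "s \<in> ann (?a \<otimes>\<^bsub>R\<^esub> ?a)"
      then show "s \<in> ann ?a" using both[OF s] annc[OF s] ac zc by (simp add: ann R.r_distr)
    qed
    then have annA: "ann ?a = ann (?a \<otimes>\<^bsub>R\<^esub> ?a)" using mem by blast
    have "bi ?a \<in> ?A" using annA m.a_closed[OF a(1) zm] by blast
    moreover have "bi a \<subseteq> bi ?a"
    proof
      fix t assume t: "t \<in> bi a"
      have "t \<otimes>\<^bsub>R\<^esub> s = \<zero>\<^bsub>R\<^esub>" if "s \<in> ann ?a" for s
      proof -
        have "s \<in> ann a" using both[OF mem[OF that]] annc[OF that] by (simp add: ann)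
        then show ?thesis using t by (simp add: bi_def)
      qed
      then show "t \<in> bi ?a" using t by (simp add: bi_def)
    qed
    ultimately have e: "bi ?a = bi a" using amax by blast
    \<comment> \<open>So z lies in the double annihilator of a + z, which by maximality is that of
      a. But z also annihilates a, so z^2 = 0, contrary to the choice of y.\<close>
    have "z \<otimes>\<^bsub>R\<^esub> s = \<zero>\<^bsub>R\<^esub>" if "s \<in> ann ?a" for s
      using both[OF mem[OF that]] annc[OF that] zc R.m_comm[of z s] by simp
    then have "z \<in> bi ?a" using zc by (simp add: bi_def)
    then have "z \<in> bi a" using e by simp
    moreover have "z \<in> ann a" using za zc by (simp add: ann)
    ultimately show False using zz by (simp add: bi_def)
  qed
  obtain P0 P1 where P: "primeideal P0 R" "primeideal P1 R" "P0 \<subset> P1"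
    using krull_dim_one(1)[OF assms(3)] by (elim exE conjE) (rule that)
  obtain y where y: "y \<in> P1" "y \<notin> P0" using P(3) by blast
  have ym: "y \<in> \<mm>" using y(1) local_primeideal_subset[OF assms(1,2) P(2)] by blast
  interpret P0: primeideal P0 R by (rule P)
  \<comment> \<open>With a = 0, the statement \<open>nil\<close> would make every element of \<mm>
    nilpotent, including one outside the prime P0.\<close>
  have a0: "a \<noteq> \<zero>\<^bsub>R\<^esub>"
  proof
    assume "a = \<zero>\<^bsub>R\<^esub>"
    then obtain k :: nat where "y [^]\<^bsub>R\<^esub> k = \<zero>\<^bsub>R\<^esub>" using nil[OF ym] mc[OF ym] by auto
    then have "y [^]\<^bsub>R\<^esub> k \<in> P0" using P0.zero_closed by simp
    then show False using primeideal_power[OF P(1) mc[OF ym]] y(2) by blast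
  qed
  have param: "Q = \<mm>" if Q: "primeideal Q R" "a \<in> Q" for Q
  proof (rule ccontr)
    assume neq: "Q \<noteq> \<mm>"
    have QM: "Q \<subset> \<mm>" using local_primeideal_subset[OF assms(1,2) Q(1)] neq by blast
    interpret Q: primeideal Q R by (rule Q(1))
    \<comment> \<open>The multiplicative set generated by a and the complement of Q. If it misses 0,
      a prime avoiding it lies strictly below Q, and with Q below \<mm> this is a chain of length
      two. Otherwise some z outside Q satisfies z a^l = 0, hence za = 0 by \<open>red\<close>, and
      \<open>nil\<close> puts z into Q.\<close>
    let ?S = "{z \<otimes>\<^bsub>R\<^esub> a [^]\<^bsub>R\<^esub> (l::nat) | z l. z \<in> carrier R \<and> z \<notin> Q}"
    have Sm: "z \<in> ?S" if "z \<in> carrier R" "z \<notin> Q" for z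
      by (rule CollectI, rule exI[of _ z], rule exI[of _ 0]) (use that in simp)
    have oneQ: "\<one>\<^bsub>R\<^esub> \<notin> Q" using Q.one_imp_carrier Q.I_notcarr by blast
    have "\<zero>\<^bsub>R\<^esub> \<in> ?S"
    proof (rule ccontr)
      assume n0: "\<zero>\<^bsub>R\<^esub> \<notin> ?S"
      have cl: "s \<otimes>\<^bsub>R\<^esub> t \<in> ?S" if st: "s \<in> ?S" "t \<in> ?S" for s t
      proof -
        obtain z and l :: nat where s: "s = z \<otimes>\<^bsub>R\<^esub> a [^]\<^bsub>R\<^esub> l" "z \<in> carrier R" "z \<notin> Q" using st(1) by auto
        obtain w and k :: nat where t: "t = w \<otimes>\<^bsub>R\<^esub> a [^]\<^bsub>R\<^esub> k" "w \<in> carrier R" "w \<notin> Q" using st(2) by auto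
        have "s \<otimes>\<^bsub>R\<^esub> t = (z \<otimes>\<^bsub>R\<^esub> w) \<otimes>\<^bsub>R\<^esub> (a [^]\<^bsub>R\<^esub> l \<otimes>\<^bsub>R\<^esub> a [^]\<^bsub>R\<^esub> k)"
          using s t ac by (simp add: R.m_ac)
        also have "a [^]\<^bsub>R\<^esub> l \<otimes>\<^bsub>R\<^esub> a [^]\<^bsub>R\<^esub> k = a [^]\<^bsub>R\<^esub> (l + k)" by (rule R.nat_pow_mult[OF ac])
        finally have "s \<otimes>\<^bsub>R\<^esub> t = (z \<otimes>\<^bsub>R\<^esub> w) \<otimes>\<^bsub>R\<^esub> a [^]\<^bsub>R\<^esub> (l + k)" .
        moreover have "z \<otimes>\<^bsub>R\<^esub> w \<notin> Q" using Q.I_prime[OF s(2) t(2)] s(3) t(3) by blast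
        ultimately show ?thesis using R.m_closed[OF s(2) t(2)] by blast
      qed
      have sub: "?S \<subseteq> carrier R" using ac by auto
      have dis: "{\<zero>\<^bsub>R\<^esub>} \<inter> ?S = {}" using n0 by blast
      obtain Q' where Q': "primeideal Q' R" "{\<zero>\<^bsub>R\<^esub>} \<subseteq> Q'" "Q' \<inter> ?S = {}"
        by (rule prime_avoiding[OF L(1) assms(2) R.zeroideal sub Sm[OF R.one_closed oneQ] cl dis]) (assumption | rule that)+
      interpret Q': primeideal Q' R by (rule Q'(1))
      have "Q' \<subseteq> Q" using Q'(3) Sm Q'.Icarr by blast
      moreover have "a \<notin> Q'"
      proof
        assume "a \<in> Q'"
        moreover have "a \<in> ?S"
          by (rule CollectI, rule exI[of _ "\<one>\<^bsub>R\<^esub>"], rule exI[of _ 1]) (use ac oneQ in simp)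
        ultimately show False using Q'(3) by blast
      qed
      ultimately have "Q' \<subset> Q" using Q(2) by blast
      then show False by (rule krull_dim_one(2)[OF assms(3) Q'(1) Q(1) L(3) _ QM])
    qed
    then obtain z and l :: nat where z: "z \<otimes>\<^bsub>R\<^esub> a [^]\<^bsub>R\<^esub> l = \<zero>\<^bsub>R\<^esub>" "z \<in> carrier R" "z \<notin> Q" by auto
    have "z \<otimes>\<^bsub>R\<^esub> a = \<zero>\<^bsub>R\<^esub>" using z(1)
    proof (induction l)
      case 0
      then show ?case using z(2) ac by simp
    next
      case (Suc l)
      show ?case
      proof (cases l)
        case 0
        then show ?thesis using Suc.prems z(2) ac by simp
      next
        case (Suc j)
        have c: "z \<otimes>\<^bsub>R\<^esub> a [^]\<^bsub>R\<^esub> j \<in> carrier R" using z(2) ac by simp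
        have "((z \<otimes>\<^bsub>R\<^esub> a [^]\<^bsub>R\<^esub> j) \<otimes>\<^bsub>R\<^esub> a) \<otimes>\<^bsub>R\<^esub> a = \<zero>\<^bsub>R\<^esub>"
          using Suc.prems Suc z(2) ac by (simp add: R.m_assoc)
        then have "(z \<otimes>\<^bsub>R\<^esub> a [^]\<^bsub>R\<^esub> j) \<otimes>\<^bsub>R\<^esub> a = \<zero>\<^bsub>R\<^esub>" by (rule red[OF c])
        then show ?thesis using Suc.IH Suc z(2) ac by (simp add: R.m_assoc)
      qed
    qed
    moreover from this have "z \<in> \<mm>" using unit0[OF z(2) _ ac] a0 by blast
    ultimately obtain k :: nat where "z [^]\<^bsub>R\<^esub> k = \<zero>\<^bsub>R\<^esub>" using nil by blast
    then have "z [^]\<^bsub>R\<^esub> k \<in> Q" using Q.zero_closed by simp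
    then show False using primeideal_power[OF Q(1) z(2)] z(3) by blast
  qed
  have disj: "nonzerodivisor R a \<or> (\<exists>b\<in>carrier R. b \<noteq> \<zero>\<^bsub>R\<^esub> \<and> colon R {\<zero>\<^bsub>R\<^esub>} b = \<mm> \<and>
       PIdl\<^bsub>R\<^esub> a \<inter> PIdl\<^bsub>R\<^esub> b = {\<zero>\<^bsub>R\<^esub>})"
  proof (cases "nonzerodivisor R a")
    case False
    \<comment> \<open>With ay = 0, a multiple b = wy has annihilator \<mm>, because the prime
      obtained from \<open>colon_prime\<close> contains a. An element ra of Rb is killed by a, so ra
      = 0 by \<open>red\<close>; hence Ra and Rb meet in zero.\<close>
    then obtain y where y: "y \<in> carrier R" "y \<noteq> \<zero>\<^bsub>R\<^esub>" "a \<otimes>\<^bsub>R\<^esub> y = \<zero>\<^bsub>R\<^esub>" using ac unfolding nonzerodivisor_def by blast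
    have I: "ideal (ann y) R" by (rule ann_ideal[OF y(1)])
    have Im: "ann y \<subseteq> \<mm>" using unit0[OF _ _ y(1)] y(2) ann by blast
    obtain w where w: "w \<in> carrier R" "primeideal (colon R (ann y) w) R" "colon R (ann y) w \<subseteq> \<mm>"
      by (rule colon_prime[OF L(1) assms(2) I L(3) Im]) (assumption | rule that)+
    have "a \<in> ann y" using y(3) ac by (simp add: ann)
    then have "colon R (ann y) w = \<mm>" using param[OF w(2)] R.ideal_subset_colon[OF I w(1)] by blast
    moreover have "colon R (ann y) w = colon R {\<zero>\<^bsub>R\<^esub>} (w \<otimes>\<^bsub>R\<^esub> y)"
      using w(1) y(1) by (auto simp: colon_def ann_def R.m_assoc)
    ultimately have cb: "colon R {\<zero>\<^bsub>R\<^esub>} (w \<otimes>\<^bsub>R\<^esub> y) = \<mm>" by simp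
    have b: "w \<otimes>\<^bsub>R\<^esub> y \<in> carrier R" using w(1) y(1) by simp
    have b0: "w \<otimes>\<^bsub>R\<^esub> y \<noteq> \<zero>\<^bsub>R\<^esub>"
    proof
      assume "w \<otimes>\<^bsub>R\<^esub> y = \<zero>\<^bsub>R\<^esub>"
      then have "\<one>\<^bsub>R\<^esub> \<in> colon R {\<zero>\<^bsub>R\<^esub>} (w \<otimes>\<^bsub>R\<^esub> y)" by (simp add: colon_def)
      then show False using cb L(6) by simp
    qed
    have "x = \<zero>\<^bsub>R\<^esub>" if xa: "x \<in> PIdl\<^bsub>R\<^esub> a" and xb: "x \<in> PIdl\<^bsub>R\<^esub> (w \<otimes>\<^bsub>R\<^esub> y)" for x
    proof -
      obtain r where r: "r \<in> carrier R" "x = r \<otimes>\<^bsub>R\<^esub> a" using xa by (auto simp: cgenideal_def)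
      obtain s where s: "s \<in> carrier R" "x = s \<otimes>\<^bsub>R\<^esub> (w \<otimes>\<^bsub>R\<^esub> y)" using xb by (auto simp: cgenideal_def)
      have "x \<otimes>\<^bsub>R\<^esub> a = s \<otimes>\<^bsub>R\<^esub> w \<otimes>\<^bsub>R\<^esub> (a \<otimes>\<^bsub>R\<^esub> y)" using s w(1) y(1) ac by (simp add: R.m_ac)
      also have "\<dots> = \<zero>\<^bsub>R\<^esub>" using y(3) s(1) w(1) by simp
      finally show ?thesis using red[OF r(1)] r(2) by simp
    qed
    moreover have "\<zero>\<^bsub>R\<^esub> \<in> PIdl\<^bsub>R\<^esub> a" "\<zero>\<^bsub>R\<^esub> \<in> PIdl\<^bsub>R\<^esub> (w \<otimes>\<^bsub>R\<^esub> y)"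
      using additive_subgroup.zero_closed[OF ideal.axioms(1)] R.cgenideal_ideal ac b by blast+
    ultimately have "PIdl\<^bsub>R\<^esub> a \<inter> PIdl\<^bsub>R\<^esub> (w \<otimes>\<^bsub>R\<^esub> y) = {\<zero>\<^bsub>R\<^esub>}" by blast
    then show ?thesis using b b0 cb by blast
  qed simp
  show ?thesis by (rule that[OF a(1) a0 _ disj]) (rule param)
qed

subsection \<open>Resolutions\<close>

text \<open>Cohomology read as an extension property: h after \<open>d j\<close> is a cocycle, and a
  map g whose coboundary it is agrees with h on the image of \<open>d j\<close>.\<close>

lemma trivial_Ext_group:
  assumes "module R N" "free_resolution R M I d e" "trivial_group (Ext_group R I d N (Suc j))"
    and "h \<in> mod_hom R (free_mod R (I j)\<lparr>carrier := d j ` carrier (free_mod R (I (Suc j)))\<rparr>) N"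
  shows "\<exists>g\<in>mod_hom R (free_mod R (I j)) N. \<forall>v\<in>d j ` carrier (free_mod R (I (Suc j))). g v = h v"
proof -
  interpret N: module R N by fact
  let ?F = "\<lambda>n. free_mod R (I n)"
  have F: "module R (?F n)" for n by (rule free_mod_module[OF N.is_cring])
  have d: "d n \<in> mod_hom R (?F (Suc n)) (?F n)" for n
    using assms(2) unfolding free_resolution_def by (simp add: Let_def)
  have dd: "d (Suc n) ` carrier (?F (Suc (Suc n))) = {x \<in> carrier (?F (Suc n)). d n x = \<zero>\<^bsub>?F n\<^esub>}" for n
    using assms(2) unfolding free_resolution_def by (simp add: Let_def)
  let ?C = "carrier (?F (Suc j))" and ?K = "d j ` carrier (?F (Suc j))"
  have K: "submodule ?K R (?F j)"
    by (rule submodule_image[OF F F d module.carrier_is_submodule[OF F]])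
  have dK: "d j \<in> mod_hom R (?F (Suc j)) (?F j\<lparr>carrier := ?K\<rparr>)"
    by (rule mod_hom_restrict_codomain[OF d order_refl])
  define f where "f = restrict (\<lambda>x. h (d j x)) ?C"
  have hd: "(\<lambda>x. h (d j x)) \<in> mod_hom R (?F (Suc j)) N" by (rule mod_hom_comp[OF dK assms(4)])
  have "f \<in> mod_hom R (?F (Suc j)) N" by (rule mod_hom_cong[OF F hd]) (simp add: f_def)
  then have fc: "f \<in> carrier (hom_module R (?F (Suc j)) N)" by (simp add: hom_module_def f_def)
  have "f (d (Suc j) x) = \<zero>\<^bsub>N\<^esub>" if x: "x \<in> carrier (?F (Suc (Suc j)))" for x
  proof -
    have "d (Suc j) x \<in> d (Suc j) ` carrier (?F (Suc (Suc j)))" using x by blast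
    then have "d (Suc j) x \<in> ?C" "d j (d (Suc j) x) = \<zero>\<^bsub>?F j\<lparr>carrier := ?K\<rparr>\<^esub>" using dd by auto
    then show ?thesis
      using mod_hom_zero[OF submodule_module[OF F K] assms(1,4)] by (simp add: f_def)
  qed
  then have coc: "f \<in> Ext_cocycles R I d N (Suc j)" using fc by (simp add: Ext_cocycles_def)
  let ?H = "Ext_coboundaries R I d N (Suc j)"
  let ?G = "hom_module R (?F (Suc j)) N\<lparr>carrier := Ext_cocycles R I d N (Suc j)\<rparr>"
  let ?z = "\<lambda>x\<in>?C. \<zero>\<^bsub>N\<^esub>"
  let ?z' = "\<lambda>x\<in>carrier (?F j). \<zero>\<^bsub>N\<^esub>"
  have "?z' \<in> mod_hom R (?F j) N" by (rule mod_hom_cong[OF F mod_hom_zero_fun[OF assms(1)]]) simp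
  then have "?z' \<in> carrier (hom_module R (?F j) N)" by (simp add: hom_module_def)
  then have "compose ?C ?z' (d j) \<in> ?H" unfolding Ext_coboundaries.simps by (rule imageI)
  moreover have "compose ?C ?z' (d j) x = ?z x" for x
    using mod_homD(1)[OF d, of x] by (cases "x \<in> ?C") (simp_all add: compose_def)
  then have "compose ?C ?z' (d j) = ?z" by (rule ext)
  ultimately have zH: "?z \<in> ?H" by simp
  have "(?z \<oplus>\<^bsub>?G\<^esub> f) x = f x" for x
    using mod_homD(1)[OF hd, of x] by (cases "x \<in> ?C") (simp_all add: hom_module_def f_def)
  then have "?z \<oplus>\<^bsub>?G\<^esub> f = f" by (rule ext)
  \<comment> \<open>Since 0 is a coboundary, f lies in its own coset, and in a trivial quotient
    group that coset is the group of coboundaries.\<close>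
  then have fin: "f \<in> r_coset (add_monoid ?G) ?H f"
    unfolding r_coset_def by (intro UN_I[OF zH]) simp
  have "r_coset (add_monoid ?G) ?H f \<in> carrier (Ext_group R I d N (Suc j))"
    using coc by (auto simp: Ext_group_def A_FactGroup_def FactGroup_def RCOSETS_def)
  then have "r_coset (add_monoid ?G) ?H f = ?H"
    using assms(3) by (simp add: trivial_group_def Ext_group_def A_FactGroup_def FactGroup_def)
  then have "f \<in> ?H" using fin by simp
  then obtain g where g: "g \<in> carrier (hom_module R (?F j) N)" "f = compose ?C g (d j)" by auto
  have "g v = h v" if vK: "v \<in> ?K" for v
  proof -
    obtain x where x: "x \<in> ?C" "v = d j x" using vK by blast
    have "f x = h (d j x)" using x by (simp add: f_def)
    moreover have "f x = g (d j x)" using g(2) x by (simp add: compose_def)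
    ultimately show ?thesis using x by simp
  qed
  moreover have "g \<in> mod_hom R (?F j) N" using g(1) by (simp add: hom_module_def)
  ultimately show ?thesis by blast
qed

section \<open>The residue field and its Ext groups\<close>

lemma quotient_module_simps [simp]:
  "carrier (quotient_module R I) = carrier (R Quot I)" "\<zero>\<^bsub>quotient_module R I\<^esub> = \<zero>\<^bsub>R Quot I\<^esub>"
  "x \<oplus>\<^bsub>quotient_module R I\<^esub> y = x \<oplus>\<^bsub>R Quot I\<^esub> y"
  "r \<odot>\<^bsub>quotient_module R I\<^esub> x = (I +>\<^bsub>R\<^esub> r) \<otimes>\<^bsub>R Quot I\<^esub> x"
  by (simp_all add: quotient_module_def)

lemma quotient_module_module:
  assumes "cring R" "ideal I R" shows "module R (quotient_module R I)"
proof -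
  interpret R: cring R by fact
  interpret I: ideal I R by fact
  interpret Q: cring "R Quot I" by (rule I.quotient_is_cring[OF assms(1)])
  note h = I.rcos_ring_hom
  have hc: "I +>\<^bsub>R\<^esub> r \<in> carrier (R Quot I)" if "r \<in> carrier R" for r by (rule ring_hom_closed[OF h that])
  show ?thesis
  proof (rule moduleI[OF assms(1)])
    show "abelian_group (quotient_module R I)"
    proof (rule abelian_groupI)
      fix x assume "x \<in> carrier (quotient_module R I)"
      then show "\<exists>y\<in>carrier (quotient_module R I). y \<oplus>\<^bsub>quotient_module R I\<^esub> x = \<zero>\<^bsub>quotient_module R I\<^esub>"
        by (intro bexI[of _ "\<ominus>\<^bsub>R Quot I\<^esub> x"]) (simp_all add: Q.l_neg)
    qed (simp_all add: Q.a_ac)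
  qed (simp_all add: hc Q.l_distr Q.r_distr Q.m_assoc ring_hom_add[OF h] ring_hom_mult[OF h] ring_hom_one[OF h])
qed

lemma quotient_module_cover:
  assumes "cring R" "ideal I R"
  shows "cover R {0::nat} (\<lambda>v. I +>\<^bsub>R\<^esub> v 0) (quotient_module R I)"
    and "hom_ker (free_mod R {0::nat}) (quotient_module R I) (\<lambda>v. I +>\<^bsub>R\<^esub> v 0) = sing_sub R I"
proof -
  interpret R: cring R by fact
  interpret I: ideal I R by fact
  note h = I.rcos_ring_hom
  have c: "v i \<in> carrier R" if "v \<in> carrier (free_mod R {0::nat})" for v i using that by (simp add: free_mod_carrier)
  have hom: "(\<lambda>v. I +>\<^bsub>R\<^esub> v 0) \<in> mod_hom R (free_mod R {0::nat}) (quotient_module R I)"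
    by (rule mod_homI) (simp_all add: c ring_hom_closed[OF h] ring_hom_add[OF h] ring_hom_mult[OF h])
  show "cover R {0::nat} (\<lambda>v. I +>\<^bsub>R\<^esub> v 0) (quotient_module R I)"
    unfolding cover_def
  proof (intro conjI hom subset_antisym subsetI)
    fix x assume "x \<in> carrier (quotient_module R I)"
    then obtain r where r: "r \<in> carrier R" "x = I +>\<^bsub>R\<^esub> r" by (auto simp: FactRing_def A_RCOSETS_def')
    then show "x \<in> (\<lambda>v. I +>\<^bsub>R\<^esub> v 0) ` carrier (free_mod R {0::nat})"
      by (intro image_eqI[OF _ sing_free_mod_mem[OF assms(1) r(1)]]) simp
  next
    show "x \<in> carrier (quotient_module R I)" if "x \<in> (\<lambda>v. I +>\<^bsub>R\<^esub> v 0) ` carrier (free_mod R {0::nat})" for x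
      using that mod_homD(1)[OF hom] by blast
  qed
  have "I +>\<^bsub>R\<^esub> r = \<zero>\<^bsub>R Quot I\<^esub> \<longleftrightarrow> r \<in> I" if "r \<in> carrier R" for r
    using I.rcos_const_imp_mem[OF that] I.a_rcos_const by (auto simp: FactRing_def)
  then show "hom_ker (free_mod R {0::nat}) (quotient_module R I) (\<lambda>v. I +>\<^bsub>R\<^esub> v 0) = sing_sub R I"
    using c by (auto simp: hom_ker_def sing_sub_def)
qed

text \<open>For i at least 2 one has Ext^i(R/\<mm>, R) = Ext^(i-1)(\<mm>, R), and the bound on the
  dimension forces i \<ge> 2; with the shift by one in \<open>ext_van_mod\<close> this is n = i - 2.
  The vanishing is read off far out in the given resolution, carried back to its start, and
  transferred to the cover of R/\<mm> by R.\<close>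

lemma gorenstein_ext_van:
  assumes "gorenstein_local_ring R \<mm>" "1 \<le> krull_dim R"
  shows "\<exists>n. ext_van_mod n R (ideal_mod R \<mm>)"
proof -
  have loc: "local_ring R \<mm>" and noeth: "noetherian_ring R" using assms(1) by (auto simp: gorenstein_local_ring_def)
  note L = local_ringD[OF loc]
  obtain i where i: "krull_dim R < enat i" "Ext_vanishes R i (quotient_module R \<mm>) (ring_module R)"
    using assms(1) unfolding gorenstein_local_ring_def by blast
  have "enat 1 < enat i" using le_less_trans[OF assms(2) i(1)] by (simp add: one_enat_def)
  then have "1 < i" by simp
  define n where "n = i - 2"
  have n: "i = Suc (Suc n)" using \<open>1 < i\<close> by (simp add: n_def)
  obtain I :: "nat \<Rightarrow> ('a set + 'a) list set" and d e where
    res: "free_resolution R (quotient_module R \<mm>) I d e" and tr: "trivial_group (Ext_group R I d (ring_module R) i)"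
    using i(2) unfolding Ext_vanishes_def by blast
  let ?F = "\<lambda>n. free_mod R (I n)" and ?M = "quotient_module R \<mm>"
  have d: "d n \<in> mod_hom R (?F (Suc n)) (?F n)" for n
    using res unfolding free_resolution_def by (simp add: Let_def)
  define K where "K k = hom_ker (?F (Suc k)) (?F k) (d k)" for k
  have dd: "d (Suc n) ` carrier (?F (Suc (Suc n))) = K n" for n
    using res unfolding free_resolution_def K_def hom_ker_def by (simp add: Let_def)
  have d0: "d 0 ` carrier (?F (Suc 0)) = hom_ker (?F 0) ?M e"
    using res unfolding free_resolution_def hom_ker_def by (simp add: Let_def)
  have e: "cover R (I 0) e ?M"
    using res unfolding free_resolution_def cover_def by (simp add: Let_def)
  have step: "ext_van (Suc k) R (I m) L"
    if "ext_van k R (I (Suc m)) (K m)" "d m ` carrier (?F (Suc m)) = L" for k m L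
  proof -
    have "d m \<in> mod_hom R (?F (Suc m)) (?F m\<lparr>carrier := L\<rparr>)"
      by (rule mod_hom_restrict_codomain[OF d]) (use that(2) in simp)
    then have "cover R (I (Suc m)) (d m) (?F m\<lparr>carrier := L\<rparr>)" unfolding cover_def using that(2) by simp
    moreover have "hom_ker (?F (Suc m)) (?F m\<lparr>carrier := L\<rparr>) (d m) = K m" by (simp add: K_def hom_ker_def)
    ultimately show ?thesis unfolding ext_van.simps using that(1) by (intro exI[of _ "I (Suc m)"] exI[of _ "d m"]) simp
  qed
  \<comment> \<open>Here k counts how far the statement has been carried back: it starts at the
    syzygy K n, where Ext has degree one, and ends at K 0.\<close>
  have "ext_van k R (I (Suc (n - k))) (K (n - k))" if "k \<le> n" for k
    using that
  proof (induction k)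
    case 0
    show ?case unfolding ext_van.simps
    proof
      fix h assume "h \<in> mod_hom R (free_mod R (I (Suc (n - 0)))\<lparr>carrier := K (n - 0)\<rparr>) (ring_module R)"
      then have "h \<in> mod_hom R (?F (Suc n)\<lparr>carrier := d (Suc n) ` carrier (?F (Suc (Suc n)))\<rparr>) (ring_module R)"
        using dd by simp
      from trivial_Ext_group[OF ring_module_module[OF L(1)] res tr[unfolded n] this]
      show "\<exists>g\<in>mod_hom R (free_mod R (I (Suc (n - 0)))) (ring_module R). \<forall>v\<in>K (n - 0). g v = h v"
        using dd by simp
    qed
  next
    case (Suc k)
    then have s: "n - k = Suc (n - Suc k)" by simp
    have "ext_van k R (I (Suc (Suc (n - Suc k)))) (K (Suc (n - Suc k)))" using Suc s by simp
    then show ?case by (rule step[OF _ dd])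
  qed
  from this[of n] have "ext_van n R (I (Suc 0)) (K 0)" by simp
  then have E: "ext_van (Suc n) R (I 0) (hom_ker (?F 0) ?M e)" by (rule step[OF _ d0])
  note Mm = quotient_module_module[OF L(1,4)]
  have "ext_van (Suc n) R {0::nat} (sing_sub R \<mm>)"
    using ext_van_stable_retract[OF noeth Mm Mm stable_retract_refl[OF Mm] _ quotient_module_cover(1)[OF L(1,4)] e E]
    by (simp add: quotient_module_cover(2)[OF L(1,4)])
  then have "ext_van_mod n R (free_mod R {0::nat}\<lparr>carrier := sing_sub R \<mm>\<rparr>)"
    unfolding ext_van.simps ext_van_mod_def .
  then show ?thesis using ext_van_mod_sing[OF L(1) noeth L(4)] by blast
qed

text \<open>The Cohen-Macaulay property in dimension one: \<open>no_socle\<close> excludes the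
  second alternative of \<open>parameter_exists\<close>.\<close>

lemma gorenstein_parameter:
  assumes "gorenstein_local_ring R \<mm>" "krull_dim R = 1"
  obtains a where "a \<in> \<mm>" "nonzerodivisor R a" "\<And>Q. primeideal Q R \<Longrightarrow> a \<in> Q \<Longrightarrow> Q = \<mm>"
proof -
  have loc: "local_ring R \<mm>" and noeth: "noetherian_ring R" using assms(1) by (auto simp: gorenstein_local_ring_def)
  note L = local_ringD[OF loc]
  obtain n where n: "ext_van_mod n R (ideal_mod R \<mm>)"
    using gorenstein_ext_van[OF assms(1)] assms(2) by auto
  obtain a where a: "a \<in> \<mm>" "a \<noteq> \<zero>\<^bsub>R\<^esub>" and p: "\<And>Q. primeideal Q R \<Longrightarrow> a \<in> Q \<Longrightarrow> Q = \<mm>" and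
    disj: "nonzerodivisor R a \<or> (\<exists>b\<in>carrier R. b \<noteq> \<zero>\<^bsub>R\<^esub> \<and> colon R {\<zero>\<^bsub>R\<^esub>} b = \<mm> \<and>
       PIdl\<^bsub>R\<^esub> a \<inter> PIdl\<^bsub>R\<^esub> b = {\<zero>\<^bsub>R\<^esub>})"
    by (rule parameter_exists[OF loc noeth assms(2)]) (assumption | rule that)+
  have ac: "a \<in> carrier R" using a(1) L(5) by blast
  have "nonzerodivisor R a" using disj
  proof (elim disjE bexE conjE)
    fix b assume "b \<in> carrier R" "b \<noteq> \<zero>\<^bsub>R\<^esub>" "colon R {\<zero>\<^bsub>R\<^esub>} b = \<mm>" "PIdl\<^bsub>R\<^esub> a \<inter> PIdl\<^bsub>R\<^esub> b = {\<zero>\<^bsub>R\<^esub>}"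
    from no_socle[OF loc noeth n ac a(2) p this] show ?thesis by simp
  qed
  then show ?thesis by (rule that[OF a(1)]) (rule p)
qed

subsection \<open>Congruences\<close>

text \<open>Membership in the carrier is part of the relation, so that chains of congruences carry
  it along.\<close>

definition ideal_cong :: "('a, 'c) ring_scheme \<Rightarrow> 'a set \<Rightarrow> 'a \<Rightarrow> 'a \<Rightarrow> bool" where
  "ideal_cong R D x y \<longleftrightarrow> x \<in> carrier R \<and> y \<in> carrier R \<and> x \<ominus>\<^bsub>R\<^esub> y \<in> D"

context ideal begin

lemma cong_carrier: "ideal_cong R I x y \<Longrightarrow> x \<in> carrier R" "ideal_cong R I x y \<Longrightarrow> y \<in> carrier R"
  by (auto simp: ideal_cong_def)

lemma cong_refl: "x \<in> carrier R \<Longrightarrow> ideal_cong R I x x"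
  by (simp add: ideal_cong_def a_minus_def r_neg)

lemma cong_trans:
  assumes "ideal_cong R I x y" "ideal_cong R I y z" shows "ideal_cong R I x z"
proof -
  have c: "x \<in> carrier R" "y \<in> carrier R" "z \<in> carrier R" using assms by (auto simp: ideal_cong_def)
  have "(x \<ominus> y) \<oplus> (y \<ominus> z) = x \<oplus> ((\<ominus> y \<oplus> y) \<oplus> \<ominus> z)"
    using c by (simp add: a_minus_def a_assoc)
  also have "\<dots> = x \<ominus> z" using c by (simp add: a_minus_def l_neg)
  finally have "x \<ominus> z \<in> I" using additive_subgroup.a_closed[OF additive_subgroup_axioms] assms unfolding ideal_cong_def by metis
  then show ?thesis using c by (simp add: ideal_cong_def)
qed

lemma cong_sym:
  assumes "ideal_cong R I x y" shows "ideal_cong R I y x"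
proof -
  have c: "x \<in> carrier R" "y \<in> carrier R" using assms by (auto simp: ideal_cong_def)
  have "\<ominus> (x \<ominus> y) = y \<ominus> x" using c by (simp add: a_minus_def minus_add a_comm)
  then show ?thesis using c additive_subgroup.a_inv_closed[OF additive_subgroup_axioms] assms unfolding ideal_cong_def by metis
qed

lemma cong_add:
  assumes "ideal_cong R I x x'" "ideal_cong R I y y'" shows "ideal_cong R I (x \<oplus> y) (x' \<oplus> y')"
proof -
  have c: "x \<in> carrier R" "y \<in> carrier R" "x' \<in> carrier R" "y' \<in> carrier R" using assms by (auto simp: ideal_cong_def)
  have "(x \<oplus> y) \<ominus> (x' \<oplus> y') = (x \<ominus> x') \<oplus> (y \<ominus> y')"
    using c by (simp add: a_minus_def minus_add a_ac)
  then show ?thesis using c additive_subgroup.a_closed[OF additive_subgroup_axioms] assms unfolding ideal_cong_def by simp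
qed

lemma cong_mult:
  assumes "ideal_cong R I x x'" "r \<in> carrier R" shows "ideal_cong R I (r \<otimes> x) (r \<otimes> x')"
proof -
  have c: "x \<in> carrier R" "x' \<in> carrier R" using assms by (auto simp: ideal_cong_def)
  have "r \<otimes> x \<ominus> r \<otimes> x' = r \<otimes> (x \<ominus> x')"
    using c assms(2) by (simp add: a_minus_def r_distr r_minus)
  then show ?thesis using c I_l_closed assms unfolding ideal_cong_def by simp
qed

lemma cong_minus:
  assumes "ideal_cong R I x x'" shows "ideal_cong R I (\<ominus> x) (\<ominus> x')"
proof -
  have c: "x \<in> carrier R" "x' \<in> carrier R" using assms by (auto simp: ideal_cong_def)
  have "\<ominus> x \<ominus> \<ominus> x' = \<ominus> (x \<ominus> x')" using c by (simp add: a_minus_def minus_add)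
  then show ?thesis using c additive_subgroup.a_inv_closed[OF additive_subgroup_axioms] assms unfolding ideal_cong_def by simp
qed

lemma cong_diff:
  assumes "ideal_cong R I x x'" "ideal_cong R I y y'" shows "ideal_cong R I (x \<ominus> y) (x' \<ominus> y')"
  unfolding a_minus_def by (rule cong_add[OF assms(1) cong_minus[OF assms(2)]])

lemma cong_zero_iff: "x \<in> carrier R \<Longrightarrow> ideal_cong R I x \<zero> \<longleftrightarrow> x \<in> I"
  by (simp add: ideal_cong_def a_minus_def)

end

section \<open>Maps that are linear modulo an ideal\<close>

text \<open>A homomorphism from K to R/D, given by a choice of representatives in R.\<close>

definition lin_mod ::
    "('a, 'c) ring_scheme \<Rightarrow> 'a set \<Rightarrow> ('a, 'b, 'd) module_scheme \<Rightarrow> 'b set \<Rightarrow> ('b \<Rightarrow> 'a) \<Rightarrow> bool" where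
  "lin_mod R D N K \<phi> \<longleftrightarrow>
     (\<forall>x\<in>K. \<forall>y\<in>K. ideal_cong R D (\<phi> (x \<oplus>\<^bsub>N\<^esub> y)) (\<phi> x \<oplus>\<^bsub>R\<^esub> \<phi> y)) \<and>
     (\<forall>r\<in>carrier R. \<forall>x\<in>K. ideal_cong R D (\<phi> (r \<odot>\<^bsub>N\<^esub> x)) (r \<otimes>\<^bsub>R\<^esub> \<phi> x)) \<and>
     (\<forall>x\<in>K. \<phi> x \<in> carrier R)"

lemma lin_modD:
  assumes "lin_mod R D N K \<phi>"
  shows "x \<in> K \<Longrightarrow> y \<in> K \<Longrightarrow> ideal_cong R D (\<phi> (x \<oplus>\<^bsub>N\<^esub> y)) (\<phi> x \<oplus>\<^bsub>R\<^esub> \<phi> y)"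
    and "r \<in> carrier R \<Longrightarrow> x \<in> K \<Longrightarrow> ideal_cong R D (\<phi> (r \<odot>\<^bsub>N\<^esub> x)) (r \<otimes>\<^bsub>R\<^esub> \<phi> x)"
    and "x \<in> K \<Longrightarrow> \<phi> x \<in> carrier R"
  using assms unfolding lin_mod_def by blast+

lemma lin_mod_zero:
  assumes "module R N" "submodule K R N" "ideal D R" "lin_mod R D N K \<phi>"
  shows "ideal_cong R D (\<phi> \<zero>\<^bsub>N\<^esub>) \<zero>\<^bsub>R\<^esub>"
proof -
  interpret N: module R N by fact
  have z: "\<zero>\<^bsub>N\<^esub> \<in> K" by (rule submodule_zero[OF assms(2)])
  show ?thesis
    using lin_modD(2)[OF assms(4) N.R.zero_closed z] lin_modD(3)[OF assms(4) z] by simp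
qed

text \<open>Freeness turns linearity modulo D into linearity: the representatives at basis vectors
  define a linear map to R, and it stays congruent to the given one on all vectors.\<close>

lemma lin_mod_lift:
  assumes "module R N" "ideal D R" "p \<in> mod_hom R (free_mod R I) N" "submodule K R N" "p ` carrier (free_mod R I) \<subseteq> K"
    and "lin_mod R D N K \<phi>"
  obtains g where "g \<in> mod_hom R (free_mod R I) (ring_module R)"
    "\<And>v. v \<in> carrier (free_mod R I) \<Longrightarrow> ideal_cong R D (g v) (\<phi> (p v))"
proof -
  interpret N: module R N by fact
  interpret D: ideal D R by fact
  note F = free_mod_module[OF N.is_cring, of I] and Rm = ring_module_module[OF N.is_cring]
  interpret F: module R "free_mod R I" by (rule F)
  have pK: "p v \<in> K" if "v \<in> carrier (free_mod R I)" for v using assms(5) that by blast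
  have u: "unit_vec R i \<in> carrier (free_mod R I)" if "i \<in> I" for i by (rule unit_vec_carrier[OF N.is_cring that])
  have "\<phi> (p (unit_vec R i)) \<in> carrier (ring_module R)" if "i \<in> I" for i
    using lin_modD(3)[OF assms(6) pK[OF u[OF that]]] by simp
  from free_hom_exists[where I = I and x = "\<lambda>i. \<phi> (p (unit_vec R i))", OF Rm this] obtain g where
    g: "g \<in> mod_hom R (free_mod R I) (ring_module R)" "\<And>i. i \<in> I \<Longrightarrow> g (unit_vec R i) = \<phi> (p (unit_vec R i))" by auto
  have "ideal_cong R D (g v) (\<phi> (p v))" if "v \<in> carrier (free_mod R I)" for v
    using N.is_cring that
  proof (induction rule: free_mod_induct)
    case zero
    then show ?case
      using mod_hom_zero[OF F Rm g(1)] mod_hom_zero[OF F assms(1,3)] D.cong_sym[OF lin_mod_zero[OF assms(1,4,2,6)]]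
      by simp
  next
    case (add v w)
    have "ideal_cong R D (g v \<oplus>\<^bsub>R\<^esub> g w) (\<phi> (p v) \<oplus>\<^bsub>R\<^esub> \<phi> (p w))" by (rule D.cong_add[OF add(3,4)])
    moreover have "ideal_cong R D (\<phi> (p v) \<oplus>\<^bsub>R\<^esub> \<phi> (p w)) (\<phi> (p v \<oplus>\<^bsub>N\<^esub> p w))"
      by (rule D.cong_sym[OF lin_modD(1)[OF assms(6) pK[OF add(1)] pK[OF add(2)]]])
    ultimately show ?case
      using D.cong_trans mod_homD(2)[OF g(1) add(1,2)] mod_homD(2)[OF assms(3) add(1,2)] by simp
  next
    case (unit r i)
    have "ideal_cong R D (r \<otimes>\<^bsub>R\<^esub> \<phi> (p (unit_vec R i))) (\<phi> (r \<odot>\<^bsub>N\<^esub> p (unit_vec R i)))"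
      by (rule D.cong_sym[OF lin_modD(2)[OF assms(6) unit(1) pK[OF u[OF unit(2)]]]])
    then show ?case
      using mod_homD(3)[OF g(1) unit(1) u[OF unit(2)]] mod_homD(3)[OF assms(3) unit(1) u[OF unit(2)]] g(2)[OF unit(2)] by simp
  qed
  then show ?thesis by (rule that[OF g(1)])
qed

lemma div_hom:
  assumes "module R N" "nonzerodivisor R d" "g \<in> mod_hom R N (ring_module R)"
    "\<And>v. v \<in> carrier N \<Longrightarrow> g v \<in> PIdl\<^bsub>R\<^esub> d"
  obtains \<psi> where "\<psi> \<in> mod_hom R N (ring_module R)" "\<And>v. v \<in> carrier N \<Longrightarrow> g v = \<psi> v \<otimes>\<^bsub>R\<^esub> d"
proof -
  interpret N: module R N by fact
  have d: "d \<in> carrier R" using assms(2) by (simp add: nonzerodivisor_def)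
  define \<psi> where "\<psi> v = (SOME c. c \<in> carrier R \<and> g v = c \<otimes>\<^bsub>R\<^esub> d)" for v
  have p: "\<psi> v \<in> carrier R \<and> g v = \<psi> v \<otimes>\<^bsub>R\<^esub> d" if "v \<in> carrier N" for v
  proof -
    have "\<exists>c. c \<in> carrier R \<and> g v = c \<otimes>\<^bsub>R\<^esub> d" using assms(4)[OF that] unfolding cgenideal_def by blast
    then show ?thesis unfolding \<psi>_def by (rule someI_ex)
  qed
  note cancel = nonzerodivisor_cancel[OF N.is_cring assms(2)]
  have "\<psi> \<in> mod_hom R N (ring_module R)"
  proof (rule mod_homI)
    fix v assume v: "v \<in> carrier N"
    show "\<psi> v \<in> carrier (ring_module R)" using p[OF v] by simp
    { fix w assume w: "w \<in> carrier N"
      have "\<psi> (v \<oplus>\<^bsub>N\<^esub> w) = \<psi> v \<oplus>\<^bsub>R\<^esub> \<psi> w"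
      proof (rule cancel)
        have "\<psi> (v \<oplus>\<^bsub>N\<^esub> w) \<otimes>\<^bsub>R\<^esub> d = g v \<oplus>\<^bsub>R\<^esub> g w" using p[of "v \<oplus>\<^bsub>N\<^esub> w"] v w mod_homD(2)[OF assms(3) v w] by simp
        then show "\<psi> (v \<oplus>\<^bsub>N\<^esub> w) \<otimes>\<^bsub>R\<^esub> d = (\<psi> v \<oplus>\<^bsub>R\<^esub> \<psi> w) \<otimes>\<^bsub>R\<^esub> d"
          using p[OF v] p[OF w] d by (simp add: N.R.l_distr)
      qed (use p v w in simp_all)
      then show "\<psi> (v \<oplus>\<^bsub>N\<^esub> w) = \<psi> v \<oplus>\<^bsub>ring_module R\<^esub> \<psi> w" by simp }
    { fix r assume r: "r \<in> carrier R"
      have "\<psi> (r \<odot>\<^bsub>N\<^esub> v) = r \<otimes>\<^bsub>R\<^esub> \<psi> v"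
      proof (rule cancel)
        have "\<psi> (r \<odot>\<^bsub>N\<^esub> v) \<otimes>\<^bsub>R\<^esub> d = r \<otimes>\<^bsub>R\<^esub> g v" using p[of "r \<odot>\<^bsub>N\<^esub> v"] v r mod_homD(3)[OF assms(3) r v] by simp
        then show "\<psi> (r \<odot>\<^bsub>N\<^esub> v) \<otimes>\<^bsub>R\<^esub> d = (r \<otimes>\<^bsub>R\<^esub> \<psi> v) \<otimes>\<^bsub>R\<^esub> d"
          using p[OF v] d r by (simp add: N.R.m_assoc)
      qed (use p v r in simp_all)
      then show "\<psi> (r \<odot>\<^bsub>N\<^esub> v) = r \<odot>\<^bsub>ring_module R\<^esub> \<psi> v" by simp }
  qed
  then show ?thesis by (rule that) (use p in blast)
qed

text \<open>Baer's criterion for the ring $R/dR$, with maps represented by their lifts to \<open>R\<close>.\<close>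

definition self_injective :: "('a, 'c) ring_scheme \<Rightarrow> 'a \<Rightarrow> bool" where
  "self_injective R d \<longleftrightarrow>
     (\<forall>I \<phi>. ideal I R \<longrightarrow> d \<in> I \<longrightarrow> lin_mod R (PIdl\<^bsub>R\<^esub> d) (ring_module R) I \<phi> \<longrightarrow> \<phi> d \<in> PIdl\<^bsub>R\<^esub> d \<longrightarrow>
        (\<exists>c\<in>carrier R. \<forall>x\<in>I. ideal_cong R (PIdl\<^bsub>R\<^esub> d) (\<phi> x) (x \<otimes>\<^bsub>R\<^esub> c)))"

text \<open>Ext^1(I, R) = 0 makes Hom(I, R) -> Hom(I, R/dR) surjective. A lift \<theta> satisfies
  \<theta>(d) = cd for some c, so \<theta>(x)d = x\<theta>(d) = xcd, and cancelling d gives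
  \<theta>(x) = xc.\<close>

lemma self_injectiveI:
  assumes "cring R" "noetherian_ring R" "nonzerodivisor R d"
    and "\<And>I. ideal I R \<Longrightarrow> d \<in> I \<Longrightarrow> ext_van_mod 0 R (ideal_mod R I)"
  shows "self_injective R d"
  unfolding self_injective_def
proof (intro allI impI)
  fix I \<phi> assume I: "ideal I R" "d \<in> I" and \<phi>: "lin_mod R (PIdl\<^bsub>R\<^esub> d) (ring_module R) I \<phi>" and \<phi>d: "\<phi> d \<in> PIdl\<^bsub>R\<^esub> d"
  interpret R: cring R by fact
  interpret I: ideal I R by fact
  have d: "d \<in> carrier R" using assms(3) by (simp add: nonzerodivisor_def)
  let ?D = "PIdl\<^bsub>R\<^esub> d"
  interpret D: ideal ?D R by (rule R.cgenideal_ideal[OF d])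
  note Rm = ring_module_module[OF assms(1)] and Im = ideal_mod_module[OF assms(1) I(1)]
  have Is: "submodule I R (ring_module R)" using I(1) by (simp add: submodule_ring_module_iff[OF assms(1)])
  have aI: "acc R (ring_module R) I" by (rule acc_mono[OF acc_ring_module[OF assms(1,2)]]) auto
  obtain g :: nat and p where p: "cover R {..<g} p (ideal_mod R I)"
    by (rule acc_cover[OF Rm Is aI]) (rule that)
  let ?F = "free_mod R {..<g}" and ?K = "hom_ker (free_mod R {..<g}) (ideal_mod R I) p"
  note F = free_mod_module[OF assms(1), of "{..<g}"]
  note p' = coverD[OF p]
  have pR: "p \<in> mod_hom R ?F (ring_module R)" by (rule mod_hom_extend_codomain[OF p'(1)]) auto
  have Ks: "submodule ?K R ?F" by (rule cover_kernel_submodule[OF Im p])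
  have KF: "?K \<subseteq> carrier ?F" by (rule module.submoduleE(1)[OF F Ks])
  have Km: "module R (?F\<lparr>carrier := ?K\<rparr>)" by (rule submodule_module[OF F Ks])
  have E: "ext_van 0 R {..<g} ?K" by (rule ext_van_modD[OF assms(2) Im assms(4)[OF I] _ p]) simp
  have pI: "p ` carrier ?F \<subseteq> I" using p'(2) by simp
  obtain f where f: "f \<in> mod_hom R ?F (ring_module R)" and fp: "\<And>v. v \<in> carrier ?F \<Longrightarrow> ideal_cong R ?D (f v) (\<phi> (p v))"
    by (rule lin_mod_lift[OF Rm D.is_ideal pR Is pI \<phi>]) (assumption | rule that)+
  \<comment> \<open>On the relations among the generators of I the lift f takes values in dR. Its
    quotient by d is a map on the syzygy and extends to some h on the free module, so f - dh kills
    the relations and descends to I.\<close>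
  have fK: "f v \<in> ?D" if "v \<in> carrier (?F\<lparr>carrier := ?K\<rparr>)" for v
  proof -
    have v: "v \<in> carrier ?F" "p v = \<zero>\<^bsub>R\<^esub>" using that by (auto simp: hom_ker_def)
    have "ideal_cong R ?D (f v) (\<phi> \<zero>\<^bsub>R\<^esub>)" using fp[OF v(1)] v(2) by simp
    moreover have "ideal_cong R ?D (\<phi> \<zero>\<^bsub>R\<^esub>) \<zero>\<^bsub>R\<^esub>"
      using lin_mod_zero[OF Rm Is D.is_ideal \<phi>] by simp
    ultimately have "ideal_cong R ?D (f v) \<zero>\<^bsub>R\<^esub>" by (rule D.cong_trans)
    then show ?thesis using D.cong_zero_iff mod_homD(1)[OF f v(1)] by simp
  qed
  obtain \<psi> where \<psi>: "\<psi> \<in> mod_hom R (?F\<lparr>carrier := ?K\<rparr>) (ring_module R)"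
    and f\<psi>: "\<And>v. v \<in> carrier (?F\<lparr>carrier := ?K\<rparr>) \<Longrightarrow> f v = \<psi> v \<otimes>\<^bsub>R\<^esub> d"
    by (rule div_hom[OF Km assms(3) mod_hom_restrict_domain[OF f KF] fK]) (assumption | rule that)+
  obtain h where h: "h \<in> mod_hom R ?F (ring_module R)" "\<forall>v\<in>?K. h v = \<psi> v"
    using bspec[OF E[unfolded ext_van.simps] \<psi>] by (rule bexE)
  have fc: "f v \<in> carrier R" "h v \<in> carrier R" if "v \<in> carrier ?F" for v
    using mod_homD(1)[OF f that] mod_homD(1)[OF h(1) that] by auto
  have q: "(\<lambda>v. f v \<ominus>\<^bsub>ring_module R\<^esub> d \<odot>\<^bsub>ring_module R\<^esub> h v) \<in> mod_hom R ?F (ring_module R)"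
    by (rule mod_hom_diff_fun[OF Rm f mod_hom_smult_fun[OF Rm h(1) d]])
  have q0: "f v \<ominus>\<^bsub>ring_module R\<^esub> d \<odot>\<^bsub>ring_module R\<^esub> h v = \<zero>\<^bsub>ring_module R\<^esub>"
    if v: "v \<in> carrier ?F" and "p v = \<zero>\<^bsub>ideal_mod R I\<^esub>" for v
  proof -
    have "v \<in> ?K" using that by (simp add: hom_ker_def)
    then have "f v = d \<otimes>\<^bsub>R\<^esub> h v" using f\<psi>[of v] h(2) fc[OF v] d R.m_comm by simp
    then show ?thesis using fc[OF v] d by (simp add: R.minus_eq_zero_iff)
  qed
  obtain \<theta> where \<theta>: "\<theta> \<in> mod_hom R (ideal_mod R I) (ring_module R)"
    and \<theta>p: "\<And>v. v \<in> carrier ?F \<Longrightarrow> \<theta> (p v) = f v \<ominus>\<^bsub>ring_module R\<^esub> d \<odot>\<^bsub>ring_module R\<^esub> h v"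
    by (rule mod_hom_descend[OF F Im Rm p' q q0]) (assumption | rule that)+
  have \<theta>\<phi>: "ideal_cong R ?D (\<theta> x) (\<phi> x)" if x: "x \<in> I" for x
  proof -
    have "x \<in> p ` carrier ?F" using p'(2) x by simp
    then obtain v where v: "v \<in> carrier ?F" "x = p v" by blast
    note c = fc[OF v(1)]
    have "h v \<otimes>\<^bsub>R\<^esub> d \<in> ?D" using c unfolding cgenideal_def by blast
    then have "d \<otimes>\<^bsub>R\<^esub> h v \<in> ?D" using R.m_comm[OF d c(2)] by simp
    then have "ideal_cong R ?D (d \<otimes>\<^bsub>R\<^esub> h v) \<zero>\<^bsub>R\<^esub>" using D.cong_zero_iff c d by simp
    then have "ideal_cong R ?D (f v \<ominus>\<^bsub>R\<^esub> d \<otimes>\<^bsub>R\<^esub> h v) (f v \<ominus>\<^bsub>R\<^esub> \<zero>\<^bsub>R\<^esub>)" by (rule D.cong_diff[OF D.cong_refl[OF c(1)]])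
    then have "ideal_cong R ?D (\<theta> x) (f v)" using \<theta>p[OF v(1)] v(2) c by (simp add: a_minus_def)
    then show ?thesis using D.cong_trans fp[OF v(1)] v(2) by blast
  qed
  have tc: "\<theta> x \<in> carrier R" if "x \<in> I" for x using mod_homD(1)[OF \<theta>, of x] that by simp
  have "ideal_cong R ?D (\<theta> d) \<zero>\<^bsub>R\<^esub>"
    using D.cong_trans[OF \<theta>\<phi>[OF I(2)]] D.cong_zero_iff lin_modD(3)[OF \<phi> I(2)] \<phi>d by blast
  then have "\<theta> d \<in> ?D" using D.cong_zero_iff tc[OF I(2)] by simp
  then obtain c where c: "c \<in> carrier R" "\<theta> d = c \<otimes>\<^bsub>R\<^esub> d" unfolding cgenideal_def by blast
  have "ideal_cong R ?D (\<phi> x) (x \<otimes>\<^bsub>R\<^esub> c)" if x: "x \<in> I" for x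
  proof -
    have xc: "x \<in> carrier R" using x by simp
    have "\<theta> x \<otimes>\<^bsub>R\<^esub> d = \<theta> (d \<otimes>\<^bsub>R\<^esub> x)" using mod_homD(3)[OF \<theta> d, of x] x tc[OF x] d R.m_comm by simp
    also have "\<dots> = \<theta> (x \<otimes>\<^bsub>R\<^esub> d)" using R.m_comm[OF d xc] by simp
    also have "\<dots> = x \<otimes>\<^bsub>R\<^esub> \<theta> d" using mod_homD(3)[OF \<theta> xc, of d] I(2) by simp
    also have "\<dots> = (x \<otimes>\<^bsub>R\<^esub> c) \<otimes>\<^bsub>R\<^esub> d" using c d xc by (simp add: R.m_assoc)
    finally have "\<theta> x = x \<otimes>\<^bsub>R\<^esub> c"
      using nonzerodivisor_cancel[OF assms(1,3) tc[OF x]] xc c(1) by simp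
    then show ?thesis using D.cong_sym[OF \<theta>\<phi>[OF x]] by simp
  qed
  then show "\<exists>c\<in>carrier R. \<forall>x\<in>I. ideal_cong R ?D (\<phi> x) (x \<otimes>\<^bsub>R\<^esub> c)" using c(1) by blast
qed

lemma nonzerodivisor_power:
  assumes "cring R" "nonzerodivisor R a" shows "nonzerodivisor R (a [^]\<^bsub>R\<^esub> (k::nat))"
proof -
  interpret R: cring R by fact
  have a: "a \<in> carrier R" using assms(2) by (simp add: nonzerodivisor_def)
  show ?thesis
  proof (induction k)
    case 0
    then show ?case by (simp add: nonzerodivisor_def)
  next
    case (Suc k)
    have "s = \<zero>\<^bsub>R\<^esub>" if s: "s \<in> carrier R" "a [^]\<^bsub>R\<^esub> Suc k \<otimes>\<^bsub>R\<^esub> s = \<zero>\<^bsub>R\<^esub>" for s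
    proof -
      have "a [^]\<^bsub>R\<^esub> k \<otimes>\<^bsub>R\<^esub> (a \<otimes>\<^bsub>R\<^esub> s) = \<zero>\<^bsub>R\<^esub>" using s a by (simp add: R.m_assoc)
      then have "a \<otimes>\<^bsub>R\<^esub> s = \<zero>\<^bsub>R\<^esub>" using Suc a s(1) R.m_closed unfolding nonzerodivisor_def by blast
      then show ?thesis using assms(2) s(1) unfolding nonzerodivisor_def by blast
    qed
    then show ?case using a by (simp add: nonzerodivisor_def)
  qed
qed

text \<open>The nonzerodivisor a brings the vanishing down to Ext^1(\<mm>, R) = 0, and every ideal
  containing a power of a is primary to \<mm>.\<close>

lemma gorenstein_self_injective:
  assumes "gorenstein_local_ring R \<mm>" "1 \<le> krull_dim R" "nonzerodivisor R a" "a \<in> \<mm>"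
    and "\<And>Q. primeideal Q R \<Longrightarrow> a \<in> Q \<Longrightarrow> Q = \<mm>"
  shows "self_injective R (a [^]\<^bsub>R\<^esub> (k::nat))"
proof -
  have loc: "local_ring R \<mm>" and noeth: "noetherian_ring R" using assms(1) by (auto simp: gorenstein_local_ring_def)
  note L = local_ringD[OF loc]
  have a: "a \<in> carrier R" using assms(3) by (simp add: nonzerodivisor_def)
  obtain n where n: "ext_van_mod n R (ideal_mod R \<mm>)"
    using gorenstein_ext_van[OF assms(1,2)] by (rule exE)
  have E0: "ext_van_mod 0 R (ideal_mod R \<mm>)"
    using n
  proof (induction n)
    case (Suc n)
    have "ext_van_mod n R (ideal_mod R \<mm>)"
      by (rule ext_van_mod_descend[OF loc noeth Suc.prems assms(3,4)]) (rule assms(5))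
    then show ?case by (rule Suc.IH)
  qed
  show ?thesis
  proof (rule self_injectiveI[OF L(1) noeth nonzerodivisor_power[OF L(1) assms(3)]])
    fix I assume I: "ideal I R" "a [^]\<^bsub>R\<^esub> k \<in> I"
    have "Q = \<mm>" if Q: "primeideal Q R" "I \<subseteq> Q" for Q
      using assms(5)[OF Q(1) primeideal_power[OF Q(1) a, of k]] Q(2) I(2) by blast
    then have "primary_to R \<mm> I" using I(1) by (simp add: primary_to_def)
    then show "ext_van_mod 0 R (ideal_mod R I)" by (rule ext_van_mod_primary[OF loc noeth E0])
  qed
qed

subsection \<open>Localization at a maximal ideal\<close>

text \<open>Sums and products in \<open>localization\<close> are unions over all representatives;
  such a union is a single fraction once each pair of representatives gives the same one.\<close>

lemma UN_UN_const:
  assumes "(a0, s0) \<in> A" "(b0, t0) \<in> B" "\<And>a s b t. (a, s) \<in> A \<Longrightarrow> (b, t) \<in> B \<Longrightarrow> f a s b t = X"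
  shows "(\<Union>(a, s)\<in>A. \<Union>(b, t)\<in>B. f a s b t) = X"
proof (intro subset_antisym subsetI)
  fix x assume "x \<in> (\<Union>(a, s)\<in>A. \<Union>(b, t)\<in>B. f a s b t)"
  then obtain a s b t where "(a, s) \<in> A" "(b, t) \<in> B" "x \<in> f a s b t" by auto
  then show "x \<in> X" using assms(3) by simp
next
  fix x assume "x \<in> X"
  then have "x \<in> f a0 s0 b0 t0" using assms by simp
  then show "x \<in> (\<Union>(a, s)\<in>A. \<Union>(b, t)\<in>B. f a s b t)"
    using UN_I[OF assms(1), of x "\<lambda>(a, s). \<Union>(b, t)\<in>B. f a s b t"]
      UN_I[OF assms(2), of x "\<lambda>(b, t). f a0 s0 b t"] by simp
qed

locale loc_at = cring T + maximalideal \<nn> T for T (structure) and \<nn> +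
  fixes S fr L
  assumes S_def: "S = carrier T - \<nn>" and fr_def: "fr = fraction T S" and L_def: "L = localization_at T \<nn>"
begin

lemma nn_prime: "primeideal \<nn> T"
  by (rule maximalideal_prime[OF is_maximalideal])

lemma S_carrier: "s \<in> S \<Longrightarrow> s \<in> carrier T"
  by (simp add: S_def)

lemma S_one: "\<one> \<in> S"
  using one_imp_carrier I_notcarr by (auto simp: S_def)

lemma T_zero: "\<zero> \<in> carrier T"
  using a_subset zero_closed by blast

lemma S_mult: "s \<in> S \<Longrightarrow> t \<in> S \<Longrightarrow> s \<otimes> t \<in> S"
  using primeideal.I_prime[OF nn_prime] by (auto simp: S_def)

lemma fr_mem: "(b, t) \<in> fr a s \<longleftrightarrow> b \<in> carrier T \<and> t \<in> S \<and> (\<exists>u\<in>S. u \<otimes> (a \<otimes> t) = u \<otimes> (b \<otimes> s))"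
  by (simp add: fr_def fraction_def)

lemma fr_refl: "a \<in> carrier T \<Longrightarrow> s \<in> S \<Longrightarrow> (a, s) \<in> fr a s"
  unfolding fr_mem using S_one by blast

lemma fr_trans:
  assumes "a \<in> carrier T" "s \<in> S" "b \<in> carrier T" "t \<in> S" "c \<in> carrier T" "r \<in> S"
    and "u \<in> S" "u \<otimes> (a \<otimes> t) = u \<otimes> (b \<otimes> s)" "v \<in> S" "v \<otimes> (b \<otimes> r) = v \<otimes> (c \<otimes> t)"
  shows "\<exists>w\<in>S. w \<otimes> (a \<otimes> r) = w \<otimes> (c \<otimes> s)"
proof
  note c = assms(1,3,5) S_carrier[OF assms(2)] S_carrier[OF assms(4)] S_carrier[OF assms(6)] S_carrier[OF assms(7)] S_carrier[OF assms(9)]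
  \<comment> \<open>The witness multiplies both given witnesses and the middle denominator t, which
    has to be cancelled.\<close>
  show "(u \<otimes> v) \<otimes> t \<in> S" using assms by (intro S_mult)
  have "((u \<otimes> v) \<otimes> t) \<otimes> (a \<otimes> r) = (v \<otimes> r) \<otimes> (u \<otimes> (a \<otimes> t))" using c by algebra
  also have "\<dots> = (u \<otimes> s) \<otimes> (v \<otimes> (b \<otimes> r))" unfolding assms(8) using c by algebra
  also have "\<dots> = ((u \<otimes> v) \<otimes> t) \<otimes> (c \<otimes> s)" unfolding assms(10) using c by algebra
  finally show "((u \<otimes> v) \<otimes> t) \<otimes> (a \<otimes> r) = ((u \<otimes> v) \<otimes> t) \<otimes> (c \<otimes> s)" .
qed

lemma fr_eqI:
  assumes "a \<in> carrier T" "s \<in> S" "b \<in> carrier T" "t \<in> S" "u \<in> S" "u \<otimes> (a \<otimes> t) = u \<otimes> (b \<otimes> s)"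
  shows "fr a s = fr b t"
proof -
  have "(c, r) \<in> fr a s \<longleftrightarrow> (c, r) \<in> fr b t" for c r
  proof
    assume "(c, r) \<in> fr a s"
    then obtain v where v: "c \<in> carrier T" "r \<in> S" "v \<in> S" "v \<otimes> (a \<otimes> r) = v \<otimes> (c \<otimes> s)" unfolding fr_mem by blast
    then show "(c, r) \<in> fr b t"
      unfolding fr_mem using fr_trans[OF assms(3,4,1,2) v(1,2) assms(5) assms(6)[symmetric] v(3,4)] by blast
  next
    assume "(c, r) \<in> fr b t"
    then obtain v where v: "c \<in> carrier T" "r \<in> S" "v \<in> S" "v \<otimes> (b \<otimes> r) = v \<otimes> (c \<otimes> t)" unfolding fr_mem by blast
    then show "(c, r) \<in> fr a s"
      unfolding fr_mem using fr_trans[OF assms(1-4) v(1,2) assms(5,6) v(3,4)] by blast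
  qed
  then have eq: "p \<in> fr a s \<longleftrightarrow> p \<in> fr b t" for p by (cases p) simp
  show ?thesis by (rule Set.set_eqI[OF eq])
qed

lemma fr_eqD:
  assumes "b \<in> carrier T" "t \<in> S" "fr a s = fr b t"
  shows "\<exists>u\<in>S. u \<otimes> (a \<otimes> t) = u \<otimes> (b \<otimes> s)"
  using fr_refl[OF assms(1,2)] unfolding assms(3)[symmetric] fr_mem by blast

lemma L_carrier: "q \<in> carrier L \<longleftrightarrow> (\<exists>a s. a \<in> carrier T \<and> s \<in> S \<and> q = fr a s)"
  unfolding L_def localization_at_def localization_def fr_def S_def by auto

lemma fr_carrier: "a \<in> carrier T \<Longrightarrow> s \<in> S \<Longrightarrow> fr a s \<in> carrier L"
  unfolding L_carrier by blast

lemma L_zero: "\<zero>\<^bsub>L\<^esub> = fr \<zero> \<one>" and L_one: "\<one>\<^bsub>L\<^esub> = fr \<one> \<one>"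
  unfolding L_def localization_at_def localization_def fr_def S_def by auto

lemma L_mult:
  assumes "a \<in> carrier T" "s \<in> S" "b \<in> carrier T" "t \<in> S"
  shows "fr a s \<otimes>\<^bsub>L\<^esub> fr b t = fr (a \<otimes> b) (s \<otimes> t)"
proof -
  have e: "fr (a' \<otimes> b') (s' \<otimes> t') = fr (a \<otimes> b) (s \<otimes> t)" if h: "(a', s') \<in> fr a s" "(b', t') \<in> fr b t" for a' s' b' t'
  proof -
    obtain u where u: "a' \<in> carrier T" "s' \<in> S" "u \<in> S" "u \<otimes> (a \<otimes> s') = u \<otimes> (a' \<otimes> s)" using h(1) unfolding fr_mem by blast
    obtain v where v: "b' \<in> carrier T" "t' \<in> S" "v \<in> S" "v \<otimes> (b \<otimes> t') = v \<otimes> (b' \<otimes> t)" using h(2) unfolding fr_mem by blast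
    note c = assms(1,3) u(1) v(1) S_carrier[OF assms(2)] S_carrier[OF assms(4)] S_carrier[OF u(2)] S_carrier[OF u(3)] S_carrier[OF v(2)] S_carrier[OF v(3)]
    show ?thesis
    proof (rule fr_eqI)
      show "u \<otimes> v \<in> S" by (rule S_mult[OF u(3) v(3)])
      have "(u \<otimes> v) \<otimes> ((a' \<otimes> b') \<otimes> (s \<otimes> t)) = (u \<otimes> (a' \<otimes> s)) \<otimes> (v \<otimes> (b' \<otimes> t))" using c by algebra
      also have "\<dots> = (u \<otimes> (a \<otimes> s')) \<otimes> (v \<otimes> (b \<otimes> t'))" using u(4) v(4) by simp
      also have "\<dots> = (u \<otimes> v) \<otimes> ((a \<otimes> b) \<otimes> (s' \<otimes> t'))" using c by algebra
      finally show "(u \<otimes> v) \<otimes> ((a' \<otimes> b') \<otimes> (s \<otimes> t)) = (u \<otimes> v) \<otimes> ((a \<otimes> b) \<otimes> (s' \<otimes> t'))" .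
    qed (use c u v assms S_mult in simp_all)
  qed
  have "fr a s \<otimes>\<^bsub>L\<^esub> fr b t = (\<Union>(a', s')\<in>fr a s. \<Union>(b', t')\<in>fr b t. fr (a' \<otimes> b') (s' \<otimes> t'))"
    unfolding L_def localization_at_def localization_def fr_def S_def by simp
  also have "\<dots> = fr (a \<otimes> b) (s \<otimes> t)"
    by (rule UN_UN_const[OF fr_refl[OF assms(1,2)] fr_refl[OF assms(3,4)] e])
  finally show ?thesis .
qed

lemma L_add:
  assumes "a \<in> carrier T" "s \<in> S" "b \<in> carrier T" "t \<in> S"
  shows "fr a s \<oplus>\<^bsub>L\<^esub> fr b t = fr (a \<otimes> t \<oplus> b \<otimes> s) (s \<otimes> t)"
proof -
  have e: "fr (a' \<otimes> t' \<oplus> b' \<otimes> s') (s' \<otimes> t') = fr (a \<otimes> t \<oplus> b \<otimes> s) (s \<otimes> t)"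
    if h: "(a', s') \<in> fr a s" "(b', t') \<in> fr b t" for a' s' b' t'
  proof -
    obtain u where u: "a' \<in> carrier T" "s' \<in> S" "u \<in> S" "u \<otimes> (a \<otimes> s') = u \<otimes> (a' \<otimes> s)" using h(1) unfolding fr_mem by blast
    obtain v where v: "b' \<in> carrier T" "t' \<in> S" "v \<in> S" "v \<otimes> (b \<otimes> t') = v \<otimes> (b' \<otimes> t)" using h(2) unfolding fr_mem by blast
    note c = assms(1,3) u(1) v(1) S_carrier[OF assms(2)] S_carrier[OF assms(4)] S_carrier[OF u(2)] S_carrier[OF u(3)] S_carrier[OF v(2)] S_carrier[OF v(3)]
    show ?thesis
    proof (rule fr_eqI)
      show "u \<otimes> v \<in> S" by (rule S_mult[OF u(3) v(3)])
      have "(u \<otimes> v) \<otimes> ((a' \<otimes> t' \<oplus> b' \<otimes> s') \<otimes> (s \<otimes> t)) =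
          (v \<otimes> (t \<otimes> t')) \<otimes> (u \<otimes> (a' \<otimes> s)) \<oplus> (u \<otimes> (s \<otimes> s')) \<otimes> (v \<otimes> (b' \<otimes> t))" using c by algebra
      also have "\<dots> = (v \<otimes> (t \<otimes> t')) \<otimes> (u \<otimes> (a \<otimes> s')) \<oplus> (u \<otimes> (s \<otimes> s')) \<otimes> (v \<otimes> (b \<otimes> t'))"
        using u(4) v(4) by simp
      also have "\<dots> = (u \<otimes> v) \<otimes> ((a \<otimes> t \<oplus> b \<otimes> s) \<otimes> (s' \<otimes> t'))" using c by algebra
      finally show "(u \<otimes> v) \<otimes> ((a' \<otimes> t' \<oplus> b' \<otimes> s') \<otimes> (s \<otimes> t)) = (u \<otimes> v) \<otimes> ((a \<otimes> t \<oplus> b \<otimes> s) \<otimes> (s' \<otimes> t'))" .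
    qed (use c u v assms S_mult in simp_all)
  qed
  have "fr a s \<oplus>\<^bsub>L\<^esub> fr b t = (\<Union>(a', s')\<in>fr a s. \<Union>(b', t')\<in>fr b t. fr (a' \<otimes> t' \<oplus> b' \<otimes> s') (s' \<otimes> t'))"
    unfolding L_def localization_at_def localization_def fr_def S_def by simp
  also have "\<dots> = fr (a \<otimes> t \<oplus> b \<otimes> s) (s \<otimes> t)"
    by (rule UN_UN_const[OF fr_refl[OF assms(1,2)] fr_refl[OF assms(3,4)] e])
  finally show ?thesis .
qed

lemma L_hom:
  assumes "cring L" shows "ring_hom_ring T L (\<lambda>r. fr r \<one>)"
proof -
  interpret L: cring L by fact
  show ?thesis
  proof (rule ring_hom_ringI[OF ring_axioms L.ring_axioms])
    show "fr (x \<otimes> y) \<one> = fr x \<one> \<otimes>\<^bsub>L\<^esub> fr y \<one>" if "x \<in> carrier T" "y \<in> carrier T" for x y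
      using L_mult[OF that(1) S_one that(2) S_one] by simp
    show "fr (x \<oplus> y) \<one> = fr x \<one> \<oplus>\<^bsub>L\<^esub> fr y \<one>" if "x \<in> carrier T" "y \<in> carrier T" for x y
      using L_add[OF that(1) S_one that(2) S_one] that by simp
  qed (simp_all add: fr_carrier S_one L_one)
qed

lemma fr_split: "a \<in> carrier T \<Longrightarrow> s \<in> S \<Longrightarrow> fr a s = fr \<one> s \<otimes>\<^bsub>L\<^esub> fr a \<one>"
  using L_mult[of \<one> s a \<one>] S_one S_carrier by simp

lemma fr_num: "a \<in> carrier T \<Longrightarrow> s \<in> S \<Longrightarrow> fr s \<one> \<otimes>\<^bsub>L\<^esub> fr a s = fr a \<one>"
proof -
  assume a: "a \<in> carrier T" "s \<in> S"
  have "fr (s \<otimes> a) s = fr a \<one>"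
    by (rule fr_eqI[OF _ a(2) a(1) S_one S_one]) (use a S_carrier m_comm in simp_all)
  then show ?thesis using L_mult[of s \<one> a s] a S_one S_carrier by simp
qed

end

lemma (in ideal) ideal_cong_iff_exists:
  assumes "cring R" "d \<in> carrier R" "x \<in> carrier R" "y \<in> carrier R"
  shows "ideal_cong R (PIdl d) x y \<longleftrightarrow> (\<exists>e\<in>carrier R. x = y \<oplus> e \<otimes> d)"
proof -
  interpret C: cring R by fact
  show ?thesis
  proof
    assume "ideal_cong R (PIdl d) x y"
    then obtain e where e: "e \<in> carrier R" "x \<ominus> y = e \<otimes> d" unfolding ideal_cong_def cgenideal_def by blast
    have "x = y \<oplus> (x \<ominus> y)" using assms by algebra
    then show "\<exists>e\<in>carrier R. x = y \<oplus> e \<otimes> d" using e by auto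
  next
    assume "\<exists>e\<in>carrier R. x = y \<oplus> e \<otimes> d"
    then obtain e where e: "e \<in> carrier R" "x = y \<oplus> e \<otimes> d" by blast
    have "x \<ominus> y = e \<otimes> d" unfolding e(2) using assms(2,4) e(1) by algebra
    then show "ideal_cong R (PIdl d) x y" using e(1) assms(3,4) unfolding ideal_cong_def cgenideal_def by blast
  qed
qed

context loc_at begin

lemma cong_locI:
  assumes "cring L" "d \<in> carrier T" "x \<in> carrier T" "s \<in> S" "y \<in> carrier T" "t \<in> S" "u \<in> S"
    and "ideal_cong T (PIdl d) (u \<otimes> (x \<otimes> t)) (u \<otimes> (y \<otimes> s))"
  shows "ideal_cong L (PIdl\<^bsub>L\<^esub> (fr d \<one>)) (fr x s) (fr y t)"
proof -
  interpret L: cring L by fact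
  interpret Lz: ideal "{\<zero>\<^bsub>L\<^esub>}" L by (rule L.zeroideal)
  note c = assms(2,3,5) S_carrier[OF assms(4)] S_carrier[OF assms(6)] S_carrier[OF assms(7)]
  obtain e where e: "e \<in> carrier T" "u \<otimes> (x \<otimes> t) = u \<otimes> (y \<otimes> s) \<oplus> e \<otimes> d"
    using ideal_cong_iff_exists[OF is_cring assms(2)] assms(8) c by auto
  have ust: "(u \<otimes> s) \<otimes> t \<in> S" by (intro S_mult assms)
  have "fr y t \<oplus>\<^bsub>L\<^esub> fr e ((u \<otimes> s) \<otimes> t) \<otimes>\<^bsub>L\<^esub> fr d \<one> = fr y t \<oplus>\<^bsub>L\<^esub> fr (e \<otimes> d) ((u \<otimes> s) \<otimes> t)"
    using L_mult[OF e(1) ust assms(2) S_one] c by simp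
  also have "\<dots> = fr (y \<otimes> ((u \<otimes> s) \<otimes> t) \<oplus> (e \<otimes> d) \<otimes> t) (t \<otimes> ((u \<otimes> s) \<otimes> t))"
    by (rule L_add) (use e c assms ust in simp_all)
  also have "\<dots> = fr x s"
  proof (rule fr_eqI[OF _ _ assms(3,4) S_one])
    have "(y \<otimes> ((u \<otimes> s) \<otimes> t) \<oplus> (e \<otimes> d) \<otimes> t) \<otimes> s = (t \<otimes> s) \<otimes> (u \<otimes> (y \<otimes> s) \<oplus> e \<otimes> d)"
      using e(1) c by algebra
    also have "\<dots> = (t \<otimes> s) \<otimes> (u \<otimes> (x \<otimes> t))" using e(2) by simp
    also have "\<dots> = x \<otimes> (t \<otimes> ((u \<otimes> s) \<otimes> t))" using c by algebra
    finally show "\<one> \<otimes> ((y \<otimes> ((u \<otimes> s) \<otimes> t) \<oplus> (e \<otimes> d) \<otimes> t) \<otimes> s) = \<one> \<otimes> (x \<otimes> (t \<otimes> ((u \<otimes> s) \<otimes> t)))" by simp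
    show "t \<otimes> ((u \<otimes> s) \<otimes> t) \<in> S" by (rule S_mult[OF assms(6) ust])
  qed (use e c in simp)
  finally have "fr x s = fr y t \<oplus>\<^bsub>L\<^esub> fr e ((u \<otimes> s) \<otimes> t) \<otimes>\<^bsub>L\<^esub> fr d \<one>" by simp
  then show ?thesis
    using Lz.ideal_cong_iff_exists[OF assms(1) fr_carrier[OF assms(2) S_one] fr_carrier[OF assms(3,4)] fr_carrier[OF assms(5,6)]]
      fr_carrier[OF e(1) ust] by blast
qed

lemma cong_locD:
  assumes "cring L" "d \<in> carrier T" "x \<in> carrier T" "s \<in> S" "y \<in> carrier T" "t \<in> S"
    and "ideal_cong L (PIdl\<^bsub>L\<^esub> (fr d \<one>)) (fr x s) (fr y t)"
  shows "\<exists>u\<in>S. ideal_cong T (PIdl d) (u \<otimes> (x \<otimes> t)) (u \<otimes> (y \<otimes> s))"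
proof -
  interpret L: cring L by fact
  interpret Lz: ideal "{\<zero>\<^bsub>L\<^esub>}" L by (rule L.zeroideal)
  note c = assms(2,3,5) S_carrier[OF assms(4)] S_carrier[OF assms(6)]
  obtain q where q: "q \<in> carrier L" "fr x s = fr y t \<oplus>\<^bsub>L\<^esub> q \<otimes>\<^bsub>L\<^esub> fr d \<one>"
    using Lz.ideal_cong_iff_exists[OF assms(1) fr_carrier[OF assms(2) S_one] fr_carrier[OF assms(3,4)] fr_carrier[OF assms(5,6)]]
      assms(7) by blast
  obtain e v where e: "e \<in> carrier T" "v \<in> S" "q = fr e v" using q(1) unfolding L_carrier by blast
  have vc: "v \<in> carrier T" by (rule S_carrier[OF e(2)])
  have "fr x s = fr y t \<oplus>\<^bsub>L\<^esub> fr (e \<otimes> d) v" using q(2) e L_mult[OF e(1,2) assms(2) S_one] vc by simp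
  also have "\<dots> = fr (y \<otimes> v \<oplus> (e \<otimes> d) \<otimes> t) (t \<otimes> v)" by (rule L_add) (use e c assms in simp_all)
  finally obtain w where w: "w \<in> S" "w \<otimes> (x \<otimes> (t \<otimes> v)) = w \<otimes> ((y \<otimes> v \<oplus> (e \<otimes> d) \<otimes> t) \<otimes> s)"
    using fr_eqD[of "y \<otimes> v \<oplus> (e \<otimes> d) \<otimes> t" "t \<otimes> v" x s] e c vc S_mult[OF assms(6) e(2)] by auto
  have wc: "w \<in> carrier T" by (rule S_carrier[OF w(1)])
  have "(w \<otimes> v) \<otimes> (x \<otimes> t) = w \<otimes> (x \<otimes> (t \<otimes> v))" using wc vc c by algebra
  also have "\<dots> = (w \<otimes> v) \<otimes> (y \<otimes> s) \<oplus> (w \<otimes> e \<otimes> t \<otimes> s) \<otimes> d" unfolding w(2) using wc vc c e(1) by algebra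
  finally have "ideal_cong T (PIdl d) ((w \<otimes> v) \<otimes> (x \<otimes> t)) ((w \<otimes> v) \<otimes> (y \<otimes> s))"
    using ideal_cong_iff_exists[OF is_cring assms(2)] wc vc c e(1) by auto
  then show ?thesis using S_mult[OF w(1) e(2)] by blast
qed

text \<open>The contraction of Q lies in \<nn>, because elements outside \<nn> become units, and it
  contains a, so it equals \<nn>. The resulting description of Q mentions only \<nn>. Any two primes
  over a/1 therefore coincide, one of them being the maximal ideal that comes with the Gorenstein
  condition.\<close>

lemma loc_prime:
  assumes "cring L" "a \<in> carrier T" "\<And>P. primeideal P T \<Longrightarrow> a \<in> P \<Longrightarrow> P \<subseteq> \<nn> \<Longrightarrow> P = \<nn>"
    and "primeideal Q L" "fr a \<one> \<in> Q"
  shows "Q = {fr y s | y s. y \<in> \<nn> \<and> s \<in> S}"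
proof -
  interpret L: cring L by fact
  interpret Q: primeideal Q L by fact
  interpret h: ring_hom_ring T L "\<lambda>r. fr r \<one>" by (rule L_hom[OF assms(1)])
  let ?P = "{r \<in> carrier T. fr r \<one> \<in> Q}"
  have P: "primeideal ?P T" by (rule h.primeideal_vimage[OF is_cring assms(4)])
  have oneQ: "\<one>\<^bsub>L\<^esub> \<notin> Q" using Q.one_imp_carrier Q.I_notcarr by blast
  have "t \<in> \<nn>" if t: "t \<in> ?P" for t
  proof (rule ccontr)
    assume "t \<notin> \<nn>"
    then have tS: "t \<in> S" using t by (simp add: S_def)
    have "fr \<one> t \<otimes>\<^bsub>L\<^esub> fr t \<one> \<in> Q" using t by (intro Q.I_l_closed fr_carrier tS) simp_all
    then have "fr t t \<in> Q" by (subst fr_split[OF S_carrier[OF tS] tS])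
    moreover have "fr t t = fr \<one> \<one>"
      by (rule fr_eqI[OF S_carrier[OF tS] tS _ S_one S_one]) (use S_carrier[OF tS] in simp_all)
    moreover have "fr \<one> \<one> \<notin> Q" using oneQ unfolding L_one .
    ultimately show False by metis
  qed
  then have sub: "?P \<subseteq> \<nn>" by (rule subsetI)
  have "a \<in> ?P" using assms(2,5) by simp
  then have "?P = \<nn>" by (rule assms(3)[OF P _ sub])
  then have nP: "y \<in> \<nn> \<longleftrightarrow> fr y \<one> \<in> Q" if "y \<in> carrier T" for y using that by blast
  show ?thesis
  proof (intro subset_antisym subsetI)
    fix q assume q: "q \<in> Q"
    then obtain y s where y: "y \<in> carrier T" "s \<in> S" "q = fr y s" using Q.Icarr L_carrier by blast
    have "fr y \<one> \<in> Q"
      using Q.I_l_closed[OF q fr_carrier[OF S_carrier[OF y(2)] S_one]] fr_num[OF y(1,2)] y(3) by simp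
    then show "q \<in> {fr y s | y s. y \<in> \<nn> \<and> s \<in> S}" using nP[OF y(1)] y by blast
  next
    fix q assume "q \<in> {fr y s | y s. y \<in> \<nn> \<and> s \<in> S}"
    then obtain y s where y: "y \<in> \<nn>" "s \<in> S" "q = fr y s" by blast
    have yc: "y \<in> carrier T" using y(1) a_subset by blast
    have "fr y \<one> \<in> Q" using nP[OF yc] y(1) by simp
    then show "q \<in> Q"
      using Q.I_l_closed[OF _ fr_carrier[OF one_closed y(2)]] fr_split[OF yc y(2)] y(3) by simp
  qed
qed

lemma fr_nonzerodivisor:
  assumes "cring L" "nonzerodivisor T a" shows "nonzerodivisor L (fr a \<one>)"
proof -
  interpret L: cring L by fact
  have a: "a \<in> carrier T" using assms(2) by (simp add: nonzerodivisor_def)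
  have "q = \<zero>\<^bsub>L\<^esub>" if q: "q \<in> carrier L" "fr a \<one> \<otimes>\<^bsub>L\<^esub> q = \<zero>\<^bsub>L\<^esub>" for q
  proof -
    obtain c s where c: "c \<in> carrier T" "s \<in> S" "q = fr c s" using q(1) unfolding L_carrier by blast
    have sc: "s \<in> carrier T" by (rule S_carrier[OF c(2)])
    have "fr (a \<otimes> c) s = fr \<zero> \<one>" using q(2) c L_mult[OF a S_one c(1,2)] sc by (simp add: L_zero)
    then obtain u where u: "u \<in> S" "u \<otimes> ((a \<otimes> c) \<otimes> \<one>) = u \<otimes> (\<zero> \<otimes> s)"
      using fr_eqD[OF T_zero S_one] by blast
    have uc: "u \<in> carrier T" by (rule S_carrier[OF u(1)])
    have "a \<otimes> (u \<otimes> c) = u \<otimes> ((a \<otimes> c) \<otimes> \<one>)" using a uc c(1) by algebra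
    also have "\<dots> = \<zero>" using u(2) uc sc by simp
    finally have "u \<otimes> c = \<zero>" using assms(2) uc c(1) unfolding nonzerodivisor_def by blast
    then have "fr c s = fr \<zero> \<one>" by (intro fr_eqI[OF c(1,2) _ S_one u(1)]) (use uc sc c(1) T_zero in simp_all)
    then show ?thesis using c(3) by (simp add: L_zero)
  qed
  then show ?thesis using fr_carrier[OF a S_one] by (simp add: nonzerodivisor_def)
qed

section \<open>Self-injectivity of the localizations and its gluing\<close>

text \<open>The hypotheses on the parameter pass to L. The lower bound on the dimension comes from a
  as well: its powers are nonzero in L, so a prime avoiding them lies strictly below
  \<open>\<mm>\<close>.\<close>

lemma loc_self_injective:
  assumes "gorenstein_local_ring L \<mm>" "nonzerodivisor T a" "a \<in> \<nn>"
    and "\<And>P. primeideal P T \<Longrightarrow> a \<in> P \<Longrightarrow> P \<subseteq> \<nn> \<Longrightarrow> P = \<nn>"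
  shows "self_injective L (fr (a [^] (k::nat)) \<one>)"
proof -
  have loc: "local_ring L \<mm>" and noeth: "noetherian_ring L" using assms(1) by (auto simp: gorenstein_local_ring_def)
  note M = local_ringD[OF loc]
  interpret L: cring L by (rule M)
  have a: "a \<in> carrier T" using assms(2) by (simp add: nonzerodivisor_def)
  let ?a = "fr a \<one>"
  have ac: "?a \<in> carrier L" by (rule fr_carrier[OF a S_one])
  have nz: "nonzerodivisor L ?a" by (rule fr_nonzerodivisor[OF M(1) assms(2)])
  \<comment> \<open>If a/1 had an inverse c/s, clearing denominators would give vs = (vc)a with v
    outside \<nn>; the right side lies in \<nn> and the left side does not.\<close>
  have am: "?a \<in> \<mm>"
  proof (rule ccontr)
    assume "?a \<notin> \<mm>"
    then have u: "?a \<in> Units L" by (rule local_unit[OF loc noeth ac])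
    obtain c s where c: "c \<in> carrier T" "s \<in> S" "inv\<^bsub>L\<^esub> ?a = fr c s" using L.Units_inv_closed[OF u] unfolding L_carrier by blast
    have sc: "s \<in> carrier T" by (rule S_carrier[OF c(2)])
    have "fr (a \<otimes> c) s = fr \<one> \<one>" using L.Units_r_inv[OF u] c L_mult[OF a S_one c(1,2)] sc by (simp add: L_one)
    then obtain v where v: "v \<in> S" "v \<otimes> ((a \<otimes> c) \<otimes> \<one>) = v \<otimes> (\<one> \<otimes> s)"
      using fr_eqD[OF one_closed S_one] by blast
    have vc: "v \<in> carrier T" by (rule S_carrier[OF v(1)])
    have "v \<otimes> s = (v \<otimes> c) \<otimes> a" using v(2) vc sc a c(1) by (simp add: m_ac)
    also have "\<dots> \<in> \<nn>" using I_l_closed[OF assms(3)] vc c(1) by simp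
    finally show False using S_mult[OF v(1) c(2)] by (simp add: S_def)
  qed
  have uniq: "Q = \<mm>" if "primeideal Q L" "?a \<in> Q" for Q
    using loc_prime[OF M(1) a assms(4) that] loc_prime[OF M(1) a assms(4) M(3) am] by simp
  have pc: "?a [^]\<^bsub>L\<^esub> (l::nat) \<noteq> \<zero>\<^bsub>L\<^esub>" for l
  proof
    assume "?a [^]\<^bsub>L\<^esub> l = \<zero>\<^bsub>L\<^esub>"
    then have "\<one>\<^bsub>L\<^esub> = \<zero>\<^bsub>L\<^esub>"
      using nonzerodivisor_power[OF M(1) nz, of l] unfolding nonzerodivisor_def by (metis L.l_null L.one_closed)
    then show False using M(6) additive_subgroup.zero_closed[OF ideal.axioms(1)[OF M(4)]] by simp
  qed
  let ?P = "range (\<lambda>l::nat. ?a [^]\<^bsub>L\<^esub> l)"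
  obtain Q where Q: "primeideal Q L" "{\<zero>\<^bsub>L\<^esub>} \<subseteq> Q" "Q \<inter> ?P = {}"
  proof (rule prime_avoiding[OF M(1) noeth L.zeroideal, of ?P])
    show "?P \<subseteq> carrier L" using ac by auto
    show "\<one>\<^bsub>L\<^esub> \<in> ?P" by (rule range_eqI[of _ _ 0]) simp
    show "s \<otimes>\<^bsub>L\<^esub> t \<in> ?P" if "s \<in> ?P" "t \<in> ?P" for s t
      using that L.nat_pow_mult[OF ac] by auto
    show "{\<zero>\<^bsub>L\<^esub>} \<inter> ?P = {}" using pc by auto
  qed
  have "?a \<in> ?P" by (rule range_eqI[of _ _ 1]) (simp add: ac)
  then have "?a \<notin> Q" using Q(3) by blast
  then have "Q \<subset> \<mm>" using local_primeideal_subset[OF loc noeth Q(1)] am by blast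
  then have dim: "1 \<le> krull_dim L" by (rule krull_dim_chain[OF Q(1) M(3)])
  have "fr (a [^] l) \<one> = ?a [^]\<^bsub>L\<^esub> l" for l :: nat
  proof (induction l)
    case (Suc l)
    have "fr (a [^] l \<otimes> a) \<one> = fr (a [^] l) \<one> \<otimes>\<^bsub>L\<^esub> ?a"
      using L_mult[of "a [^] l" \<one> a \<one>] a S_one by simp
    then show ?case using Suc by simp
  qed (simp add: L_one)
  then show ?thesis using gorenstein_self_injective[OF assms(1) dim nz am uniq, of k] by simp
qed

text \<open>Localize \<phi> and clear denominators. Over L it is multiplication by some e/v; over T
  the corresponding congruence holds for each y after multiplication by some u outside \<nn>, and
  finite generation of I makes u uniform.\<close>

lemma loc_lin_mod:
  assumes "cring L" "noetherian_ring T" "d \<in> carrier T" "self_injective L (fr d \<one>)"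
    and I: "ideal I T" "d \<in> I" and \<phi>: "lin_mod T (PIdl d) (ring_module T) I \<phi>" "\<phi> d \<in> PIdl d"
  shows "\<exists>t\<in>S. \<exists>c\<in>carrier T. \<forall>y\<in>I. ideal_cong T (PIdl d) (t \<otimes> \<phi> y) (y \<otimes> c)"
proof -
  interpret L: cring L by fact
  interpret N: noetherian_ring T by fact
  interpret I: ideal I T by (rule I)
  interpret D: ideal "PIdl d" T by (rule cgenideal_ideal[OF assms(3)])
  let ?\<delta> = "fr d \<one>"
  have \<delta>: "?\<delta> \<in> carrier L" by (rule fr_carrier[OF assms(3) S_one])
  interpret E: ideal "PIdl\<^bsub>L\<^esub> ?\<delta>" L by (rule L.cgenideal_ideal[OF \<delta>])
  have Ic: "y \<in> carrier T" if "y \<in> I" for y using that by (rule I.Icarr)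
  have \<phi>c: "\<phi> y \<in> carrier T" if "y \<in> I" for y by (rule lin_modD(3)[OF \<phi>(1) that])
  have \<phi>m: "ideal_cong T (PIdl d) (\<phi> (r \<otimes> y)) (r \<otimes> \<phi> y)" if "r \<in> carrier T" "y \<in> I" for r y
    using lin_modD(2)[OF \<phi>(1) that] by simp
  have \<phi>a: "ideal_cong T (PIdl d) (\<phi> (x \<oplus> y)) (\<phi> x \<oplus> \<phi> y)" if "x \<in> I" "y \<in> I" for x y
    using lin_modD(1)[OF \<phi>(1) that] by simp
  define J where "J = {fr y s | y s. y \<in> I \<and> s \<in> S}"
  define \<Phi> where "\<Phi> q = (let p = SOME p. fst p \<in> I \<and> snd p \<in> S \<and> q = fr (fst p) (snd p) in fr (\<phi> (fst p)) (snd p))" for q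
  \<comment> \<open>\<open>\<Phi>\<close> uses a chosen representative z/t of the fraction y/s. Some
    u outside \<nn> satisfies uyt = uzs, and linearity of \<phi> modulo d turns this into a
    congruence between the values at y and at z.\<close>
  have \<Phi>: "ideal_cong L (PIdl\<^bsub>L\<^esub> ?\<delta>) (\<Phi> (fr y s)) (fr (\<phi> y) s)" if ys: "y \<in> I" "s \<in> S" for y s
  proof -
    define p where "p = (SOME p. fst p \<in> I \<and> snd p \<in> S \<and> fr y s = fr (fst p) (snd p))"
    have "fst p \<in> I \<and> snd p \<in> S \<and> fr y s = fr (fst p) (snd p)"
      unfolding p_def by (rule someI[of _ "(y, s)"]) (use ys in simp)
    then obtain z t where z: "p = (z, t)" "z \<in> I" "t \<in> S" "fr y s = fr z t" by (cases p) auto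
    have \<Phi>z: "\<Phi> (fr y s) = fr (\<phi> z) t" using z(1) by (simp add: \<Phi>_def flip: p_def)
    obtain u where u: "u \<in> S" "u \<otimes> (y \<otimes> t) = u \<otimes> (z \<otimes> s)" using fr_eqD[OF Ic[OF z(2)] z(3,4)] by blast
    note c = S_carrier[OF ys(2)] S_carrier[OF z(3)] S_carrier[OF u(1)]
    have "ideal_cong T (PIdl d) (\<phi> ((u \<otimes> s) \<otimes> z)) ((u \<otimes> s) \<otimes> \<phi> z)" by (rule \<phi>m[OF _ z(2)]) (use c in simp)
    moreover have "(u \<otimes> s) \<otimes> z = (u \<otimes> t) \<otimes> y" using u(2) c Ic[OF z(2)] Ic[OF ys(1)] by (simp add: m_ac)
    ultimately have "ideal_cong T (PIdl d) ((u \<otimes> s) \<otimes> \<phi> z) ((u \<otimes> t) \<otimes> \<phi> y)"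
      using D.cong_trans[OF D.cong_sym \<phi>m[OF m_closed[OF c(3,2)] ys(1)]] by metis
    then have "ideal_cong T (PIdl d) (u \<otimes> (\<phi> z \<otimes> s)) (u \<otimes> (\<phi> y \<otimes> t))"
      using c \<phi>c[OF z(2)] \<phi>c[OF ys(1)] by (simp add: m_ac)
    then show ?thesis unfolding \<Phi>z by (rule cong_locI[OF assms(1,3) \<phi>c[OF z(2)] z(3) \<phi>c[OF ys(1)] ys(2) u(1)])
  qed
  have cong1: "ideal_cong L (PIdl\<^bsub>L\<^esub> ?\<delta>) (fr x s) (fr y s)" if "ideal_cong T (PIdl d) x y" "s \<in> S" for x y s
  proof (rule cong_locI[OF assms(1,3) _ that(2) _ that(2) S_one])
    show "x \<in> carrier T" "y \<in> carrier T" using that(1) by (auto simp: ideal_cong_def)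
    have "ideal_cong T (PIdl d) (s \<otimes> x) (s \<otimes> y)" by (rule D.cong_mult[OF that(1) S_carrier[OF that(2)]])
    then show "ideal_cong T (PIdl d) (\<one> \<otimes> (x \<otimes> s)) (\<one> \<otimes> (y \<otimes> s))"
      using \<open>x \<in> carrier T\<close> \<open>y \<in> carrier T\<close> S_carrier[OF that(2)] by (simp add: m_comm)
  qed
  have Jmem: "\<exists>y s. y \<in> I \<and> s \<in> S \<and> q = fr y s" if "q \<in> J" for q using that unfolding J_def by blast
  have add: "fr x s \<oplus>\<^bsub>L\<^esub> fr y t = fr (x \<otimes> t \<oplus> y \<otimes> s) (s \<otimes> t) \<and> x \<otimes> t \<oplus> y \<otimes> s \<in> I \<and> s \<otimes> t \<in> S"
    if "x \<in> I" "s \<in> S" "y \<in> I" "t \<in> S" for x s y t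
    using L_add[OF Ic[OF that(1)] that(2) Ic[OF that(3)] that(4)] S_mult[OF that(2,4)]
      I.a_closed[OF I.I_r_closed[OF that(1) S_carrier[OF that(4)]] I.I_r_closed[OF that(3) S_carrier[OF that(2)]]] by simp
  have smult: "fr r t \<otimes>\<^bsub>L\<^esub> fr y s = fr (r \<otimes> y) (t \<otimes> s) \<and> r \<otimes> y \<in> I \<and> t \<otimes> s \<in> S"
    if "r \<in> carrier T" "t \<in> S" "y \<in> I" "s \<in> S" for r t y s
    using L_mult[OF that(1,2) Ic[OF that(3)] that(4)] S_mult[OF that(2,4)] I.I_l_closed[OF that(3,1)] by simp
  have Ji: "ideal J L"
  proof (rule L.idealI')
    show "J \<subseteq> carrier L" unfolding J_def using Ic fr_carrier by auto
    show "\<zero>\<^bsub>L\<^esub> \<in> J" unfolding J_def L_zero using I.zero_closed S_one by blast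
    fix q assume "q \<in> J"
    then obtain y s where q: "y \<in> I" "s \<in> S" "q = fr y s" using Jmem by blast
    { fix q' assume "q' \<in> J"
      then obtain y' s' where q': "y' \<in> I" "s' \<in> S" "q' = fr y' s'" using Jmem by blast
      show "q \<oplus>\<^bsub>L\<^esub> q' \<in> J" unfolding J_def q(3) q'(3) using add[OF q(1,2) q'(1,2)] by blast }
    { fix r assume "r \<in> carrier L"
      then obtain a t where r: "a \<in> carrier T" "t \<in> S" "r = fr a t" unfolding L_carrier by blast
      show "r \<otimes>\<^bsub>L\<^esub> q \<in> J" unfolding J_def q(3) r(3) using smult[OF r(1,2) q(1,2)] by blast }
  qed
  have dJ: "?\<delta> \<in> J" unfolding J_def using I(2) S_one by blast
  have lin: "lin_mod L (PIdl\<^bsub>L\<^esub> ?\<delta>) (ring_module L) J \<Phi>"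
    unfolding lin_mod_def
  proof (intro conjI ballI)
    fix q assume "q \<in> J"
    then obtain y s where q: "y \<in> I" "s \<in> S" "q = fr y s" using Jmem by blast
    note c = \<phi>c[OF q(1)] S_carrier[OF q(2)]
    have \<Phi>q: "ideal_cong L (PIdl\<^bsub>L\<^esub> ?\<delta>) (\<Phi> q) (fr (\<phi> y) s)" unfolding q(3) by (rule \<Phi>[OF q(1,2)])
    then show "\<Phi> q \<in> carrier L" by (simp add: ideal_cong_def)
    { fix q' assume "q' \<in> J"
      then obtain y' s' where q': "y' \<in> I" "s' \<in> S" "q' = fr y' s'" using Jmem by blast
      note c' = \<phi>c[OF q'(1)] S_carrier[OF q'(2)]
      note ad = add[OF q(1,2) q'(1,2)]
      have \<Phi>q': "ideal_cong L (PIdl\<^bsub>L\<^esub> ?\<delta>) (\<Phi> q') (fr (\<phi> y') s')" unfolding q'(3) by (rule \<Phi>[OF q'(1,2)])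
      have "ideal_cong T (PIdl d) (\<phi> (y \<otimes> s' \<oplus> y' \<otimes> s)) (\<phi> (s' \<otimes> y) \<oplus> \<phi> (s \<otimes> y'))"
        using \<phi>a[OF I.I_l_closed[OF q(1) c'(2)] I.I_l_closed[OF q'(1) c(2)]] c c' Ic[OF q(1)] Ic[OF q'(1)] by (simp add: m_comm)
      moreover have "ideal_cong T (PIdl d) (\<phi> (s' \<otimes> y) \<oplus> \<phi> (s \<otimes> y')) (s' \<otimes> \<phi> y \<oplus> s \<otimes> \<phi> y')"
        by (rule D.cong_add[OF \<phi>m[OF c'(2) q(1)] \<phi>m[OF c(2) q'(1)]])
      ultimately have "ideal_cong T (PIdl d) (\<phi> (y \<otimes> s' \<oplus> y' \<otimes> s)) (s' \<otimes> \<phi> y \<oplus> s \<otimes> \<phi> y')" by (rule D.cong_trans)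
      moreover have "s' \<otimes> \<phi> y \<oplus> s \<otimes> \<phi> y' = \<phi> y \<otimes> s' \<oplus> \<phi> y' \<otimes> s" using c c' by (simp add: m_comm)
      ultimately have "ideal_cong L (PIdl\<^bsub>L\<^esub> ?\<delta>) (fr (\<phi> (y \<otimes> s' \<oplus> y' \<otimes> s)) (s \<otimes> s')) (fr (\<phi> y \<otimes> s' \<oplus> \<phi> y' \<otimes> s) (s \<otimes> s'))"
        using cong1 ad by metis
      then have "ideal_cong L (PIdl\<^bsub>L\<^esub> ?\<delta>) (\<Phi> (q \<oplus>\<^bsub>L\<^esub> q')) (fr (\<phi> y \<otimes> s' \<oplus> \<phi> y' \<otimes> s) (s \<otimes> s'))"
        using E.cong_trans[OF \<Phi>[of "y \<otimes> s' \<oplus> y' \<otimes> s" "s \<otimes> s'"]] ad q(3) q'(3) by simp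
      then have "ideal_cong L (PIdl\<^bsub>L\<^esub> ?\<delta>) (\<Phi> (q \<oplus>\<^bsub>L\<^esub> q')) (fr (\<phi> y) s \<oplus>\<^bsub>L\<^esub> fr (\<phi> y') s')"
        using L_add[OF c(1) q(2) c'(1) q'(2)] by simp
      then show "ideal_cong L (PIdl\<^bsub>L\<^esub> ?\<delta>) (\<Phi> (q \<oplus>\<^bsub>ring_module L\<^esub> q')) (\<Phi> q \<oplus>\<^bsub>L\<^esub> \<Phi> q')"
        using E.cong_trans[OF _ E.cong_sym[OF E.cong_add[OF \<Phi>q \<Phi>q']]] by simp }
    { fix r assume "r \<in> carrier L"
      then obtain a t where r: "a \<in> carrier T" "t \<in> S" "r = fr a t" unfolding L_carrier by blast
      note sm = smult[OF r(1,2) q(1,2)]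
      have "ideal_cong L (PIdl\<^bsub>L\<^esub> ?\<delta>) (fr (\<phi> (a \<otimes> y)) (t \<otimes> s)) (fr (a \<otimes> \<phi> y) (t \<otimes> s))"
        using cong1[OF \<phi>m[OF r(1) q(1)]] sm by blast
      then have "ideal_cong L (PIdl\<^bsub>L\<^esub> ?\<delta>) (\<Phi> (r \<otimes>\<^bsub>L\<^esub> q)) (fr (a \<otimes> \<phi> y) (t \<otimes> s))"
        using E.cong_trans[OF \<Phi>[of "a \<otimes> y" "t \<otimes> s"]] sm q(3) r(3) by simp
      then have "ideal_cong L (PIdl\<^bsub>L\<^esub> ?\<delta>) (\<Phi> (r \<otimes>\<^bsub>L\<^esub> q)) (r \<otimes>\<^bsub>L\<^esub> fr (\<phi> y) s)"
        using L_mult[OF r(1,2) c(1) q(2)] r(3) by simp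
      then show "ideal_cong L (PIdl\<^bsub>L\<^esub> ?\<delta>) (\<Phi> (r \<odot>\<^bsub>ring_module L\<^esub> q)) (r \<otimes>\<^bsub>L\<^esub> \<Phi> q)"
        using E.cong_trans[OF _ E.cong_sym[OF E.cong_mult[OF \<Phi>q \<open>r \<in> carrier L\<close>]]] by simp }
  qed
  have "ideal_cong T (PIdl d) (\<phi> d) \<zero>" using D.cong_zero_iff[OF \<phi>c[OF I(2)]] \<phi>(2) by simp
  then have "ideal_cong L (PIdl\<^bsub>L\<^esub> ?\<delta>) (fr (\<phi> d) \<one>) \<zero>\<^bsub>L\<^esub>" unfolding L_zero by (rule cong1[OF _ S_one])
  then have "ideal_cong L (PIdl\<^bsub>L\<^esub> ?\<delta>) (\<Phi> ?\<delta>) \<zero>\<^bsub>L\<^esub>" by (rule E.cong_trans[OF \<Phi>[OF I(2) S_one]])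
  then have "\<Phi> ?\<delta> \<in> PIdl\<^bsub>L\<^esub> ?\<delta>" using E.cong_zero_iff E.cong_carrier by blast
  from assms(4)[unfolded self_injective_def, rule_format, OF Ji dJ lin this]
  obtain q where q: "q \<in> carrier L" "\<forall>x\<in>J. ideal_cong L (PIdl\<^bsub>L\<^esub> ?\<delta>) (\<Phi> x) (x \<otimes>\<^bsub>L\<^esub> q)"
    by (elim bexE) (rule that)
  obtain e v where e: "e \<in> carrier T" "v \<in> S" "q = fr e v" using q(1) unfolding L_carrier by blast
  have vc: "v \<in> carrier T" by (rule S_carrier[OF e(2)])
  \<comment> \<open>The elements of I for which the multiplier u suffices. They form an ideal that
    grows when u is multiplied by elements of S, so a common u for finitely many generators serves
    all of I.\<close>
  let ?G = "\<lambda>u. {y \<in> I. ideal_cong T (PIdl d) (u \<otimes> (v \<otimes> \<phi> y)) (u \<otimes> (y \<otimes> e))}"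
  have each: "\<exists>u\<in>S. y \<in> ?G u" if y: "y \<in> I" for y
  proof -
    have "fr y \<one> \<in> J" unfolding J_def using y S_one by blast
    then have "ideal_cong L (PIdl\<^bsub>L\<^esub> ?\<delta>) (\<Phi> (fr y \<one>)) (fr y \<one> \<otimes>\<^bsub>L\<^esub> q)" using q(2) by blast
    then have "ideal_cong L (PIdl\<^bsub>L\<^esub> ?\<delta>) (fr (\<phi> y) \<one>) (fr (y \<otimes> e) v)"
      using E.cong_trans[OF E.cong_sym[OF \<Phi>[OF y S_one]]] L_mult[OF Ic[OF y] S_one e(1,2)] e(3) vc by simp
    from cong_locD[OF assms(1,3) \<phi>c[OF y] S_one _ e(2) this]
    obtain u where "u \<in> S" "ideal_cong T (PIdl d) (u \<otimes> (\<phi> y \<otimes> v)) (u \<otimes> ((y \<otimes> e) \<otimes> \<one>))"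
      using Ic[OF y] e(1) by auto
    then show ?thesis using y Ic[OF y] \<phi>c[OF y] e(1) vc by (auto simp: m_comm intro!: bexI[of _ u])
  qed
  have G: "ideal (?G u) T" if u: "u \<in> S" for u
  proof (rule idealI')
    have uc: "u \<in> carrier T" by (rule S_carrier[OF u])
    show "?G u \<subseteq> carrier T" using Ic by blast
    have z: "\<phi> \<zero> \<in> carrier T" by (rule \<phi>c[OF I.zero_closed])
    have "ideal_cong T (PIdl d) (\<phi> (\<zero> \<otimes> \<zero>)) (\<zero> \<otimes> \<phi> \<zero>)" by (rule \<phi>m[OF T_zero I.zero_closed])
    then have "ideal_cong T (PIdl d) (\<phi> \<zero>) \<zero>" using z T_zero by simp
    from D.cong_mult[OF this, of "u \<otimes> v"]
    show "\<zero> \<in> ?G u" using uc vc z e(1) T_zero I.zero_closed by (simp add: m_assoc)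
    fix x assume x: "x \<in> ?G u"
    note xc = Ic[of x] \<phi>c[of x]
    { fix y assume y: "y \<in> ?G u"
      note yc = Ic[of y] \<phi>c[of y]
      have "ideal_cong T (PIdl d) ((u \<otimes> v) \<otimes> \<phi> (x \<oplus> y)) ((u \<otimes> v) \<otimes> (\<phi> x \<oplus> \<phi> y))"
        by (rule D.cong_mult[OF \<phi>a]) (use x y uc vc in simp_all)
      then have "ideal_cong T (PIdl d) (u \<otimes> (v \<otimes> \<phi> (x \<oplus> y))) (u \<otimes> (v \<otimes> \<phi> x) \<oplus> u \<otimes> (v \<otimes> \<phi> y))"
        using x y xc yc uc vc \<phi>c[of "x \<oplus> y"] by (simp add: m_assoc r_distr)
      moreover have "ideal_cong T (PIdl d) (u \<otimes> (v \<otimes> \<phi> x) \<oplus> u \<otimes> (v \<otimes> \<phi> y)) (u \<otimes> (x \<otimes> e) \<oplus> u \<otimes> (y \<otimes> e))"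
        by (rule D.cong_add) (use x y in simp_all)
      ultimately have "ideal_cong T (PIdl d) (u \<otimes> (v \<otimes> \<phi> (x \<oplus> y))) (u \<otimes> (x \<otimes> e) \<oplus> u \<otimes> (y \<otimes> e))" by (rule D.cong_trans)
      then show "x \<oplus> y \<in> ?G u" using x y xc yc uc e(1) by (simp add: r_distr l_distr) }
    { fix r assume r: "r \<in> carrier T"
      have "ideal_cong T (PIdl d) ((u \<otimes> v) \<otimes> \<phi> (r \<otimes> x)) ((u \<otimes> v) \<otimes> (r \<otimes> \<phi> x))"
        by (rule D.cong_mult[OF \<phi>m]) (use x r uc vc in simp_all)
      then have "ideal_cong T (PIdl d) (u \<otimes> (v \<otimes> \<phi> (r \<otimes> x))) (r \<otimes> (u \<otimes> (v \<otimes> \<phi> x)))"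
        using x xc uc vc r \<phi>c[OF I.I_l_closed[of x r]] by (simp add: m_ac)
      moreover have "ideal_cong T (PIdl d) (r \<otimes> (u \<otimes> (v \<otimes> \<phi> x))) (r \<otimes> (u \<otimes> (x \<otimes> e)))"
        by (rule D.cong_mult[OF _ r]) (use x in simp)
      ultimately have "ideal_cong T (PIdl d) (u \<otimes> (v \<otimes> \<phi> (r \<otimes> x))) (r \<otimes> (u \<otimes> (x \<otimes> e)))" by (rule D.cong_trans)
      then show "r \<otimes> x \<in> ?G u" using x xc uc e(1) r I.I_l_closed[of x r] by (simp add: m_ac) }
  qed
  have mono: "?G u \<subseteq> ?G (w \<otimes> u)" if uw: "u \<in> S" "w \<in> S" for u w
  proof
    fix y assume y: "y \<in> ?G u"
    have "ideal_cong T (PIdl d) (w \<otimes> (u \<otimes> (v \<otimes> \<phi> y))) (w \<otimes> (u \<otimes> (y \<otimes> e)))"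
      by (rule D.cong_mult[OF _ S_carrier[OF uw(2)]]) (use y in simp)
    then show "y \<in> ?G (w \<otimes> u)"
      using y Ic[of y] \<phi>c[of y] S_carrier[OF uw(1)] S_carrier[OF uw(2)] vc e(1) by (simp add: m_assoc)
  qed
  obtain A where A: "A \<subseteq> carrier T" "finite A" "I = Idl A" using N.finetely_gen[OF I(1)] by blast
  have AI: "A \<subseteq> I" using genideal_self[OF A(1)] A(3) by simp
  have "\<exists>u\<in>S. B \<subseteq> ?G u" if "finite B" "B \<subseteq> I" for B
    using that
  proof induction
    case empty
    then show ?case using S_one by blast
  next
    case (insert b B)
    then obtain u where u: "u \<in> S" "B \<subseteq> ?G u" by auto
    obtain w where w: "w \<in> S" "b \<in> ?G w" using each[of b] insert.prems by auto
    have "B \<subseteq> ?G (w \<otimes> u)" using mono[OF u(1) w(1)] u(2) by blast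
    moreover have "b \<in> ?G (u \<otimes> w)" using mono[OF w(1) u(1)] w(2) by blast
    moreover have "u \<otimes> w = w \<otimes> u" by (rule m_comm[OF S_carrier[OF u(1)] S_carrier[OF w(1)]])
    ultimately show ?case using S_mult[OF w(1) u(1)] by (intro bexI[of _ "w \<otimes> u"]) auto
  qed
  from this[OF A(2) AI] obtain u where u: "u \<in> S" "A \<subseteq> ?G u" by (rule bexE)
  have IG: "I \<subseteq> ?G u" using genideal_minimal[OF G[OF u(1)] u(2)] A(3) by simp
  have uc: "u \<in> carrier T" by (rule S_carrier[OF u(1)])
  have "ideal_cong T (PIdl d) ((u \<otimes> v) \<otimes> \<phi> y) (y \<otimes> (u \<otimes> e))" if y: "y \<in> I" for y
  proof -
    have "ideal_cong T (PIdl d) (u \<otimes> (v \<otimes> \<phi> y)) (u \<otimes> (y \<otimes> e))" using IG y by blast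
    then show ?thesis using Ic[OF y] \<phi>c[OF y] uc vc e(1) by (simp add: m_assoc m_lcomm)
  qed
  then show ?thesis using S_mult[OF u(1) e(2)] uc e(1)
    by (intro bexI[of _ "u \<otimes> v"] bexI[of _ "u \<otimes> e"]) simp_all
qed

end

text \<open>The multipliers t for which t\<phi> is a multiplication modulo a^k form an ideal. The
  local statement gives it an element outside each maximal ideal, so it contains 1.\<close>

lemma gorenstein_ring_self_injective:
  assumes "gorenstein_ring T" "nonzerodivisor T a"
    and "\<And>\<nn>. maximalideal \<nn> T \<Longrightarrow> a \<in> \<nn>"
    and "\<And>P. primeideal P T \<Longrightarrow> a \<in> P \<Longrightarrow> maximalideal P T"
  shows "self_injective T (a [^]\<^bsub>T\<^esub> (k::nat))"
  unfolding self_injective_def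
proof (intro allI impI)
  have cr: "cring T" and noeth: "noetherian_ring T" using assms(1) by (auto simp: gorenstein_ring_def)
  interpret T: cring T by (rule cr)
  interpret N: noetherian_ring T by (rule noeth)
  let ?d = "a [^]\<^bsub>T\<^esub> k"
  have a: "a \<in> carrier T" using assms(2) by (simp add: nonzerodivisor_def)
  have d: "?d \<in> carrier T" using a by simp
  let ?D = "PIdl\<^bsub>T\<^esub> ?d"
  interpret D: ideal ?D T by (rule T.cgenideal_ideal[OF d])
  fix I \<phi> assume I: "ideal I T" "?d \<in> I" and \<phi>: "lin_mod T ?D (ring_module T) I \<phi>" "\<phi> ?d \<in> ?D"
  interpret I: ideal I T by (rule I)
  have Ic: "y \<in> carrier T" if "y \<in> I" for y using that by (rule I.Icarr)
  have \<phi>c: "\<phi> y \<in> carrier T" if "y \<in> I" for y by (rule lin_modD(3)[OF \<phi>(1) that])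
  define U where "U = {t \<in> carrier T. \<exists>c\<in>carrier T. \<forall>y\<in>I. ideal_cong T ?D (t \<otimes>\<^bsub>T\<^esub> \<phi> y) (y \<otimes>\<^bsub>T\<^esub> c)}"
  have U: "ideal U T"
  proof (rule T.idealI')
    show "U \<subseteq> carrier T" by (auto simp: U_def)
    show "\<zero>\<^bsub>T\<^esub> \<in> U"
      unfolding U_def using Ic \<phi>c D.cong_refl by (auto intro!: bexI[of _ "\<zero>\<^bsub>T\<^esub>"])
    fix t assume t: "t \<in> U"
    then obtain c where c: "t \<in> carrier T" "c \<in> carrier T" "\<forall>y\<in>I. ideal_cong T ?D (t \<otimes>\<^bsub>T\<^esub> \<phi> y) (y \<otimes>\<^bsub>T\<^esub> c)"
      unfolding U_def by blast
    { fix s assume s: "s \<in> U"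
      then obtain e where e: "s \<in> carrier T" "e \<in> carrier T" "\<forall>y\<in>I. ideal_cong T ?D (s \<otimes>\<^bsub>T\<^esub> \<phi> y) (y \<otimes>\<^bsub>T\<^esub> e)"
        unfolding U_def by blast
      have "ideal_cong T ?D ((t \<oplus>\<^bsub>T\<^esub> s) \<otimes>\<^bsub>T\<^esub> \<phi> y) (y \<otimes>\<^bsub>T\<^esub> (c \<oplus>\<^bsub>T\<^esub> e))" if y: "y \<in> I" for y
        using D.cong_add[OF c(3)[rule_format, OF y] e(3)[rule_format, OF y]] c e Ic[OF y] \<phi>c[OF y]
        by (simp add: T.l_distr T.r_distr)
      then show "t \<oplus>\<^bsub>T\<^esub> s \<in> U" unfolding U_def using c e by (intro CollectI conjI bexI[of _ "c \<oplus>\<^bsub>T\<^esub> e"]) auto }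
    { fix r assume r: "r \<in> carrier T"
      have "ideal_cong T ?D ((r \<otimes>\<^bsub>T\<^esub> t) \<otimes>\<^bsub>T\<^esub> \<phi> y) (y \<otimes>\<^bsub>T\<^esub> (r \<otimes>\<^bsub>T\<^esub> c))" if y: "y \<in> I" for y
        using D.cong_mult[OF c(3)[rule_format, OF y] r] c r Ic[OF y] \<phi>c[OF y] by (simp add: T.m_assoc T.m_lcomm)
      then show "r \<otimes>\<^bsub>T\<^esub> t \<in> U" unfolding U_def using c r by (intro CollectI conjI bexI[of _ "r \<otimes>\<^bsub>T\<^esub> c"]) auto }
  qed
  have "U = carrier T"
  proof (rule ccontr)
    assume "U \<noteq> carrier T"
    then obtain \<nn> where n: "maximalideal \<nn> T" "U \<subseteq> \<nn>"
      by (rule N.ex_maximalideal[OF U]) (assumption | rule that)+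
    interpret M: maximalideal \<nn> T by (rule n(1))
    define S where "S = carrier T - \<nn>"
    define fr where "fr = fraction T S"
    define L where "L = localization_at T \<nn>"
    interpret loc: loc_at T \<nn> S fr L by (unfold_locales) (simp_all add: S_def fr_def L_def)
    obtain \<mm> where m: "gorenstein_local_ring L \<mm>" using assms(1) n(1) unfolding gorenstein_ring_def L_def by blast
    then have Lc: "cring L" by (simp add: gorenstein_local_ring_def local_ring_def)
    have pm: "P = \<nn>" if "primeideal P T" "a \<in> P" "P \<subseteq> \<nn>" for P
    proof -
      interpret P: maximalideal P T by (rule assms(4)[OF that(1,2)])
      show ?thesis using P.I_maximal[OF M.is_ideal that(3) M.a_subset] M.I_notcarr by blast
    qed
    have si: "self_injective L (fr ?d \<one>\<^bsub>T\<^esub>)"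
      by (rule loc.loc_self_injective[OF m assms(2) assms(3)[OF n(1)] pm])
    obtain t c where t: "t \<in> S" "c \<in> carrier T" "\<forall>y\<in>I. ideal_cong T ?D (t \<otimes>\<^bsub>T\<^esub> \<phi> y) (y \<otimes>\<^bsub>T\<^esub> c)"
      using loc.loc_lin_mod[OF Lc noeth d si I \<phi>] by (elim bexE) (rule that)
    then have "t \<in> U" unfolding U_def S_def by blast
    then show False using t(1) n(2) unfolding S_def by blast
  qed
  then have "\<one>\<^bsub>T\<^esub> \<in> U" by simp
  then obtain c where c: "c \<in> carrier T" "\<forall>y\<in>I. ideal_cong T ?D (\<one>\<^bsub>T\<^esub> \<otimes>\<^bsub>T\<^esub> \<phi> y) (y \<otimes>\<^bsub>T\<^esub> c)"
    unfolding U_def by blast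
  then show "\<exists>c\<in>carrier T. \<forall>x\<in>I. ideal_cong T ?D (\<phi> x) (x \<otimes>\<^bsub>T\<^esub> c)"
    using \<phi>c by (intro bexI[OF _ c(1)]) simp
qed

subsection \<open>Extension of maps modulo an element\<close>

definition adjoin :: "('a, 'c) ring_scheme \<Rightarrow> ('a, 'b, 'd) module_scheme \<Rightarrow> 'b set \<Rightarrow> 'b \<Rightarrow> 'b set" where
  "adjoin R N K y = {z \<oplus>\<^bsub>N\<^esub> r \<odot>\<^bsub>N\<^esub> y | z r. z \<in> K \<and> r \<in> carrier R}"

lemma adjoin_submodule:
  assumes "module R N" "submodule K R N" "y \<in> carrier N"
  shows "submodule (adjoin R N K y) R N" "K \<subseteq> adjoin R N K y" "y \<in> adjoin R N K y"
proof -
  interpret N: module R N by fact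
  note E = N.submoduleE[OF assms(2)]
  have zc: "z \<in> carrier N" if "z \<in> K" for z using E(1) that by blast
  show "submodule (adjoin R N K y) R N"
  proof (rule N.submoduleI)
    show "adjoin R N K y \<subseteq> carrier N" using zc assms(3) by (auto simp: adjoin_def)
    have "\<zero>\<^bsub>N\<^esub> = \<zero>\<^bsub>N\<^esub> \<oplus>\<^bsub>N\<^esub> \<zero>\<^bsub>R\<^esub> \<odot>\<^bsub>N\<^esub> y" using assms(3) by simp
    then show "\<zero>\<^bsub>N\<^esub> \<in> adjoin R N K y" unfolding adjoin_def using submodule_zero[OF assms(2)] N.R.zero_closed by blast
    fix a assume "a \<in> adjoin R N K y"
    then obtain z r where a: "a = z \<oplus>\<^bsub>N\<^esub> r \<odot>\<^bsub>N\<^esub> y" "z \<in> K" "r \<in> carrier R" by (auto simp: adjoin_def)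
    have "\<ominus>\<^bsub>N\<^esub> a = (\<ominus>\<^bsub>N\<^esub> z) \<oplus>\<^bsub>N\<^esub> (\<ominus>\<^bsub>R\<^esub> r) \<odot>\<^bsub>N\<^esub> y"
      using a zc[OF a(2)] assms(3) by (simp add: N.minus_add N.smult_l_minus)
    then show "\<ominus>\<^bsub>N\<^esub> a \<in> adjoin R N K y" unfolding adjoin_def using a E(3) N.R.a_inv_closed by blast
    { fix b assume "b \<in> adjoin R N K y"
      then obtain z' r' where b: "b = z' \<oplus>\<^bsub>N\<^esub> r' \<odot>\<^bsub>N\<^esub> y" "z' \<in> K" "r' \<in> carrier R" by (auto simp: adjoin_def)
      have "a \<oplus>\<^bsub>N\<^esub> b = (z \<oplus>\<^bsub>N\<^esub> z') \<oplus>\<^bsub>N\<^esub> (r \<oplus>\<^bsub>R\<^esub> r') \<odot>\<^bsub>N\<^esub> y"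
        using a b zc assms(3) by (simp add: N.smult_l_distr N.a_ac)
      then show "a \<oplus>\<^bsub>N\<^esub> b \<in> adjoin R N K y" unfolding adjoin_def using a b E(5) N.R.a_closed by blast }
    { fix s assume s: "s \<in> carrier R"
      have "s \<odot>\<^bsub>N\<^esub> a = (s \<odot>\<^bsub>N\<^esub> z) \<oplus>\<^bsub>N\<^esub> (s \<otimes>\<^bsub>R\<^esub> r) \<odot>\<^bsub>N\<^esub> y"
        using a s zc assms(3) by (simp add: N.smult_r_distr N.smult_assoc1)
      then show "s \<odot>\<^bsub>N\<^esub> a \<in> adjoin R N K y" unfolding adjoin_def using a s E(4) N.R.m_closed by blast }
  qed
  show "K \<subseteq> adjoin R N K y"
  proof
    fix z assume z: "z \<in> K"
    then have "z = z \<oplus>\<^bsub>N\<^esub> \<zero>\<^bsub>R\<^esub> \<odot>\<^bsub>N\<^esub> y" using zc assms(3) by simp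
    then show "z \<in> adjoin R N K y" unfolding adjoin_def using z N.R.zero_closed by blast
  qed
  have "y = \<zero>\<^bsub>N\<^esub> \<oplus>\<^bsub>N\<^esub> \<one>\<^bsub>R\<^esub> \<odot>\<^bsub>N\<^esub> y" using assms(3) by simp
  then show "y \<in> adjoin R N K y" unfolding adjoin_def using submodule_zero[OF assms(2)] N.R.one_closed by blast
qed

text \<open>An element of K + Ry has many expressions z + sy, and \<open>\<psi>'\<close> evaluates a
  chosen one. Two expressions differ by a multiple (s - s')y that lies in K, where the compatibility
  of c with \<open>\<psi>\<close> makes the values agree modulo D.\<close>

lemma lin_mod_adjoin:
  assumes "module R N" "ideal D R" "submodule K R N" "y \<in> carrier N" "lin_mod R D N K \<psi>" "c \<in> carrier R"
    and "\<And>s. s \<in> carrier R \<Longrightarrow> s \<odot>\<^bsub>N\<^esub> y \<in> K \<Longrightarrow> ideal_cong R D (\<psi> (s \<odot>\<^bsub>N\<^esub> y)) (s \<otimes>\<^bsub>R\<^esub> c)"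
  obtains \<psi>' where "lin_mod R D N (adjoin R N K y) \<psi>'"
    "\<And>z s. z \<in> K \<Longrightarrow> s \<in> carrier R \<Longrightarrow> ideal_cong R D (\<psi>' (z \<oplus>\<^bsub>N\<^esub> s \<odot>\<^bsub>N\<^esub> y)) (\<psi> z \<oplus>\<^bsub>R\<^esub> s \<otimes>\<^bsub>R\<^esub> c)"
proof -
  interpret N: module R N by fact
  interpret D: ideal D R by fact
  note E = N.submoduleE[OF assms(3)]
  have zc: "z \<in> carrier N" if "z \<in> K" for z using E(1) that by blast
  have pc: "\<psi> z \<in> carrier R" if "z \<in> K" for z by (rule lin_modD(3)[OF assms(5) that])
  define \<psi>' where "\<psi>' w = (let p = SOME p. fst p \<in> K \<and> snd p \<in> carrier R \<and> w = fst p \<oplus>\<^bsub>N\<^esub> snd p \<odot>\<^bsub>N\<^esub> y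
      in \<psi> (fst p) \<oplus>\<^bsub>R\<^esub> snd p \<otimes>\<^bsub>R\<^esub> c)" for w
  have eval: "ideal_cong R D (\<psi>' (z \<oplus>\<^bsub>N\<^esub> s \<odot>\<^bsub>N\<^esub> y)) (\<psi> z \<oplus>\<^bsub>R\<^esub> s \<otimes>\<^bsub>R\<^esub> c)" if zs: "z \<in> K" "s \<in> carrier R" for z s
  proof -
    define p where "p = (SOME p. fst p \<in> K \<and> snd p \<in> carrier R \<and> z \<oplus>\<^bsub>N\<^esub> s \<odot>\<^bsub>N\<^esub> y = fst p \<oplus>\<^bsub>N\<^esub> snd p \<odot>\<^bsub>N\<^esub> y)"
    have "fst p \<in> K \<and> snd p \<in> carrier R \<and> z \<oplus>\<^bsub>N\<^esub> s \<odot>\<^bsub>N\<^esub> y = fst p \<oplus>\<^bsub>N\<^esub> snd p \<odot>\<^bsub>N\<^esub> y"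
      unfolding p_def by (rule someI[of _ "(z, s)"]) (use zs in simp)
    then obtain z' s' where p: "p = (z', s')" "z' \<in> K" "s' \<in> carrier R" "z \<oplus>\<^bsub>N\<^esub> s \<odot>\<^bsub>N\<^esub> y = z' \<oplus>\<^bsub>N\<^esub> s' \<odot>\<^bsub>N\<^esub> y"
      by (cases p) auto
    have val: "\<psi>' (z \<oplus>\<^bsub>N\<^esub> s \<odot>\<^bsub>N\<^esub> y) = \<psi> z' \<oplus>\<^bsub>R\<^esub> s' \<otimes>\<^bsub>R\<^esub> c" using p(1) by (simp add: \<psi>'_def flip: p_def)
    let ?t = "s \<ominus>\<^bsub>R\<^esub> s'"
    have t: "?t \<in> carrier R" using zs p by simp
    note cz = zc[OF zs(1)] zc[OF p(2)]
    have sy: "s \<odot>\<^bsub>N\<^esub> y \<in> carrier N" "s' \<odot>\<^bsub>N\<^esub> y \<in> carrier N" using zs p assms(4) by simp_all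
    have "z \<oplus>\<^bsub>N\<^esub> ?t \<odot>\<^bsub>N\<^esub> y = (z \<oplus>\<^bsub>N\<^esub> s \<odot>\<^bsub>N\<^esub> y) \<ominus>\<^bsub>N\<^esub> s' \<odot>\<^bsub>N\<^esub> y"
      using cz sy zs p(3) assms(4) by (simp add: a_minus_def N.smult_l_distr N.smult_l_minus N.a_assoc)
    also have "\<dots> = (z' \<oplus>\<^bsub>N\<^esub> s' \<odot>\<^bsub>N\<^esub> y) \<ominus>\<^bsub>N\<^esub> s' \<odot>\<^bsub>N\<^esub> y" unfolding p(4) ..
    also have "\<dots> = z'" using cz sy by (simp add: a_minus_def N.a_assoc N.r_neg)
    finally have z': "z \<oplus>\<^bsub>N\<^esub> ?t \<odot>\<^bsub>N\<^esub> y = z'" .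
    have "?t \<odot>\<^bsub>N\<^esub> y = (\<ominus>\<^bsub>N\<^esub> z) \<oplus>\<^bsub>N\<^esub> (z \<oplus>\<^bsub>N\<^esub> ?t \<odot>\<^bsub>N\<^esub> y)"
      using cz t assms(4) by (simp add: N.l_neg flip: N.a_assoc)
    then have tK: "?t \<odot>\<^bsub>N\<^esub> y \<in> K" unfolding z' using E(3)[OF zs(1)] E(5) p(2) by simp
    have "ideal_cong R D (\<psi> z') (\<psi> z \<oplus>\<^bsub>R\<^esub> \<psi> (?t \<odot>\<^bsub>N\<^esub> y))" using lin_modD(1)[OF assms(5) zs(1) tK] z' by simp
    moreover have "ideal_cong R D (\<psi> z \<oplus>\<^bsub>R\<^esub> \<psi> (?t \<odot>\<^bsub>N\<^esub> y)) (\<psi> z \<oplus>\<^bsub>R\<^esub> ?t \<otimes>\<^bsub>R\<^esub> c)"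
      by (rule D.cong_add[OF D.cong_refl[OF pc[OF zs(1)]] assms(7)[OF t tK]])
    ultimately have "ideal_cong R D (\<psi> z') (\<psi> z \<oplus>\<^bsub>R\<^esub> ?t \<otimes>\<^bsub>R\<^esub> c)" by (rule D.cong_trans)
    then have "ideal_cong R D (\<psi> z' \<oplus>\<^bsub>R\<^esub> s' \<otimes>\<^bsub>R\<^esub> c) ((\<psi> z \<oplus>\<^bsub>R\<^esub> ?t \<otimes>\<^bsub>R\<^esub> c) \<oplus>\<^bsub>R\<^esub> s' \<otimes>\<^bsub>R\<^esub> c)"
      by (rule D.cong_add[OF _ D.cong_refl]) (use p(3) assms(6) in simp)
    moreover have "(\<psi> z \<oplus>\<^bsub>R\<^esub> ?t \<otimes>\<^bsub>R\<^esub> c) \<oplus>\<^bsub>R\<^esub> s' \<otimes>\<^bsub>R\<^esub> c = \<psi> z \<oplus>\<^bsub>R\<^esub> s \<otimes>\<^bsub>R\<^esub> c"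
      using pc[OF zs(1)] zs(2) p(3) assms(6) by algebra
    ultimately show ?thesis using val by simp
  qed
  have lin: "lin_mod R D N (adjoin R N K y) \<psi>'"
    unfolding lin_mod_def
  proof (intro conjI ballI)
    fix w assume "w \<in> adjoin R N K y"
    then obtain z s where w: "z \<in> K" "s \<in> carrier R" "w = z \<oplus>\<^bsub>N\<^esub> s \<odot>\<^bsub>N\<^esub> y" by (auto simp: adjoin_def)
    note ew = eval[OF w(1,2), folded w(3)]
    show "\<psi>' w \<in> carrier R" using ew by (simp add: ideal_cong_def)
    { fix w' assume "w' \<in> adjoin R N K y"
      then obtain z' s' where w': "z' \<in> K" "s' \<in> carrier R" "w' = z' \<oplus>\<^bsub>N\<^esub> s' \<odot>\<^bsub>N\<^esub> y" by (auto simp: adjoin_def)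
      note ew' = eval[OF w'(1,2), folded w'(3)]
      have "w \<oplus>\<^bsub>N\<^esub> w' = (z \<oplus>\<^bsub>N\<^esub> z') \<oplus>\<^bsub>N\<^esub> (s \<oplus>\<^bsub>R\<^esub> s') \<odot>\<^bsub>N\<^esub> y"
        using w w' zc assms(4) by (simp add: N.smult_l_distr N.a_ac)
      then have "ideal_cong R D (\<psi>' (w \<oplus>\<^bsub>N\<^esub> w')) (\<psi> (z \<oplus>\<^bsub>N\<^esub> z') \<oplus>\<^bsub>R\<^esub> (s \<oplus>\<^bsub>R\<^esub> s') \<otimes>\<^bsub>R\<^esub> c)"
        using eval[OF E(5)[OF w(1) w'(1)] N.R.a_closed[OF w(2) w'(2)]] by simp
      moreover have "ideal_cong R D (\<psi> (z \<oplus>\<^bsub>N\<^esub> z') \<oplus>\<^bsub>R\<^esub> (s \<oplus>\<^bsub>R\<^esub> s') \<otimes>\<^bsub>R\<^esub> c) ((\<psi> z \<oplus>\<^bsub>R\<^esub> \<psi> z') \<oplus>\<^bsub>R\<^esub> (s \<oplus>\<^bsub>R\<^esub> s') \<otimes>\<^bsub>R\<^esub> c)"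
        by (rule D.cong_add[OF lin_modD(1)[OF assms(5) w(1) w'(1)] D.cong_refl]) (use w w' assms(6) in simp)
      moreover have "(\<psi> z \<oplus>\<^bsub>R\<^esub> \<psi> z') \<oplus>\<^bsub>R\<^esub> (s \<oplus>\<^bsub>R\<^esub> s') \<otimes>\<^bsub>R\<^esub> c = (\<psi> z \<oplus>\<^bsub>R\<^esub> s \<otimes>\<^bsub>R\<^esub> c) \<oplus>\<^bsub>R\<^esub> (\<psi> z' \<oplus>\<^bsub>R\<^esub> s' \<otimes>\<^bsub>R\<^esub> c)"
        using pc[OF w(1)] pc[OF w'(1)] w(2) w'(2) assms(6) by algebra
      ultimately show "ideal_cong R D (\<psi>' (w \<oplus>\<^bsub>N\<^esub> w')) (\<psi>' w \<oplus>\<^bsub>R\<^esub> \<psi>' w')"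
        using D.cong_trans D.cong_sym[OF D.cong_add[OF ew ew']] by metis }
    { fix r assume r: "r \<in> carrier R"
      have "r \<odot>\<^bsub>N\<^esub> w = (r \<odot>\<^bsub>N\<^esub> z) \<oplus>\<^bsub>N\<^esub> (r \<otimes>\<^bsub>R\<^esub> s) \<odot>\<^bsub>N\<^esub> y"
        using w zc assms(4) r by (simp add: N.smult_r_distr N.smult_assoc1)
      then have "ideal_cong R D (\<psi>' (r \<odot>\<^bsub>N\<^esub> w)) (\<psi> (r \<odot>\<^bsub>N\<^esub> z) \<oplus>\<^bsub>R\<^esub> (r \<otimes>\<^bsub>R\<^esub> s) \<otimes>\<^bsub>R\<^esub> c)"
        using eval[OF E(4)[OF r w(1)] N.R.m_closed[OF r w(2)]] by simp
      moreover have "ideal_cong R D (\<psi> (r \<odot>\<^bsub>N\<^esub> z) \<oplus>\<^bsub>R\<^esub> (r \<otimes>\<^bsub>R\<^esub> s) \<otimes>\<^bsub>R\<^esub> c) (r \<otimes>\<^bsub>R\<^esub> \<psi> z \<oplus>\<^bsub>R\<^esub> (r \<otimes>\<^bsub>R\<^esub> s) \<otimes>\<^bsub>R\<^esub> c)"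
        by (rule D.cong_add[OF lin_modD(2)[OF assms(5) r w(1)] D.cong_refl]) (use w r assms(6) in simp)
      moreover have "r \<otimes>\<^bsub>R\<^esub> \<psi> z \<oplus>\<^bsub>R\<^esub> (r \<otimes>\<^bsub>R\<^esub> s) \<otimes>\<^bsub>R\<^esub> c = r \<otimes>\<^bsub>R\<^esub> (\<psi> z \<oplus>\<^bsub>R\<^esub> s \<otimes>\<^bsub>R\<^esub> c)"
        using pc[OF w(1)] w(2) assms(6) r by algebra
      ultimately show "ideal_cong R D (\<psi>' (r \<odot>\<^bsub>N\<^esub> w)) (r \<otimes>\<^bsub>R\<^esub> \<psi>' w)"
        using D.cong_trans D.cong_sym[OF D.cong_mult[OF ew r]] by metis }
  qed
  show ?thesis by (rule that[OF lin]) (rule eval)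
qed

text \<open>Baer's argument, with the chain condition in the place of Zorn's lemma. If y is outside
  the domain L of a maximal extension, the ideal of all s with sy in L contains d, and
  self-injectivity provides a value c for y. The conditions on the elements dx say that the map is
  really one from a submodule of N/dN to R/dR.\<close>

lemma baer_extension:
  assumes "module R N" "acc R N (carrier N)" "d \<in> carrier R" "self_injective R d"
    and "submodule K R N" "\<And>x. x \<in> carrier N \<Longrightarrow> d \<odot>\<^bsub>N\<^esub> x \<in> K"
    and "lin_mod R (PIdl\<^bsub>R\<^esub> d) N K \<phi>" "\<And>x. x \<in> carrier N \<Longrightarrow> \<phi> (d \<odot>\<^bsub>N\<^esub> x) \<in> PIdl\<^bsub>R\<^esub> d"
  obtains \<psi> where "lin_mod R (PIdl\<^bsub>R\<^esub> d) N (carrier N) \<psi>" "\<And>x. x \<in> K \<Longrightarrow> ideal_cong R (PIdl\<^bsub>R\<^esub> d) (\<psi> x) (\<phi> x)"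
proof -
  interpret N: module R N by fact
  let ?D = "PIdl\<^bsub>R\<^esub> d"
  interpret D: ideal ?D R by (rule N.R.cgenideal_ideal[OF assms(3)])
  define P where "P L \<psi> \<longleftrightarrow> submodule L R N \<and> K \<subseteq> L \<and> lin_mod R ?D N L \<psi> \<and> (\<forall>x\<in>K. ideal_cong R ?D (\<psi> x) (\<phi> x))" for L \<psi>
  let ?A = "{L. \<exists>\<psi>. P L \<psi>}"
  have "P K \<phi>" unfolding P_def using assms(5,7) D.cong_refl lin_modD(3)[OF assms(7)] by blast
  then have ne: "?A \<noteq> {}" by blast
  have "\<exists>L\<in>?A. \<forall>M\<in>?A. L \<subseteq> M \<longrightarrow> M = L"
    by (rule acc_maximal[OF assms(2) ne]) (auto simp: P_def dest: N.submoduleE(1))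
  then obtain L where L: "L \<in> ?A" "\<forall>M\<in>?A. L \<subseteq> M \<longrightarrow> M = L" by (rule bexE)
  then obtain \<psi> where "P L \<psi>" by blast
  then have Ls: "submodule L R N" and KL: "K \<subseteq> L" and \<psi>: "lin_mod R ?D N L \<psi>" "\<forall>x\<in>K. ideal_cong R ?D (\<psi> x) (\<phi> x)"
    unfolding P_def by auto
  note E = N.submoduleE[OF Ls]
  have "y \<in> L" if y: "y \<in> carrier N" for y
  proof (rule ccontr)
    assume yL: "y \<notin> L"
    let ?I = "{s \<in> carrier R. s \<odot>\<^bsub>N\<^esub> y \<in> L}"
    let ?\<chi> = "\<lambda>s. \<psi> (s \<odot>\<^bsub>N\<^esub> y)"
    have I: "ideal ?I R"
      by (rule N.R.idealI') (use y E(4,5) submodule_zero[OF Ls] in \<open>auto simp: N.smult_l_distr N.smult_assoc1\<close>)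
    have dI: "d \<in> ?I" using assms(3) assms(6)[OF y] KL by blast
    have lin: "lin_mod R ?D (ring_module R) ?I ?\<chi>"
      unfolding lin_mod_def
    proof (intro conjI ballI)
      fix s assume s: "s \<in> ?I"
      show "?\<chi> s \<in> carrier R" using s lin_modD(3)[OF \<psi>(1)] by blast
      show "ideal_cong R ?D (?\<chi> (s \<oplus>\<^bsub>ring_module R\<^esub> t)) (?\<chi> s \<oplus>\<^bsub>R\<^esub> ?\<chi> t)" if "t \<in> ?I" for t
        using lin_modD(1)[OF \<psi>(1), of "s \<odot>\<^bsub>N\<^esub> y" "t \<odot>\<^bsub>N\<^esub> y"] s that y by (simp add: N.smult_l_distr)
      show "ideal_cong R ?D (?\<chi> (r \<odot>\<^bsub>ring_module R\<^esub> s)) (r \<otimes>\<^bsub>R\<^esub> ?\<chi> s)" if "r \<in> carrier R" for r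
        using lin_modD(2)[OF \<psi>(1) that, of "s \<odot>\<^bsub>N\<^esub> y"] s that y by (simp add: N.smult_assoc1)
    qed
    have "ideal_cong R ?D (?\<chi> d) (\<phi> (d \<odot>\<^bsub>N\<^esub> y))" using \<psi>(2) assms(6)[OF y] by blast
    moreover have "ideal_cong R ?D (\<phi> (d \<odot>\<^bsub>N\<^esub> y)) \<zero>\<^bsub>R\<^esub>"
      using D.cong_zero_iff lin_modD(3)[OF assms(7) assms(6)[OF y]] assms(8)[OF y] by blast
    ultimately have "ideal_cong R ?D (?\<chi> d) \<zero>\<^bsub>R\<^esub>" by (rule D.cong_trans)
    then have "?\<chi> d \<in> ?D" using D.cong_zero_iff D.cong_carrier by blast
    from assms(4)[unfolded self_injective_def, rule_format, OF I dI lin this]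
    obtain c where c: "c \<in> carrier R" "\<forall>s\<in>?I. ideal_cong R ?D (?\<chi> s) (s \<otimes>\<^bsub>R\<^esub> c)" by (elim bexE) (rule that)
    have cs: "ideal_cong R ?D (\<psi> (s \<odot>\<^bsub>N\<^esub> y)) (s \<otimes>\<^bsub>R\<^esub> c)" if "s \<in> carrier R" "s \<odot>\<^bsub>N\<^esub> y \<in> L" for s
      using c(2) that by blast
    obtain \<psi>' where \<psi>': "lin_mod R ?D N (adjoin R N L y) \<psi>'"
      and ev: "\<And>z s. z \<in> L \<Longrightarrow> s \<in> carrier R \<Longrightarrow> ideal_cong R ?D (\<psi>' (z \<oplus>\<^bsub>N\<^esub> s \<odot>\<^bsub>N\<^esub> y)) (\<psi> z \<oplus>\<^bsub>R\<^esub> s \<otimes>\<^bsub>R\<^esub> c)"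
      by (rule lin_mod_adjoin[OF assms(1) D.is_ideal Ls y \<psi>(1) c(1) cs]) (assumption | rule that)+
    note Aj = adjoin_submodule[OF assms(1) Ls y]
    have "ideal_cong R ?D (\<psi>' x) (\<phi> x)" if x: "x \<in> K" for x
    proof -
      have xL: "x \<in> L" using x KL by blast
      then have "x \<in> carrier N" using E(1) by blast
      then have "ideal_cong R ?D (\<psi>' x) (\<psi> x)" using ev[OF xL N.R.zero_closed] y c(1) lin_modD(3)[OF \<psi>(1) xL] by simp
      then show ?thesis using D.cong_trans \<psi>(2) x by blast
    qed
    then have "P (adjoin R N L y) \<psi>'" unfolding P_def using Aj KL \<psi>' by blast
    then have "adjoin R N L y = L" using L(2) Aj(2) by blast
    then show False using Aj(3) yL by blast
  qed
  then have LN: "L = carrier N" using E(1) by blast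
  show ?thesis by (rule that[OF \<psi>(1)[unfolded LN]]) (use \<psi>(2) in blast)
qed

text \<open>
  A map $N \to R/a^{s+1}R$ agrees modulo \<open>a\<close> with a linear map $N \to R$ as soon as \<open>s\<close>
  exceeds a bound for the \<open>a\<close>-torsion of the cokernel of $\mathrm{Hom}(F, R) \to \mathrm{Hom}(F', R)$ for a presentation $F' \to F \to N$.
\<close>

lemma exact_lift:
  assumes "cring R" "noetherian_ring R" "module R N" "cover R {..<g::nat} p N" "a \<in> carrier R"
  shows "\<exists>s::nat. \<forall>h. lin_mod R (PIdl\<^bsub>R\<^esub> (a [^]\<^bsub>R\<^esub> Suc s)) N (carrier N) h \<longrightarrow>
    (\<exists>f\<in>mod_hom R N (ring_module R). \<forall>x\<in>carrier N. ideal_cong R (PIdl\<^bsub>R\<^esub> a) (f x) (h x))"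
proof -
  interpret R: cring R by fact
  interpret N: module R N by fact
  let ?F = "free_mod R {..<g}" and ?K = "hom_ker (free_mod R {..<g}) N p"
  note F = free_mod_module[OF assms(1), of "{..<g}"] and Rm = ring_module_module[OF assms(1)]
  note p = coverD[OF assms(4)]
  have Ks: "submodule ?K R ?F" by (rule cover_kernel_submodule[OF assms(3,4)])
  have KF: "?K \<subseteq> carrier ?F" by (rule module.submoduleE(1)[OF F Ks])
  have aK: "acc R ?F ?K" by (rule acc_mono[OF acc_free_mod[OF assms(1,2)] KF]) simp
  obtain l :: nat and q where q: "cover R {..<l} q (?F\<lparr>carrier := ?K\<rparr>)"
    by (rule acc_cover[OF F Ks aK]) (rule that)
  let ?G = "free_mod R {..<l}"
  note G = free_mod_module[OF assms(1), of "{..<l}"]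
  interpret G: module R ?G by (rule G)
  have qF: "q \<in> mod_hom R ?G ?F" by (rule mod_hom_extend_codomain[OF coverD(1)[OF q] KF])
  have qK: "q ` carrier ?G = ?K" using coverD(2)[OF q] by simp
  let ?H = "mod_hom R ?F (ring_module R)"
  let ?u = "\<lambda>j. q (unit_vec R j)"
  have uF: "?u j \<in> carrier ?F" if "j \<in> {..<l}" for j
    by (rule mod_homD(1)[OF qF unit_vec_carrier[OF assms(1) that]])
  have hc: "f (?u j) \<in> carrier R" if "f \<in> ?H" "j \<in> {..<l}" for f j
    using mod_homD(1)[OF that(1) uF[OF that(2)]] by simp
  \<comment> \<open>Maps on the relations are recorded by their vectors w of values at a generating
    system. At a stable index s, if a^(s+1)w comes from a map on the free module, then so does a^s
    w.\<close>
  define C where "C s = {w \<in> carrier ?G. \<exists>f\<in>?H. \<forall>j\<in>{..<l}. a [^]\<^bsub>R\<^esub> s \<otimes>\<^bsub>R\<^esub> w j = f (?u j)}" for s :: nat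
  have ac: "a [^]\<^bsub>R\<^esub> s \<in> carrier R" for s :: nat using assms(5) by simp
  have wc: "w j \<in> carrier R" if "w \<in> carrier ?G" for w j using that by (simp add: free_mod_carrier)
  have CI: "w \<in> C s" if "w \<in> carrier ?G" "f \<in> ?H" "\<And>j. j \<in> {..<l} \<Longrightarrow> a [^]\<^bsub>R\<^esub> s \<otimes>\<^bsub>R\<^esub> w j = f (?u j)" for s w f
    unfolding C_def by (intro CollectI conjI bexI[of _ f] ballI that)
  have CE: thesis if "w \<in> C s" "\<And>f. w \<in> carrier ?G \<Longrightarrow> f \<in> ?H \<Longrightarrow> \<forall>j\<in>{..<l}. a [^]\<^bsub>R\<^esub> s \<otimes>\<^bsub>R\<^esub> w j = f (?u j) \<Longrightarrow> thesis" for s w thesis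
    using that(1) unfolding C_def by (elim CollectE conjE bexE) (rule that(2))
  have Cs: "submodule (C s) R ?G" for s
  proof (rule G.submoduleI)
    show "C s \<subseteq> carrier ?G" by (auto simp: C_def)
    have "(\<lambda>x. \<zero>\<^bsub>R\<^esub>) \<in> ?H" using mod_hom_zero_fun[OF Rm, of ?F] by simp
    then show "\<zero>\<^bsub>?G\<^esub> \<in> C s"
      by (rule CI[OF G.zero_closed]) (use ac[of s] in simp)
    fix w assume "w \<in> C s"
    then obtain f where w: "w \<in> carrier ?G" "f \<in> ?H" "\<forall>j\<in>{..<l}. a [^]\<^bsub>R\<^esub> s \<otimes>\<^bsub>R\<^esub> w j = f (?u j)" by (rule CE)
    have sm: "r \<odot>\<^bsub>?G\<^esub> w \<in> C s" if r: "r \<in> carrier R" for r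
    proof -
      have "(\<lambda>x. r \<odot>\<^bsub>ring_module R\<^esub> f x) \<in> ?H" by (rule mod_hom_smult_fun[OF Rm w(2) r])
      moreover have "a [^]\<^bsub>R\<^esub> s \<otimes>\<^bsub>R\<^esub> (r \<odot>\<^bsub>?G\<^esub> w) j = r \<odot>\<^bsub>ring_module R\<^esub> f (?u j)" if "j \<in> {..<l}" for j
        using w(3)[rule_format, OF that] R.m_lcomm[OF ac[of s] r wc[OF w(1), of j]] by simp
      ultimately show ?thesis by (rule CI[OF G.smult_closed[OF r w(1)]])
    qed
    then show "r \<odot>\<^bsub>?G\<^esub> w \<in> C s" if "r \<in> carrier R" for r using that by blast
    have "(\<ominus>\<^bsub>R\<^esub> \<one>\<^bsub>R\<^esub>) \<odot>\<^bsub>?G\<^esub> w = \<ominus>\<^bsub>?G\<^esub> w"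
      using G.smult_l_minus[OF R.one_closed w(1)] G.smult_one[OF w(1)] by simp
    then show "\<ominus>\<^bsub>?G\<^esub> w \<in> C s" using sm[of "\<ominus>\<^bsub>R\<^esub> \<one>\<^bsub>R\<^esub>"] by simp
    fix w' assume "w' \<in> C s"
    then obtain f' where w': "w' \<in> carrier ?G" "f' \<in> ?H" "\<forall>j\<in>{..<l}. a [^]\<^bsub>R\<^esub> s \<otimes>\<^bsub>R\<^esub> w' j = f' (?u j)" by (rule CE)
    have "(\<lambda>x. f x \<oplus>\<^bsub>ring_module R\<^esub> f' x) \<in> ?H" by (rule mod_hom_add_fun[OF Rm w(2) w'(2)])
    moreover have "a [^]\<^bsub>R\<^esub> s \<otimes>\<^bsub>R\<^esub> (w \<oplus>\<^bsub>?G\<^esub> w') j = f (?u j) \<oplus>\<^bsub>ring_module R\<^esub> f' (?u j)" if "j \<in> {..<l}" for j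
      using w(3)[rule_format, OF that] w'(3)[rule_format, OF that] R.r_distr[OF wc[OF w(1)] wc[OF w'(1)] ac] by simp
    ultimately show "w \<oplus>\<^bsub>?G\<^esub> w' \<in> C s" by (rule CI[OF G.a_closed[OF w(1) w'(1)]])
  qed
  have CG: "C s \<subseteq> carrier ?G" for s by (auto simp: C_def)
  have Cm: "C s \<subseteq> C (Suc s)" for s
  proof
    fix w assume "w \<in> C s"
    then obtain f where w: "w \<in> carrier ?G" "f \<in> ?H" "\<forall>j\<in>{..<l}. a [^]\<^bsub>R\<^esub> s \<otimes>\<^bsub>R\<^esub> w j = f (?u j)" by (rule CE)
    have "(\<lambda>x. a \<odot>\<^bsub>ring_module R\<^esub> f x) \<in> ?H" by (rule mod_hom_smult_fun[OF Rm w(2) assms(5)])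
    moreover have "a [^]\<^bsub>R\<^esub> Suc s \<otimes>\<^bsub>R\<^esub> w j = a \<odot>\<^bsub>ring_module R\<^esub> f (?u j)" if "j \<in> {..<l}" for j
      using w(3)[rule_format, OF that, symmetric] ac[of s] wc[OF w(1), of j] assms(5) by (simp add: R.m_ac)
    ultimately show "w \<in> C (Suc s)" by (rule CI[OF w(1)])
  qed
  have "\<exists>s. \<forall>k\<ge>s. C k = C s"
    by (rule accD[where Y = C, OF acc_free_mod[OF assms(1,2), of "{..<l}"] Cs CG Cm]) simp
  then obtain s where s: "\<forall>k\<ge>s. C k = C s" by (rule exE)
  let ?d = "a [^]\<^bsub>R\<^esub> Suc s"
  let ?D = "PIdl\<^bsub>R\<^esub> ?d" and ?A = "PIdl\<^bsub>R\<^esub> a"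
  have d: "?d \<in> carrier R" using ac[of "Suc s"] .
  interpret D: ideal ?D R by (rule R.cgenideal_ideal[OF d])
  interpret A: ideal ?A R by (rule R.cgenideal_ideal[OF assms(5)])
  have "?d \<in> ?A" unfolding cgenideal_def using ac[of s] by auto
  then have DA: "?D \<subseteq> ?A" by (rule R.cgenideal_minimal[OF A.is_ideal])
  have "\<exists>f\<in>mod_hom R N (ring_module R). \<forall>x\<in>carrier N. ideal_cong R ?A (f x) (h x)"
    if h: "lin_mod R ?D N (carrier N) h" for h
  proof -
    have pN: "p ` carrier ?F \<subseteq> carrier N" using p(2) by simp
    obtain f0 where f0: "f0 \<in> ?H" and f0h: "\<And>v. v \<in> carrier ?F \<Longrightarrow> ideal_cong R ?D (f0 v) (h (p v))"
      by (rule lin_mod_lift[OF assms(3) D.is_ideal p(1) N.carrier_is_submodule pN h]) (assumption | rule that)+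
    have "\<exists>c\<in>carrier R. f0 (?u j) = c \<otimes>\<^bsub>R\<^esub> ?d" if j: "j \<in> {..<l}" for j
    proof -
      have "?u j \<in> ?K" using qK unit_vec_carrier[OF assms(1) j] by blast
      then have "p (?u j) = \<zero>\<^bsub>N\<^esub>" by (simp add: hom_ker_def)
      then have "ideal_cong R ?D (f0 (?u j)) (h \<zero>\<^bsub>N\<^esub>)" using f0h[OF uF[OF j]] by simp
      then have "ideal_cong R ?D (f0 (?u j)) \<zero>\<^bsub>R\<^esub>"
        using D.cong_trans lin_mod_zero[OF assms(3) N.carrier_is_submodule D.is_ideal h] by blast
      then have "f0 (?u j) \<in> ?D" using D.cong_zero_iff hc[OF f0 j] by blast
      then show ?thesis unfolding cgenideal_def by blast
    qed
    then obtain c where c: "\<And>j. j \<in> {..<l} \<Longrightarrow> c j \<in> carrier R \<and> f0 (?u j) = c j \<otimes>\<^bsub>R\<^esub> ?d" by metis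
    define w where "w j = (if j \<in> {..<l} then c j else \<zero>\<^bsub>R\<^esub>)" for j
    have "{j. w j \<noteq> \<zero>\<^bsub>R\<^esub>} \<subseteq> {..<l}" by (auto simp: w_def)
    then have "finite {j. w j \<noteq> \<zero>\<^bsub>R\<^esub>}" using finite_subset by blast
    then have wG: "w \<in> carrier ?G" using c by (simp add: free_mod_carrier w_def)
    have "?d \<otimes>\<^bsub>R\<^esub> w j = f0 (?u j)" if "j \<in> {..<l}" for j
      using c[OF that] that R.m_comm[OF d, of "c j"] by (simp only: w_def if_True)
    then have "w \<in> C (Suc s)" by (rule CI[OF wG f0])
    then have "w \<in> C s" unfolding s[rule_format, OF le_SucI[OF order_refl]] .
    then obtain f1 where f1: "f1 \<in> ?H" "\<forall>j\<in>{..<l}. a [^]\<^bsub>R\<^esub> s \<otimes>\<^bsub>R\<^esub> w j = f1 (?u j)" by (rule CE)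
    have perm: "x \<otimes>\<^bsub>R\<^esub> (y \<otimes>\<^bsub>R\<^esub> z) = z \<otimes>\<^bsub>R\<^esub> (y \<otimes>\<^bsub>R\<^esub> x)"
      if "x \<in> carrier R" "y \<in> carrier R" "z \<in> carrier R" for x y z using that by algebra
    have fe: "f0 (?u j) = a \<odot>\<^bsub>ring_module R\<^esub> f1 (?u j)" if j: "j \<in> {..<l}" for j
    proof -
      have "f0 (?u j) = w j \<otimes>\<^bsub>R\<^esub> (a [^]\<^bsub>R\<^esub> s \<otimes>\<^bsub>R\<^esub> a)" using c[OF j] j by (simp add: w_def)
      also have "\<dots> = a \<otimes>\<^bsub>R\<^esub> (a [^]\<^bsub>R\<^esub> s \<otimes>\<^bsub>R\<^esub> w j)" by (rule perm[OF wc[OF wG] ac assms(5)])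
      finally show ?thesis using f1(2) j by simp
    qed
    have af1: "(\<lambda>v. a \<odot>\<^bsub>ring_module R\<^esub> f1 v) \<in> ?H" by (rule mod_hom_smult_fun[OF Rm f1(1) assms(5)])
    have fq: "f0 (q v) = a \<odot>\<^bsub>ring_module R\<^esub> f1 (q v)" if "v \<in> carrier ?G" for v
      by (rule free_hom_eq[OF assms(1) Rm mod_hom_comp[OF qF f0] mod_hom_comp[OF qF af1] fe that])
    have f01: "f0 v \<in> carrier R" "f1 v \<in> carrier R" if "v \<in> carrier ?F" for v
      using mod_homD(1)[OF f0 that] mod_homD(1)[OF f1(1) that] by auto
    \<comment> \<open>The lift f0 equals a f1 on the relations, so f0 - a f1 descends to N.
      Subtracting a f1 is the reason why the result agrees with h only modulo a.\<close>
    have diff: "(\<lambda>v. f0 v \<ominus>\<^bsub>ring_module R\<^esub> a \<odot>\<^bsub>ring_module R\<^esub> f1 v) \<in> ?H" by (rule mod_hom_diff_fun[OF Rm f0 af1])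
    have diff0: "f0 v \<ominus>\<^bsub>ring_module R\<^esub> a \<odot>\<^bsub>ring_module R\<^esub> f1 v = \<zero>\<^bsub>ring_module R\<^esub>"
      if "v \<in> carrier ?F" "p v = \<zero>\<^bsub>N\<^esub>" for v
    proof -
      have "v \<in> q ` carrier ?G" unfolding qK using that by (simp add: hom_ker_def)
      then have "f0 v = a \<otimes>\<^bsub>R\<^esub> f1 v" using fq by auto
      then show ?thesis using f01[OF that(1)] assms(5) by (simp add: R.minus_eq_zero_iff)
    qed
    obtain f where f: "f \<in> mod_hom R N (ring_module R)"
      and fp: "\<And>v. v \<in> carrier ?F \<Longrightarrow> f (p v) = f0 v \<ominus>\<^bsub>ring_module R\<^esub> a \<odot>\<^bsub>ring_module R\<^esub> f1 v"
      by (rule mod_hom_descend[OF F assms(3) Rm p diff diff0]) (assumption | rule that)+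
    have "ideal_cong R ?A (f x) (h x)" if x: "x \<in> carrier N" for x
    proof -
      have "x \<in> p ` carrier ?F" using p(2) x by simp
      then obtain v where v: "v \<in> carrier ?F" "x = p v" by blast
      note fv = f01[OF v(1)]
      have "f1 v \<otimes>\<^bsub>R\<^esub> a \<in> ?A" using fv unfolding cgenideal_def by blast
      then have "ideal_cong R ?A (a \<otimes>\<^bsub>R\<^esub> f1 v) \<zero>\<^bsub>R\<^esub>" unfolding A.cong_zero_iff[OF R.m_closed[OF assms(5) fv(2)]] R.m_comm[OF fv(2) assms(5)] .
      then have "ideal_cong R ?A (f0 v \<ominus>\<^bsub>R\<^esub> a \<otimes>\<^bsub>R\<^esub> f1 v) (f0 v \<ominus>\<^bsub>R\<^esub> \<zero>\<^bsub>R\<^esub>)" by (rule A.cong_diff[OF A.cong_refl[OF fv(1)]])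
      then have "ideal_cong R ?A (f x) (f0 v)" using fp[OF v(1)] v(2) fv by (simp add: a_minus_def)
      moreover have "ideal_cong R ?A (f0 v) (h x)" using f0h[OF v(1)] v(2) DA unfolding ideal_cong_def by blast
      ultimately show ?thesis by (rule A.cong_trans)
    qed
    then show ?thesis by (intro bexI[OF _ f] ballI)
  qed
  note ex = this
  show ?thesis by (intro exI[of _ s] allI impI) (rule ex)
qed

text \<open>
  If \<open>b\<close> spans the socle of $R/a^kR$ at $\mathfrak n$ and $bx \notin a^kN$, then $dz + tbx \mapsto tb$, for
  $d = a^k$, extends to a map on \<open>N\<close> that sends \<open>x\<close> to \<open>1\<close> modulo $\mathfrak n$.
\<close>

lemma trace_or_divides:
  assumes "cring R" "noetherian_ring R" "module R N" "cover R {..<g::nat} p N"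
    and "maximalideal \<nn> R" "a \<in> \<nn>" "\<And>P. primeideal P R \<Longrightarrow> a \<in> P \<Longrightarrow> maximalideal P R"
    and "\<And>k::nat. self_injective R (a [^]\<^bsub>R\<^esub> k)"
    and "\<And>f x. f \<in> mod_hom R N (ring_module R) \<Longrightarrow> x \<in> carrier N \<Longrightarrow> f x \<in> \<nn>"
  obtains k :: nat and b where "b \<in> carrier R" "b \<notin> PIdl\<^bsub>R\<^esub> (a [^]\<^bsub>R\<^esub> k)"
    "\<And>x. x \<in> carrier N \<Longrightarrow> \<exists>y\<in>carrier N. b \<odot>\<^bsub>N\<^esub> x = a [^]\<^bsub>R\<^esub> k \<odot>\<^bsub>N\<^esub> y"
proof -
  interpret R: cring R by fact
  interpret N: module R N by fact
  interpret M: maximalideal \<nn> R by fact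
  have a: "a \<in> carrier R" using assms(6) by (rule M.Icarr)
  obtain s :: nat where s: "\<forall>h. lin_mod R (PIdl\<^bsub>R\<^esub> (a [^]\<^bsub>R\<^esub> Suc s)) N (carrier N) h \<longrightarrow>
    (\<exists>f\<in>mod_hom R N (ring_module R). \<forall>x\<in>carrier N. ideal_cong R (PIdl\<^bsub>R\<^esub> a) (f x) (h x))"
    using exact_lift[OF assms(1-4) a] by (rule exE)
  let ?d = "a [^]\<^bsub>R\<^esub> Suc s"
  let ?D = "PIdl\<^bsub>R\<^esub> ?d"
  have d: "?d \<in> carrier R" using R.nat_pow_closed[OF a] .
  interpret D: ideal ?D R by (rule R.cgenideal_ideal[OF d])
  have "?d \<in> \<nn>" using M.I_l_closed[OF assms(6) R.nat_pow_closed[OF a, of s]] by simp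
  then have Dn: "?D \<subseteq> \<nn>" by (rule R.cgenideal_minimal[OF M.is_ideal])
  \<comment> \<open>The prime (a^(s+1)R : b) contains a power of a, hence a itself, and is therefore
    maximal; lying in \<nn>, it equals \<nn>.\<close>
  obtain b where b: "b \<in> carrier R" "primeideal (colon R ?D b) R" "colon R ?D b \<subseteq> \<nn>"
    by (rule colon_prime[OF assms(1,2) D.is_ideal R.maximalideal_prime[OF assms(5)] Dn]) (assumption | rule that)+
  have "?d \<in> colon R ?D b" using R.ideal_subset_colon[OF D.is_ideal b(1)] R.cgenideal_self[OF d] by blast
  then have "a \<in> colon R ?D b" by (rule primeideal_power[OF b(2) a])
  then interpret Q: maximalideal "colon R ?D b" R by (rule assms(7)[OF b(2)])
  have col: "colon R ?D b = \<nn>" using Q.I_maximal[OF M.is_ideal b(3) M.a_subset] M.I_notcarr by blast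
  have one: "\<one>\<^bsub>R\<^esub> \<notin> \<nn>" using M.one_imp_carrier M.I_notcarr by blast
  have nb: "t \<in> \<nn> \<longleftrightarrow> t \<otimes>\<^bsub>R\<^esub> b \<in> ?D" if "t \<in> carrier R" for t
    using that unfolding col[symmetric] colon_def by simp
  have bD: "b \<notin> ?D" using nb[OF R.one_closed] one b(1) by simp
  have "\<exists>y\<in>carrier N. b \<odot>\<^bsub>N\<^esub> x = ?d \<odot>\<^bsub>N\<^esub> y" if x: "x \<in> carrier N" for x
  proof (rule ccontr)
    assume neg: "\<not> ?thesis"
    let ?dN = "(\<lambda>y. ?d \<odot>\<^bsub>N\<^esub> y) ` carrier N" and ?bx = "b \<odot>\<^bsub>N\<^esub> x"
    have bx: "?bx \<in> carrier N" using b(1) x by simp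
    have nbx: "?bx \<notin> ?dN" using neg by blast
    have dh: "(\<lambda>y. ?d \<odot>\<^bsub>N\<^esub> y) \<in> mod_hom R N N" by (rule mod_hom_smult_fun[OF assms(3) mod_hom_id d])
    have dN: "submodule ?dN R N" by (rule submodule_image[OF assms(3,3) dh N.carrier_is_submodule])
    note E = N.submoduleE[OF dN]
    let ?I = "{t \<in> carrier R. t \<odot>\<^bsub>N\<^esub> ?bx \<in> ?dN}"
    have I: "ideal ?I R"
      by (rule R.idealI') (use bx E(4,5) submodule_zero[OF dN] in \<open>auto simp: N.smult_l_distr N.smult_assoc1 simp del: image_iff\<close>)
    have nI: "\<nn> \<subseteq> ?I"
    proof
      fix t assume t: "t \<in> \<nn>"
      then have tc: "t \<in> carrier R" by (rule M.Icarr)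
      obtain e where e: "e \<in> carrier R" "t \<otimes>\<^bsub>R\<^esub> b = e \<otimes>\<^bsub>R\<^esub> ?d" using nb[OF tc] t unfolding cgenideal_def by blast
      have "t \<odot>\<^bsub>N\<^esub> ?bx = (t \<otimes>\<^bsub>R\<^esub> b) \<odot>\<^bsub>N\<^esub> x" using tc b(1) x by (simp add: N.smult_assoc1)
      also have "\<dots> = (?d \<otimes>\<^bsub>R\<^esub> e) \<odot>\<^bsub>N\<^esub> x" using e R.m_comm[OF e(1) d] by simp
      also have "\<dots> = ?d \<odot>\<^bsub>N\<^esub> (e \<odot>\<^bsub>N\<^esub> x)" by (rule N.smult_assoc1[OF d e(1) x])
      finally show "t \<in> ?I" using tc e(1) x by blast
    qed
    have "?I \<noteq> carrier R"
    proof
      assume "?I = carrier R"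
      then have "\<one>\<^bsub>R\<^esub> \<in> ?I" by blast
      then show False using nbx bx by simp
    qed
    then have In: "?I = \<nn>" using M.I_maximal[OF I nI] by blast
    have z: "lin_mod R ?D N ?dN (\<lambda>_. \<zero>\<^bsub>R\<^esub>)"
      unfolding lin_mod_def using D.cong_refl[OF R.zero_closed] by simp
    have wd: "ideal_cong R ?D \<zero>\<^bsub>R\<^esub> (t \<otimes>\<^bsub>R\<^esub> b)" if "t \<in> carrier R" "t \<odot>\<^bsub>N\<^esub> ?bx \<in> ?dN" for t
    proof -
      have "t \<in> \<nn>" using that In by blast
      then have "t \<otimes>\<^bsub>R\<^esub> b \<in> ?D" using nb[OF that(1)] by simp
      then show ?thesis using D.cong_sym D.cong_zero_iff that(1) b(1) by simp
    qed
    obtain \<phi> where \<phi>: "lin_mod R ?D N (adjoin R N ?dN ?bx) \<phi>"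
      and ev: "\<And>z t. z \<in> ?dN \<Longrightarrow> t \<in> carrier R \<Longrightarrow> ideal_cong R ?D (\<phi> (z \<oplus>\<^bsub>N\<^esub> t \<odot>\<^bsub>N\<^esub> ?bx)) (\<zero>\<^bsub>R\<^esub> \<oplus>\<^bsub>R\<^esub> t \<otimes>\<^bsub>R\<^esub> b)"
      by (rule lin_mod_adjoin[OF assms(3) D.is_ideal dN bx z b(1) wd]) (assumption | rule that)+
    note Aj = adjoin_submodule[OF assms(3) dN bx]
    have dA: "?d \<odot>\<^bsub>N\<^esub> y \<in> adjoin R N ?dN ?bx" if "y \<in> carrier N" for y using Aj(2) that by blast
    have d0: "\<phi> (?d \<odot>\<^bsub>N\<^esub> y) \<in> ?D" if y: "y \<in> carrier N" for y
    proof -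
      have "?d \<odot>\<^bsub>N\<^esub> y \<in> ?dN" using y by blast
      from ev[OF this R.zero_closed] have "ideal_cong R ?D (\<phi> (?d \<odot>\<^bsub>N\<^esub> y)) \<zero>\<^bsub>R\<^esub>"
        using N.smult_closed[OF d y] bx b(1) by (simp del: R.nat_pow_Suc)
      then show ?thesis using D.cong_zero_iff D.cong_carrier by blast
    qed
    have acc: "acc R N (carrier N)" by (rule cover_acc[OF assms(1-4)]) simp
    obtain \<psi> where \<psi>: "lin_mod R ?D N (carrier N) \<psi>" and \<psi>\<phi>: "\<And>y. y \<in> adjoin R N ?dN ?bx \<Longrightarrow> ideal_cong R ?D (\<psi> y) (\<phi> y)"
      by (rule baer_extension[OF assms(3) acc d assms(8) Aj(1) dA \<phi> d0]) (assumption | rule that)+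
    have \<psi>x: "\<psi> x \<in> carrier R" by (rule lin_modD(3)[OF \<psi> x])
    have "ideal_cong R ?D (b \<otimes>\<^bsub>R\<^esub> \<psi> x) (\<psi> ?bx)" by (rule D.cong_sym[OF lin_modD(2)[OF \<psi> b(1) x]])
    moreover have "ideal_cong R ?D (\<psi> ?bx) (\<phi> ?bx)" by (rule \<psi>\<phi>[OF Aj(3)])
    moreover have "ideal_cong R ?D (\<phi> ?bx) b"
      using ev[OF submodule_zero[OF dN] R.one_closed] bx b(1) by simp
    ultimately have "ideal_cong R ?D (b \<otimes>\<^bsub>R\<^esub> \<psi> x) b" using D.cong_trans by blast
    \<comment> \<open>The element \<psi>(x) - 1 annihilates b modulo a^(s+1), so it lies in \<nn>.
      The linear map f that agrees with \<open>\<psi>\<close> modulo a then takes a value at x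
      congruent to 1 modulo \<nn>.\<close>
    then have "b \<otimes>\<^bsub>R\<^esub> \<psi> x \<ominus>\<^bsub>R\<^esub> b \<in> ?D" by (simp only: ideal_cong_def)
    moreover have "b \<otimes>\<^bsub>R\<^esub> \<psi> x \<ominus>\<^bsub>R\<^esub> b = (\<psi> x \<ominus>\<^bsub>R\<^esub> \<one>\<^bsub>R\<^esub>) \<otimes>\<^bsub>R\<^esub> b" using \<psi>x b(1) by algebra
    ultimately have \<psi>1: "\<psi> x \<ominus>\<^bsub>R\<^esub> \<one>\<^bsub>R\<^esub> \<in> \<nn>" using nb[of "\<psi> x \<ominus>\<^bsub>R\<^esub> \<one>\<^bsub>R\<^esub>"] \<psi>x by (simp del: R.nat_pow_Suc)
    obtain f where f: "f \<in> mod_hom R N (ring_module R)" "\<forall>x\<in>carrier N. ideal_cong R (PIdl\<^bsub>R\<^esub> a) (f x) (\<psi> x)"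
      using s[rule_format, OF \<psi>] by (rule bexE)
    have An: "PIdl\<^bsub>R\<^esub> a \<subseteq> \<nn>" by (rule R.cgenideal_minimal[OF M.is_ideal assms(6)])
    have fx: "f x \<in> \<nn>" "f x \<in> carrier R" using assms(9)[OF f(1) x] M.Icarr by blast+
    have "f x \<ominus>\<^bsub>R\<^esub> \<psi> x \<in> \<nn>" using f(2) x An unfolding ideal_cong_def by blast
    then have "f x \<ominus>\<^bsub>R\<^esub> (f x \<ominus>\<^bsub>R\<^esub> \<psi> x) \<ominus>\<^bsub>R\<^esub> (\<psi> x \<ominus>\<^bsub>R\<^esub> \<one>\<^bsub>R\<^esub>) \<in> \<nn>"
      using ideal_diff[OF M.is_ideal ideal_diff[OF M.is_ideal fx(1)] \<psi>1] by blast
    moreover have "f x \<ominus>\<^bsub>R\<^esub> (f x \<ominus>\<^bsub>R\<^esub> \<psi> x) \<ominus>\<^bsub>R\<^esub> (\<psi> x \<ominus>\<^bsub>R\<^esub> \<one>\<^bsub>R\<^esub>) = \<one>\<^bsub>R\<^esub>" using fx(2) \<psi>x by algebra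
    ultimately show False using one by simp
  qed
  then show ?thesis by (rule that[OF b(1) bD])
qed

subsection \<open>The center of the endomorphism ring\<close>

locale endo_center = M: module R M
  for R :: "('a, 'c) ring_scheme" and M :: "('a, 'b, 'd) module_scheme"
begin

abbreviation T where "T \<equiv> ring_center (End_ring R M)"

lemma T_carrier:
  "z \<in> carrier T \<longleftrightarrow> z \<in> mod_hom R M M \<and> z \<in> extensional (carrier M) \<and>
    (\<forall>h\<in>mod_hom R M M \<inter> extensional (carrier M). compose (carrier M) z h = compose (carrier M) h z)"
  by (auto simp: ring_center_def End_ring_def hom_module_def)

text \<open>Elements of \<open>End_ring\<close> are extensional. Passing to restrictions gives
  commutation with arbitrary linear maps, such as those that rigidity produces.\<close>

lemma T_D:
  assumes "z \<in> carrier T"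
  shows "z \<in> mod_hom R M M" "z \<in> extensional (carrier M)"
    and "h \<in> mod_hom R M M \<Longrightarrow> x \<in> carrier M \<Longrightarrow> z (h x) = h (z x)"
proof -
  show z: "z \<in> mod_hom R M M" "z \<in> extensional (carrier M)" using assms unfolding T_carrier by auto
  assume h: "h \<in> mod_hom R M M" and x: "x \<in> carrier M"
  have "restrict h (carrier M) \<in> mod_hom R M M" by (rule mod_hom_cong[OF M.module_axioms h]) simp
  then have "compose (carrier M) z (restrict h (carrier M)) = compose (carrier M) (restrict h (carrier M)) z"
    using assms unfolding T_carrier by simp
  from fun_cong[OF this, of x] show "z (h x) = h (z x)" using x mod_homD(1)[OF z(1) x] by (simp add: compose_def)
qed

lemma T_I:
  assumes "z \<in> mod_hom R M M" "\<And>h x. h \<in> mod_hom R M M \<Longrightarrow> x \<in> carrier M \<Longrightarrow> z (h x) = h (z x)"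
  shows "restrict z (carrier M) \<in> carrier T"
  unfolding T_carrier
proof (intro conjI ballI)
  show "restrict z (carrier M) \<in> mod_hom R M M" by (rule mod_hom_cong[OF M.module_axioms assms(1)]) simp
  fix h assume "h \<in> mod_hom R M M \<inter> extensional (carrier M)"
  then have h: "h \<in> mod_hom R M M" by simp
  show "compose (carrier M) (restrict z (carrier M)) h = compose (carrier M) h (restrict z (carrier M))"
    using assms(2)[OF h] mod_homD(1)[OF h] by (auto simp: compose_def fun_eq_iff)
qed simp

lemma T_ext:
  assumes "z \<in> carrier T" "w \<in> carrier T" "\<And>x. x \<in> carrier M \<Longrightarrow> z x = w x" shows "z = w"
  using T_D(2)[OF assms(1)] T_D(2)[OF assms(2)] assms(3) by (rule extensionalityI)

lemma T_closed: "z \<in> carrier T \<Longrightarrow> x \<in> carrier M \<Longrightarrow> z x \<in> carrier M"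
  by (rule mod_homD(1)[OF T_D(1)])

lemma T_ops:
  assumes "x \<in> carrier M"
  shows "(z \<otimes>\<^bsub>T\<^esub> w) x = z (w x)" "(z \<oplus>\<^bsub>T\<^esub> w) x = z x \<oplus>\<^bsub>M\<^esub> w x" "\<zero>\<^bsub>T\<^esub> x = \<zero>\<^bsub>M\<^esub>" "\<one>\<^bsub>T\<^esub> x = x"
  using assms by (simp_all add: ring_center_def End_ring_def hom_module_def compose_def)

lemma T_minus:
  assumes "cring T" "z \<in> carrier T" "x \<in> carrier M"
  shows "(\<ominus>\<^bsub>T\<^esub> z) x = \<ominus>\<^bsub>M\<^esub> z x"
proof -
  interpret T: cring T by fact
  have "(\<ominus>\<^bsub>T\<^esub> z) x \<oplus>\<^bsub>M\<^esub> z x = (\<ominus>\<^bsub>T\<^esub> z \<oplus>\<^bsub>T\<^esub> z) x" using assms(3) by (simp add: T_ops)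
  also have "\<dots> = \<zero>\<^bsub>M\<^esub>" using assms by (simp add: T.l_neg T_ops)
  finally show ?thesis using M.minus_equality[of "(\<ominus>\<^bsub>T\<^esub> z) x" "z x"] T_closed assms T.a_inv_closed by simp
qed

lemma T_diff:
  assumes "cring T" "z \<in> carrier T" "w \<in> carrier T" "x \<in> carrier M"
  shows "(z \<ominus>\<^bsub>T\<^esub> w) x = z x \<ominus>\<^bsub>M\<^esub> w x"
  unfolding a_minus_def using T_ops(2)[OF assms(4)] T_minus[OF assms(1,3,4)] by simp

definition \<rho> :: "'a \<Rightarrow> 'b \<Rightarrow> 'b" where "\<rho> r = (\<lambda>x\<in>carrier M. r \<odot>\<^bsub>M\<^esub> x)"

lemma rho_apply: "x \<in> carrier M \<Longrightarrow> \<rho> r x = r \<odot>\<^bsub>M\<^esub> x"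
  by (simp add: \<rho>_def)

lemma rho_closed: "r \<in> carrier R \<Longrightarrow> \<rho> r \<in> carrier T"
  unfolding \<rho>_def
  by (rule T_I[OF mod_hom_smult_fun[OF M.module_axioms mod_hom_id]]) (simp_all add: mod_homD(3))

text \<open>This structure of M over T is the one on which trace maps live;
  \<open>center_as_module\<close>, the structure of T over R by way of \<open>\<rho>\<close>, is the
  one for the chain condition and Nakayama's lemma.\<close>

definition center_module :: "('b \<Rightarrow> 'b, 'b) module" where
  "center_module = \<lparr>carrier = carrier M, mult = undefined, one = undefined, zero = \<zero>\<^bsub>M\<^esub>, add = add M,
     smult = (\<lambda>z x. z x)\<rparr>"

lemma center_module_simps [simp]:
  "carrier center_module = carrier M" "\<zero>\<^bsub>center_module\<^esub> = \<zero>\<^bsub>M\<^esub>"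
  "x \<oplus>\<^bsub>center_module\<^esub> y = x \<oplus>\<^bsub>M\<^esub> y" "z \<odot>\<^bsub>center_module\<^esub> x = z x"
  by (simp_all add: center_module_def)

definition center_as_module :: "('a, 'b \<Rightarrow> 'b) module" where
  "center_as_module = \<lparr>carrier = carrier T, mult = undefined, one = undefined, zero = \<zero>\<^bsub>T\<^esub>, add = add T,
     smult = (\<lambda>r z. \<rho> r \<otimes>\<^bsub>T\<^esub> z)\<rparr>"

lemma center_as_module_simps [simp]:
  "carrier center_as_module = carrier T" "\<zero>\<^bsub>center_as_module\<^esub> = \<zero>\<^bsub>T\<^esub>"
  "z \<oplus>\<^bsub>center_as_module\<^esub> w = z \<oplus>\<^bsub>T\<^esub> w" "r \<odot>\<^bsub>center_as_module\<^esub> z = \<rho> r \<otimes>\<^bsub>T\<^esub> z"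
  by (simp_all add: center_as_module_def)

end

locale cring_endo_center = endo_center R M + T: cring "ring_center (End_ring R M)"
  for R :: "('a, 'c) ring_scheme" and M :: "('a, 'b, 'd) module_scheme"
begin

lemmas T_cring = T.is_cring

lemma rho_hom:
  "r \<in> carrier R \<Longrightarrow> s \<in> carrier R \<Longrightarrow> \<rho> (r \<oplus>\<^bsub>R\<^esub> s) = \<rho> r \<oplus>\<^bsub>T\<^esub> \<rho> s"
  "r \<in> carrier R \<Longrightarrow> s \<in> carrier R \<Longrightarrow> \<rho> (r \<otimes>\<^bsub>R\<^esub> s) = \<rho> r \<otimes>\<^bsub>T\<^esub> \<rho> s"
  "\<rho> \<one>\<^bsub>R\<^esub> = \<one>\<^bsub>T\<^esub>" "\<rho> \<zero>\<^bsub>R\<^esub> = \<zero>\<^bsub>T\<^esub>"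
  by (rule T_ext; simp add: rho_closed rho_apply T_ops M.smult_l_distr M.smult_assoc1)+

lemma rho_minus: "r \<in> carrier R \<Longrightarrow> \<rho> (\<ominus>\<^bsub>R\<^esub> r) = \<ominus>\<^bsub>T\<^esub> \<rho> r"
  by (rule T_ext) (simp_all add: rho_closed rho_apply T_minus[OF T_cring] M.smult_l_minus)

lemma rho_diff: "r \<in> carrier R \<Longrightarrow> s \<in> carrier R \<Longrightarrow> \<rho> (r \<ominus>\<^bsub>R\<^esub> s) = \<rho> r \<ominus>\<^bsub>T\<^esub> \<rho> s"
  by (simp add: a_minus_def rho_hom rho_minus)

lemma rho_pow: "r \<in> carrier R \<Longrightarrow> \<rho> (r [^]\<^bsub>R\<^esub> (k::nat)) = \<rho> r [^]\<^bsub>T\<^esub> k"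
  by (induction k) (simp_all add: rho_hom)

lemma center_module_module: "module T center_module"
proof (rule moduleI[OF T_cring])
  show "abelian_group center_module"
    by (rule abelian_groupI) (auto simp: M.a_ac M.l_neg intro!: bexI[of _ "\<ominus>\<^bsub>M\<^esub> _"])
qed (simp_all add: T_ops T_closed mod_homD(2)[OF T_D(1)])

lemma center_as_module_module: "module R center_as_module"
proof (rule moduleI[OF M.is_cring])
  show "abelian_group center_as_module"
    by (rule abelian_groupI) (auto simp: T.a_ac T.l_neg intro!: bexI[of _ "\<ominus>\<^bsub>T\<^esub> _"])
qed (simp_all add: rho_closed rho_hom T.l_distr T.r_distr T.m_assoc)

end

section \<open>The center in the presence of a parameter\<close>

text \<open>Of the Gorenstein condition on R only the chain condition and the parameter a are kept.
  The condition on T remains a hypothesis of the lemmas that use it, apart from its chain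
  condition.\<close>

locale center_setting = cring_endo_center R M
  for R :: "('a, 'c) ring_scheme" and M :: "('a, 'b, 'd) module_scheme" +
  fixes \<mm> :: "'a set" and a :: 'a and g :: nat and p :: "(nat \<Rightarrow> 'a) \<Rightarrow> 'b"
  assumes loc: "local_ring R \<mm>" and noeth: "noetherian_ring R" and noethT: "noetherian_ring T"
    and tf: "torsionfree_module R M" and faithful: "faithful_module R M"
    and cov: "cover R {..<g} p M"
    and a_in: "a \<in> \<mm>" and nzd: "nonzerodivisor R a"
    and prime_eq: "\<And>Q. primeideal Q R \<Longrightarrow> a \<in> Q \<Longrightarrow> Q = \<mm>"
begin

lemma a_carrier: "a \<in> carrier R" using nzd by (simp add: nonzerodivisor_def)

lemmas loc_facts = local_ringD[OF loc]

lemma torsionfree_cancel: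
  assumes "nonzerodivisor R c" "x \<in> carrier M" "y \<in> carrier M" "c \<odot>\<^bsub>M\<^esub> x = c \<odot>\<^bsub>M\<^esub> y" shows "x = y"
proof -
  have c: "c \<in> carrier R" using assms(1) by (simp add: nonzerodivisor_def)
  have "c \<odot>\<^bsub>M\<^esub> (x \<ominus>\<^bsub>M\<^esub> y) = c \<odot>\<^bsub>M\<^esub> x \<ominus>\<^bsub>M\<^esub> c \<odot>\<^bsub>M\<^esub> y"
    using c assms(2,3) by (simp add: a_minus_def M.smult_r_distr M.smult_r_minus)
  also have "\<dots> = \<zero>\<^bsub>M\<^esub>" using c assms(3) unfolding assms(4) by (simp add: M.minus_eq_zero_iff)
  finally have "x \<ominus>\<^bsub>M\<^esub> y = \<zero>\<^bsub>M\<^esub>" using tf assms(1-3) unfolding torsionfree_module_def by blast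
  then show ?thesis using assms(2,3) by (simp add: M.minus_eq_zero_iff)
qed

lemma center_module_cover: obtains q where "cover T {..<g} q center_module"
proof -
  note p = coverD[OF cov]
  have "p (unit_vec R i) \<in> carrier center_module" if "i \<in> {..<g}" for i
    using mod_homD(1)[OF p(1) unit_vec_carrier[OF M.is_cring that]] by simp
  from free_hom_exists[where I = "{..<g}" and x = "\<lambda>i. p (unit_vec R i)", OF center_module_module this] obtain q where
    q: "q \<in> mod_hom T (free_mod T {..<g}) center_module" "\<And>i. i \<in> {..<g} \<Longrightarrow> q (unit_vec T i) = p (unit_vec R i)" by auto
  let ?F = "free_mod T {..<g}"
  note F = free_mod_module[OF T_cring, of "{..<g}"]
  let ?S = "q ` carrier ?F"
  have S: "submodule ?S T center_module"
    by (rule submodule_image[OF F center_module_module q(1) module.carrier_is_submodule[OF F]])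
  note E = module.submoduleE[OF center_module_module S]
  have "p v \<in> ?S" if "v \<in> carrier (free_mod R {..<g})" for v
    using M.is_cring that
  proof (induction rule: free_mod_induct)
    case zero
    show ?case
      using mod_hom_zero[OF free_mod_module[OF M.is_cring] M.module_axioms p(1)] submodule_zero[OF S] by simp
  next
    case (add v w)
    then show ?case using mod_homD(2)[OF p(1) add(1,2)] E(5)[OF add(3,4)] by simp
  next
    case (unit r i)
    have u: "unit_vec R i \<in> carrier (free_mod R {..<g})" by (rule unit_vec_carrier[OF M.is_cring unit(2)])
    have "p (unit_vec R i) \<in> ?S"
      using q(2)[OF unit(2)] imageI[OF unit_vec_carrier[OF T_cring unit(2)], of q] by simp
    then have "\<rho> r (p (unit_vec R i)) \<in> ?S" using E(4)[OF rho_closed[OF unit(1)]] by simp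
    then show ?case using mod_homD(3)[OF p(1) unit(1) u] rho_apply[OF mod_homD(1)[OF p(1) u]] by simp
  qed
  then have "carrier M \<subseteq> ?S" unfolding p(2)[symmetric] by (rule image_subsetI)
  then have "cover T {..<g} q center_module" unfolding cover_def using q(1) E(1) by simp
  then show ?thesis by (rule that)
qed

text \<open>An element of T that kills the generators of M is zero, so T embeds over R in a finite
  power of M.\<close>

lemma center_acc: "acc R center_as_module (carrier center_as_module)"
proof (rule acc_joint[where A = "{..<g}" and f = "\<lambda>i z. z (p (unit_vec R i))", OF _ center_as_module_module M.module_axioms])
  note p = coverD[OF cov]
  have pu: "p (unit_vec R i) \<in> carrier M" if "i \<in> {..<g}" for i
    by (rule mod_homD(1)[OF p(1) unit_vec_carrier[OF M.is_cring that]])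
  show "(\<lambda>z. z (p (unit_vec R i))) \<in> mod_hom R center_as_module M" if "i \<in> {..<g}" for i
    by (rule mod_homI) (simp_all add: T_closed T_ops pu[OF that] rho_apply)
  show "acc R M (carrier M)" by (rule cover_acc[OF M.is_cring noeth M.module_axioms cov]) simp
  show "submodule (carrier center_as_module) R center_as_module"
    by (rule module.carrier_is_submodule[OF center_as_module_module])
  fix z assume "z \<in> carrier center_as_module" and z0: "\<And>i. i \<in> {..<g} \<Longrightarrow> z (p (unit_vec R i)) = \<zero>\<^bsub>M\<^esub>"
  then have z: "z \<in> carrier T" by simp
  have "z (p v) = \<zero>\<^bsub>M\<^esub>" if "v \<in> carrier (free_mod R {..<g})" for v
    by (rule free_hom_eq[OF M.is_cring M.module_axioms mod_hom_comp[OF p(1) T_D(1)[OF z]]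
          mod_hom_zero_fun[OF M.module_axioms] _ that]) (rule z0)
  then have "z x = \<zero>\<^bsub>M\<^esub>" if "x \<in> carrier M" for x using that unfolding p(2)[symmetric] by blast
  then have "z = \<zero>\<^bsub>T\<^esub>" by (intro T_ext[OF z T.zero_closed]) (simp add: T_ops)
  then show "z = \<zero>\<^bsub>center_as_module\<^esub>" by simp
qed simp

text \<open>Division by c is unambiguous in a torsionfree module, so w/c is linear and commutes with
  every endomorphism because w does. Thus membership in cT can be tested on M: if wM lies in cM,
  then w lies in cT.\<close>

lemma center_divide:
  assumes "nonzerodivisor R c" "w \<in> carrier T" "\<And>x. x \<in> carrier M \<Longrightarrow> \<exists>y\<in>carrier M. w x = c \<odot>\<^bsub>M\<^esub> y"
  shows "\<exists>e\<in>carrier T. w = e \<otimes>\<^bsub>T\<^esub> \<rho> c"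
proof -
  have c: "c \<in> carrier R" using assms(1) by (simp add: nonzerodivisor_def)
  define e where "e x = (SOME y. y \<in> carrier M \<and> w x = c \<odot>\<^bsub>M\<^esub> y)" for x
  have e: "e x \<in> carrier M \<and> w x = c \<odot>\<^bsub>M\<^esub> e x" if "x \<in> carrier M" for x
    unfolding e_def by (rule someI_ex) (use assms(3)[OF that] in blast)
  note ec = e[THEN conjunct1] and ew = e[THEN conjunct2]
  note w = T_D[OF assms(2)]
  have eq: "e x = y" if "x \<in> carrier M" "y \<in> carrier M" "w x = c \<odot>\<^bsub>M\<^esub> y" for x y
    by (rule torsionfree_cancel[OF assms(1) ec[OF that(1)] that(2)]) (use ew[OF that(1)] that(3) in simp)
  have hom: "e \<in> mod_hom R M M"
  proof (rule mod_homI)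
    fix x assume x: "x \<in> carrier M"
    show "e x \<in> carrier M" by (rule ec[OF x])
    { fix y assume y: "y \<in> carrier M"
      show "e (x \<oplus>\<^bsub>M\<^esub> y) = e x \<oplus>\<^bsub>M\<^esub> e y"
        by (rule eq) (use x y c ec[OF x] ec[OF y] mod_homD(2)[OF w(1) x y] ew[OF x] ew[OF y] in \<open>simp_all add: M.smult_r_distr\<close>) }
    { fix r assume r: "r \<in> carrier R"
      show "e (r \<odot>\<^bsub>M\<^esub> x) = r \<odot>\<^bsub>M\<^esub> e x"
      proof (rule eq)
        have "w (r \<odot>\<^bsub>M\<^esub> x) = r \<odot>\<^bsub>M\<^esub> (c \<odot>\<^bsub>M\<^esub> e x)" using mod_homD(3)[OF w(1) r x] ew[OF x] by simp
        also have "\<dots> = c \<odot>\<^bsub>M\<^esub> (r \<odot>\<^bsub>M\<^esub> e x)"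
          using r c ec[OF x] M.R.m_comm[OF r c] by (simp flip: M.smult_assoc1)
        finally show "w (r \<odot>\<^bsub>M\<^esub> x) = c \<odot>\<^bsub>M\<^esub> (r \<odot>\<^bsub>M\<^esub> e x)" .
      qed (use x r ec[OF x] in simp_all) }
  qed
  have com: "e (h x) = h (e x)" if h: "h \<in> mod_hom R M M" and x: "x \<in> carrier M" for h x
  proof (rule eq)
    have "w (h x) = h (c \<odot>\<^bsub>M\<^esub> e x)" using w(3)[OF h x] ew[OF x] by simp
    then show "w (h x) = c \<odot>\<^bsub>M\<^esub> h (e x)" using mod_homD(3)[OF h c ec[OF x]] by simp
  qed (use mod_homD(1)[OF h] x ec[OF x] in simp_all)
  have eT: "restrict e (carrier M) \<in> carrier T" by (rule T_I[OF hom com])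
  have "w = restrict e (carrier M) \<otimes>\<^bsub>T\<^esub> \<rho> c"
    by (rule T_ext[OF assms(2)])
      (use eT rho_closed[OF c] c ew mod_homD(3)[OF hom c] in \<open>simp_all add: T_ops rho_apply\<close>)
  then show ?thesis using eT by (rule bexI)
qed

lemma rho_nonzerodivisor:
  assumes "nonzerodivisor R c" shows "nonzerodivisor T (\<rho> c)"
  unfolding nonzerodivisor_def
proof (intro conjI ballI impI)
  have c: "c \<in> carrier R" using assms by (simp add: nonzerodivisor_def)
  show "\<rho> c \<in> carrier T" by (rule rho_closed[OF c])
  fix s assume s: "s \<in> carrier T" and 0: "\<rho> c \<otimes>\<^bsub>T\<^esub> s = \<zero>\<^bsub>T\<^esub>"
  show "s = \<zero>\<^bsub>T\<^esub>"
  proof (rule T_ext[OF s T.zero_closed])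
    fix x assume x: "x \<in> carrier M"
    have "c \<odot>\<^bsub>M\<^esub> s x = \<zero>\<^bsub>M\<^esub>" using fun_cong[OF 0, of x] x T_closed[OF s x] by (simp add: T_ops rho_apply)
    then show "s x = \<zero>\<^bsub>T\<^esub> x"
      using torsionfree_cancel[OF assms T_closed[OF s x] M.zero_closed] c x by (simp add: T_ops)
  qed
qed

lemma rho_ideal_submodule: "ideal I T \<Longrightarrow> submodule I R center_as_module"
proof -
  assume I: "ideal I T"
  interpret I: ideal I T by fact
  interpret C: module R center_as_module by (rule center_as_module_module)
  have "\<ominus>\<^bsub>center_as_module\<^esub> x = \<ominus>\<^bsub>T\<^esub> x" for x
    by (simp add: a_inv_def m_inv_def center_as_module_def)
  then show ?thesis
    by (intro C.submoduleI) (use I.a_subset in \<open>auto simp: I.I_l_closed rho_closed\<close>)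
qed

text \<open>A maximal proper R-submodule Z of T containing \<nn> also contains \<mm>T. The largest
  ideal of T inside Z, which is \<open>?J\<close>, is proper and contains \<nn>, so it equals \<nn>;
  and it contains the image of \<mm>.\<close>

lemma maximalideal_rho:
  assumes "maximalideal \<nn> T" "r \<in> \<mm>" shows "\<rho> r \<in> \<nn>"
proof -
  interpret N: maximalideal \<nn> T by fact
  have ne: "\<nn> \<noteq> carrier center_as_module" using N.I_notcarr by simp
  obtain Z where Z: "submodule Z R center_as_module" "\<nn> \<subseteq> Z" "Z \<noteq> carrier center_as_module"
    "\<And>r x. r \<in> \<mm> \<Longrightarrow> x \<in> carrier center_as_module \<Longrightarrow> r \<odot>\<^bsub>center_as_module\<^esub> x \<in> Z"
    by (rule nakayama_maximal[OF loc noeth center_as_module_module center_acc rho_ideal_submodule[OF N.is_ideal] ne])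
      (assumption | rule that)+
  note E = module.submoduleE[OF center_as_module_module Z(1)]
  have r: "\<rho> r \<in> carrier T" using assms(2) loc_facts(5) rho_closed by blast
  let ?J = "{t \<in> carrier T. \<forall>u\<in>carrier T. t \<otimes>\<^bsub>T\<^esub> u \<in> Z}"
  have J: "ideal ?J T"
  proof (rule T.idealI')
    show "\<zero>\<^bsub>T\<^esub> \<in> ?J" using submodule_zero[OF Z(1)] by simp
    fix x assume x: "x \<in> ?J"
    show "s \<otimes>\<^bsub>T\<^esub> x \<in> ?J" if s: "s \<in> carrier T" for s
    proof -
      have "(s \<otimes>\<^bsub>T\<^esub> x) \<otimes>\<^bsub>T\<^esub> u = x \<otimes>\<^bsub>T\<^esub> (s \<otimes>\<^bsub>T\<^esub> u)" if "u \<in> carrier T" for u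
        using x s that by (simp add: T.m_ac)
      then show ?thesis using x s by simp
    qed
    show "x \<oplus>\<^bsub>T\<^esub> y \<in> ?J" if "y \<in> ?J" for y
      using x that E(5) by (simp add: T.l_distr)
  qed blast
  have "\<nn> \<subseteq> ?J" using Z(2) N.I_r_closed N.Icarr by blast
  then have "?J = \<nn> \<or> ?J = carrier T" by (rule N.I_maximal[OF J]) blast
  moreover have "?J \<noteq> carrier T"
  proof
    assume J: "?J = carrier T"
    have "z \<in> Z" if z: "z \<in> carrier T" for z
    proof -
      have "z \<in> ?J" using z unfolding J .
      then have "z \<otimes>\<^bsub>T\<^esub> \<one>\<^bsub>T\<^esub> \<in> Z" by blast
      then show ?thesis using z by simp
    qed
    then show False using Z(3) E(1) by auto
  qed
  moreover have "\<rho> r \<in> ?J" using r Z(4)[OF assms(2)] by simp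
  ultimately show ?thesis by blast
qed

text \<open>P contracts to a prime of R containing a, and \<mm> is the only such prime.\<close>

lemma rho_vimage:
  assumes "primeideal P T" "\<rho> a \<in> P" "r \<in> carrier R"
  shows "\<rho> r \<in> P \<longleftrightarrow> r \<in> \<mm>"
proof -
  interpret P: primeideal P T by fact
  let ?Q = "{r \<in> carrier R. \<rho> r \<in> P}"
  have "\<one>\<^bsub>T\<^esub> \<notin> P" using P.one_imp_carrier P.I_notcarr by blast
  then have ne: "\<one>\<^bsub>R\<^esub> \<notin> ?Q" by (simp add: rho_hom)
  have I: "ideal ?Q R"
    by (rule M.R.idealI') (auto simp: rho_hom rho_closed P.I_l_closed)
  have "primeideal ?Q R"
  proof (rule primeidealI[OF I M.is_cring])
    show "carrier R \<noteq> ?Q" using ne by blast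
    fix x y assume xy: "x \<in> carrier R" "y \<in> carrier R" "x \<otimes>\<^bsub>R\<^esub> y \<in> ?Q"
    then show "x \<in> ?Q \<or> y \<in> ?Q" using P.I_prime[OF rho_closed rho_closed] by (auto simp: rho_hom)
  qed
  then have "?Q = \<mm>" by (rule prime_eq) (use assms(2) a_carrier in simp)
  then show ?thesis using assms(3) by blast
qed

end

context center_setting begin

lemma unit_in_ideal:
  assumes "ideal J T" "r \<in> carrier R" "r \<notin> \<mm>" "t \<in> carrier T" "\<rho> r \<otimes>\<^bsub>T\<^esub> t \<in> J" shows "t \<in> J"
proof -
  interpret J: ideal J T by fact
  have u: "r \<in> Units R" by (rule local_unit[OF loc noeth assms(2,3)])
  have i: "inv\<^bsub>R\<^esub> r \<in> carrier R" using u by simp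
  have "\<rho> (inv\<^bsub>R\<^esub> r) \<otimes>\<^bsub>T\<^esub> (\<rho> r \<otimes>\<^bsub>T\<^esub> t) \<in> J" by (rule J.I_l_closed[OF assms(5) rho_closed[OF i]])
  moreover have "\<rho> (inv\<^bsub>R\<^esub> r) \<otimes>\<^bsub>T\<^esub> (\<rho> r \<otimes>\<^bsub>T\<^esub> t) = \<rho> (inv\<^bsub>R\<^esub> r \<otimes>\<^bsub>R\<^esub> r) \<otimes>\<^bsub>T\<^esub> t"
    using i assms(2,4) by (simp add: rho_hom rho_closed T.m_assoc)
  ultimately show ?thesis using u assms(4) by (simp add: rho_hom)
qed

text \<open>
  For \<open>t\<close> outside \<open>P\<close>, the powers of \<open>t\<close> satisfy a relation over \<open>R\<close> modulo \<open>P\<close> by the ascending chain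
  condition; if \<open>t\<close> lay in a proper ideal $J \supset P$, its constant coefficient would lie in
  $\mathfrak m$ and hence in \<open>P\<close>, so the relation could be divided by \<open>t\<close> down to degree zero.
\<close>

lemma prime_maximal:
  assumes "primeideal P T" "\<rho> a \<in> P" shows "maximalideal P T"
proof (rule maximalidealI)
  interpret P: primeideal P T by fact
  interpret C: module R center_as_module by (rule center_as_module_module)
  show "ideal P T" by (rule P.is_ideal)
  show "carrier T \<noteq> P" by (rule P.I_notcarr)
  fix J assume J: "ideal J T" "P \<subseteq> J" "J \<subseteq> carrier T"
  interpret J: ideal J T by fact
  show "J = P \<or> J = carrier T"
  proof (rule ccontr)
    assume neg: "\<not> ?thesis"
    then obtain t where t: "t \<in> J" "t \<notin> P" using J(2) by blast
    have tc: "t \<in> carrier T" using t(1) by (rule J.Icarr)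
    have one: "\<one>\<^bsub>T\<^esub> \<notin> J" using J.one_imp_carrier neg by blast
    have small: "\<rho> r \<in> P" if r: "r \<in> carrier R" "\<rho> r \<in> J" for r
    proof -
      have "r \<in> \<mm>" using unit_in_ideal[OF J(1) r(1) _ T.one_closed] r one rho_closed[OF r(1)] by auto
      then show ?thesis using rho_vimage[OF assms r(1)] by simp
    qed
    \<comment> \<open>Y j is P + R + Rt + ... + Rt^j, the polynomials in t of degree at most j
      modulo P.\<close>
    define Y where "Y = rec_nat (adjoin R center_as_module P \<one>\<^bsub>T\<^esub>)
      (\<lambda>j Z. adjoin R center_as_module Z (t [^]\<^bsub>T\<^esub> Suc j))"
    have Y0: "Y 0 = adjoin R center_as_module P \<one>\<^bsub>T\<^esub>"
      and YS: "Y (Suc j) = adjoin R center_as_module (Y j) (t [^]\<^bsub>T\<^esub> Suc j)" for j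
      by (simp_all add: Y_def)
    have tp: "t [^]\<^bsub>T\<^esub> j \<in> carrier T" for j :: nat using tc by simp
    have tpC: "t [^]\<^bsub>T\<^esub> j \<in> carrier center_as_module" for j :: nat using tp by simp
    have Pm: "submodule P R center_as_module" by (rule rho_ideal_submodule[OF P.is_ideal])
    have oneC: "\<one>\<^bsub>T\<^esub> \<in> carrier center_as_module" by simp
    have Ys: "submodule (Y j) R center_as_module" for j
    proof (induction j)
      case 0 then show ?case unfolding Y0 by (rule adjoin_submodule(1)[OF center_as_module_module Pm oneC])
    next
      case (Suc j) then show ?case unfolding YS by (rule adjoin_submodule(1)[OF center_as_module_module _ tpC])
    qed
    have Ym: "Y j \<subseteq> Y (Suc j)" for j
      unfolding YS by (rule adjoin_submodule(2)[OF center_as_module_module Ys tpC])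
    note E = C.submoduleE[OF Ys]
    have Yc: "y \<in> carrier T" if "y \<in> Y j" for y j using E(1) that by auto
    have PY: "P \<subseteq> Y j" for j
      by (induction j) (use Ym adjoin_submodule(2)[OF center_as_module_module Pm oneC] Y0 in blast)+
    have tY: "t [^]\<^bsub>T\<^esub> Suc j \<in> Y (Suc j)" for j
      unfolding YS by (rule adjoin_submodule(3)[OF center_as_module_module Ys tpC])
    \<comment> \<open>Horner form: the constant coefficient r is split off, and the rest is t times
      an element of Y j, modulo P.\<close>
    have dec: "\<exists>r\<in>carrier R. \<exists>y'\<in>Y j. \<exists>q\<in>P. y = \<rho> r \<oplus>\<^bsub>T\<^esub> t \<otimes>\<^bsub>T\<^esub> y' \<oplus>\<^bsub>T\<^esub> q" if "y \<in> Y (Suc j)" for y j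
      using that
    proof (induction j arbitrary: y)
      case 0
      then obtain z s where z: "y = z \<oplus>\<^bsub>T\<^esub> \<rho> s \<otimes>\<^bsub>T\<^esub> t" "z \<in> Y 0" "s \<in> carrier R"
        using tc by (auto simp: YS adjoin_def)
      then obtain q r where q: "z = q \<oplus>\<^bsub>T\<^esub> \<rho> r \<otimes>\<^bsub>T\<^esub> \<one>\<^bsub>T\<^esub>" "q \<in> P" "r \<in> carrier R"
        by (auto simp: Y0 adjoin_def)
      note c = P.Icarr[OF q(2)] rho_closed[OF q(3)] rho_closed[OF z(3)]
      have "y = \<rho> r \<oplus>\<^bsub>T\<^esub> t \<otimes>\<^bsub>T\<^esub> \<rho> s \<oplus>\<^bsub>T\<^esub> q" unfolding z(1) q(1) using c tc by algebra
      moreover have "\<one>\<^bsub>T\<^esub> \<in> Y 0" unfolding Y0 by (rule adjoin_submodule(3)[OF center_as_module_module Pm oneC])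
      then have "\<rho> s \<in> Y 0" using E(4)[OF z(3), of "\<one>\<^bsub>T\<^esub>" 0] c by simp
      ultimately show ?case using q(2,3) by blast
    next
      case (Suc j)
      then obtain z s where z: "y = z \<oplus>\<^bsub>T\<^esub> \<rho> s \<otimes>\<^bsub>T\<^esub> t [^]\<^bsub>T\<^esub> Suc (Suc j)" "z \<in> Y (Suc j)" "s \<in> carrier R"
        by (auto simp: YS[of "Suc j"] adjoin_def)
      obtain r y' q where r: "r \<in> carrier R" "y' \<in> Y j" "q \<in> P" "z = \<rho> r \<oplus>\<^bsub>T\<^esub> t \<otimes>\<^bsub>T\<^esub> y' \<oplus>\<^bsub>T\<^esub> q"
        using Suc.IH[OF z(2)] by (elim bexE) (rule that)
      let ?u = "t [^]\<^bsub>T\<^esub> Suc j"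
      have u: "?u \<in> carrier T" by (rule tp)
      have s2: "t [^]\<^bsub>T\<^esub> Suc (Suc j) = ?u \<otimes>\<^bsub>T\<^esub> t" by simp
      note c = P.Icarr[OF r(3)] rho_closed[OF r(1)] rho_closed[OF z(3)] Yc[OF r(2)]
      have "y = \<rho> r \<oplus>\<^bsub>T\<^esub> t \<otimes>\<^bsub>T\<^esub> (y' \<oplus>\<^bsub>T\<^esub> \<rho> s \<otimes>\<^bsub>T\<^esub> ?u) \<oplus>\<^bsub>T\<^esub> q"
        unfolding z(1) r(4) s2 using c tc u by algebra
      moreover have "y' \<in> Y (Suc j)" using r(2) Ym by blast
      then have "y' \<oplus>\<^bsub>T\<^esub> \<rho> s \<otimes>\<^bsub>T\<^esub> ?u \<in> Y (Suc j)"
        using E(5)[of y' "Suc j" "\<rho> s \<otimes>\<^bsub>T\<^esub> ?u"] E(4)[OF z(3) tY[of j]] by (simp del: T.nat_pow_Suc)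
      ultimately show ?case using r(1,3) by blast
    qed
    \<comment> \<open>Modulo P the constant coefficient is the multiple t(y - y') of t, so
      \<open>small\<close> puts it into P. As P is prime and t lies outside it, y - y' lies in
      P.\<close>
    have desc: "y \<in> Y j" if yj: "t \<otimes>\<^bsub>T\<^esub> y \<in> Y (Suc j)" "y \<in> carrier T" for y j
    proof -
      obtain r y' q where r: "r \<in> carrier R" "y' \<in> Y j" "q \<in> P" "t \<otimes>\<^bsub>T\<^esub> y = \<rho> r \<oplus>\<^bsub>T\<^esub> t \<otimes>\<^bsub>T\<^esub> y' \<oplus>\<^bsub>T\<^esub> q"
        using dec[OF yj(1)] by (elim bexE) (rule that)
      note c = P.Icarr[OF r(3)] rho_closed[OF r(1)] Yc[OF r(2)]
      have e: "\<rho> r = t \<otimes>\<^bsub>T\<^esub> (y \<ominus>\<^bsub>T\<^esub> y') \<ominus>\<^bsub>T\<^esub> q"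
        using r(4) c tc yj(2) by algebra
      have "t \<otimes>\<^bsub>T\<^esub> (y \<ominus>\<^bsub>T\<^esub> y') \<in> J" using J.I_r_closed[OF t(1)] c yj(2) by simp
      then have "\<rho> r \<in> J" using e r(3) J(2) ideal_diff[OF J(1)] by auto
      then have "\<rho> r \<in> P" by (rule small[OF r(1)])
      moreover have "t \<otimes>\<^bsub>T\<^esub> (y \<ominus>\<^bsub>T\<^esub> y') = \<rho> r \<oplus>\<^bsub>T\<^esub> q" using r(4) c tc yj(2) by algebra
      ultimately have "t \<otimes>\<^bsub>T\<^esub> (y \<ominus>\<^bsub>T\<^esub> y') \<in> P" using r(3) by simp
      then have "y \<ominus>\<^bsub>T\<^esub> y' \<in> P" using P.I_prime[OF tc] c yj(2) t(2) by blast
      then have "y \<ominus>\<^bsub>T\<^esub> y' \<in> Y j" using PY by blast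
      then have "(y \<ominus>\<^bsub>T\<^esub> y') \<oplus>\<^bsub>T\<^esub> y' \<in> Y j" using E(5)[OF _ r(2)] by simp
      moreover have "(y \<ominus>\<^bsub>T\<^esub> y') \<oplus>\<^bsub>T\<^esub> y' = y" using c yj(2) by algebra
      ultimately show ?thesis by simp
    qed
    have stop: "t [^]\<^bsub>T\<^esub> Suc j \<notin> Y j" for j
    proof (induction j)
      case 0
      show ?case
      proof
        assume "t [^]\<^bsub>T\<^esub> Suc 0 \<in> Y 0"
        then obtain q r where q: "t = q \<oplus>\<^bsub>T\<^esub> \<rho> r \<otimes>\<^bsub>T\<^esub> \<one>\<^bsub>T\<^esub>" "q \<in> P" "r \<in> carrier R"
          using tc by (auto simp: Y0 adjoin_def)
        note c = P.Icarr[OF q(2)] rho_closed[OF q(3)]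
        have "\<rho> r = t \<ominus>\<^bsub>T\<^esub> q" using q(1) c tc by algebra
        then have "\<rho> r \<in> J" using ideal_diff[OF J(1) t(1)] q(2) J(2) by auto
        then have "\<rho> r \<in> P" by (rule small[OF q(3)])
        then have "q \<oplus>\<^bsub>T\<^esub> \<rho> r \<otimes>\<^bsub>T\<^esub> \<one>\<^bsub>T\<^esub> \<in> P" using q(2) c by simp
        then show False using t(2) q(1) by simp
      qed
    next
      case (Suc j)
      have "t [^]\<^bsub>T\<^esub> Suc (Suc j) = t \<otimes>\<^bsub>T\<^esub> t [^]\<^bsub>T\<^esub> Suc j"
        using T.m_comm[OF tc tp[of "Suc j"]] by simp
      then show ?case using desc[OF _ tp[of "Suc j"], of j] Suc.IH by metis
    qed
    have "\<exists>n. \<forall>k\<ge>n. Y k = Y n" by (rule accD[where Y = Y, OF center_acc Ys E(1) Ym])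
    then obtain n where "\<forall>k\<ge>n. Y k = Y n" by (rule exE)
    from this[rule_format, OF le_SucI[OF order_refl]] show False using tY[of n] stop[of n] by simp
  qed
qed

text \<open>Applied to every maximal ideal in turn, this says that the trace ideal of M over T is
  the unit ideal.\<close>

lemma center_trace:
  assumes "gorenstein_ring T" "maximalideal \<nn> T"
  obtains f x where "f \<in> mod_hom T center_module (ring_module T)" "x \<in> carrier M" "f x \<notin> \<nn>"
proof (rule ccontr)
  assume "\<not> thesis"
  then have f: "f x \<in> \<nn>" if "f \<in> mod_hom T center_module (ring_module T)" "x \<in> carrier center_module" for f x
    using that \<open>\<And>f x. f \<in> mod_hom T center_module (ring_module T) \<Longrightarrow> x \<in> carrier M \<Longrightarrow> f x \<notin> \<nn> \<Longrightarrow> thesis\<close> by auto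
  obtain q where q: "cover T {..<g} q center_module" by (rule center_module_cover)
  have inj: "self_injective T (\<rho> a [^]\<^bsub>T\<^esub> k)" for k :: nat
    by (rule gorenstein_ring_self_injective[OF assms(1) rho_nonzerodivisor[OF nzd]])
      (rule maximalideal_rho[OF _ a_in] prime_maximal; assumption)+
  obtain k :: nat and b where b: "b \<in> carrier T" "b \<notin> PIdl\<^bsub>T\<^esub> (\<rho> a [^]\<^bsub>T\<^esub> k)"
    "\<And>x. x \<in> carrier center_module \<Longrightarrow> \<exists>y\<in>carrier center_module. b \<odot>\<^bsub>center_module\<^esub> x = \<rho> a [^]\<^bsub>T\<^esub> k \<odot>\<^bsub>center_module\<^esub> y"
    by (rule trace_or_divides[where a = "\<rho> a" and \<nn> = \<nn> and p = q and g = g, OF T_cring noethT center_module_module q assms(2) maximalideal_rho[OF assms(2) a_in]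
          prime_maximal inj])
      (assumption | (rule f, assumption, assumption) | rule that)+
  have "\<exists>y\<in>carrier M. b x = a [^]\<^bsub>R\<^esub> k \<odot>\<^bsub>M\<^esub> y" if x: "x \<in> carrier M" for x
    using b(3)[of x] x unfolding rho_pow[OF a_carrier, symmetric] by (auto simp: rho_apply)
  then have "\<exists>e\<in>carrier T. b = e \<otimes>\<^bsub>T\<^esub> \<rho> (a [^]\<^bsub>R\<^esub> k)"
    by (rule center_divide[OF nonzerodivisor_power[OF M.is_cring nzd] b(1)])
  then obtain e where "e \<in> carrier T" "b = e \<otimes>\<^bsub>T\<^esub> \<rho> (a [^]\<^bsub>R\<^esub> k)" by (rule bexE)
  then show False using b(2) unfolding rho_pow[OF a_carrier] cgenideal_def by blast
qed

end

subsection \<open>Rigidity\<close>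

definition mod_cong :: "('a, 'b, 'd) module_scheme \<Rightarrow> 'b set \<Rightarrow> 'b \<Rightarrow> 'b \<Rightarrow> bool" where
  "mod_cong N D x y \<longleftrightarrow> x \<in> carrier N \<and> y \<in> carrier N \<and> x \<ominus>\<^bsub>N\<^esub> y \<in> D"

locale submodule_cong = N: module R N
  for R :: "('a, 'c) ring_scheme" and N :: "('a, 'b, 'd) module_scheme" +
  fixes D :: "'b set"
  assumes D: "submodule D R N"
begin

lemmas DE = N.submoduleE[OF D]

lemma cong_trans:
  assumes "mod_cong N D x y" "mod_cong N D y z" shows "mod_cong N D x z"
proof -
  have c: "x \<in> carrier N" "y \<in> carrier N" "z \<in> carrier N" using assms by (auto simp: mod_cong_def)
  have "(x \<ominus>\<^bsub>N\<^esub> y) \<oplus>\<^bsub>N\<^esub> (y \<ominus>\<^bsub>N\<^esub> z) = x \<oplus>\<^bsub>N\<^esub> ((\<ominus>\<^bsub>N\<^esub> y \<oplus>\<^bsub>N\<^esub> y) \<oplus>\<^bsub>N\<^esub> \<ominus>\<^bsub>N\<^esub> z)"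
    using c by (simp add: a_minus_def N.a_assoc)
  also have "\<dots> = x \<ominus>\<^bsub>N\<^esub> z" using c by (simp add: a_minus_def N.l_neg)
  finally have "x \<ominus>\<^bsub>N\<^esub> z \<in> D" using DE(5) assms unfolding mod_cong_def by metis
  then show ?thesis using c by (simp add: mod_cong_def)
qed

lemma cong_sym:
  assumes "mod_cong N D x y" shows "mod_cong N D y x"
proof -
  have c: "x \<in> carrier N" "y \<in> carrier N" using assms by (auto simp: mod_cong_def)
  have "\<ominus>\<^bsub>N\<^esub> (x \<ominus>\<^bsub>N\<^esub> y) = y \<ominus>\<^bsub>N\<^esub> x" using c by (simp add: a_minus_def N.minus_add N.a_comm)
  then show ?thesis using c DE(3) assms unfolding mod_cong_def by metis
qed

lemma cong_add:
  assumes "mod_cong N D x x'" "mod_cong N D y y'" shows "mod_cong N D (x \<oplus>\<^bsub>N\<^esub> y) (x' \<oplus>\<^bsub>N\<^esub> y')"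
proof -
  have c: "x \<in> carrier N" "y \<in> carrier N" "x' \<in> carrier N" "y' \<in> carrier N" using assms by (auto simp: mod_cong_def)
  have "(x \<oplus>\<^bsub>N\<^esub> y) \<ominus>\<^bsub>N\<^esub> (x' \<oplus>\<^bsub>N\<^esub> y') = (x \<ominus>\<^bsub>N\<^esub> x') \<oplus>\<^bsub>N\<^esub> (y \<ominus>\<^bsub>N\<^esub> y')"
    using c by (simp add: a_minus_def N.minus_add N.a_ac)
  then show ?thesis using c DE(5) assms unfolding mod_cong_def by simp
qed

lemma cong_zero_iff:
  assumes x: "x \<in> carrier N" shows "mod_cong N D x \<zero>\<^bsub>N\<^esub> \<longleftrightarrow> x \<in> D"
proof -
  have z: "\<ominus>\<^bsub>N\<^esub> \<zero>\<^bsub>N\<^esub> = \<zero>\<^bsub>N\<^esub>" by (rule N.M.minus_equality) simp_all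
  have "x \<ominus>\<^bsub>N\<^esub> \<zero>\<^bsub>N\<^esub> = x" unfolding a_minus_def z by (rule N.M.r_zero[OF x])
  then show ?thesis using x by (simp only: mod_cong_def) simp
qed

end

text \<open>
  Lifting along a free cover $F \to M$, the given map becomes linear up to a map into \<open>aM\<close>; on the
  syzygy it is \<open>a\<close> times a homomorphism to \<open>M\<close>, which extends to \<open>F\<close> by rigidity and
  can be subtracted.
\<close>

lemma rigid_lift:
  fixes R :: "('a, 'c) ring_scheme" and M :: "('a, 'b, 'd) module_scheme"
  assumes "module R M" "rigid_module R M" "a \<in> carrier R" "D = (\<lambda>m. a \<odot>\<^bsub>M\<^esub> m) ` carrier M"
    and cancel: "\<And>x y. x \<in> carrier M \<Longrightarrow> y \<in> carrier M \<Longrightarrow> a \<odot>\<^bsub>M\<^esub> x = a \<odot>\<^bsub>M\<^esub> y \<Longrightarrow> x = y"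
    and "\<And>x. x \<in> carrier M \<Longrightarrow> \<psi> x \<in> carrier M"
    and "\<And>x y. x \<in> carrier M \<Longrightarrow> y \<in> carrier M \<Longrightarrow> mod_cong M D (\<psi> (x \<oplus>\<^bsub>M\<^esub> y)) (\<psi> x \<oplus>\<^bsub>M\<^esub> \<psi> y)"
    and "\<And>r x. r \<in> carrier R \<Longrightarrow> x \<in> carrier M \<Longrightarrow> mod_cong M D (\<psi> (r \<odot>\<^bsub>M\<^esub> x)) (r \<odot>\<^bsub>M\<^esub> \<psi> x)"
  obtains \<psi>' where "\<psi>' \<in> mod_hom R M M" "\<And>x. x \<in> carrier M \<Longrightarrow> mod_cong M D (\<psi>' x) (\<psi> x)"
proof -
  interpret M: module R M by fact
  have ah: "(\<lambda>m. a \<odot>\<^bsub>M\<^esub> m) \<in> mod_hom R M M" by (rule mod_hom_smult_fun[OF assms(1) mod_hom_id assms(3)])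
  have Ds: "submodule D R M" unfolding assms(4) by (rule submodule_image[OF assms(1,1) ah M.carrier_is_submodule])
  interpret C: submodule_cong R M D by (intro submodule_cong.intro submodule_cong_axioms.intro assms(1) Ds)
  obtain I :: "nat \<Rightarrow> ('b + 'a) list set" and d e where res: "free_resolution R M I d e"
    and tr: "trivial_group (Ext_group R I d M (Suc 0))"
    using assms(2) unfolding rigid_module_def Ext_vanishes_def by auto
  let ?F = "free_mod R (I 0)" and ?K = "d 0 ` carrier (free_mod R (I (Suc 0)))"
  note F = free_mod_module[OF M.is_cring, of "I 0"]
  interpret F: module R ?F by (rule F)
  have e: "e \<in> mod_hom R ?F M" "e ` carrier ?F = carrier M" and K: "?K = hom_ker ?F M e"
    using res unfolding free_resolution_def hom_ker_def by (simp_all add: Let_def)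
  have Ks: "submodule ?K R ?F" unfolding K by (rule hom_ker_submodule[OF F assms(1) e(1)])
  note KE = F.submoduleE[OF Ks]
  have ec: "e v \<in> carrier M" if "v \<in> carrier ?F" for v by (rule mod_homD(1)[OF e(1) that])
  have u: "unit_vec R i \<in> carrier ?F" if "i \<in> I 0" for i by (rule unit_vec_carrier[OF M.is_cring that])
  have "\<psi> (e (unit_vec R i)) \<in> carrier M" if "i \<in> I 0" for i using assms(6)[OF ec[OF u[OF that]]] .
  from free_hom_exists[where I = "I 0" and x = "\<lambda>i. \<psi> (e (unit_vec R i))", OF assms(1) this] obtain f where
    f: "f \<in> mod_hom R ?F M" and fu: "\<And>i. i \<in> I 0 \<Longrightarrow> f (unit_vec R i) = \<psi> (e (unit_vec R i))" by auto
  note fc = mod_homD(1)[OF f]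
  have \<psi>0: "mod_cong M D (\<psi> \<zero>\<^bsub>M\<^esub>) \<zero>\<^bsub>M\<^esub>"
    using assms(8)[OF M.R.zero_closed M.M.zero_closed] assms(6)[OF M.M.zero_closed] by simp
  have f\<psi>: "mod_cong M D (f v) (\<psi> (e v))" if "v \<in> carrier ?F" for v
    using M.is_cring that
  proof (induction rule: free_mod_induct)
    case zero
    have "f \<zero>\<^bsub>?F\<^esub> = \<zero>\<^bsub>M\<^esub>" "e \<zero>\<^bsub>?F\<^esub> = \<zero>\<^bsub>M\<^esub>"
      by (rule mod_hom_zero[OF F assms(1) f], rule mod_hom_zero[OF F assms(1) e(1)])
    then show ?case using C.cong_sym[OF \<psi>0] by (simp only:)
  next
    case (add v w)
    show ?case
      unfolding mod_homD(2)[OF f add(1,2)] mod_homD(2)[OF e(1) add(1,2)]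
      by (rule C.cong_trans[OF C.cong_add[OF add(3,4)] C.cong_sym[OF assms(7)[OF ec[OF add(1)] ec[OF add(2)]]]])
  next
    case (unit r i)
    show ?case
      unfolding mod_homD(3)[OF f unit(1) u[OF unit(2)]] mod_homD(3)[OF e(1) unit(1) u[OF unit(2)]] fu[OF unit(2)]
      by (rule C.cong_sym[OF assms(8)[OF unit(1) ec[OF u[OF unit(2)]]]])
  qed
  define h where "h v = (SOME m. m \<in> carrier M \<and> f v = a \<odot>\<^bsub>M\<^esub> m)" for v
  have h: "h v \<in> carrier M \<and> f v = a \<odot>\<^bsub>M\<^esub> h v" if v: "v \<in> ?K" for v
  proof -
    have vF: "v \<in> carrier ?F" and "e v = \<zero>\<^bsub>M\<^esub>" using v unfolding K hom_ker_def by auto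
    then have "mod_cong M D (f v) \<zero>\<^bsub>M\<^esub>" using C.cong_trans[OF f\<psi>[OF vF]] \<psi>0 by simp
    then have "f v \<in> D" using C.cong_zero_iff fc[OF vF] by simp
    then have "\<exists>m. m \<in> carrier M \<and> f v = a \<odot>\<^bsub>M\<^esub> m" unfolding assms(4) by blast
    then show ?thesis unfolding h_def by (rule someI_ex)
  qed
  note hc = h[THEN conjunct1] and fh = h[THEN conjunct2]
  have KF: "v \<in> carrier ?F" if "v \<in> ?K" for v using KE(1) that by blast
  have "h \<in> mod_hom R (?F\<lparr>carrier := ?K\<rparr>) M"
  proof (rule mod_homI)
    fix v assume "v \<in> carrier (?F\<lparr>carrier := ?K\<rparr>)"
    then have v: "v \<in> ?K" by simp
    show "h v \<in> carrier M" by (rule hc[OF v])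
    { fix w assume "w \<in> carrier (?F\<lparr>carrier := ?K\<rparr>)"
      then have w: "w \<in> ?K" by simp
      have vw: "v \<oplus>\<^bsub>?F\<^esub> w \<in> ?K" by (rule KE(5)[OF v w])
      have "a \<odot>\<^bsub>M\<^esub> h (v \<oplus>\<^bsub>?F\<^esub> w) = a \<odot>\<^bsub>M\<^esub> (h v \<oplus>\<^bsub>M\<^esub> h w)"
        unfolding fh[OF vw, symmetric] mod_homD(2)[OF f KF[OF v] KF[OF w]] fh[OF v] fh[OF w]
        by (rule M.smult_r_distr[OF assms(3) hc[OF v] hc[OF w], symmetric])
      from cancel[OF hc[OF vw] M.a_closed[OF hc[OF v] hc[OF w]] this]
      show "h (v \<oplus>\<^bsub>?F\<lparr>carrier := ?K\<rparr>\<^esub> w) = h v \<oplus>\<^bsub>M\<^esub> h w" by simp }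
    { fix r assume r: "r \<in> carrier R"
      have rv: "r \<odot>\<^bsub>?F\<^esub> v \<in> ?K" by (rule KE(4)[OF r v])
      have "a \<odot>\<^bsub>M\<^esub> h (r \<odot>\<^bsub>?F\<^esub> v) = r \<odot>\<^bsub>M\<^esub> (a \<odot>\<^bsub>M\<^esub> h v)"
        unfolding fh[OF rv, symmetric] mod_homD(3)[OF f r KF[OF v]] fh[OF v] ..
      also have "\<dots> = a \<odot>\<^bsub>M\<^esub> (r \<odot>\<^bsub>M\<^esub> h v)"
        unfolding M.smult_assoc1[OF r assms(3) hc[OF v], symmetric] M.smult_assoc1[OF assms(3) r hc[OF v], symmetric]
          M.R.m_comm[OF r assms(3)] ..
      finally show "h (r \<odot>\<^bsub>?F\<lparr>carrier := ?K\<rparr>\<^esub> v) = r \<odot>\<^bsub>M\<^esub> h v"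
        using cancel[OF hc[OF rv] M.smult_closed[OF r hc[OF v]]] by simp }
  qed
  from trivial_Ext_group[OF assms(1) res tr this] obtain k where
    k: "k \<in> mod_hom R ?F M" "\<forall>v\<in>?K. k v = h v" by (rule bexE)
  have ak: "(\<lambda>v. a \<odot>\<^bsub>M\<^esub> k v) \<in> mod_hom R ?F M" by (rule mod_hom_smult_fun[OF assms(1) k(1) assms(3)])
  have l: "(\<lambda>v. f v \<ominus>\<^bsub>M\<^esub> a \<odot>\<^bsub>M\<^esub> k v) \<in> mod_hom R ?F M" by (rule mod_hom_diff_fun[OF assms(1) f ak])
  have l0: "f v \<ominus>\<^bsub>M\<^esub> a \<odot>\<^bsub>M\<^esub> k v = \<zero>\<^bsub>M\<^esub>" if v: "v \<in> carrier ?F" "e v = \<zero>\<^bsub>M\<^esub>" for v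
  proof -
    have vK: "v \<in> ?K" unfolding K hom_ker_def using v by simp
    show ?thesis
      unfolding bspec[OF k(2) vK] fh[OF vK]
      using M.smult_closed[OF assms(3) hc[OF vK]] by (simp add: a_minus_def M.r_neg)
  qed
  obtain \<psi>' where \<psi>': "\<psi>' \<in> mod_hom R M M"
    and ev: "\<And>v. v \<in> carrier ?F \<Longrightarrow> \<psi>' (e v) = f v \<ominus>\<^bsub>M\<^esub> a \<odot>\<^bsub>M\<^esub> k v"
    by (rule mod_hom_descend[OF F assms(1,1) e l l0]) (assumption | rule that)+
  have "mod_cong M D (\<psi>' x) (\<psi> x)" if x: "x \<in> carrier M" for x
  proof -
    have "x \<in> e ` carrier ?F" unfolding e(2) by (rule x)
    then obtain v where v: "x = e v" "v \<in> carrier ?F" by (rule imageE)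
    have ka: "a \<odot>\<^bsub>M\<^esub> k v \<in> D" unfolding assms(4) by (rule imageI) (rule mod_homD(1)[OF k(1) v(2)])
    have kc: "a \<odot>\<^bsub>M\<^esub> k v \<in> carrier M" by (rule M.smult_closed[OF assms(3) mod_homD(1)[OF k(1) v(2)]])
    have "(f v \<ominus>\<^bsub>M\<^esub> a \<odot>\<^bsub>M\<^esub> k v) \<ominus>\<^bsub>M\<^esub> f v = \<ominus>\<^bsub>M\<^esub> (a \<odot>\<^bsub>M\<^esub> k v)"
      using kc fc[OF v(2)] by (simp add: a_minus_def M.M.a_ac) (simp add: M.M.r_neg flip: M.M.a_assoc)
    then have "mod_cong M D (f v \<ominus>\<^bsub>M\<^esub> a \<odot>\<^bsub>M\<^esub> k v) (f v)"
      unfolding mod_cong_def using C.DE(3)[OF ka] kc fc[OF v(2)] by simp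
    then have "mod_cong M D (\<psi>' x) (f v)" unfolding v(1) ev[OF v(2)] .
    then show ?thesis using C.cong_trans f\<psi>[OF v(2)] unfolding v(1) by blast
  qed
  then show ?thesis by (rule that[OF \<psi>'])
qed

lemma set_add_memI: "x \<in> H \<Longrightarrow> y \<in> K \<Longrightarrow> x \<oplus>\<^bsub>G\<^esub> y \<in> H <+>\<^bsub>G\<^esub> K"
  by (auto simp: set_add_def set_mult_def)

lemma set_add_subsetI: "(\<And>x y. x \<in> H \<Longrightarrow> y \<in> K \<Longrightarrow> x \<oplus>\<^bsub>G\<^esub> y \<in> S) \<Longrightarrow> H <+>\<^bsub>G\<^esub> K \<subseteq> S"
  by (auto simp: set_add_def set_mult_def)

section \<open>Congruence modulo a on the module and on its center\<close>

context center_setting begin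

abbreviation D where "D \<equiv> PIdl\<^bsub>T\<^esub> (\<rho> a)"
abbreviation aM where "aM \<equiv> (\<lambda>m. a \<odot>\<^bsub>M\<^esub> m) ` carrier M"

lemma D_ideal: "ideal D T" by (rule T.cgenideal_ideal[OF rho_closed[OF a_carrier]])

lemma aM_cong: "submodule_cong R M aM"
proof (intro submodule_cong.intro submodule_cong_axioms.intro M.module_axioms)
  have "(\<lambda>m. a \<odot>\<^bsub>M\<^esub> m) \<in> mod_hom R M M" by (rule mod_hom_smult_fun[OF M.module_axioms mod_hom_id a_carrier])
  then show "submodule aM R M" by (rule submodule_image[OF M.module_axioms M.module_axioms _ M.carrier_is_submodule])
qed

lemma T_aM:
  assumes "z \<in> carrier T" "x \<in> aM" shows "z x \<in> aM"
proof -
  obtain m where m: "x = a \<odot>\<^bsub>M\<^esub> m" "m \<in> carrier M" using assms(2) by (rule imageE)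
  have "z x = a \<odot>\<^bsub>M\<^esub> z m" unfolding m(1) by (rule mod_homD(3)[OF T_D(1)[OF assms(1)] a_carrier m(2)])
  then show ?thesis by (rule image_eqI) (rule T_closed[OF assms(1) m(2)])
qed

text \<open>This lets congruences modulo aT be tested at the elements of M modulo aM, the form in
  which rigidity yields them. The direction from M to T is division by a.\<close>

lemma mem_D_iff:
  assumes w: "w \<in> carrier T" shows "w \<in> D \<longleftrightarrow> (\<forall>x\<in>carrier M. w x \<in> aM)"
proof
  assume "w \<in> D"
  then obtain u where u: "u \<in> carrier T" "w = u \<otimes>\<^bsub>T\<^esub> \<rho> a" unfolding cgenideal_def by auto
  show "\<forall>x\<in>carrier M. w x \<in> aM"
  proof
    fix x assume x: "x \<in> carrier M"
    have "w x = u (a \<odot>\<^bsub>M\<^esub> x)" unfolding u(2) T_ops(1)[OF x] rho_apply[OF x] ..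
    then show "w x \<in> aM" using T_aM[OF u(1)] x by simp
  qed
next
  assume "\<forall>x\<in>carrier M. w x \<in> aM"
  then have "\<exists>y\<in>carrier M. w x = a \<odot>\<^bsub>M\<^esub> y" if "x \<in> carrier M" for x using that by blast
  then have "\<exists>e\<in>carrier T. w = e \<otimes>\<^bsub>T\<^esub> \<rho> a" by (rule center_divide[OF nzd w])
  then show "w \<in> D" unfolding cgenideal_def by blast
qed

lemma D_cong_iff:
  assumes "u \<in> carrier T" "v \<in> carrier T"
  shows "ideal_cong T D u v \<longleftrightarrow> (\<forall>x\<in>carrier M. mod_cong M aM (u x) (v x))"
  using assms mem_D_iff[of "u \<ominus>\<^bsub>T\<^esub> v"] T_closed
  by (simp add: ideal_cong_def mod_cong_def T_diff[OF T_cring])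

lemma cong_T:
  assumes "z \<in> carrier T" "mod_cong M aM x y" shows "mod_cong M aM (z x) (z y)"
proof -
  have c: "x \<in> carrier M" "y \<in> carrier M" "x \<ominus>\<^bsub>M\<^esub> y \<in> aM" using assms(2) by (auto simp: mod_cong_def)
  have "z x \<ominus>\<^bsub>M\<^esub> z y \<in> aM"
    using T_aM[OF assms(1) c(3)] mod_hom_diff[OF M.module_axioms M.module_axioms T_D(1)[OF assms(1)] c(1,2)] by simp
  then show ?thesis using c T_closed[OF assms(1)] by (simp add: mod_cong_def)
qed

text \<open>
  For $f : M \to T$ and \<open>x\<close> in \<open>M\<close>, rigidity lifts $y \mapsto \varphi(f y) x$ to an endomorphism of \<open>M\<close>, which
  commutes with \<open>T\<close>. Hence $\varphi$ is \<open>T\<close>-linear modulo \<open>a\<close> on the trace ideal, which is \<open>T\<close>.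
\<close>

lemma linear_imp_multiplication:
  assumes "rigid_module R M" "gorenstein_ring T"
    and \<phi>c: "\<And>t. t \<in> carrier T \<Longrightarrow> \<phi> t \<in> carrier T"
    and \<phi>a: "\<And>t u. t \<in> carrier T \<Longrightarrow> u \<in> carrier T \<Longrightarrow> ideal_cong T D (\<phi> (t \<oplus>\<^bsub>T\<^esub> u)) (\<phi> t \<oplus>\<^bsub>T\<^esub> \<phi> u)"
    and \<phi>s: "\<And>r t. r \<in> carrier R \<Longrightarrow> t \<in> carrier T \<Longrightarrow> ideal_cong T D (\<phi> (\<rho> r \<otimes>\<^bsub>T\<^esub> t)) (\<rho> r \<otimes>\<^bsub>T\<^esub> \<phi> t)"
    and t: "t \<in> carrier T"
  shows "ideal_cong T D (\<phi> t) (t \<otimes>\<^bsub>T\<^esub> \<phi> \<one>\<^bsub>T\<^esub>)"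
proof -
  interpret D: ideal D T by (rule D_ideal)
  interpret C: submodule_cong R M aM by (rule aM_cong)
  \<comment> \<open>The elements at which \<phi> is T-linear modulo a. They form an ideal, so it is
    enough that all values of maps M -> T belong to it.\<close>
  let ?U = "{u \<in> carrier T. \<forall>t\<in>carrier T. ideal_cong T D (\<phi> (t \<otimes>\<^bsub>T\<^esub> u)) (t \<otimes>\<^bsub>T\<^esub> \<phi> u)}"
  have trace: "f y \<in> ?U" if f: "f \<in> mod_hom T center_module (ring_module T)" and y: "y \<in> carrier M" for f y
  proof -
    have fc: "f z \<in> carrier T" if "z \<in> carrier M" for z using mod_homD(1)[OF f] that by simp
    have fa: "f (z \<oplus>\<^bsub>M\<^esub> w) = f z \<oplus>\<^bsub>T\<^esub> f w" if "z \<in> carrier M" "w \<in> carrier M" for z w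
      using mod_homD(2)[OF f] that by simp
    have fs: "f (t z) = t \<otimes>\<^bsub>T\<^esub> f z" if "t \<in> carrier T" "z \<in> carrier M" for t z
      using mod_homD(3)[OF f] that by simp
    have "ideal_cong T D (\<phi> (t \<otimes>\<^bsub>T\<^esub> f y)) (t \<otimes>\<^bsub>T\<^esub> \<phi> (f y))" if t: "t \<in> carrier T" for t
      unfolding D_cong_iff[OF \<phi>c[OF T.m_closed[OF t fc[OF y]]] T.m_closed[OF t \<phi>c[OF fc[OF y]]]]
    proof
      fix x assume x: "x \<in> carrier M"
      let ?\<psi> = "\<lambda>z. \<phi> (f z) x"
      have ev: "mod_cong M aM (u x) (v x)" if "ideal_cong T D u v" for u v
        using that D_cong_iff[OF D.cong_carrier[OF that]] x by blast
      have 1: "?\<psi> z \<in> carrier M" if "z \<in> carrier M" for z by (rule T_closed[OF \<phi>c[OF fc[OF that]] x])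
      have 2: "mod_cong M aM (?\<psi> (z \<oplus>\<^bsub>M\<^esub> w)) (?\<psi> z \<oplus>\<^bsub>M\<^esub> ?\<psi> w)" if "z \<in> carrier M" "w \<in> carrier M" for z w
        using ev[OF \<phi>a[OF fc[OF that(1)] fc[OF that(2)]]] unfolding fa[OF that] T_ops(2)[OF x] .
      have 3: "mod_cong M aM (?\<psi> (r \<odot>\<^bsub>M\<^esub> z)) (r \<odot>\<^bsub>M\<^esub> ?\<psi> z)" if "r \<in> carrier R" "z \<in> carrier M" for r z
        using ev[OF \<phi>s[OF that(1) fc[OF that(2)]]]
        unfolding fs[OF rho_closed[OF that(1)] that(2), symmetric] T_ops(1)[OF x] rho_apply[OF that(2)] rho_apply[OF 1[OF that(2)]] .
      obtain \<psi>' where \<psi>': "\<psi>' \<in> mod_hom R M M" and c: "\<And>z. z \<in> carrier M \<Longrightarrow> mod_cong M aM (\<psi>' z) (?\<psi> z)"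
        by (rule rigid_lift[OF M.module_axioms assms(1) a_carrier refl torsionfree_cancel[OF nzd] 1 2 3])
          (assumption | rule that)+
      have ty: "t y \<in> carrier M" by (rule T_closed[OF t y])
      have "mod_cong M aM (?\<psi> (t y)) (\<psi>' (t y))" by (rule C.cong_sym[OF c[OF ty]])
      moreover have "mod_cong M aM (\<psi>' (t y)) (t (?\<psi> y))" using cong_T[OF t c[OF y]] unfolding T_D(3)[OF t \<psi>' y] .
      ultimately have "mod_cong M aM (?\<psi> (t y)) (t (?\<psi> y))" by (rule C.cong_trans)
      then show "mod_cong M aM (\<phi> (t \<otimes>\<^bsub>T\<^esub> f y) x) ((t \<otimes>\<^bsub>T\<^esub> \<phi> (f y)) x)"
        unfolding fs[OF t y] T_ops(1)[OF x] .
    qed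
    then show ?thesis using fc[OF y] by blast
  qed
  have U: "ideal ?U T"
  proof (rule T.idealI')
    have "ideal_cong T D (\<phi> (\<rho> \<zero>\<^bsub>R\<^esub> \<otimes>\<^bsub>T\<^esub> \<zero>\<^bsub>T\<^esub>)) (\<rho> \<zero>\<^bsub>R\<^esub> \<otimes>\<^bsub>T\<^esub> \<phi> \<zero>\<^bsub>T\<^esub>)" by (rule \<phi>s) simp_all
    then have 0: "ideal_cong T D (\<phi> \<zero>\<^bsub>T\<^esub>) \<zero>\<^bsub>T\<^esub>" using \<phi>c[OF T.zero_closed] by (simp add: rho_hom)
    have "ideal_cong T D (\<phi> (t \<otimes>\<^bsub>T\<^esub> \<zero>\<^bsub>T\<^esub>)) (t \<otimes>\<^bsub>T\<^esub> \<phi> \<zero>\<^bsub>T\<^esub>)" if "t \<in> carrier T" for t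
      using D.cong_trans[OF 0 D.cong_sym] D.cong_mult[OF 0 that] that by simp
    then show "\<zero>\<^bsub>T\<^esub> \<in> ?U" by blast
    fix u assume "u \<in> ?U"
    then have u: "u \<in> carrier T" and ut: "\<And>t. t \<in> carrier T \<Longrightarrow> ideal_cong T D (\<phi> (t \<otimes>\<^bsub>T\<^esub> u)) (t \<otimes>\<^bsub>T\<^esub> \<phi> u)" by auto
    show "u \<oplus>\<^bsub>T\<^esub> v \<in> ?U" if "v \<in> ?U" for v
    proof -
      have v: "v \<in> carrier T" and vt: "\<And>t. t \<in> carrier T \<Longrightarrow> ideal_cong T D (\<phi> (t \<otimes>\<^bsub>T\<^esub> v)) (t \<otimes>\<^bsub>T\<^esub> \<phi> v)" using that by auto
      have "ideal_cong T D (\<phi> (t \<otimes>\<^bsub>T\<^esub> (u \<oplus>\<^bsub>T\<^esub> v))) (t \<otimes>\<^bsub>T\<^esub> \<phi> (u \<oplus>\<^bsub>T\<^esub> v))" if t: "t \<in> carrier T" for t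
      proof -
        have "ideal_cong T D (\<phi> (t \<otimes>\<^bsub>T\<^esub> (u \<oplus>\<^bsub>T\<^esub> v))) (\<phi> (t \<otimes>\<^bsub>T\<^esub> u) \<oplus>\<^bsub>T\<^esub> \<phi> (t \<otimes>\<^bsub>T\<^esub> v))"
          unfolding T.r_distr[OF u v t] by (rule \<phi>a[OF T.m_closed[OF t u] T.m_closed[OF t v]])
        moreover have "ideal_cong T D (\<phi> (t \<otimes>\<^bsub>T\<^esub> u) \<oplus>\<^bsub>T\<^esub> \<phi> (t \<otimes>\<^bsub>T\<^esub> v)) (t \<otimes>\<^bsub>T\<^esub> (\<phi> u \<oplus>\<^bsub>T\<^esub> \<phi> v))"
          unfolding T.r_distr[OF \<phi>c[OF u] \<phi>c[OF v] t] by (rule D.cong_add[OF ut[OF t] vt[OF t]])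
        moreover have "ideal_cong T D (t \<otimes>\<^bsub>T\<^esub> (\<phi> u \<oplus>\<^bsub>T\<^esub> \<phi> v)) (t \<otimes>\<^bsub>T\<^esub> \<phi> (u \<oplus>\<^bsub>T\<^esub> v))"
          by (rule D.cong_mult[OF D.cong_sym[OF \<phi>a[OF u v]] t])
        ultimately show ?thesis using D.cong_trans by blast
      qed
      then show ?thesis using u v by blast
    qed
    show "s \<otimes>\<^bsub>T\<^esub> u \<in> ?U" if s: "s \<in> carrier T" for s
    proof -
      have "ideal_cong T D (\<phi> (t \<otimes>\<^bsub>T\<^esub> (s \<otimes>\<^bsub>T\<^esub> u))) (t \<otimes>\<^bsub>T\<^esub> \<phi> (s \<otimes>\<^bsub>T\<^esub> u))" if t: "t \<in> carrier T" for t
        using D.cong_trans[OF ut[OF T.m_closed[OF t s]]] D.cong_mult[OF D.cong_sym[OF ut[OF s]] t]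
        unfolding T.m_assoc[OF t s u] T.m_assoc[OF t s \<phi>c[OF u]] by blast
      then show ?thesis using s u by blast
    qed
  qed blast
  have "?U = carrier T"
  proof (rule ccontr)
    assume "?U \<noteq> carrier T"
    then obtain \<nn> where \<nn>: "maximalideal \<nn> T" "?U \<subseteq> \<nn>"
      by (rule noetherian_ring.ex_maximalideal[OF noethT U])
    obtain f x where "f \<in> mod_hom T center_module (ring_module T)" "x \<in> carrier M" "f x \<notin> \<nn>"
      by (rule center_trace[OF assms(2) \<nn>(1)])
    then show False using trace \<nn>(2) by blast
  qed
  then have "\<one>\<^bsub>T\<^esub> \<in> ?U" using T.one_closed by blast
  then have "ideal_cong T D (\<phi> (t \<otimes>\<^bsub>T\<^esub> \<one>\<^bsub>T\<^esub>)) (t \<otimes>\<^bsub>T\<^esub> \<phi> \<one>\<^bsub>T\<^esub>)" using t by blast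
  then show ?thesis using t by simp
qed

text \<open>Faithfulness makes M nonzero, so 1 and 0 differ in T.\<close>

lemma ex_maximal: obtains \<nn> where "maximalideal \<nn> T"
proof -
  have "\<one>\<^bsub>T\<^esub> \<noteq> \<zero>\<^bsub>T\<^esub>"
  proof
    assume 1: "\<one>\<^bsub>T\<^esub> = \<zero>\<^bsub>T\<^esub>"
    have "\<one>\<^bsub>R\<^esub> \<odot>\<^bsub>M\<^esub> x = \<zero>\<^bsub>M\<^esub>" if "x \<in> carrier M" for x
      using fun_cong[OF 1, of x] that by (simp add: T_ops)
    then have "\<one>\<^bsub>R\<^esub> = \<zero>\<^bsub>R\<^esub>" using faithful unfolding faithful_module_def by blast
    then show False using loc_facts(6) additive_subgroup.zero_closed[OF ideal.axioms(1)[OF loc_facts(4)]] by simp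
  qed
  then have "{\<zero>\<^bsub>T\<^esub>} \<noteq> carrier T" using T.one_closed by blast
  then show ?thesis
    by (rule noetherian_ring.ex_maximalideal[OF noethT T.zeroideal]) (rule that)
qed

text \<open>
  Otherwise let $Z \supseteq R$ be a maximal proper \<open>R\<close>-submodule of \<open>T\<close> and \<open>b\<close> a socle element of $T/aT$.
  Then $T \to T/Z \cong k \to bk$ is \<open>R\<close>-linear and kills \<open>1\<close>, so \<open>T\<close>-linearity forces
  it to vanish.
\<close>

lemma center_eq:
  assumes "rigid_module R M" "gorenstein_ring T" shows "carrier T = \<rho> ` carrier R"
proof (rule ccontr)
  assume neg: "\<not> ?thesis"
  let ?C = "center_as_module" and ?Y = "\<rho> ` carrier R"
  note Cm = center_as_module_module
  interpret C: module R ?C by (rule Cm)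
  interpret D: ideal D T by (rule D_ideal)
  have "\<rho> \<in> mod_hom R (ring_module R) ?C"
    by (rule mod_homI) (simp_all add: rho_closed rho_hom)
  from submodule_image[OF ring_module_module[OF M.is_cring] Cm this
      module.carrier_is_submodule[OF ring_module_module[OF M.is_cring]]]
  have Y: "submodule ?Y R ?C" by simp
  have ne: "?Y \<noteq> carrier ?C" using neg by auto
  obtain Z where Z: "submodule Z R ?C" "?Y \<subseteq> Z" "Z \<noteq> carrier ?C"
    and Zm: "\<And>w x. w \<in> carrier ?C \<Longrightarrow> w \<notin> Z \<Longrightarrow> x \<in> carrier ?C \<Longrightarrow> \<exists>z\<in>Z. \<exists>r\<in>carrier R. x = z \<oplus>\<^bsub>?C\<^esub> r \<odot>\<^bsub>?C\<^esub> w"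
    by (rule nakayama_maximal[OF loc noeth Cm center_acc Y ne]) (assumption | rule that)+
  note E = C.submoduleE[OF Z(1)]
  have Zc: "z \<in> carrier T" if "z \<in> Z" for z using E(1) that by auto
  obtain w where w: "w \<in> carrier T" "w \<notin> Z" using Z(3) E(1) by auto
  obtain \<nn> where \<nn>: "maximalideal \<nn> T" by (rule ex_maximal)
  have D\<nn>: "D \<subseteq> \<nn>" by (rule T.cgenideal_minimal[OF maximalideal.axioms(1)[OF \<nn>] maximalideal_rho[OF \<nn> a_in]])
  obtain b where b: "b \<in> carrier T" "primeideal (colon T D b) T"
    by (rule colon_prime[OF T_cring noethT D_ideal T.maximalideal_prime[OF \<nn>] D\<nn>]) (rule that)
  interpret Q: primeideal "colon T D b" T by (rule b(2))
  have "\<rho> a \<in> colon T D b"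
    using T.ideal_subset_colon[OF D_ideal b(1)] T.cgenideal_self[OF rho_closed[OF a_carrier]] by blast
  then have Qm: "maximalideal (colon T D b) T" by (rule prime_maximal[OF b(2)])
  \<comment> \<open>Modulo aT the annihilator of b is a maximal ideal of T, and every maximal ideal
    contains the image of \<mm>. Hence R acts on the class of b through its residue field.\<close>
  have mb: "\<rho> r \<otimes>\<^bsub>T\<^esub> b \<in> D" if "r \<in> \<mm>" for r
    using maximalideal_rho[OF Qm that] unfolding colon_def by (elim CollectE conjE)
  have bD: "b \<notin> D"
  proof
    assume "b \<in> D"
    then have "\<one>\<^bsub>T\<^esub> \<otimes>\<^bsub>T\<^esub> b \<in> D" unfolding T.l_one[OF b(1)] .
    then have "\<one>\<^bsub>T\<^esub> \<in> colon T D b" unfolding colon_def using T.one_closed by (intro CollectI conjI)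
    then have "colon T D b = carrier T" by (rule Q.one_imp_carrier)
    then show False using Q.I_notcarr by simp
  qed
  have rep: "\<exists>r. r \<in> carrier R \<and> t \<ominus>\<^bsub>T\<^esub> \<rho> r \<otimes>\<^bsub>T\<^esub> w \<in> Z" if t: "t \<in> carrier T" for t
  proof -
    obtain z r where z: "z \<in> Z" "r \<in> carrier R" "t = z \<oplus>\<^bsub>T\<^esub> \<rho> r \<otimes>\<^bsub>T\<^esub> w"
      using Zm[of w t] w t by auto
    have "t \<ominus>\<^bsub>T\<^esub> \<rho> r \<otimes>\<^bsub>T\<^esub> w = z"
      unfolding z(3) using Zc[OF z(1)] rho_closed[OF z(2)] w(1) by algebra
    then show ?thesis using z by blast
  qed
  \<comment> \<open>The coefficient of t along w modulo Z. It is determined only modulo \<mm>, since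
    rw in Z forces r into \<mm>, but this makes its product with b well defined modulo aT.\<close>
  define c where "c t = (SOME r. r \<in> carrier R \<and> t \<ominus>\<^bsub>T\<^esub> \<rho> r \<otimes>\<^bsub>T\<^esub> w \<in> Z)" for t
  have c: "c t \<in> carrier R \<and> t \<ominus>\<^bsub>T\<^esub> \<rho> (c t) \<otimes>\<^bsub>T\<^esub> w \<in> Z" if "t \<in> carrier T" for t
    unfolding c_def by (rule someI_ex[OF rep[OF that]])
  note cc = c[THEN conjunct1]
  have Zd: "x \<ominus>\<^bsub>T\<^esub> y \<in> Z" if "x \<in> Z" "y \<in> Z" for x y
  proof -
    have "\<rho> (\<ominus>\<^bsub>R\<^esub> \<one>\<^bsub>R\<^esub>) \<otimes>\<^bsub>T\<^esub> y \<in> Z" using E(4)[OF _ that(2), of "\<ominus>\<^bsub>R\<^esub> \<one>\<^bsub>R\<^esub>"] by simp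
    then have "\<ominus>\<^bsub>T\<^esub> y \<in> Z" using Zc[OF that(2)] by (simp add: rho_minus rho_hom T.l_minus)
    then show ?thesis using E(5)[OF that(1)] by (simp add: a_minus_def)
  qed
  have kill: "\<rho> r \<otimes>\<^bsub>T\<^esub> b \<in> D" if r: "r \<in> carrier R" "\<rho> r \<otimes>\<^bsub>T\<^esub> w \<in> Z" for r
  proof (rule mb, rule ccontr)
    assume "r \<notin> \<mm>"
    then have u: "r \<in> Units R" by (rule local_unit[OF loc noeth r(1)])
    have i: "inv\<^bsub>R\<^esub> r \<in> carrier R" using u by simp
    have "\<rho> (inv\<^bsub>R\<^esub> r) \<otimes>\<^bsub>T\<^esub> (\<rho> r \<otimes>\<^bsub>T\<^esub> w) \<in> Z" using E(4)[OF i r(2)] by simp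
    moreover have "\<rho> (inv\<^bsub>R\<^esub> r) \<otimes>\<^bsub>T\<^esub> (\<rho> r \<otimes>\<^bsub>T\<^esub> w) = \<rho> (inv\<^bsub>R\<^esub> r \<otimes>\<^bsub>R\<^esub> r) \<otimes>\<^bsub>T\<^esub> w"
      using i r(1) w(1) by (simp add: rho_hom rho_closed T.m_assoc)
    ultimately show False using u w by (simp add: rho_hom)
  qed
  have val: "ideal_cong T D (\<rho> (c t) \<otimes>\<^bsub>T\<^esub> b) (\<rho> r \<otimes>\<^bsub>T\<^esub> b)"
    if t: "t \<in> carrier T" and r: "r \<in> carrier R" "t \<ominus>\<^bsub>T\<^esub> \<rho> r \<otimes>\<^bsub>T\<^esub> w \<in> Z" for t r
  proof -
    note k = rho_closed[OF cc[OF t]] rho_closed[OF r(1)]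
    have "(t \<ominus>\<^bsub>T\<^esub> \<rho> r \<otimes>\<^bsub>T\<^esub> w) \<ominus>\<^bsub>T\<^esub> (t \<ominus>\<^bsub>T\<^esub> \<rho> (c t) \<otimes>\<^bsub>T\<^esub> w) = (\<rho> (c t) \<ominus>\<^bsub>T\<^esub> \<rho> r) \<otimes>\<^bsub>T\<^esub> w"
      using k t w(1) by algebra
    then have "\<rho> (c t \<ominus>\<^bsub>R\<^esub> r) \<otimes>\<^bsub>T\<^esub> w \<in> Z"
      using Zd[OF r(2) c[OF t, THEN conjunct2]] by (simp add: rho_diff[OF cc[OF t] r(1)])
    then have "\<rho> (c t \<ominus>\<^bsub>R\<^esub> r) \<otimes>\<^bsub>T\<^esub> b \<in> D" by (rule kill[OF M.R.minus_closed[OF cc[OF t] r(1)]])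
    moreover have "\<rho> (c t \<ominus>\<^bsub>R\<^esub> r) \<otimes>\<^bsub>T\<^esub> b = \<rho> (c t) \<otimes>\<^bsub>T\<^esub> b \<ominus>\<^bsub>T\<^esub> \<rho> r \<otimes>\<^bsub>T\<^esub> b"
      unfolding rho_diff[OF cc[OF t] r(1)] using k b(1) by algebra
    ultimately show ?thesis using k b(1) by (simp add: ideal_cong_def)
  qed
  let ?\<phi> = "\<lambda>t. \<rho> (c t) \<otimes>\<^bsub>T\<^esub> b"
  have 1: "?\<phi> t \<in> carrier T" if "t \<in> carrier T" for t using rho_closed[OF cc[OF that]] b(1) by simp
  have 2: "ideal_cong T D (?\<phi> (t \<oplus>\<^bsub>T\<^esub> u)) (?\<phi> t \<oplus>\<^bsub>T\<^esub> ?\<phi> u)" if t: "t \<in> carrier T" and u: "u \<in> carrier T" for t u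
  proof -
    note k = rho_closed[OF cc[OF t]] rho_closed[OF cc[OF u]]
    have "(t \<oplus>\<^bsub>T\<^esub> u) \<ominus>\<^bsub>T\<^esub> \<rho> (c t \<oplus>\<^bsub>R\<^esub> c u) \<otimes>\<^bsub>T\<^esub> w
        = (t \<ominus>\<^bsub>T\<^esub> \<rho> (c t) \<otimes>\<^bsub>T\<^esub> w) \<oplus>\<^bsub>T\<^esub> (u \<ominus>\<^bsub>T\<^esub> \<rho> (c u) \<otimes>\<^bsub>T\<^esub> w)"
      unfolding rho_hom(1)[OF cc[OF t] cc[OF u]] using k t u w(1) by algebra
    then have "(t \<oplus>\<^bsub>T\<^esub> u) \<ominus>\<^bsub>T\<^esub> \<rho> (c t \<oplus>\<^bsub>R\<^esub> c u) \<otimes>\<^bsub>T\<^esub> w \<in> Z"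
      using E(5)[OF c[OF t, THEN conjunct2] c[OF u, THEN conjunct2]] by simp
    from val[OF T.a_closed[OF t u] M.R.a_closed[OF cc[OF t] cc[OF u]] this]
    show ?thesis unfolding rho_hom(1)[OF cc[OF t] cc[OF u]] T.l_distr[OF k b(1)] .
  qed
  have 3: "ideal_cong T D (?\<phi> (\<rho> r \<otimes>\<^bsub>T\<^esub> t)) (\<rho> r \<otimes>\<^bsub>T\<^esub> ?\<phi> t)" if r: "r \<in> carrier R" and t: "t \<in> carrier T" for r t
  proof -
    note k = rho_closed[OF cc[OF t]] rho_closed[OF r]
    have "\<rho> r \<otimes>\<^bsub>T\<^esub> t \<ominus>\<^bsub>T\<^esub> \<rho> (r \<otimes>\<^bsub>R\<^esub> c t) \<otimes>\<^bsub>T\<^esub> w = \<rho> r \<otimes>\<^bsub>T\<^esub> (t \<ominus>\<^bsub>T\<^esub> \<rho> (c t) \<otimes>\<^bsub>T\<^esub> w)"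
      unfolding rho_hom(2)[OF r cc[OF t]] using k t w(1) by algebra
    then have "\<rho> r \<otimes>\<^bsub>T\<^esub> t \<ominus>\<^bsub>T\<^esub> \<rho> (r \<otimes>\<^bsub>R\<^esub> c t) \<otimes>\<^bsub>T\<^esub> w \<in> Z"
      using E(4)[OF r c[OF t, THEN conjunct2]] by simp
    from val[OF T.m_closed[OF k(2) t] M.R.m_closed[OF r cc[OF t]] this]
    show ?thesis unfolding rho_hom(2)[OF r cc[OF t]] T.m_assoc[OF k(2) k(1) b(1)] .
  qed
  \<comment> \<open>Evaluation at w gives the contradiction: w has coefficient 1, so its value is b,
    while 1 lies in Z and has value 0.\<close>
  have "ideal_cong T D (?\<phi> w) (w \<otimes>\<^bsub>T\<^esub> ?\<phi> \<one>\<^bsub>T\<^esub>)"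
    by (rule linear_imp_multiplication[where \<phi> = ?\<phi>, OF assms 1 2 3 w(1)])
  moreover have "ideal_cong T D (w \<otimes>\<^bsub>T\<^esub> ?\<phi> \<one>\<^bsub>T\<^esub>) \<zero>\<^bsub>T\<^esub>"
  proof -
    have "\<rho> \<one>\<^bsub>R\<^esub> \<in> Z" using Z(2) M.R.one_closed by blast
    then have "\<one>\<^bsub>T\<^esub> \<ominus>\<^bsub>T\<^esub> \<rho> \<zero>\<^bsub>R\<^esub> \<otimes>\<^bsub>T\<^esub> w \<in> Z" using w(1) by (simp add: rho_hom a_minus_def)
    from val[OF T.one_closed M.R.zero_closed this] have "ideal_cong T D (?\<phi> \<one>\<^bsub>T\<^esub>) \<zero>\<^bsub>T\<^esub>" using b(1) by (simp add: rho_hom)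
    from D.cong_mult[OF this w(1)] show ?thesis using w(1) by simp
  qed
  moreover have "ideal_cong T D b (?\<phi> w)"
  proof -
    have "w \<ominus>\<^bsub>T\<^esub> \<rho> \<one>\<^bsub>R\<^esub> \<otimes>\<^bsub>T\<^esub> w = \<zero>\<^bsub>T\<^esub>" using w(1) by (simp add: rho_hom a_minus_def T.r_neg)
    then have "w \<ominus>\<^bsub>T\<^esub> \<rho> \<one>\<^bsub>R\<^esub> \<otimes>\<^bsub>T\<^esub> w \<in> Z" using submodule_zero[OF Z(1)] by simp
    from D.cong_sym[OF val[OF w(1) M.R.one_closed this]] show ?thesis using b(1) by (simp add: rho_hom)
  qed
  ultimately have "ideal_cong T D b \<zero>\<^bsub>T\<^esub>" using D.cong_trans by blast
  then show False using D.cong_zero_iff b(1) bD by blast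
qed

section \<open>Splitting off the free summand\<close>

text \<open>The value f(x) lies outside \<nn>, and as T = R it is the image of a unit r.
  Faithfulness makes \<open>\<rho>\<close> injective, so sending s to sx embeds R in M, and dividing
  by r splits M into Rx and the kernel of f.\<close>

lemma free_summand:
  assumes "rigid_module R M" "gorenstein_ring T" shows "has_free_summand R M"
proof -
  obtain \<nn> where \<nn>: "maximalideal \<nn> T" by (rule ex_maximal)
  obtain f x where f: "f \<in> mod_hom T center_module (ring_module T)" and x: "x \<in> carrier M" and fx: "f x \<notin> \<nn>"
    by (rule center_trace[OF assms(2) \<nn>])
  have fc: "f z \<in> carrier T" if "z \<in> carrier M" for z using mod_homD(1)[OF f] that by simp
  have fa: "f (z \<oplus>\<^bsub>M\<^esub> w) = f z \<oplus>\<^bsub>T\<^esub> f w" if "z \<in> carrier M" "w \<in> carrier M" for z w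
    using mod_homD(2)[OF f] that by simp
  have fs: "f (r \<odot>\<^bsub>M\<^esub> z) = \<rho> r \<otimes>\<^bsub>T\<^esub> f z" if "r \<in> carrier R" "z \<in> carrier M" for r z
    using mod_homD(3)[OF f, of "\<rho> r" z] rho_closed[OF that(1)] that(2) by (simp add: rho_apply)
  have fR: "f \<in> mod_hom R M center_as_module" by (rule mod_homI) (simp_all add: fc fa fs)
  obtain r where r: "r \<in> carrier R" "f x = \<rho> r" using fc[OF x] unfolding center_eq[OF assms] by blast
  have "r \<notin> \<mm>" using maximalideal_rho[OF \<nn>] fx r(2) by auto
  then have u: "r \<in> Units R" by (rule local_unit[OF loc noeth r(1)])
  have i: "inv\<^bsub>R\<^esub> r \<in> carrier R" using u by simp
  have inj: "s = \<zero>\<^bsub>R\<^esub>" if s: "s \<in> carrier R" "f (s \<odot>\<^bsub>M\<^esub> x) = \<zero>\<^bsub>T\<^esub>" for s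
  proof -
    have "\<rho> (s \<otimes>\<^bsub>R\<^esub> r) = \<zero>\<^bsub>T\<^esub>" using s(2) fs[OF s(1) x] r rho_hom(2)[OF s(1) r(1)] by simp
    then have "(s \<otimes>\<^bsub>R\<^esub> r) \<odot>\<^bsub>M\<^esub> y = \<zero>\<^bsub>M\<^esub>" if "y \<in> carrier M" for y
      using rho_apply[OF that, of "s \<otimes>\<^bsub>R\<^esub> r"] that by (simp add: T_ops)
    then have "s \<otimes>\<^bsub>R\<^esub> r = \<zero>\<^bsub>R\<^esub>" using faithful M.R.m_closed[OF s(1) r(1)] unfolding faithful_module_def by blast
    then have "(s \<otimes>\<^bsub>R\<^esub> r) \<otimes>\<^bsub>R\<^esub> inv\<^bsub>R\<^esub> r = \<zero>\<^bsub>R\<^esub>" using i by simp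
    then show ?thesis using s(1) r(1) i u by (simp add: M.R.m_assoc)
  qed
  let ?h = "\<lambda>s. s \<odot>\<^bsub>M\<^esub> x"
  let ?N = "?h ` carrier R" and ?L = "hom_ker M center_as_module f"
  have h: "?h \<in> mod_hom R (ring_module R) M"
    by (rule mod_homI) (simp_all add: x M.smult_l_distr M.smult_assoc1)
  note Rm = ring_module_module[OF M.is_cring]
  have "submodule (?h ` carrier (ring_module R)) R M"
    by (rule submodule_image[OF Rm M.module_axioms h module.carrier_is_submodule[OF Rm]])
  then have N: "submodule ?N R M" by simp
  have L: "submodule ?L R M" by (rule hom_ker_submodule[OF M.module_axioms center_as_module_module fR])
  have NL: "?N \<inter> ?L = {\<zero>\<^bsub>M\<^esub>}"
  proof (intro equalityI subsetI)
    fix y assume "y \<in> ?N \<inter> ?L"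
    then obtain s where s: "s \<in> carrier R" "y = s \<odot>\<^bsub>M\<^esub> x" "f y = \<zero>\<^bsub>T\<^esub>" by (auto simp: hom_ker_def)
    then have "s = \<zero>\<^bsub>R\<^esub>" using inj by blast
    then show "y \<in> {\<zero>\<^bsub>M\<^esub>}" using s(2) x by simp
  qed (use submodule_zero[OF N] submodule_zero[OF L] in blast)
  have split: "y = z \<oplus>\<^bsub>M\<^esub> (y \<ominus>\<^bsub>M\<^esub> z)" if "z \<in> carrier M" "y \<in> carrier M" for y z
  proof -
    have "z \<oplus>\<^bsub>M\<^esub> (y \<ominus>\<^bsub>M\<^esub> z) = y \<oplus>\<^bsub>M\<^esub> (z \<oplus>\<^bsub>M\<^esub> \<ominus>\<^bsub>M\<^esub> z)"
      unfolding a_minus_def by (rule M.M.a_lcomm) (use that in simp_all)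
    then show ?thesis using that by (simp add: M.M.r_neg)
  qed
  have "y \<in> ?N <+>\<^bsub>M\<^esub> ?L" if y: "y \<in> carrier M" for y
  proof -
    obtain s where s: "s \<in> carrier R" "f y = \<rho> s" using fc[OF y] unfolding center_eq[OF assms] by blast
    let ?z = "(s \<otimes>\<^bsub>R\<^esub> inv\<^bsub>R\<^esub> r) \<odot>\<^bsub>M\<^esub> x"
    have si: "s \<otimes>\<^bsub>R\<^esub> inv\<^bsub>R\<^esub> r \<in> carrier R" using s(1) i by simp
    have z: "?z \<in> ?N" using si by blast
    have zc: "?z \<in> carrier M" using si x by simp
    have "f ?z = \<rho> ((s \<otimes>\<^bsub>R\<^esub> inv\<^bsub>R\<^esub> r) \<otimes>\<^bsub>R\<^esub> r)" unfolding fs[OF si x] r(2) rho_hom(2)[OF si r(1)] ..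
    also have "\<dots> = f y" using s i r(1) u by (simp add: M.R.m_assoc)
    finally have "f (y \<ominus>\<^bsub>M\<^esub> ?z) = f y \<ominus>\<^bsub>center_as_module\<^esub> f y"
      using mod_hom_diff[OF M.module_axioms center_as_module_module fR y zc] by simp
    also have "\<dots> = \<zero>\<^bsub>center_as_module\<^esub>"
      using abelian_group.minus_eq_zero_iff[OF module.axioms(2)[OF center_as_module_module]] fc[OF y] by simp
    finally have "y \<ominus>\<^bsub>M\<^esub> ?z \<in> ?L" unfolding hom_ker_def using y zc by simp
    moreover have "y = ?z \<oplus>\<^bsub>M\<^esub> (y \<ominus>\<^bsub>M\<^esub> ?z)" by (rule split[OF zc y])
    ultimately show ?thesis using set_add_memI[OF z] by metis
  qed
  moreover have "?N <+>\<^bsub>M\<^esub> ?L \<subseteq> carrier M"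
    using M.submoduleE(1)[OF N] M.submoduleE(1)[OF L] by (intro set_add_subsetI M.a_closed) (erule (1) subsetD)+
  ultimately have NLM: "?N <+>\<^bsub>M\<^esub> ?L = carrier M" by (intro equalityI) (assumption | rule subsetI)+
  have bij: "bij_betw ?h (carrier R) ?N"
  proof (rule bij_betw_imageI[OF inj_onI refl])
    fix s t assume s: "s \<in> carrier R" and t: "t \<in> carrier R" and eq: "s \<odot>\<^bsub>M\<^esub> x = t \<odot>\<^bsub>M\<^esub> x"
    have "(s \<ominus>\<^bsub>R\<^esub> t) \<odot>\<^bsub>M\<^esub> x = s \<odot>\<^bsub>M\<^esub> x \<ominus>\<^bsub>M\<^esub> t \<odot>\<^bsub>M\<^esub> x"
      using s t x by (simp add: a_minus_def M.smult_l_distr M.smult_l_minus)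
    also have "\<dots> = \<zero>\<^bsub>M\<^esub>" unfolding eq using t x by (simp add: a_minus_def M.M.r_neg)
    finally have "f ((s \<ominus>\<^bsub>R\<^esub> t) \<odot>\<^bsub>M\<^esub> x) = \<zero>\<^bsub>T\<^esub>"
      using mod_hom_zero[OF M.module_axioms center_as_module_module fR] by simp
    then have "s \<ominus>\<^bsub>R\<^esub> t = \<zero>\<^bsub>R\<^esub>" by (rule inj[OF M.R.minus_closed[OF s t]])
    then show "s = t" using s t by (simp add: M.R.minus_eq_zero_iff)
  qed
  have hN: "?h \<in> mod_hom R (ring_module R) (M\<lparr>carrier := ?N\<rparr>)"
    by (rule mod_hom_restrict_codomain[OF h]) simp
  show ?thesis
    unfolding has_free_summand_def
    by (intro exI[of _ ?N] exI[of _ ?L] conjI N L NL NLM bexI[OF _ hN] bij)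
qed

end

theorem theorem6p4:
  fixes R :: "('a, 'c) ring_scheme"
    and \<mm> :: "'a set"
    and M :: "('a, 'b, 'd) module_scheme"
  assumes "gorenstein_local_ring R \<mm>"
    and "krull_dim R = 1"
    and "module R M"
    and "fg_module R M"
    and "torsionfree_module R M"
    and "faithful_module R M"
    and "rigid_module R M"
    and "gorenstein_ring (ring_center (End_ring R M))"
  shows "has_free_summand R M"
proof -
  obtain a where a: "a \<in> \<mm>" "nonzerodivisor R a" "\<And>Q. primeideal Q R \<Longrightarrow> a \<in> Q \<Longrightarrow> Q = \<mm>"
    by (rule gorenstein_parameter[OF assms(1,2)]) (assumption | rule that)+
  obtain g :: nat and p where p: "cover R {..<g} p M" by (rule fg_module_cover[OF assms(3,4)])
  interpret endo_center R M by (intro endo_center.intro assms(3))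
  interpret center_setting R M \<mm> a g p
    using assms(1,3,5,6,8) a p
    by (intro center_setting.intro cring_endo_center.intro endo_center.intro center_setting_axioms.intro)
      (auto simp: gorenstein_local_ring_def gorenstein_ring_def)
  show ?thesis by (rule free_summand[OF assms(7,8)])
qed

end
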